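(* In the setting of the context (generic case): (1) For $1\le i\le p$, $1\le k\le r_i$, $1\le h\le \ell_{i,k}$ one has, for $x\in\mathcal S_i^{+}$ and for $x\in\mathcal S_i^{-}$, the connection formula $$U_{t_i,k,h}(x)=\sum_{j=1}^{2}\sum_{\tilde h=1}^{n}C_{\infty,j,\tilde h;t_i,k,h}\,U_{\infty,j,\tilde h}(x)$$ with (the same in both sectors) $$C_{\infty,j,\tilde h;t_i,k,h}=e^{\pi\sqrt{-1}(\lambda_{i,k}-\rho_{j'})}(t_i-t_{p+1})^{2\lambda_{i,k}-\rho_1-\rho_2}\frac{\Gamma(\rho_j-\rho_{j'})\Gamma(\lambda_{i,k}+1)}{\Gamma(\rho_j+1)\Gamma(\lambda_{i,k}-\rho_{j'})}\,\gamma_{\tilde h;t'_i,k,h}(-\rho_{j'}-1)\quad(1\le j\le 2,\ 1\le\tilde h\le n).$$ (2) For $1\le i\le p$, $1\le k\le q$, $1\le h\le m_k$ one has, for $x\in\mathcal S_i^{\pm}$, $$U_{t_{p+1},k,h}(x)=\sum_{j=1}^{2}\sum_{\tilde h=1}^{n}C^{\langle\mathcal S_i^{\pm}\rangle}_{\infty,j,\tilde h;t_{p+1},k,h}\,U_{\infty,j,\tilde h}(x)$$ with $$C^{\langle\mathcal S_i^{\pm}\rangle}_{\infty,j,\tilde h;t_{p+1},k,h}=\frac{\Gamma(\rho_j-\rho_{j'})\Gamma(\rho_1+\rho_2-\mu_k+1)}{\Gamma(\rho_j+1)\Gamma(\rho_j-\mu_k+1)}\,\gamma^{\langle\mathcal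 S_i^{\prime\mp}\rangle}_{\tilde h;\infty,k,h}(-\rho_{j'}-1)\quad(1\le j\le 2,\ 1\le\tilde h\le n),$$ where the double signs correspond. Here $j'$ denotes the element of $\{1,2\}$ different from $j$.
   Context: **System.** Let $t_1,\dots,t_{p+1}\in\mathbb C$ be distinct, no three on a straight line; $T=\mathrm{diag}(t_1I_{n_1},\dots,t_pI_{n_p})$, $n=n_1+\dots+n_p$. Let $A\in M(n;\mathbb C)$, partitioned in blocks $A_{ij}$ like $T$, have diagonal blocks $A_{ii}=\mathrm{diag}(\lambda_{i,1}I_{\ell_{i,1}},\dots,\lambda_{i,r_i}I_{\ell_{i,r_i}})$ ($\lambda_{i,k}$ distinct for fixed $i$), and let $P\in GL(n;\mathbb C)$ be such that $A'=P^{-1}AP=\mathrm{diag}(\mu_1I_{m_1},\dots,\mu_qI_{m_q})$ ($\mu_k$ distinct). Let $\rho_1,\rho_2\in\mathbb C$. The rank $2n$ system is $$(xI_{2n}-\mathcal T)\frac{dU}{dx}=\mathcal A_PU,\quad \mathcal T=\begin{pmatrix}T&\\&t_{p+1}I_n\end{pmatrix},\quad \mathcal A_P=\begin{pmatrix}A&P\\-(A'-\rho_1I_n)(A'-\rho_2I_n)P^{-1}&(\rho_1+\rho_2)I_n-A'\end{pmatrix}.$$ **Assumptions.** None of the following is an integer: $\lambda_{i,k}$; $\lambda_{i,k}-\lambda_{i,h}$ ($k\ne h$); $\mu_k$; $\mu_k-\mu_h$ ($k\neq h$); $\lambda_{i,k}-\mu_h$; $\rho_j$; $\rho_1-\rho_2$;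 $\rho_j-\lambda_{i,k}$; $\rho_j-\mu_k$ (all admissible indices). **Sectors.** Arguments $\theta_i=\arg(t_i-t_{p+1})$ are fixed with $\theta_1<\dots<\theta_p<\theta_1+2\pi$, and $\theta_{p+1}$ is a fixed real number with $\theta_p<\theta_{p+1}<\theta_1+2\pi$; $\theta_0=\theta_{p+1}-2\pi$. With $\delta>0$ fixed and sufficiently small, $\mathcal S_i^+=\{\theta_i<\arg(x-t_{p+1})<\min(\theta_{i+1}-\delta,\theta_i+\pi)\}$, $\mathcal S_i^-=\{\max(\theta_{i-1}+\delta,\theta_i-\pi)<\arg(x-t_{p+1})<\theta_i\}$ ($1\le i\le p$). In $\mathcal S_i^\pm$ powers of $x-t_{p+1}$ use this argument; $\arg(x-t_i)\in(\theta_i,\theta_i+\pi)$ in $\mathcal S_i^+$ and $\in(\theta_i-\pi,\theta_i)$ in $\mathcal S_i^-$. Powers of $t_i-t_{p+1}$ use $\arg=\theta_i$. **Local solutions.** $\varepsilon_m(k)$ is the $k$-th unit $m$-vector. The following are the unique solutions of the system of the given form (convergent series), continued analytically in the sectors: $U_{t_i,k,h}(x)=(x-t_i)^{\lambda_{i,k}}\{\varepsilon_{2n}(n_1+\dots+n_{i-1}+\ell_{i,1}+\dots+\ell_{i,k-1}+h)+\sum_{m\ge1}G(m)(x-t_i)^m\}$ ($1\le i\le p$); $U_{t_{p+1},k,h}(x)=(x-t_{p+1})^{\rho_1+\rho_2-\mu_k}\{\varepsilon_{2n}(n+m_1+\dots+m_{k-1}+h)+\sum_{m\ge1}G(m)(x-t_{p+1})^m\}$;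 $U_{\infty,j,h}(x)=(x-t_{p+1})^{\rho_j}\{\begin{pmatrix}P\\\rho_jI_n-A'\end{pmatrix}\varepsilon_n(h)+\sum_{m\ge1}G(m)(x-t_{p+1})^{-m}\}$ ($j=1,2$, $1\le h\le n$). **Underlying system.** Fix $\eta_0\in\mathbb C$; $t'_i=\eta_0+\frac1{t_i-t_{p+1}}$, $T'=\mathrm{diag}(t'_1I_{n_1},\dots,t'_pI_{n_p})$, $\theta'_i=\arg(t'_i-\eta_0)=-\theta_i$, $\theta'_\infty=-\theta_{p+1}$, $\theta'_{p+1}=\theta'_\infty$, $\theta'_0=\theta'_\infty+2\pi$. The underlying system is $(\zeta I_n-T')\frac{dw}{d\zeta}=(\rho I_n+A)w$. For $\rho$ with $\rho+\lambda_{i,k}\notin\mathbb Z$ for all $i,k$, it has unique solutions $w_{t'_i,k,h}(\rho;\zeta)=(\zeta-t'_i)^{\rho+\lambda_{i,k}}\{\varepsilon_n(n_1+\dots+n_{i-1}+\ell_{i,1}+\dots+\ell_{i,k-1}+h)+O(\zeta-t'_i)\}$ near $t'_i$ and $w_{\infty,k,h}(\rho;\zeta)=(\zeta-\eta_0)^{\rho+\mu_k}\{P\varepsilon_n(m_1+\dots+m_{k-1}+h)+O((\zeta-\eta_0)^{-1})\}$ near $\infty$ (the $O$-terms being convergent power series). Let $\mathcal P'=\mathbb C\setminus\bigcup_i\{\eta_0+(t'_i-\eta_0)s: s\ge1\}$; in $\mathcal P'$ the branch of $w_{t'_i,k,h}$ is fixed by $\arg(\zeta-t'_i)\in(\theta'_i-2\pi,\theta'_i)$.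 Let $\mathcal S_i^{\prime-}=\{\max(\theta'_{i+1}+\delta,\theta'_i-\pi)<\arg(\zeta-\eta_0)<\theta'_i\}$, $\mathcal S_i^{\prime+}=\{\theta'_i<\arg(\zeta-\eta_0)<\min(\theta'_{i-1}-\delta,\theta'_i+\pi)\}$. With $[P^{-1}]_{\tilde h}$ the $\tilde h$-th row of $P^{-1}$, $$\gamma_{\tilde h;t'_i,k,h}(\rho)=[P^{-1}]_{\tilde h}(\eta_0I_n-T')w_{t'_i,k,h}(\rho;\eta_0),\qquad \gamma^{\langle\mathcal S_i^{\prime\pm}\rangle}_{\tilde h;\infty,k,h}(\rho)=[P^{-1}]_{\tilde h}(\eta_0I_n-T')\,w_{\infty,k,h}|_{\mathcal S_i^{\prime\pm}}(\rho;\eta_0),$$ where $w_{\infty,k,h}|_{\mathcal S_i^{\prime\pm}}$ is the analytic continuation of $w_{\infty,k,h}$ (branch given by $\arg(\zeta-\eta_0)$ in the defining range of $\mathcal S_i^{\prime\pm}$) to a neighbourhood of $\eta_0$ through the sector $\mathcal S_i^{\prime\pm}$.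
   Formalization: Part (2) is stated for those k for which ρ_1+ρ_2−μ_k is not a negative integer; otherwise Γ(ρ_1+ρ_2−μ_k+1) has a pole and U_{t_{p+1},k,h} is not unique. *)

theory Defs
  imports "HOL-Complex_Analysis.Complex_Analysis" "Jordan_Normal_Form.Matrix"
begin

no_notation vec_nth (infixl \<open>$\<close> 90)
no_notation fps_nth (infixl \<open>$\<close> 75)

text \<open>
  Blocks, eigenvalues, and basis vectors are numbered from 1 (as are all finite families below),
  whereas the entries of vectors and matrices are numbered from 0.
\<close>

definition offset :: "(nat \<Rightarrow> nat) \<Rightarrow> nat \<Rightarrow> nat" where
  "offset d i = (\<Sum>a = 1..<i. d a)"

definition scalar_blocks :: "nat \<Rightarrow> (nat \<Rightarrow> complex) \<Rightarrow> (nat \<Rightarrow> nat) \<Rightarrow> complex mat" where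
  "scalar_blocks N c d = diag_block_mat (map (\<lambda>a. c a \<cdot>\<^sub>m 1\<^sub>m (d a)) [1..<Suc N])"

definition diagonal_block :: "(nat \<Rightarrow> nat) \<Rightarrow> nat \<Rightarrow> complex mat \<Rightarrow> complex mat" where
  "diagonal_block d i A =
     mat (d i) (d i) (\<lambda>(a, b). A $$ (offset d i + a, offset d i + b))"

text \<open>
  Branches of powers: the argument is prescribed to lie in a set \<open>I\<close> of reals, which is
  always an open interval of length at most \<open>2 * pi\<close>, so that it is determined by \<open>I\<close>.
\<close>

definition arg_in :: "real set \<Rightarrow> complex \<Rightarrow> real" where
  "arg_in I z = (THE \<phi>. \<phi> \<in> I \<and> is_Arg z \<phi>)"

definition powr_arg :: "real \<Rightarrow> complex \<Rightarrow> complex \<Rightarrow> complex" where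
  "powr_arg \<phi> z a = exp (a * (complex_of_real (ln (norm z)) + \<i> * complex_of_real \<phi>))"

definition sector :: "complex \<Rightarrow> real set \<Rightarrow> complex set" where
  "sector c I = {z. z \<noteq> c \<and> (\<exists>\<phi>\<in>I. is_Arg (z - c) \<phi>)}"

text \<open>Holomorphic solutions of \<open>(x - T) dU/dx = A U\<close> on an open set \<open>S\<close>.\<close>

definition okubo_solution ::
  "complex mat \<Rightarrow> complex mat \<Rightarrow> complex set \<Rightarrow> (complex \<Rightarrow> complex vec) \<Rightarrow> bool" where
  "okubo_solution T A S U \<longleftrightarrow>
     (let N = dim_row A in
       (\<forall>x\<in>S. U x \<in> carrier_vec N) \<and>
       (\<forall>\<nu><N. (\<lambda>x. U x $ \<nu>) holomorphic_on S) \<and>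
       (\<forall>x\<in>S. (x \<cdot>\<^sub>m 1\<^sub>m N - T) *\<^sub>v vec N (\<lambda>\<nu>. deriv (\<lambda>y. U y $ \<nu>) x) = A *\<^sub>v U x))"

text \<open>
  \<open>U x = (x - c) ^ a * (v + (\<Sum>m\<ge>1. G m * (x - c) ^ m))\<close> for \<open>x\<close> in \<open>S\<close> near \<open>c\<close>, with a
  convergent series and \<open>arg (x - c)\<close> taken in \<open>I\<close>; then the same with powers of
  \<open>1 / (x - c)\<close> for large \<open>x\<close> in \<open>S\<close>.
\<close>

definition expands_at ::
  "complex \<Rightarrow> real set \<Rightarrow> complex \<Rightarrow> complex vec \<Rightarrow> complex set \<Rightarrow> (complex \<Rightarrow> complex vec) \<Rightarrow> bool" where
  "expands_at c I a v S U \<longleftrightarrow>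
     (\<exists>G R. R > 0 \<and> G 0 = v \<and> (\<forall>m. G m \<in> carrier_vec (dim_vec v)) \<and>
       (\<forall>x\<in>S. norm (x - c) < R \<longrightarrow> (\<forall>\<nu><dim_vec v.
          (\<lambda>m. powr_arg (arg_in I (x - c)) (x - c) a * (G m $ \<nu> * (x - c) ^ m)) sums (U x $ \<nu>))))"

definition expands_at_infinity ::
  "complex \<Rightarrow> real set \<Rightarrow> complex \<Rightarrow> complex vec \<Rightarrow> complex set \<Rightarrow> (complex \<Rightarrow> complex vec) \<Rightarrow> bool" where
  "expands_at_infinity c I a v S U \<longleftrightarrow>
     (\<exists>G R. G 0 = v \<and> (\<forall>m. G m \<in> carrier_vec (dim_vec v)) \<and>
       (\<forall>x\<in>S. norm (x - c) > R \<longrightarrow> (\<forall>\<nu><dim_vec v.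
          (\<lambda>m. powr_arg (arg_in I (x - c)) (x - c) a * (G m $ \<nu> * inverse (x - c) ^ m))
            sums (U x $ \<nu>))))"

datatype side = Plus | Minus

fun opposite :: "side \<Rightarrow> side" where
  "opposite Plus = Minus"
| "opposite Minus = Plus"

text \<open>
  Ranges of arguments: \<open>sector_args\<close> of \<open>x - t (p + 1)\<close> in the sectors \<open>S_i^+\<close>, \<open>S_i^-\<close>;
  \<open>side_args\<close> of \<open>x - t i\<close> in the same sectors; \<open>sector_args'\<close> of \<open>\<zeta> - \<eta>\<^sub>0\<close> in the sectors
  \<open>S'_i^+\<close>, \<open>S'_i^-\<close>, where \<open>\<theta>'\<close> is decreasing.
\<close>

fun sector_args :: "(nat \<Rightarrow> real) \<Rightarrow> real \<Rightarrow> side \<Rightarrow> nat \<Rightarrow> real set" where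
  "sector_args \<theta> \<delta> Plus i = {\<theta> i <..< min (\<theta> (i + 1) - \<delta>) (\<theta> i + pi)}"
| "sector_args \<theta> \<delta> Minus i = {max (\<theta> (i - 1) + \<delta>) (\<theta> i - pi) <..< \<theta> i}"

fun side_args :: "(nat \<Rightarrow> real) \<Rightarrow> side \<Rightarrow> nat \<Rightarrow> real set" where
  "side_args \<theta> Plus i = {\<theta> i <..< \<theta> i + pi}"
| "side_args \<theta> Minus i = {\<theta> i - pi <..< \<theta> i}"

fun sector_args' :: "(nat \<Rightarrow> real) \<Rightarrow> real \<Rightarrow> side \<Rightarrow> nat \<Rightarrow> real set" where
  "sector_args' \<theta>' \<delta> Plus i = {\<theta>' i <..< min (\<theta>' (i - 1) - \<delta>) (\<theta>' i + pi)}"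
| "sector_args' \<theta>' \<delta> Minus i = {max (\<theta>' (i + 1) + \<delta>) (\<theta>' i - pi) <..< \<theta>' i}"

definition slit_plane :: "nat \<Rightarrow> (nat \<Rightarrow> complex) \<Rightarrow> complex \<Rightarrow> complex set" where
  "slit_plane p t' \<eta>\<^sub>0 =
     - (\<Union>i\<in>{1..p}. {\<eta>\<^sub>0 + (t' i - \<eta>\<^sub>0) * complex_of_real s | s. s \<ge> 1})"

text \<open>The functional \<open>\<gamma>\<close>; \<open>h\<close> counts the rows of \<open>P\<^sup>-\<^sup>1\<close> from 1.\<close>

definition gamma_coeff ::
  "complex mat \<Rightarrow> complex mat \<Rightarrow> complex \<Rightarrow> nat \<Rightarrow> (complex \<Rightarrow> complex vec) \<Rightarrow> complex" where
  "gamma_coeff Pinv T' \<eta>\<^sub>0 h w =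
     scalar_prod (row Pinv (h - 1)) ((\<eta>\<^sub>0 \<cdot>\<^sub>m 1\<^sub>m (dim_row T') - T') *\<^sub>v w \<eta>\<^sub>0)"

end

theory Submission
  imports Defs "Jordan_Normal_Form.Determinant"
begin

text \<open>
  Put \<open>x = c + y\<close> with \<open>c = t (p + 1)\<close>. Eliminating the lower half of a solution \<open>U\<close> leaves a
  second-order equation for its upper half \<open>u\<close>. For a solution \<open>w\<close> of the underlying system with
  parameter \<open>- \<rho> j' - 1\<close>, the function
  \<open>B(y) = y powr (\<rho> j - \<rho> j' - 1) * (T - c) \<inverse> w (\<eta>\<^sub>0 + 1 / y)\<close> solves a first-order system, and
  comparing coefficient recursions at \<open>t i\<close> (or at \<open>c\<close>) shows that \<open>u\<close> is, up to a Gamma factor,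
  the Riemann--Liouville integral of order \<open>\<rho> j' + 1\<close> of \<open>B\<close> based at that point. At infinity \<open>u\<close>
  has the two exponents \<open>\<rho> 1\<close> and \<open>\<rho> 2\<close>. Enough operators \<open>y d/dy - \<kappa>\<close> annihilate finitely many
  terms with exponents in \<open>\<rho> j' - \<nat>\<close>, and since \<open>B\<close> at infinity is governed by \<open>w (\<eta>\<^sub>0)\<close>, a scaling limit of
  the integral isolates the coefficient of \<open>y powr \<rho> j\<close> as a Beta integral times \<open>w (\<eta>\<^sub>0)\<close>.
\<close>

text \<open>The exponents are arbitrary complex numbers, so the Riemann--Liouville integral need not
  converge at either end. Instead of deforming contours, the proof multiplies the kernel by
  \<open>y ^ L\<close>, raises the order to \<open>\<alpha> - L + M\<close> and differentiates
  \<open>M\<close> times afterwards, while \<open>L\<close> Euler operators act on \<open>u\<close>.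
  Both sides then have proportional series at the base point, and the same \<open>L\<close>
  operators push the second exponent at infinity below the first, so that a limit along a ray can
  see the coefficient. The order of integration is dictated by the indicial polynomial at infinity:
  integrating to the order of one root plus one turns the factor belonging to that root into a shift
  of coefficients, which leaves a first-order recursion. The exponential factor and the exponent
  \<open>2 * lam\<close> in the constants come from the inversion: 1/(y + e) - 1/e = - y / (e (y +
  e)) carries one sign and, near y = 0, two factors e in the denominator.\<close>

section \<open>Parameter integrals and the Beta integral\<close>

lemma deriv_translate:
  fixes g :: "complex \<Rightarrow> complex"
  assumes "g holomorphic_on A" "open A" "z + d \<in> A"
  shows "deriv (\<lambda>w. g (w + d)) z = deriv g (z + d)"
proof -
  have "(g has_field_derivative deriv g (z + d)) (at (z + d))"
    using assms by (simp add: holomorphic_derivI)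
  then have "((\<lambda>w. g (w + d)) has_field_derivative deriv g (z + d)) (at z)"
    by (simp add: DERIV_shift)
  then show ?thesis by (rule DERIV_imp_deriv)
qed

text \<open>As (y', s') tends to (y, s), the translates w |-> k (w + y' - y) s' converge uniformly
  near y, because k is uniformly continuous on a compact neighbourhood. Weierstrass' theorem then
  gives convergence of the derivatives at the fixed point y, which are the derivatives of k at the
  moving points.\<close>

lemma continuous_on_deriv_param:
  fixes k :: "complex \<Rightarrow> real \<Rightarrow> complex"
  assumes U: "open U" and J: "compact J"
    and cont: "continuous_on (U \<times> J) (\<lambda>(y, s). k y s)"
    and hol: "\<And>s. s \<in> J \<Longrightarrow> (\<lambda>y. k y s) holomorphic_on U"
  shows "continuous_on (U \<times> J) (\<lambda>(y, s). deriv (\<lambda>y. k y s) y)"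
  unfolding continuous_on_def
proof
  fix p assume "p \<in> U \<times> J"
  then obtain y s where p: "p = (y, s)" "y \<in> U" "s \<in> J" by auto
  define F where "F = at (y, s) within U \<times> J"
  show "((\<lambda>(y, s). deriv (\<lambda>y. k y s) y) \<longlongrightarrow> (case p of (y, s) \<Rightarrow> deriv (\<lambda>y. k y s) y)) (at p within U \<times> J)"
  proof (cases "F = bot")
    case True
    then show ?thesis using p by (simp add: F_def)
  next
    case nb: False
    \<comment> \<open>Radius 2 r, because points of the r-ball around y will be moved by shifts of
      size less than r and must stay inside.\<close>
    obtain r where r: "r > 0" "cball y (2 * r) \<subseteq> U"
    proof -
      obtain r where "r > 0" "cball y r \<subseteq> U" using U p(2) open_contains_cball by blast
      then show ?thesis using that[of "r/2"] by auto
    qed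
    have K: "compact (cball y (2*r) \<times> J)" by (intro compact_Times J) auto
    have uc: "uniformly_continuous_on (cball y (2*r) \<times> J) (\<lambda>(y, s). k y s)"
      using K by (intro compact_uniformly_continuous continuous_on_subset[OF cont]) (use r in auto)
    have evin: "eventually (\<lambda>q. q \<in> U \<times> J \<and> fst q \<in> ball y r) F"
    proof -
      have "eventually (\<lambda>q. q \<in> U \<times> J) F" unfolding F_def by (simp add: eventually_at_filter)
      moreover have "(fst \<longlongrightarrow> y) F" unfolding F_def
        using tendsto_fst[OF tendsto_ident_at, of "(y,s)" "U \<times> J"] by simp
      then have "eventually (\<lambda>q. fst q \<in> ball y r) F"
        by (rule topological_tendstoD) (use r in auto)
      ultimately show ?thesis by eventually_elim auto
    qed
    have ul: "uniform_limit (ball y r) (\<lambda>q w. k (w + (fst q - y)) (snd q)) (\<lambda>w. k w s) F"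
    proof (rule uniform_limitI)
      fix e :: real assume "e > 0"
      then obtain d where d: "d > 0" "\<And>q q'. q \<in> cball y (2*r) \<times> J \<Longrightarrow> q' \<in> cball y (2*r) \<times> J \<Longrightarrow> dist q' q < d
          \<Longrightarrow> dist (case q' of (y, s) \<Rightarrow> k y s) (case q of (y, s) \<Rightarrow> k y s) < e"
        using uc unfolding uniformly_continuous_on_def by metis
      have "((\<lambda>q. q) \<longlongrightarrow> (y, s)) F" unfolding F_def by (rule tendsto_ident_at)
      then have "eventually (\<lambda>q. dist q (y, s) < d) F" using d(1) by (rule tendstoD)
      with evin show "eventually (\<lambda>q. \<forall>w\<in>ball y r. dist (k (w + (fst q - y)) (snd q)) (k w s) < e) F"
      proof eventually_elim
        case (elim q)
        show ?case
        proof
          fix w assume w: "w \<in> ball y r"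
          have 1: "(w, s) \<in> cball y (2*r) \<times> J" using w p r by auto
          have "dist y (w + (fst q - y)) = norm ((y - w) + (y - fst q))" by (simp add: dist_norm algebra_simps)
          also have "\<dots> \<le> r + r" using w elim by (intro norm_triangle_mono) (auto simp: dist_norm)
          finally have 2: "(w + (fst q - y), snd q) \<in> cball y (2*r) \<times> J" using elim by auto
          have "dist (w + (fst q - y), snd q) (w, s) = dist q (y, s)"
            by (cases q) (simp add: dist_Pair_Pair dist_norm)
          then show "dist (k (w + (fst q - y)) (snd q)) (k w s) < e"
            using d(2)[OF 1 2] elim by simp
        qed
      qed
    qed
    have evh: "eventually (\<lambda>q. (\<lambda>w. k (w + (fst q - y)) (snd q)) holomorphic_on ball y r) F"
      using evin
    proof eventually_elim
      case (elim q)
      have *: "(\<lambda>w. w + (fst q - y)) ` ball y r \<subseteq> U"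
      proof
        fix x assume "x \<in> (\<lambda>w. w + (fst q - y)) ` ball y r"
        then obtain w where w: "w \<in> ball y r" "x = w + (fst q - y)" by auto
        have "dist y x = norm ((y - w) + (y - fst q))" unfolding w(2) dist_norm by (rule arg_cong[where f=norm]) simp
        also have "\<dots> \<le> r + r" using w elim by (intro norm_triangle_mono) (auto simp: dist_norm)
        finally show "x \<in> U" using r by auto
      qed
      have "((\<lambda>y. k y (snd q)) \<circ> (\<lambda>w. w + (fst q - y))) holomorphic_on ball y r"
        using elim * by (intro holomorphic_on_compose_gen[OF _ hol]) (auto intro!: holomorphic_intros)
      then show ?case by (simp add: o_def)
    qed
    have "((\<lambda>q. (deriv ^^ 1) (\<lambda>w. k (w + (fst q - y)) (snd q)) y) \<longlongrightarrow> (deriv ^^ 1) (\<lambda>w. k w s) y) F"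
      by (rule higher_deriv_complex_uniform_limit[OF ul evh nb]) (use r in auto)
    then have "((\<lambda>q. deriv (\<lambda>w. k (w + (fst q - y)) (snd q)) y) \<longlongrightarrow> deriv (\<lambda>w. k w s) y) F" by simp
    then have "((\<lambda>(y, s). deriv (\<lambda>y. k y s) y) \<longlongrightarrow> deriv (\<lambda>w. k w s) y) F"
    proof (rule Lim_transform_eventually)
      show "\<forall>\<^sub>F q in F. deriv (\<lambda>w. k (w + (fst q - y)) (snd q)) y = (case q of (y, s) \<Rightarrow> deriv (\<lambda>y. k y s) y)"
        using evin
      proof eventually_elim
        case (elim q)
        then show ?case using deriv_translate[OF hol U, of "snd q" y "fst q - y"]
          by (cases q) auto
      qed
    qed
    then show ?thesis using p by (simp add: F_def)
  qed
qed

text \<open>The Leibniz rule wants the derivative of the integrand to be jointly continuous; by the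
  previous lemma this is automatic for an integrand that is itself jointly continuous.\<close>

lemma holomorphic_integral_param:
  fixes k :: "complex \<Rightarrow> real \<Rightarrow> complex"
  assumes U: "open U"
    and cont: "continuous_on (U \<times> {a..b}) (\<lambda>(y, s). k y s)"
    and hol: "\<And>s. s \<in> {a..b} \<Longrightarrow> (\<lambda>y. k y s) holomorphic_on U"
  shows "(\<lambda>y. integral {a..b} (k y)) holomorphic_on U"
proof -
  have "(\<lambda>y. integral {a..b} (k y)) field_differentiable at y" if y: "y \<in> U" for y
  proof -
    obtain r where r: "r > 0" "ball y r \<subseteq> U" using U y open_contains_ball by blast
    have "(\<lambda>y. integral (cbox a b) (k y)) holomorphic_on ball y r"
    proof (rule leibniz_rule_holomorphic)
      show "((\<lambda>x. k x t) has_field_derivative deriv (\<lambda>y. k y t) x) (at x within ball y r)"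
        if "x \<in> ball y r" "t \<in> cbox a b" for x t
        using that r hol[of t] U by (intro has_field_derivative_at_within[OF holomorphic_derivI]) auto
      show "k x integrable_on cbox a b" if "x \<in> ball y r" for x
      proof (rule integrable_continuous)
        have "continuous_on (cbox a b) ((\<lambda>(y, s). k y s) \<circ> (\<lambda>t. (x, t)))"
          using that r by (intro continuous_on_compose continuous_on_subset[OF cont] continuous_intros) auto
        then show "continuous_on (cbox a b) (k x)" by (simp add: o_def)
      qed
      show "continuous_on (ball y r \<times> cbox a b) (\<lambda>(x, t). deriv (\<lambda>y. k y t) x)"
        using r by (intro continuous_on_subset[OF continuous_on_deriv_param[OF U _ cont hol]]) auto
    qed auto
    then have "(\<lambda>y. integral {a..b} (k y)) holomorphic_on ball y r" by simp
    then show ?thesis using r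
      by (auto intro: holomorphic_on_imp_differentiable_at[OF _ open_ball])
  qed
  then show ?thesis by (simp add: holomorphic_on_def field_differentiable_at_within)
qed

text \<open>An exponent of positive real part makes \<open>powr\<close> continuous even where its
  nonnegative real base becomes 0, so the end points of the interval are harmless.\<close>

lemma continuous_on_beta_integrand:
  fixes p q :: "'a::topological_space \<Rightarrow> complex" and s :: "'a \<Rightarrow> real"
  assumes "continuous_on A p" "continuous_on A q" "continuous_on A s"
    and "\<And>x. x \<in> A \<Longrightarrow> Re (p x) > 0 \<and> Re (q x) > 0 \<and> s x \<in> {0..1}"
  shows "continuous_on A (\<lambda>x. of_real (s x) powr p x * of_real (1 - s x) powr q x)"
  using assms by (intro continuous_intros) (auto simp: complex_nonpos_Reals_iff)

text \<open>The real formula is continued analytically, one exponent at a time. Requiring positive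
  real parts, rather than real parts above -1, keeps the integrand continuous on the closed
  interval.\<close>

lemma has_integral_Beta_complex:
  assumes p: "Re p > 0" and q: "Re q > 0"
  shows "((\<lambda>s. complex_of_real s powr p * complex_of_real (1 - s) powr q) has_integral Beta (p + 1) (q + 1)) {0..1}"
proof -
  define k where "k = (\<lambda>p q s. complex_of_real s powr p * complex_of_real (1 - s) powr q)"
  define U where "U = {z::complex. Re z > 0}"
  have U: "open U" "connected U"
    by (auto simp: U_def open_halfspace_Re_gt convex_connected convex_halfspace_Re_gt)
  \<comment> \<open>The positive reals accumulate at 1 inside the half-plane \<open>U\<close>; this
    is what the identity theorem needs.\<close>
  have "1 islimpt (of_real ` {0<..} :: complex set)"
    unfolding islimpt_sequential
  proof (intro exI[of _ "\<lambda>n. of_real (1 + 1 / real (Suc n))"] conjI allI)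
    have "(\<lambda>n. 1 + 1 / real (Suc n)) \<longlonglongrightarrow> 1 + 0"
      by (intro tendsto_intros LIMSEQ_Suc[OF lim_1_over_n])
    then show "(\<lambda>n. complex_of_real (1 + 1 / real (Suc n))) \<longlonglongrightarrow> 1"
      using tendsto_of_real[where 'a=complex] by fastforce
  next
    fix n
    have pos: "1 + 1 / real (Suc n) \<in> {0<..}" by (simp add: add_pos_nonneg)
    have "1 + 1 / real (Suc n) \<noteq> 1" by simp
    then show "complex_of_real (1 + 1 / real (Suc n)) \<in> of_real ` {0<..} - {1}"
      using pos by (metis DiffI imageI of_real_eq_1_iff singletonD)
  qed
  then have lp: "1 islimpt (of_real ` {0<..} \<inter> U)"
    by (rule islimpt_subset) (auto simp: U_def)
  have step: "f = g" if "f holomorphic_on U" "g holomorphic_on U" "\<And>x. x > 0 \<Longrightarrow> f (of_real x) = g (of_real x)" "z \<in> U" "f z \<noteq> g z"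
    for f g :: "complex \<Rightarrow> complex" and z
  proof -
    have "f z - g z = 0"
      by (rule analytic_continuation[of "\<lambda>z. f z - g z" U "of_real ` {0<..} \<inter> U" 1])
        (use that U lp in \<open>auto intro!: holomorphic_intros simp: U_def\<close>)
    then show ?thesis using that by simp
  qed
  have ident: "f z = g z" if "f holomorphic_on U" "g holomorphic_on U" "\<And>x. x > 0 \<Longrightarrow> f (of_real x) = g (of_real x)" "z \<in> U"
    for f g :: "complex \<Rightarrow> complex" and z
    using step[OF that] by metis
  have contk: "continuous_on {0..1} (k p q)" if "p \<in> U" "q \<in> U" for p q
    unfolding k_def using that by (intro continuous_on_beta_integrand continuous_intros) (auto simp: U_def)
  have holBeta: "(\<lambda>z. Beta (f z + 1) (g z + 1)) holomorphic_on U"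
    if "f holomorphic_on U" "g holomorphic_on U" "\<And>z. z \<in> U \<Longrightarrow> f z \<in> U \<and> g z \<in> U" for f g
  proof (intro holomorphic_intros that)
    show "f z + 1 \<notin> \<int>\<^sub>\<le>\<^sub>0 " if "z \<in> U" for z using that \<open>\<And>z. z \<in> U \<Longrightarrow> f z \<in> U \<and> g z \<in> U\<close>[of z]
      by (auto simp: U_def elim!: nonpos_Ints_cases dest!: arg_cong[where f=Re])
    show "g z + 1 \<notin> \<int>\<^sub>\<le>\<^sub>0 " if "z \<in> U" for z using that \<open>\<And>z. z \<in> U \<Longrightarrow> f z \<in> U \<and> g z \<in> U\<close>[of z]
      by (auto simp: U_def elim!: nonpos_Ints_cases dest!: arg_cong[where f=Re])
  qed
  have 1: "integral {0..1} (k (of_real p) (of_real q)) = Beta (of_real p + 1) (of_real q + 1)" if "p > 0" "q > 0" for p q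
  proof -
    have "((\<lambda>s. of_real (s powr (p + 1 - 1) * (1 - s) powr (q + 1 - 1))) has_integral complex_of_real (Beta (p+1) (q+1))) {0..1}"
      using that by (intro has_integral_of_real has_integral_Beta_real) auto
    then have "((k (of_real p) (of_real q)) has_integral complex_of_real (Beta (p+1) (q+1))) {0..1}"
      by (rule has_integral_eq[rotated]) (auto simp: k_def powr_of_real simp flip: of_real_diff)
    then show ?thesis
      by (simp add: integral_unique Beta_complex_of_real[symmetric])
  qed
  \<comment> \<open>Continuation in \<open>p\<close> while \<open>q\<close> is still real.
    Afterwards \<open>q\<close> is continued for the complex \<open>p\<close> reached here.\<close>
  have 2: "integral {0..1} (k p (of_real q)) = Beta (p + 1) (of_real q + 1)" if "p \<in> U" "q > 0" for p q
  proof (rule ident[where z=p])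
    show "(\<lambda>p. integral {0..1} (k p (of_real q))) holomorphic_on U"
    proof (rule holomorphic_integral_param[OF U(1)])
      show "continuous_on (U \<times> {0..1}) (\<lambda>(p, s). k p (of_real q) s)"
        unfolding k_def split_def using that
        by (intro continuous_on_beta_integrand continuous_intros) (auto simp: U_def)
      show "(\<lambda>p. k p (of_real q) s) holomorphic_on U" if "s \<in> {0..1}" for s
        unfolding k_def using that by (cases "s = 0") (auto intro!: holomorphic_intros)
    qed
    show "(\<lambda>z. Beta (z + 1) (of_real q + 1)) holomorphic_on U"
      using that by (intro holBeta holomorphic_intros) (auto simp: U_def)
  qed (use that 1 in auto)
  have "integral {0..1} (k p q) = Beta (p + 1) (q + 1)"
  proof (rule ident[where z=q])
    show "(\<lambda>q. integral {0..1} (k p q)) holomorphic_on U"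
    proof (rule holomorphic_integral_param[OF U(1)])
      show "continuous_on (U \<times> {0..1}) (\<lambda>(q, s). k p q s)"
        unfolding k_def split_def using p
        by (intro continuous_on_beta_integrand continuous_intros) (auto simp: U_def)
      show "(\<lambda>q. k p q s) holomorphic_on U" if "s \<in> {0..1}" for s
        unfolding k_def using that by (cases "s = 1") (auto intro!: holomorphic_intros)
    qed
    show "(\<lambda>z. Beta (p + 1) (z + 1)) holomorphic_on U"
      using p by (intro holBeta holomorphic_intros) (auto simp: U_def)
  qed (use p q 2 in \<open>auto simp: U_def\<close>)
  then have "(k p q has_integral Beta (p + 1) (q + 1)) {0..1}"
    using contk[of p q] p q by (metis (full_types) U_def has_integral_iff integrable_continuous_real mem_Collect_eq)
  then show ?thesis by (simp add: k_def)
qed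

section \<open>Powers and Frobenius series on a cone\<close>

text \<open>Abstracts a sector with apex 0 and a logarithm whose argument may leave the principal
  range. Invariance under positive scaling serves both the integrals from the apex and the limits
  along rays; the bound on the imaginary part allows |y^a| to be estimated by a power of
  |y|.\<close>

locale cone_branch =
  fixes Q :: "complex set" and Lg :: "complex \<Rightarrow> complex"
  assumes open_Q: "open Q" and connected_Q: "connected Q" and Q_nonempty: "Q \<noteq> {}"
    and Lg_holomorphic: "Lg holomorphic_on Q"
    and exp_Lg: "y \<in> Q \<Longrightarrow> exp (Lg y) = y"
    and cone: "0 < s \<Longrightarrow> y \<in> Q \<Longrightarrow> complex_of_real s * y \<in> Q"
    and Lg_scale: "0 < s \<Longrightarrow> y \<in> Q \<Longrightarrow> Lg (complex_of_real s * y) = complex_of_real (ln s) + Lg y"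
    and Im_Lg_bounded: "\<exists>C. \<forall>y\<in>Q. \<bar>Im (Lg y)\<bar> \<le> C"
begin

definition pw :: "complex \<Rightarrow> complex \<Rightarrow> complex" where
  "pw a y = exp (a * Lg y)"

lemma zero_notin_Q: "0 \<notin> Q"
  using exp_Lg[of 0] by auto

lemma pw_nonzero [simp]: "pw a y \<noteq> 0"
  by (simp add: pw_def)

lemma pw_add: "pw (a + b) y = pw a y * pw b y"
  by (simp add: pw_def exp_add algebra_simps)

lemma pw_of_nat: "y \<in> Q \<Longrightarrow> pw (of_nat m) y = y ^ m"
  by (simp add: pw_def exp_of_nat_mult exp_Lg)

lemma pw_add_nat: "y \<in> Q \<Longrightarrow> pw (a + of_nat m) y = pw a y * y ^ m"
  by (simp add: pw_add pw_of_nat)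

lemma pw_minus_one: "y \<in> Q \<Longrightarrow> pw (a - 1) y = pw a y / y"
  using pw_add_nat[of y "a - 1" 1] zero_notin_Q by (auto simp: field_simps)

lemma pw_scale: "0 < s \<Longrightarrow> y \<in> Q \<Longrightarrow> pw a (of_real s * y) = of_real s powr a * pw a y"
  by (simp add: pw_def Lg_scale powr_def Ln_of_real exp_add ring_distribs)

lemma pw_holomorphic: "pw a holomorphic_on Q"
  unfolding pw_def[abs_def] by (intro holomorphic_intros Lg_holomorphic)

lemma pw_has_field_derivative:
  assumes y: "y \<in> Q" shows "(pw a has_field_derivative a * pw a y / y) (at y)"
proof -
  have L: "(Lg has_field_derivative deriv Lg y) (at y)"
    using Lg_holomorphic open_Q y by (rule holomorphic_derivI)
  \<comment> \<open>Differentiating exp (Lg y) = y yields the derivative 1 / y of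
    \<open>Lg\<close>.\<close>
  have "((\<lambda>y. exp (Lg y)) has_field_derivative exp (Lg y) * deriv Lg y) (at y)"
    by (rule derivative_eq_intros L refl | simp)+
  moreover have "((\<lambda>y. exp (Lg y)) has_field_derivative 1) (at y)"
    by (rule has_field_derivative_transform_within_open[OF _ open_Q y, of "\<lambda>y. y"]) (auto simp: exp_Lg)
  ultimately have "exp (Lg y) * deriv Lg y = 1" by (rule DERIV_unique)
  then have "deriv Lg y = 1 / y"
    using exp_Lg[OF y] zero_notin_Q y by (metis nonzero_mult_div_cancel_left)
  with L have L': "(Lg has_field_derivative 1 / y) (at y)" by simp
  show ?thesis unfolding pw_def[abs_def]
    by (rule derivative_eq_intros L' refl | simp)+
qed

text \<open>|y^a| = |y|^(Re a) * exp (- Im a * arg y), and the argument is bounded on the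
  cone.\<close>

lemma pw_norm_bound: "\<exists>C>0. \<forall>y\<in>Q. norm (pw a y) \<le> C * norm y powr Re a"
proof -
  obtain C where C: "\<And>y. y \<in> Q \<Longrightarrow> \<bar>Im (Lg y)\<bar> \<le> C" using Im_Lg_bounded by auto
  have "norm (pw a y) \<le> exp (\<bar>Im a\<bar> * C) * norm y powr Re a" if y: "y \<in> Q" for y
  proof -
    have "norm y = exp (Re (Lg y))" using exp_Lg[OF y] by (metis norm_exp_eq_Re)
    then have "norm y powr Re a = exp (Re a * Re (Lg y))" by (simp add: powr_def)
    moreover have "norm (pw a y) = exp (Re a * Re (Lg y) - Im a * Im (Lg y))"
      by (simp add: pw_def)
    moreover have "- (Im a * Im (Lg y)) \<le> \<bar>Im a\<bar> * C"
      using C[OF y] mult_mono[of "\<bar>Im a\<bar>" "\<bar>Im a\<bar>" "\<bar>Im (Lg y)\<bar>" C]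
      by (auto simp: abs_mult[symmetric])
    ultimately show ?thesis by (simp flip: exp_add)
  qed
  then show ?thesis by (intro exI[of _ "exp (\<bar>Im a\<bar> * C)"]) auto
qed

lemma small_point:
  assumes "R > 0" obtains y where "y \<in> Q" "norm y = R"
proof -
  obtain y0 where y0: "y0 \<in> Q" using Q_nonempty by auto
  then have "y0 \<noteq> 0" using zero_notin_Q by auto
  then show ?thesis using that[of "of_real (R / norm y0) * y0"] cone[of "R / norm y0" y0] y0 assms
    by (auto simp: norm_mult norm_divide)
qed

definition frobenius :: "complex \<Rightarrow> (nat \<Rightarrow> complex) \<Rightarrow> (complex \<Rightarrow> complex) \<Rightarrow> bool" where
  "frobenius a c f \<longleftrightarrow>
     (\<exists>R>0. \<forall>y\<in>Q. norm y < R \<longrightarrow> (\<lambda>m. pw a y * (c m * y ^ m)) sums f y)"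

text \<open>\<open>frobenius\<close> asks for convergence only inside the cone. But the cone has
  points of every modulus, and a power series that converges at a point converges absolutely at all
  points of smaller modulus; so the series defines a holomorphic function on a full disc around the
  apex.\<close>

lemma frobenius_holomorphicE:
  assumes "frobenius a c f"
  obtains R \<phi> where "R > 0" "\<phi> holomorphic_on ball 0 R"
    "\<And>y. norm y < R \<Longrightarrow> (\<lambda>m. c m * y ^ m) sums \<phi> y"
    "\<And>y. norm y < R \<Longrightarrow> summable (\<lambda>m. norm (c m * y ^ m))"
    "\<And>y. y \<in> Q \<Longrightarrow> norm y < R \<Longrightarrow> f y = pw a y * \<phi> y"
proof -
  obtain R where R: "R > 0" "\<And>y. y \<in> Q \<Longrightarrow> norm y < R \<Longrightarrow> (\<lambda>m. pw a y * (c m * y ^ m)) sums f y"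
    using assms unfolding frobenius_def by auto
  define \<phi> where "\<phi> = (\<lambda>y. \<Sum>m. c m * y ^ m)"
  have nsum: "summable (\<lambda>m. norm (c m * y ^ m))" if "norm y < R" for y
  proof -
    obtain z where z: "z \<in> Q" "norm z = (norm y + R) / 2"
    proof -
      have "(norm y + R) / 2 > 0" using R(1) by (simp add: add_nonneg_pos)
      then show ?thesis using that small_point by blast
    qed
    have "summable (\<lambda>m. pw a z * (c m * z ^ m))"
      using R(2)[of z] z that by (auto simp: sums_iff)
    then have "summable (\<lambda>m. c m * z ^ m)" by (simp add: summable_mult_D)
    moreover have "norm y < norm z" using that unfolding z(2) by (simp add: field_simps)
    ultimately show ?thesis by (rule powser_insidea)
  qed
  have sums: "(\<lambda>m. c m * y ^ m) sums \<phi> y" if "norm y < R" for y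
    unfolding \<phi>_def by (rule summable_sums[OF summable_norm_cancel[OF nsum[OF that]]])
  show ?thesis
  proof (rule that[OF R(1) _ sums nsum])
    show "\<phi> holomorphic_on ball 0 R"
      by (rule power_series_holomorphic[where a=c]) (use sums in auto)
    show "f y = pw a y * \<phi> y" if "y \<in> Q" "norm y < R" for y
      by (rule sums_unique2[OF R(2)[OF that] sums_mult[OF sums[OF that(2)]]])
  qed
qed

lemma frobenius_powser_zero:
  assumes R: "R > 0" and s: "\<And>y. y \<in> Q \<Longrightarrow> norm y < R \<Longrightarrow> (\<lambda>m. c m * y ^ m) sums 0"
  shows "c m = (0::complex)"
proof (rule ccontr)
  assume nz: "c m \<noteq> 0"
  have "frobenius 0 c (\<lambda>y. 0)"
    unfolding frobenius_def pw_def using R s by auto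
  then obtain r \<phi> where r: "r > 0" "\<And>y. norm y < r \<Longrightarrow> (\<lambda>m. c m * y ^ m) sums \<phi> y"
      "\<And>y. y \<in> Q \<Longrightarrow> norm y < r \<Longrightarrow> 0 = pw 0 y * \<phi> y"
    by (rule frobenius_holomorphicE) blast
  \<comment> \<open>The series is multiplied by y because \<open>powser_0_nonzero\<close> needs a
    function that vanishes at the centre and a nonzero coefficient of positive index.\<close>
  define d where "d = (\<lambda>m. case m of 0 \<Rightarrow> 0 | Suc m \<Rightarrow> c m)"
  have "(\<lambda>m. d m * (y - 0) ^ m) sums (y * \<phi> y)" if "norm (y - 0) < r" for y
  proof -
    have "(\<lambda>m. d (Suc m) * y ^ Suc m) sums (y * \<phi> y)"
      using sums_mult[OF r(2), of y y] that by (simp add: d_def mult_ac)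
    then show ?thesis using sums_Suc[of "\<lambda>m. d m * y ^ m"] by (simp add: d_def)
  qed
  then obtain s where s: "s > 0" "\<And>z. z \<in> cball 0 s - {0} \<Longrightarrow> z * \<phi> z \<noteq> 0"
    using powser_0_nonzero[of r 0 d "\<lambda>y. y * \<phi> y" "Suc m"] r(1) nz by (auto simp: d_def)
  obtain y where y: "y \<in> Q" "norm y = min s r / 2" using small_point[of "min s r / 2"] s r by auto
  have "\<phi> y = 0" using r(3)[OF y(1)] y s r by auto
  moreover have "y \<in> cball 0 s - {0}" using y s(1) r(1) zero_notin_Q by auto
  ultimately show False using s(2) by auto
qed

lemma frobenius_unique:
  assumes "frobenius a c f" "frobenius a d f"
  shows "c m = d m"
proof -
  obtain R where R: "R > 0" "\<And>y. y \<in> Q \<Longrightarrow> norm y < R \<Longrightarrow> (\<lambda>m. pw a y * (c m * y ^ m)) sums f y"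
    using assms unfolding frobenius_def by auto
  obtain R' where R': "R' > 0" "\<And>y. y \<in> Q \<Longrightarrow> norm y < R' \<Longrightarrow> (\<lambda>m. pw a y * (d m * y ^ m)) sums f y"
    using assms unfolding frobenius_def by auto
  have "(\<lambda>m. c m - d m) m = 0"
  proof (rule frobenius_powser_zero[of "min R R'"])
    fix y assume y: "y \<in> Q" "norm y < min R R'"
    have "(\<lambda>m. pw a y * (c m * y ^ m) - pw a y * (d m * y ^ m)) sums (f y - f y)"
      using y by (intro sums_diff R R') auto
    then have "(\<lambda>m. pw a y * ((c m - d m) * y ^ m)) sums (pw a y * 0)"
      by (simp add: algebra_simps)
    then show "(\<lambda>m. (c m - d m) * y ^ m) sums 0"
      by (metis pw_nonzero sums_mult_iff)
  qed (use R R' in auto)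
  then show ?thesis by simp
qed

lemma frobenius_cong:
  assumes "\<And>y. y \<in> Q \<Longrightarrow> f y = g y" "frobenius a c f"
  shows "frobenius a c g"
  using assms unfolding frobenius_def by simp

lemma frobenius_of_holomorphic:
  assumes "R > 0" "\<phi> holomorphic_on ball 0 R" "\<And>y. y \<in> Q \<Longrightarrow> norm y < R \<Longrightarrow> f y = pw a y * \<phi> y"
  shows "frobenius a (\<lambda>m. (deriv ^^ m) \<phi> 0 / fact m) f"
  unfolding frobenius_def
proof (intro exI[of _ R] conjI ballI impI)
  fix y assume "y \<in> Q" "norm y < R"
  then show "(\<lambda>m. pw a y * ((deriv ^^ m) \<phi> 0 / fact m * y ^ m)) sums f y"
    using sums_mult[OF holomorphic_power_series[OF assms(2), of y], of "pw a y"] assms(3) by simp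
qed (use assms in auto)

lemma frobenius_add:
  assumes "frobenius a c f" "frobenius a d g"
  shows "frobenius a (\<lambda>m. c m + d m) (\<lambda>y. f y + g y)"
proof -
  obtain R where R: "R > 0" "\<And>y. y \<in> Q \<Longrightarrow> norm y < R \<Longrightarrow> (\<lambda>m. pw a y * (c m * y ^ m)) sums f y"
    using assms unfolding frobenius_def by auto
  obtain R' where R': "R' > 0" "\<And>y. y \<in> Q \<Longrightarrow> norm y < R' \<Longrightarrow> (\<lambda>m. pw a y * (d m * y ^ m)) sums g y"
    using assms unfolding frobenius_def by auto
  show ?thesis unfolding frobenius_def
  proof (intro exI[of _ "min R R'"] conjI ballI impI)
    fix y assume "y \<in> Q" "norm y < min R R'"
    then show "(\<lambda>m. pw a y * ((c m + d m) * y ^ m)) sums (f y + g y)"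
      using sums_add[OF R(2) R'(2), of y y] by (simp add: algebra_simps)
  qed (use R R' in auto)
qed

lemma frobenius_cmult:
  assumes "frobenius a c f"
  shows "frobenius a (\<lambda>m. k * c m) (\<lambda>y. k * f y)"
proof -
  obtain R where R: "R > 0" "\<And>y. y \<in> Q \<Longrightarrow> norm y < R \<Longrightarrow> (\<lambda>m. pw a y * (c m * y ^ m)) sums f y"
    using assms unfolding frobenius_def by auto
  show ?thesis unfolding frobenius_def
  proof (intro exI[of _ R] conjI ballI impI)
    fix y assume "y \<in> Q" "norm y < R"
    then show "(\<lambda>m. pw a y * ((k * c m) * y ^ m)) sums (k * f y)"
      using sums_mult[OF R(2), of y k] by (simp add: algebra_simps)
  qed (use R in auto)
qed

lemma frobenius_zero: "frobenius a (\<lambda>m. 0) (\<lambda>y. 0)"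
  unfolding frobenius_def by (auto intro: exI[of _ 1])

lemma frobenius_sum:
  assumes "\<And>i. i \<in> I \<Longrightarrow> frobenius a (c i) (f i)"
  shows "frobenius a (\<lambda>m. \<Sum>i\<in>I. c i m) (\<lambda>y. \<Sum>i\<in>I. f i y)"
  using assms
  by (induction I rule: infinite_finite_induct) (auto intro: frobenius_zero frobenius_add)

lemma frobenius_mult_var:
  assumes "frobenius a c f"
  shows "frobenius a (\<lambda>m. case m of 0 \<Rightarrow> 0 | Suc m \<Rightarrow> c m) (\<lambda>y. y * f y)"
proof -
  obtain R where R: "R > 0" "\<And>y. y \<in> Q \<Longrightarrow> norm y < R \<Longrightarrow> (\<lambda>m. pw a y * (c m * y ^ m)) sums f y"
    using assms unfolding frobenius_def by auto
  let ?d = "\<lambda>m. case m of 0 \<Rightarrow> 0 | Suc m \<Rightarrow> c m"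
  show ?thesis unfolding frobenius_def
  proof (intro exI[of _ R] conjI ballI impI)
    fix y assume "y \<in> Q" "norm y < R"
    then have "(\<lambda>m. pw a y * (?d (Suc m) * y ^ Suc m)) sums (y * f y)"
      using sums_mult[OF R(2), of y y] by (simp add: algebra_simps)
    then show "(\<lambda>m. pw a y * (?d m * y ^ m)) sums (y * f y)"
      using sums_Suc[of "\<lambda>m. pw a y * (?d m * y ^ m)"] by simp
  qed (use R in auto)
qed

text \<open>The Euler operator y d/dy is diagonal on the powers y^(a + m). Differential equations
  written with it therefore become recursions for the coefficients.\<close>

lemma frobenius_euler:
  assumes f: "frobenius a c f"
  shows "frobenius a (\<lambda>m. (a + of_nat m) * c m) (\<lambda>y. y * deriv f y)"
proof -
  obtain R \<phi> where R: "R > 0" "\<phi> holomorphic_on ball 0 R"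
    "\<And>y. norm y < R \<Longrightarrow> (\<lambda>m. c m * y ^ m) sums \<phi> y"
    "\<And>y. norm y < R \<Longrightarrow> summable (\<lambda>m. norm (c m * y ^ m))"
    "\<And>y. y \<in> Q \<Longrightarrow> norm y < R \<Longrightarrow> f y = pw a y * \<phi> y"
    using frobenius_holomorphicE[OF f] by blast
  show ?thesis unfolding frobenius_def
  proof (intro exI[of _ R] conjI ballI impI)
    fix y assume y: "y \<in> Q" "norm y < R"
    then have y0: "y \<noteq> 0" using zero_notin_Q by auto
    have o: "open (Q \<inter> ball 0 R)" using open_Q by auto
    have ser: "((\<lambda>z. \<Sum>n. c n * z ^ n) has_field_derivative (\<Sum>n. diffs c n * y ^ n)) (at y)"
      by (rule termdiffs_strong'[of R]) (use R(3) y in \<open>auto simp: sums_iff\<close>)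
    have d\<phi>: "(\<phi> has_field_derivative (\<Sum>n. diffs c n * y ^ n)) (at y)"
      by (rule has_field_derivative_transform_within_open[OF ser open_ball[of 0 R]])
        (use R(3) y in \<open>auto simp: sums_iff\<close>)
    have "((\<lambda>y. pw a y * \<phi> y) has_field_derivative
        a * pw a y / y * \<phi> y + (\<Sum>n. diffs c n * y ^ n) * pw a y) (at y)"
      using DERIV_mult[OF pw_has_field_derivative[OF y(1)] d\<phi>] by simp
    then have "(f has_field_derivative
        a * pw a y / y * \<phi> y + (\<Sum>n. diffs c n * y ^ n) * pw a y) (at y)"
      by (rule has_field_derivative_transform_within_open[OF _ o]) (use y R(5) in auto)
    then have df: "y * deriv f y = pw a y * (a * \<phi> y + y * (\<Sum>n. diffs c n * y ^ n))"
      using y0 by (simp add: DERIV_imp_deriv field_simps)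
    have "summable (\<lambda>n. diffs c n * y ^ n)"
      by (rule termdiff_converges[of y R]) (use R(3) y in \<open>auto simp: sums_iff\<close>)
    then have "(\<lambda>n. y * (diffs c n * y ^ n)) sums (y * (\<Sum>n. diffs c n * y ^ n))"
      by (intro sums_mult summable_sums)
    then have "(\<lambda>n. of_nat (Suc n) * (c (Suc n) * y ^ Suc n)) sums (y * (\<Sum>n. diffs c n * y ^ n))"
      by (simp add: diffs_def mult_ac)
    then have "(\<lambda>n. of_nat n * (c n * y ^ n)) sums (y * (\<Sum>n. diffs c n * y ^ n))"
      using sums_Suc[of "\<lambda>n. of_nat n * (c n * y ^ n)"] by simp
    from sums_mult[OF sums_add[OF sums_mult[OF R(3)[OF y(2)], of a] this], of "pw a y"]
    show "(\<lambda>m. pw a y * ((a + of_nat m) * c m * y ^ m)) sums (y * deriv f y)"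
      unfolding df by (simp add: algebra_simps)
  qed (use R in auto)
qed

text \<open>Equal series give equality near the apex, and connectedness of the cone carries it to
  all of \<open>Q\<close>.\<close>

lemma frobenius_identity:
  assumes "frobenius a c f" "frobenius a c g" "f holomorphic_on Q" "g holomorphic_on Q" "y \<in> Q"
  shows "f y = g y"
proof -
  obtain R where R: "R > 0" "\<And>y. y \<in> Q \<Longrightarrow> norm y < R \<Longrightarrow> (\<lambda>m. pw a y * (c m * y ^ m)) sums f y"
    using assms unfolding frobenius_def by auto
  obtain R' where R': "R' > 0" "\<And>y. y \<in> Q \<Longrightarrow> norm y < R' \<Longrightarrow> (\<lambda>m. pw a y * (c m * y ^ m)) sums g y"
    using assms unfolding frobenius_def by auto
  obtain z where "z \<in> Q" "norm z = min R R' / 2" using small_point[of "min R R' / 2"] R R' by auto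
  then have "z \<in> Q \<inter> ball 0 (min R R')" using R(1) R'(1) by (simp add: min_def split: if_splits)
  then have ne: "Q \<inter> ball 0 (min R R') \<noteq> {}" by blast
  show ?thesis
  proof (rule analytic_continuation_open[of "Q \<inter> ball 0 (min R R')" Q f g])
    show "f z = g z" if "z \<in> Q \<inter> ball 0 (min R R')" for z
      using R(2)[of z] R'(2)[of z] that sums_unique2 by auto
  qed (use ne assms open_Q connected_Q in auto)
qed

end

section \<open>Expansions with two exponents\<close>

text \<open>The operator identity y^i D^i = H (H - 1) ... (H - i + 1) for the Euler operator H = y
  d/dy. It trades higher derivatives for operators that are diagonal on Frobenius series.\<close>

lemma euler_tower_deriv:
  assumes Q: "open Q" and f: "f holomorphic_on Q"
    and E0: "E 0 = f" and ES: "\<And>i. E (Suc i) = (\<lambda>y. y * deriv (E i) y - of_nat i * E i y)"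
    and y: "y \<in> Q"
  shows "E i y = y ^ i * (deriv ^^ i) f y"
  using y
proof (induction i arbitrary: y)
  case 0
  then show ?case by (simp add: E0)
next
  case (Suc i)
  have "(deriv ^^ i) f holomorphic_on Q" using f Q by (rule holomorphic_higher_deriv)
  then have D: "((deriv ^^ i) f has_field_derivative (deriv ^^ Suc i) f y) (at y)"
    using holomorphic_derivI[OF _ Q Suc.prems] by simp
  have "((\<lambda>y. y ^ i * (deriv ^^ i) f y) has_field_derivative
      of_nat i * y ^ (i - 1) * (deriv ^^ i) f y + y ^ i * (deriv ^^ Suc i) f y) (at y)"
    by (rule derivative_eq_intros D refl | simp)+
  then have "(E i has_field_derivative
      of_nat i * y ^ (i - 1) * (deriv ^^ i) f y + y ^ i * (deriv ^^ Suc i) f y) (at y)"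
    by (rule has_field_derivative_transform_within_open[OF _ Q Suc.prems]) (simp add: Suc.IH)
  then have "E (Suc i) y = y * (of_nat i * y ^ (i - 1) * (deriv ^^ i) f y + y ^ i * (deriv ^^ Suc i) f y)
      - of_nat i * (y ^ i * (deriv ^^ i) f y)"
    by (simp add: ES DERIV_imp_deriv Suc)
  also have "\<dots> = y ^ Suc i * (deriv ^^ Suc i) f y"
    by (cases i) (simp_all add: algebra_simps)
  finally show ?case .
qed

context cone_branch
begin

text \<open>No coefficient of the y^b part is recorded, since only its growth will matter. That
  \<open>c\<close> is determined by \<open>f\<close> needs conditions on the exponents; see
  \<open>two_exponents_zero\<close>.\<close>

definition two_exponents ::
    "complex \<Rightarrow> complex \<Rightarrow> (complex \<Rightarrow> complex) \<Rightarrow> complex \<Rightarrow> bool" where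
  "two_exponents a b f c \<longleftrightarrow> (\<exists>r>0. \<exists>\<phi> \<psi>. \<phi> holomorphic_on ball 0 r \<and> \<psi> holomorphic_on ball 0 r \<and>
     \<phi> 0 = c \<and> (\<forall>y\<in>Q. norm y > 1 / r \<longrightarrow> f y = pw a y * \<phi> (1 / y) + pw b y * \<psi> (1 / y)))"

lemma two_exponentsI:
  assumes "r > 0" "\<phi> holomorphic_on ball 0 r" "\<psi> holomorphic_on ball 0 r" "\<phi> 0 = c"
    "\<And>y. y \<in> Q \<Longrightarrow> norm y > 1 / r \<Longrightarrow> f y = pw a y * \<phi> (1 / y) + pw b y * \<psi> (1 / y)"
  shows "two_exponents a b f c"
  using assms unfolding two_exponents_def by blast

lemma has_field_derivative_pw_inverse:
  assumes \<phi>: "\<phi> holomorphic_on ball 0 r" and y: "y \<in> Q" "norm y > 1 / r" and r: "r > 0"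
  shows "((\<lambda>y. pw a y * \<phi> (1 / y)) has_field_derivative
      pw a y * (a * \<phi> (1 / y) - (1 / y) * deriv \<phi> (1 / y)) / y) (at y)"
proof -
  have y0: "y \<noteq> 0" using y zero_notin_Q by auto
  have "1 / y \<in> ball 0 r" using y r y0 by (simp add: norm_divide field_simps)
  then have D: "(\<phi> has_field_derivative deriv \<phi> (1 / y)) (at (1 / y))"
    using \<phi> by (intro holomorphic_derivI[where S="ball 0 r"]) auto
  have "((\<lambda>y. 1 / y) has_field_derivative - (1 / y ^ 2)) (at y)"
    by (rule derivative_eq_intros refl y0 | simp add: power2_eq_square y0)+
  from DERIV_chain2[OF D this]
  have "((\<lambda>y. \<phi> (1 / y)) has_field_derivative deriv \<phi> (1 / y) * - (1 / y ^ 2)) (at y)" .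
  from DERIV_mult[OF pw_has_field_derivative[OF y(1)] this]
  show ?thesis
    using y0 by (simp add: power2_eq_square diff_divide_distrib algebra_simps)
qed

text \<open>The operator y d/dy - b multiplies y^(b - k) by -k. So the leading term of the second
  part disappears and its exponent drops by one, while the leading coefficient of the first part
  only acquires the factor a - b.\<close>

lemma two_exponents_step:
  assumes "two_exponents a b f c"
  shows "two_exponents a (b - 1) (\<lambda>y. y * deriv f y - b * f y) ((a - b) * c)"
proof -
  obtain r \<phi> \<psi> where r: "r > 0" "\<phi> holomorphic_on ball 0 r" "\<psi> holomorphic_on ball 0 r" "\<phi> 0 = c"
    "\<And>y. y \<in> Q \<Longrightarrow> norm y > 1 / r \<Longrightarrow> f y = pw a y * \<phi> (1 / y) + pw b y * \<psi> (1 / y)"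
    using assms unfolding two_exponents_def by blast
  show ?thesis
  proof (rule two_exponentsI[of r "\<lambda>z. (a - b) * \<phi> z - z * deriv \<phi> z" "\<lambda>z. - deriv \<psi> z"])
    fix y assume y: "y \<in> Q" "norm y > 1 / r"
    then have y0: "y \<noteq> 0" using zero_notin_Q by auto
    let ?d = "pw a y * (a * \<phi> (1 / y) - (1 / y) * deriv \<phi> (1 / y)) / y
      + pw b y * (b * \<psi> (1 / y) - (1 / y) * deriv \<psi> (1 / y)) / y"
    have o: "open (Q \<inter> {y. norm y > 1 / r})"
      by (intro open_Int open_Q open_Collect_less continuous_intros)
    have "(f has_field_derivative ?d) (at y)"
      by (rule has_field_derivative_transform_within_open[OF DERIV_add[OF
            has_field_derivative_pw_inverse[OF r(2) y r(1)] has_field_derivative_pw_inverse[OF r(3) y r(1)]] o])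
        (use y r(5) in auto)
    then have "y * deriv f y = y * ?d" by (simp add: DERIV_imp_deriv)
    also have "\<dots> = pw a y * (a * \<phi> (1 / y) - (1 / y) * deriv \<phi> (1 / y))
      + pw b y * (b * \<psi> (1 / y) - (1 / y) * deriv \<psi> (1 / y))"
      using y0 by (simp add: distrib_left)
    finally show "y * deriv f y - b * f y = pw a y * ((a - b) * \<phi> (1 / y) - 1 / y * deriv \<phi> (1 / y))
        + pw (b - 1) y * - deriv \<psi> (1 / y)"
      using r(5)[OF y] y0 y by (simp add: pw_minus_one algebra_simps)
  qed (use r in \<open>auto intro!: holomorphic_intros\<close>)
qed

text \<open>When y^a dominates y^b, the leading coefficient can be read off along a single ray,
  already from the points (n + 1) y.\<close>

lemma two_exponents_limit:
  assumes f: "two_exponents a b f c" and ab: "Re b < Re a" and y: "y \<in> Q"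
  shows "(\<lambda>n. of_nat (Suc n) powr (-a) * f (of_nat (Suc n) * y)) \<longlonglongrightarrow> c * pw a y"
proof -
  obtain r \<phi> \<psi> where r: "r > 0" "\<phi> holomorphic_on ball 0 r" "\<psi> holomorphic_on ball 0 r" "\<phi> 0 = c"
    "\<And>y. y \<in> Q \<Longrightarrow> norm y > 1 / r \<Longrightarrow> f y = pw a y * \<phi> (1 / y) + pw b y * \<psi> (1 / y)"
    using f unfolding two_exponents_def by blast
  have y0: "y \<noteq> 0" using y zero_notin_Q by auto
  have lim0: "(\<lambda>n. 1 / (of_nat (Suc n) * y)) \<longlonglongrightarrow> 0"
  proof -
    have "(\<lambda>n. inverse (of_nat (Suc n)) * (1 / y)) \<longlonglongrightarrow> 0 * (1 / y)"
      by (intro tendsto_mult tendsto_const LIMSEQ_Suc[OF lim_inverse_n])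
    then show ?thesis by (simp add: field_simps)
  qed
  have c: "isCont \<phi> 0" "isCont \<psi> 0"
    using r by (auto intro!: continuous_on_interior[of "ball 0 r"] holomorphic_on_imp_continuous_on)
  have l1: "(\<lambda>n. \<phi> (1 / (of_nat (Suc n) * y))) \<longlonglongrightarrow> c"
    using isCont_tendsto_compose[OF c(1) lim0] r(4) by simp
  have l2: "(\<lambda>n. \<psi> (1 / (of_nat (Suc n) * y))) \<longlonglongrightarrow> \<psi> 0"
    using isCont_tendsto_compose[OF c(2) lim0] by simp
  have l3: "(\<lambda>n. of_nat (Suc n) powr (b - a)) \<longlonglongrightarrow> (0::complex)"
  proof (rule tendsto_norm_zero_cancel)
    have "(\<lambda>n. real (Suc n) powr (Re b - Re a)) \<longlonglongrightarrow> 0"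
      using ab by (intro LIMSEQ_Suc[where f="\<lambda>n. real n powr (Re b - Re a)"] tendsto_neg_powr filterlim_real_sequentially) auto
    moreover have "norm (of_nat (Suc n) powr (b - a) :: complex) = real (Suc n) powr (Re b - Re a)" for n
      by (subst norm_powr_real_powr) (auto simp del: of_nat_Suc)
    ultimately show "(\<lambda>n. norm (of_nat (Suc n) powr (b - a) :: complex)) \<longlonglongrightarrow> 0" by presburger
  qed
  have "eventually (\<lambda>n. norm (1 / (of_nat (Suc n) * y)) < r) sequentially"
    using tendstoD[OF lim0 r(1)] by simp
  then have ev: "eventually (\<lambda>n. pw a y * \<phi> (1 / (of_nat (Suc n) * y))
      + of_nat (Suc n) powr (b - a) * (pw b y * \<psi> (1 / (of_nat (Suc n) * y)))
      = of_nat (Suc n) powr (-a) * f (of_nat (Suc n) * y)) sequentially"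
  proof eventually_elim
    case (elim n)
    have s: "0 < real (Suc n)" by simp
    have e: "of_nat (Suc n) * y = of_real (real (Suc n)) * y" by simp
    have yq: "of_nat (Suc n) * y \<in> Q" using cone[OF s y] by simp
    have "norm (of_nat (Suc n) * y) > 1 / r"
    proof -
      have "0 < norm (of_nat (Suc n) * y)" using y0 by (simp del: of_nat_Suc)
      moreover have "1 / norm (of_nat (Suc n) * y) < r" using elim by (simp add: norm_divide del: of_nat_Suc)
      ultimately show ?thesis using r(1) by (simp add: field_simps del: of_nat_Suc)
    qed
    from r(5)[OF yq this] have "f (of_nat (Suc n) * y) = of_nat (Suc n) powr a * pw a y * \<phi> (1 / (of_nat (Suc n) * y))
        + of_nat (Suc n) powr b * pw b y * \<psi> (1 / (of_nat (Suc n) * y))"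
      using pw_scale[OF s y] by (simp del: of_nat_Suc)
    then show ?case
      by (simp add: powr_diff powr_minus field_simps del: of_nat_Suc)
  qed
  have "(\<lambda>n. pw a y * \<phi> (1 / (of_nat (Suc n) * y))
      + of_nat (Suc n) powr (b - a) * (pw b y * \<psi> (1 / (of_nat (Suc n) * y)))) \<longlonglongrightarrow>
      pw a y * c + 0 * (pw b y * \<psi> 0)"
    by (intro tendsto_intros l1 l2 l3)
  then show ?thesis using Lim_transform_eventually[OF _ ev] by (simp add: mult.commute)
qed

section \<open>Riemann--Liouville integrals\<close>

text \<open>
  The Riemann--Liouville integral of order \<open>a\<close> from the apex of the cone, up to the factor
  \<open>Gamma a\<close>, written over \<open>{0..1}\<close>.
\<close>

definition rl_integral :: "complex \<Rightarrow> (complex \<Rightarrow> complex) \<Rightarrow> complex \<Rightarrow> complex" where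
  "rl_integral a b y =
     pw a y * integral {0..1} (\<lambda>s. b (of_real s * y) * of_real (1 - s) powr (a - 1))"

text \<open>The value 0 at the apex makes the integrand of \<open>rl_integral\<close> continuous on
  the closed interval as soon as Re a > 1, so that no improper integrals occur.\<close>

definition vanishing :: "(complex \<Rightarrow> complex) \<Rightarrow> bool" where
  "vanishing b \<longleftrightarrow> b holomorphic_on Q \<and> continuous_on (insert 0 Q) b \<and> b 0 = 0"

lemma vanishing_pw:
  assumes "Re p > 0" shows "vanishing (\<lambda>y. if y = 0 then 0 else pw p y)"
proof -
  obtain C where C: "C > 0" "\<And>y. y \<in> Q \<Longrightarrow> norm (pw p y) \<le> C * norm y powr Re p"
    using pw_norm_bound by blast
  have hol: "(\<lambda>y. if y = 0 then 0 else pw p y) holomorphic_on Q"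
    by (rule holomorphic_transform[OF pw_holomorphic[of p]]) (use zero_notin_Q in auto)
  have "continuous (at y within insert 0 Q) (\<lambda>y. if y = 0 then 0 else pw p y)" if y: "y \<in> insert 0 Q" for y
  proof (cases "y = 0")
    case False
    then have "isCont (\<lambda>y. if y = 0 then 0 else pw p y) y"
      using hol y open_Q holomorphic_on_imp_continuous_on continuous_on_eq_continuous_at by blast
    then show ?thesis by (rule continuous_at_imp_continuous_at_within)
  next
    case True
    have lim: "((\<lambda>y. C * norm y powr Re p) \<longlongrightarrow> C * 0) (at 0 within insert 0 Q)"
      using assms by (intro tendsto_mult tendsto_const tendsto_zero_powrI[where b="Re p"] tendsto_norm_zero tendsto_ident_at) auto
    have "((\<lambda>y. if y = 0 then 0 else pw p y) \<longlongrightarrow> 0) (at 0 within insert 0 Q)"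
    proof (rule Lim_null_comparison[OF _ lim[unfolded mult_zero_right]])
      show "\<forall>\<^sub>F y in at 0 within insert 0 Q. norm (if y = 0 then 0 else pw p y) \<le> C * norm y powr Re p"
        using C by (auto simp: eventually_at_filter)
    qed
    then show ?thesis by (simp add: True continuous_within)
  qed
  then show ?thesis using hol unfolding vanishing_def by (auto simp: continuous_on_eq_continuous_within)
qed

lemma cone0: "0 \<le> s \<Longrightarrow> y \<in> Q \<Longrightarrow> of_real s * y \<in> insert 0 Q"
  using cone[of s y] by (cases "s = 0") auto

lemma continuous_on_rl_integrand:
  assumes b: "vanishing b" and a: "Re a > 1"
  shows "continuous_on (Q \<times> {0..1}) (\<lambda>(y, s). b (of_real s * y) * of_real (1 - s) powr (a - 1))"
  unfolding split_def
proof (intro continuous_on_mult)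
  show "continuous_on (Q \<times> {0..1}) (\<lambda>x. b (of_real (snd x) * fst x))"
  proof (rule continuous_on_compose2[of "insert 0 Q" b])
    show "(\<lambda>x. of_real (snd x) * fst x) ` (Q \<times> {0..1}) \<subseteq> insert 0 Q"
      using cone0 by (intro image_subsetI) (metis atLeastAtMost_iff mem_Times_iff)
  qed (use b in \<open>auto simp: vanishing_def intro!: continuous_intros\<close>)
  show "continuous_on (Q \<times> {0..1}) (\<lambda>x. of_real (1 - snd x) powr (a - 1))"
    using a by (intro continuous_intros) auto
qed

lemma continuous_on_rl_integrand':
  assumes b: "vanishing b" and a: "Re a > 1" and y: "y \<in> Q"
  shows "continuous_on {0..1} (\<lambda>s. b (of_real s * y) * of_real (1 - s) powr (a - 1))"
proof -
  have "continuous_on {0..1} ((\<lambda>(y, s). b (of_real s * y) * of_real (1 - s) powr (a - 1)) \<circ> (\<lambda>s. (y, s)))"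
    by (intro continuous_on_compose continuous_on_subset[OF continuous_on_rl_integrand[OF b a]] continuous_intros)
      (use y in auto)
  then show ?thesis by (simp add: o_def)
qed

lemma rl_integral_holomorphic:
  assumes b: "vanishing b" and a: "Re a > 1"
  shows "rl_integral a b holomorphic_on Q"
  unfolding rl_integral_def[abs_def]
proof (rule holomorphic_on_mult[OF pw_holomorphic holomorphic_integral_param[OF open_Q
    continuous_on_rl_integrand[OF b a]]])
  fix s :: real assume s: "s \<in> {0..1}"
  show "(\<lambda>y. b (of_real s * y) * of_real (1 - s) powr (a - 1)) holomorphic_on Q"
  proof (cases "s = 0")
    case False
    have "(b \<circ> (\<lambda>y. of_real s * y)) holomorphic_on Q"
      using b s False cone
      by (intro holomorphic_on_compose_gen[where t=Q] holomorphic_intros) (auto simp: vanishing_def)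
    then show ?thesis by (intro holomorphic_intros) (simp add: o_def)
  qed auto
qed

text \<open>Termwise integration: scaling y by s turns the m-th term into a multiple of s^(p + m),
  whose integral against (1 - s)^(a - 1) is a Beta value.\<close>

lemma rl_integral_frobenius:
  assumes b: "vanishing b" and a: "Re a > 1" and p: "Re p > 0" and f: "frobenius p c b"
  shows "frobenius (p + a) (\<lambda>m. Beta (p + of_nat m + 1) a * c m) (rl_integral a b)"
proof -
  obtain R \<phi> where R: "R > 0" "\<phi> holomorphic_on ball 0 R"
    "\<And>y. norm y < R \<Longrightarrow> (\<lambda>m. c m * y ^ m) sums \<phi> y"
    "\<And>y. norm y < R \<Longrightarrow> summable (\<lambda>m. norm (c m * y ^ m))"
    "\<And>y. y \<in> Q \<Longrightarrow> norm y < R \<Longrightarrow> b y = pw p y * \<phi> y"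
    using frobenius_holomorphicE[OF f] by blast
  show ?thesis unfolding frobenius_def
  proof (intro exI[of _ R] conjI ballI impI)
    fix y assume y: "y \<in> Q" "norm y < R"
    define u where "u = (\<lambda>m s. pw p y * (c m * y ^ m) *
      (complex_of_real s powr (p + of_nat m) * complex_of_real (1 - s) powr (a - 1)))"
    \<comment> \<open>Both powers have norm at most 1, so the M-test reduces to absolute convergence
      of the series of \<open>b\<close> at \<open>y\<close>, uniformly in \<open>s\<close>.\<close>
    have nb: "norm (complex_of_real s powr (p + of_nat m) * complex_of_real (1 - s) powr (a - 1)) \<le> 1"
      if "s \<in> {0..1}" for s m
    proof -
      have "norm (complex_of_real s powr (p + of_nat m)) \<le> 1"
        using that p by (cases "s = 0") (auto simp: norm_powr_real_powr powr_le1)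
      moreover have "norm (complex_of_real (1 - s) powr (a - 1)) \<le> 1"
        using that a by (cases "s = 1") (auto simp: norm_powr_real_powr powr_le1 simp flip: of_real_diff)
      ultimately show ?thesis unfolding norm_mult using mult_le_one norm_ge_zero by blast
    qed
    have ul: "uniform_limit {0..1} (\<lambda>n s. \<Sum>m<n. u m s) (\<lambda>s. \<Sum>m. u m s) sequentially"
    proof (rule Weierstrass_m_test)
      show "norm (u m s) \<le> norm (pw p y) * norm (c m * y ^ m)" if "s \<in> {0..1}" for m s
        using mult_left_mono[OF nb[OF that], of "norm (pw p y * (c m * y ^ m))" m]
        unfolding u_def norm_mult by (simp add: mult_ac)
      show "summable (\<lambda>m. norm (pw p y) * norm (c m * y ^ m))"
        using R(4)[OF y(2)] by (rule summable_mult)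
    qed
    have us: "(\<Sum>m. u m s) = b (of_real s * y) * of_real (1 - s) powr (a - 1)" if s: "s \<in> {0..1}" for s
    proof (cases "s = 0")
      case True
      then show ?thesis using b by (simp add: u_def vanishing_def)
    next
      case False
      then have s0: "s > 0" using s by auto
      have sy: "of_real s * y \<in> Q" using cone[OF s0 y(1)] .
      have "norm (of_real s * y) \<le> 1 * norm y" unfolding norm_mult using s by (intro mult_right_mono) auto
      then have nsy: "norm (of_real s * y) < R" using y by simp
      have "(\<lambda>m. pw p (of_real s * y) * (c m * (of_real s * y) ^ m) * of_real (1 - s) powr (a - 1))
          sums (b (of_real s * y) * of_real (1 - s) powr (a - 1))"
        unfolding R(5)[OF sy nsy] by (intro sums_mult sums_mult2 R(3) nsy)
      also have "(\<lambda>m. pw p (of_real s * y) * (c m * (of_real s * y) ^ m) * of_real (1 - s) powr (a - 1)) = (\<lambda>m. u m s)"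
        unfolding u_def pw_scale[OF s0 y(1)]
        using s0 by (simp add: powr_add powr_nat' power_mult_distrib mult_ac)
      finally show ?thesis by (simp add: sums_iff)
    qed
    have ui: "(u m has_integral pw p y * (c m * y ^ m) * Beta (p + of_nat m + 1) a) {0..1}" for m
      unfolding u_def using has_integral_Beta_complex[of "p + of_nat m" "a - 1"] p a
      by (intro has_integral_mult_right) simp
    obtain I J where IJ: "\<And>n. ((\<lambda>s. \<Sum>m<n. u m s) has_integral I n) {0..1}"
      "((\<lambda>s. \<Sum>m. u m s) has_integral J) {0..1}" "I \<longlonglongrightarrow> J"
    proof (rule uniform_limit_integral[OF ul])
      show "continuous_on {0..1} (\<lambda>s. \<Sum>m<n. u m s)" for n
        unfolding u_def
      proof (intro continuous_on_sum continuous_on_mult_left continuous_on_beta_integrand)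
      qed (use p a in \<open>auto intro!: continuous_intros\<close>)
    qed auto
    have "I n = (\<Sum>m<n. pw p y * (c m * y ^ m) * Beta (p + of_nat m + 1) a)" for n
      by (rule has_integral_unique[OF IJ(1)]) (intro has_integral_sum ui finite_lessThan)
    then have "(\<lambda>m. pw p y * (c m * y ^ m) * Beta (p + of_nat m + 1) a) sums J"
      using IJ(3) unfolding sums_def by presburger
    moreover have "J = integral {0..1} (\<lambda>s. b (of_real s * y) * of_real (1 - s) powr (a - 1))"
      unfolding integral_unique[OF IJ(2), symmetric] by (intro integral_cong us)
    ultimately have "(\<lambda>m. pw a y * (pw p y * (c m * y ^ m) * Beta (p + of_nat m + 1) a)) sums rl_integral a b y"
      unfolding rl_integral_def by (intro sums_mult) simp
    then show "(\<lambda>m. pw (p + a) y * (Beta (p + of_nat m + 1) a * c m * y ^ m)) sums rl_integral a b y"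
      by (simp add: pw_add mult_ac)
  qed (use R in auto)
qed

end

lemma prod_falling_pochhammer:
  fixes z :: complex
  shows "(\<Prod>i<M. z - of_nat i) = pochhammer (z - of_nat M + 1) M"
proof (induction M)
  case (Suc M)
  have "pochhammer (z - of_nat (Suc M) + 1) (Suc M) = (z - of_nat M) * pochhammer (z - of_nat M + 1) M"
    using pochhammer_rec[of "z - of_nat M" M] by simp
  then show ?case using Suc by simp
qed simp

section \<open>Growth of Riemann--Liouville integrals and the scalar connection coefficient\<close>

context cone_branch
begin

text \<open>Here the factor goes into the exponent and the coefficients stay;
  \<open>frobenius_mult_var\<close> keeps the exponent and moves the coefficients instead.\<close>

lemma frobenius_shift:
  assumes "frobenius a c f"
  shows "frobenius (a + of_nat k) c (\<lambda>y. y ^ k * f y)"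
proof -
  obtain R where R: "R > 0" "\<And>y. y \<in> Q \<Longrightarrow> norm y < R \<Longrightarrow> (\<lambda>m. pw a y * (c m * y ^ m)) sums f y"
    using assms unfolding frobenius_def by auto
  show ?thesis unfolding frobenius_def
  proof (intro exI[of _ R] conjI ballI impI)
    fix y assume "y \<in> Q" "norm y < R"
    then show "(\<lambda>m. pw (a + of_nat k) y * (c m * y ^ m)) sums (y ^ k * f y)"
      using sums_mult[OF R(2), of y "y ^ k"] by (simp add: pw_add_nat mult_ac)
  qed (use R in auto)
qed

lemma vanishing_of_frobenius:
  assumes f: "frobenius p c f" and p: "Re p > 0" and hol: "f holomorphic_on Q"
  shows "vanishing (\<lambda>y. if y = 0 then 0 else f y)"
proof -
  obtain R \<phi> where R: "R > 0" "\<phi> holomorphic_on ball 0 R"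
    "\<And>y. y \<in> Q \<Longrightarrow> norm y < R \<Longrightarrow> f y = pw p y * \<phi> y"
    using frobenius_holomorphicE[OF f] by metis
  have hol': "(\<lambda>y. if y = 0 then 0 else f y) holomorphic_on Q"
    by (rule holomorphic_transform[OF hol]) (use zero_notin_Q in auto)
  have "continuous (at y within insert 0 Q) (\<lambda>y. if y = 0 then 0 else f y)" if y: "y \<in> insert 0 Q" for y
  proof (cases "y = 0")
    case False
    then have "isCont (\<lambda>y. if y = 0 then 0 else f y) y"
      using hol' y open_Q holomorphic_on_imp_continuous_on continuous_on_eq_continuous_at by blast
    then show ?thesis by (rule continuous_at_imp_continuous_at_within)
  next
    case True
    let ?g = "\<lambda>y. if y = 0 then 0 else pw p y"
    have "continuous_on (insert 0 Q) ?g" using vanishing_pw[OF p] by (simp add: vanishing_def)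
    then have 1: "(?g \<longlongrightarrow> ?g 0) (at 0 within insert 0 Q)" unfolding continuous_on_def by blast
    have "isCont \<phi> 0"
      using R by (auto intro!: continuous_on_interior[of "ball 0 R"] holomorphic_on_imp_continuous_on)
    then have "(\<phi> \<longlongrightarrow> \<phi> 0) (at 0 within insert 0 Q)"
      by (simp add: continuous_within[symmetric] continuous_at_imp_continuous_at_within)
    from tendsto_mult[OF 1 this]
    have "((\<lambda>y. ?g y * \<phi> y) \<longlongrightarrow> 0) (at 0 within insert 0 Q)" by simp
    then have "((\<lambda>y. if y = 0 then 0 else f y) \<longlongrightarrow> 0) (at 0 within insert 0 Q)"
      by (rule Lim_transform_within[OF _ R(1)]) (use R(3) in auto)
    then show ?thesis by (simp add: True continuous_within)
  qed
  then show ?thesis using hol' unfolding vanishing_def by (auto simp: continuous_on_eq_continuous_within)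
qed

text \<open>A pure power is reproduced exactly, not only asymptotically; it is the comparison
  function at infinity.\<close>

lemma rl_integral_pw:
  assumes "Re k > 0" "Re a > 1" "y \<in> Q"
  shows "rl_integral a (\<lambda>y. if y = 0 then 0 else pw k y) y = Beta (k + 1) a * pw (k + a) y"
proof -
  have "((\<lambda>s. pw k y * (complex_of_real s powr k * complex_of_real (1 - s) powr (a - 1)))
      has_integral pw k y * Beta (k + 1) (a - 1 + 1)) {0..1}"
    using assms by (intro has_integral_mult_right has_integral_Beta_complex) auto
  then have "((\<lambda>s. (if complex_of_real s * y = 0 then 0 else pw k (of_real s * y)) * complex_of_real (1 - s) powr (a - 1))
      has_integral pw k y * Beta (k + 1) a) {0..1}"
  proof (subst has_integral_cong)
    fix s :: real assume "s \<in> {0..1}"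
    then show "(if complex_of_real s * y = 0 then 0 else pw k (of_real s * y)) * complex_of_real (1 - s) powr (a - 1) =
      pw k y * (complex_of_real s powr k * complex_of_real (1 - s) powr (a - 1))"
      using assms zero_notin_Q pw_scale[of s y k] by (cases "s = 0") auto
  qed simp
  then show ?thesis
    unfolding rl_integral_def by (simp add: integral_unique pw_add)
qed

text \<open>Turns D = o(y^k) into a bound valid down to the apex and uniform over the compact set
  \<open>K\<close>: far out the limit applies, and the remaining part of the cone over
  \<open>K\<close>, apex included, is compact. The constant \<open>C\<close> becomes negligible
  after rescaling.\<close>

lemma dominated_by_power:
  assumes D: "vanishing D" and lim: "((\<lambda>y. D y * pw (-k) y) \<longlongrightarrow> 0) (inf at_infinity (principal Q))"
    and K: "compact K" "K \<subseteq> Q" and e: "e > 0"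
  obtains C where "C \<ge> 0" "\<And>s y. 0 \<le> s \<Longrightarrow> y \<in> K \<Longrightarrow> norm (D (of_real s * y)) \<le> e * s powr Re k + C"
proof -
  have "compact (pw k ` K)"
    using K by (intro compact_continuous_image holomorphic_on_imp_continuous_on holomorphic_on_subset[OF pw_holomorphic])
  then obtain M where M: "M > 0" "\<And>y. y \<in> K \<Longrightarrow> norm (pw k y) \<le> M"
    using bounded_pos[of "pw k ` K"] compact_imp_bounded by auto
  have "eventually (\<lambda>y. norm (D y * pw (-k) y) < e / M) (inf at_infinity (principal Q))"
    using tendstoD[OF lim, of "e / M"] e M by simp
  then obtain X where X: "\<And>y. y \<in> Q \<Longrightarrow> norm y \<ge> X \<Longrightarrow> norm (D y * pw (-k) y) < e / M"
    unfolding eventually_inf_principal eventually_at_infinity by auto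
  have "compact ((\<lambda>y. inverse (norm y)) ` K)"
    using K zero_notin_Q by (intro compact_continuous_image continuous_intros) auto
  then have "bounded ((\<lambda>y. inverse (norm y)) ` K)" by (rule compact_imp_bounded)
  then obtain I where "I > 0" "\<forall>x \<in> (\<lambda>y. inverse (norm y)) ` K. norm x \<le> I"
    unfolding bounded_pos by blast
  then have I: "I > 0" "\<And>y. y \<in> K \<Longrightarrow> inverse (norm y) \<le> I" by auto
  \<comment> \<open>Chosen so that s > \<open>Y\<close> forces |s y| >= \<open>X\<close> for every y
    in \<open>K\<close> at once.\<close>
  define Y where "Y = \<bar>X\<bar> * I"
  have "compact ((\<lambda>(s, y). of_real s * y) ` ({0..Y} \<times> K))"
    using K by (intro compact_continuous_image compact_Times) (auto simp: split_def intro!: continuous_intros)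
  moreover have sub: "(\<lambda>(s, y). of_real s * y) ` ({0..Y} \<times> K) \<subseteq> insert 0 Q"
  proof (rule image_subsetI)
    fix x assume "x \<in> {0..Y} \<times> K"
    then show "(case x of (s, y) \<Rightarrow> of_real s * y) \<in> insert 0 Q"
      using cone0[of "fst x" "snd x"] K(2) by (simp add: split_def mem_Times_iff subset_iff)
  qed
  ultimately have "compact (D ` (\<lambda>(s, y). of_real s * y) ` ({0..Y} \<times> K))"
    using D unfolding vanishing_def by (intro compact_continuous_image[OF continuous_on_subset[OF _ sub]]) auto
  then have "bounded (D ` (\<lambda>(s, y). of_real s * y) ` ({0..Y} \<times> K))" by (rule compact_imp_bounded)
  then obtain C where C0: "C > 0" "\<forall>x \<in> D ` (\<lambda>(s, y). of_real s * y) ` ({0..Y} \<times> K). norm x \<le> C"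
    unfolding bounded_pos by blast
  have C: "norm (D (of_real s * y)) \<le> C" if "0 \<le> s" "s \<le> Y" "y \<in> K" for s y
  proof -
    have "(s, y) \<in> {0..Y} \<times> K" using that by simp
    then have "D (of_real s * y) \<in> D ` (\<lambda>(s, y). of_real s * y) ` ({0..Y} \<times> K)" by (intro image_eqI refl) auto
    then show ?thesis using C0(2) by blast
  qed
  have "norm (D (of_real s * y)) \<le> e * s powr Re k + C" if s: "0 \<le> s" and y: "y \<in> K" for s y
  proof (cases "s \<le> Y")
    case True
    then have "norm (D (of_real s * y)) \<le> C" using C s y by auto
    moreover have "0 \<le> e * s powr Re k" using e by simp
    ultimately show ?thesis by linarith
  next
    case False
    have "0 \<le> Y" using I(1) by (simp add: Y_def)
    then have s0: "s > 0" using False by linarith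
    have yQ: "y \<in> Q" using y K by auto
    then have y0: "norm y > 0" using zero_notin_Q by auto
    have "\<bar>X\<bar> * inverse (norm y) \<le> Y" unfolding Y_def using I(2)[OF y] by (intro mult_left_mono) auto
    then have "\<bar>X\<bar> * inverse (norm y) < s" using False by linarith
    then have "X \<le> norm (of_real s * y)" using s0 y0 by (simp add: norm_mult field_simps)
    then have "norm (D (of_real s * y) * pw (-k) (of_real s * y)) < e / M"
      using X cone[OF s0 yQ] by blast
    then have "norm (D (of_real s * y)) * norm (pw (-k) (of_real s * y)) * norm (pw k (of_real s * y))
        \<le> e / M * norm (pw k (of_real s * y))"
      unfolding norm_mult by (intro mult_right_mono) auto
    moreover have "pw (-k) (of_real s * y) * pw k (of_real s * y) = 1"
      using pw_add[of "-k" k] by (simp add: pw_def)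
    then have "norm (pw (-k) (of_real s * y)) * norm (pw k (of_real s * y)) = 1" by (metis norm_mult norm_one)
    ultimately have "norm (D (of_real s * y)) \<le> e / M * norm (pw k (of_real s * y))"
      by (simp add: mult.assoc)
    also have "norm (pw k (of_real s * y)) = s powr Re k * norm (pw k y)"
      using s0 yQ by (simp add: pw_scale norm_mult norm_powr_real_powr)
    also have "e / M * (s powr Re k * norm (pw k y)) \<le> e / M * (s powr Re k * M)"
      using e M y by (intro mult_left_mono) auto
    also have "\<dots> = e * s powr Re k" using M by simp
    finally show ?thesis using C0(1) by linarith
  qed
  then show ?thesis using that[of C] C0(1) by auto
qed

text \<open>Subtracting l y^k, whose integral is known exactly, leaves a remainder of smaller order
  that \<open>dominated_by_power\<close> controls. Uniformity on compact sets is needed because the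
  limit will be differentiated.\<close>

lemma rl_integral_asymptotics:
  assumes b: "vanishing b" and a: "Re a > 1" and k: "Re k > 0"
    and lim: "((\<lambda>y. b y * pw (-k) y) \<longlongrightarrow> l) (inf at_infinity (principal Q))"
    and K: "compact K" "K \<subseteq> Q"
  shows "uniform_limit K (\<lambda>n y. of_nat (Suc n) powr (-(k + a)) * rl_integral a b (of_nat (Suc n) * y))
    (\<lambda>y. l * Beta (k + 1) a * pw (k + a) y) sequentially"
proof -
  define p where "p = (\<lambda>y. if y = 0 then 0 else pw k y)"
  define D where "D = (\<lambda>y. b y - l * p y)"
  have p: "vanishing p" unfolding p_def using k by (rule vanishing_pw)
  have D: "vanishing D"
    using b p unfolding vanishing_def D_def by (auto intro!: holomorphic_intros continuous_intros)
  have lim0: "((\<lambda>y. b y * pw (-k) y - l) \<longlongrightarrow> l - l) (inf at_infinity (principal Q))"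
    by (intro tendsto_intros lim)
  have limD: "((\<lambda>y. D y * pw (-k) y) \<longlongrightarrow> 0) (inf at_infinity (principal Q))"
  proof (rule Lim_transform_eventually[OF lim0[unfolded diff_self]])
    have "b y * pw (-k) y - l = D y * pw (-k) y" if "y \<in> Q" for y
    proof -
      have "y \<noteq> 0" using that zero_notin_Q by auto
      moreover have "pw k y * pw (-k) y = 1" using pw_add[of k "-k" y] by (simp add: pw_def)
      ultimately show ?thesis by (simp add: D_def p_def left_diff_distrib mult.assoc)
    qed
    then show "\<forall>\<^sub>F y in inf at_infinity (principal Q). b y * pw (-k) y - l = D y * pw (-k) y"
      by (simp add: eventually_inf_principal)
  qed
  have diff: "of_nat (Suc n) powr (-(k + a)) * rl_integral a b (of_nat (Suc n) * y) - l * Beta (k + 1) a * pw (k + a) y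
      = of_nat (Suc n) powr (-(k + a)) * rl_integral a D (of_nat (Suc n) * y)" if y: "y \<in> Q" for n y
  proof -
    have N: "0 < real (Suc n)" by simp
    have z: "of_nat (Suc n) * y \<in> Q" using cone[OF N y] by simp
    have i: "(\<lambda>s. b (of_real s * z) * of_real (1 - s) powr (a - 1)) integrable_on {0..1}" if "vanishing b" "z \<in> Q" for b z
      using continuous_on_rl_integrand'[OF that(1) a that(2)] by (rule integrable_continuous_real)
    have "rl_integral a D (of_nat (Suc n) * y) = rl_integral a b (of_nat (Suc n) * y) - l * rl_integral a p (of_nat (Suc n) * y)"
      unfolding rl_integral_def D_def
      by (subst integral_mult_right[symmetric] right_diff_distrib[symmetric] mult.left_commute[of l] integral_diff[symmetric],
          (intro integrable_on_mult_right i p b z)?)+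
        (simp add: algebra_simps)
    moreover have "rl_integral a p (of_nat (Suc n) * y) = Beta (k + 1) a * (of_nat (Suc n) powr (k + a) * pw (k + a) y)"
      unfolding p_def using rl_integral_pw[OF k a z] pw_scale[OF N y] by simp
    moreover have "of_nat (Suc n) powr (-(k + a)) * of_nat (Suc n) powr (k + a) = (1::complex)"
      by (simp only: powr_add[symmetric]) (simp del: of_nat_Suc)
    moreover have "c * x - l * z * w = c * (x - l * (z * (d * w)))" if "c * d = 1" for c d w x z :: complex
    proof -
      have "c * (l * (z * (d * w))) = (c * d) * (l * z * w)" by (simp only: mult_ac)
      then show ?thesis using that by (simp add: right_diff_distrib)
    qed
    ultimately show ?thesis by presburger
  qed
  have "compact (pw a ` K)"
    using K by (intro compact_continuous_image holomorphic_on_imp_continuous_on holomorphic_on_subset[OF pw_holomorphic])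
  then obtain M where M: "M > 0" "\<And>y. y \<in> K \<Longrightarrow> norm (pw a y) \<le> M"
    using bounded_pos[of "pw a ` K"] compact_imp_bounded by auto
  show ?thesis
  proof (rule uniform_limitI)
    fix e :: real assume e: "e > 0"
    \<comment> \<open>\<open>M\<close> bounds |y^a| on \<open>K\<close>; the factor 2 leaves room
      for the term with \<open>C\<close>, which tends to 0.\<close>
    define e' where "e' = e / (2 * M)"
    have e': "e' > 0" using e M by (simp add: e'_def)
    obtain C where C: "C \<ge> 0" "\<And>s y. 0 \<le> s \<Longrightarrow> y \<in> K \<Longrightarrow> norm (D (of_real s * y)) \<le> e' * s powr Re k + C"
      using dominated_by_power[OF D limD K e'] by blast
    have bound: "norm (of_nat (Suc n) powr (-(k + a)) * rl_integral a D (of_nat (Suc n) * y))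
        \<le> M * (e' + C * real (Suc n) powr (- Re k))" if y: "y \<in> K" for n y
    proof -
      have yQ: "y \<in> Q" using y K by auto
      define N where "N = real (Suc n)"
      have N: "N > 0" "complex_of_nat (Suc n) = of_real N" by (auto simp: N_def)
      have z: "of_real N * y \<in> Q" using cone[OF N(1) yQ] .
      have "norm (integral {0..1} (\<lambda>s. D (of_real s * (of_real N * y)) * of_real (1 - s) powr (a - 1)))
          \<le> (e' * N powr Re k + C) * (1 - 0)"
      proof (rule integral_bound)
        fix s :: real assume s: "s \<in> {0..1}"
        have 1: "norm (complex_of_real (1 - s) powr (a - 1)) \<le> 1"
          using s a by (cases "s = 1") (auto simp: norm_powr_real_powr powr_le1 simp flip: of_real_diff)
        have "norm (D (of_real (s * N) * y)) \<le> e' * (s * N) powr Re k + C"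
          using s N by (intro C y) auto
        also have "(s * N) powr Re k \<le> N powr Re k"
          using s N k by (intro powr_mono2) (auto simp: mult_le_cancel_right1)
        finally have 2: "norm (D (of_real s * (of_real N * y))) \<le> e' * N powr Re k + C"
          using e' by (simp add: mult.assoc)
        show "norm (D (of_real s * (of_real N * y)) * of_real (1 - s) powr (a - 1)) \<le> e' * N powr Re k + C"
          unfolding norm_mult using mult_mono[OF 2 1] C(1) e' by simp
      qed (use continuous_on_rl_integrand'[OF D a z] in auto)
      then have "norm (rl_integral a D (of_real N * y)) \<le> N powr Re a * norm (pw a y) * (e' * N powr Re k + C)"
        unfolding rl_integral_def pw_scale[OF N(1) yQ] norm_mult
        using N by (intro mult_mono) (auto simp: norm_powr_real_powr)
      also have "\<dots> \<le> N powr Re a * M * (e' * N powr Re k + C)"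
        using M(2)[OF y] C(1) e' by (intro mult_right_mono mult_left_mono) auto
      finally have "norm (of_real N powr (-(k + a)) * rl_integral a D (of_real N * y))
          \<le> N powr (- Re k - Re a) * (N powr Re a * M * (e' * N powr Re k + C))"
        unfolding norm_mult using N by (intro mult_mono) (auto simp: norm_powr_real_powr)
      also have "\<dots> = M * (e' + C * N powr (- Re k))"
        using N by (simp add: powr_diff powr_minus field_simps)
      finally show ?thesis unfolding N(2) N_def .
    qed
    have "(\<lambda>n. M * (e' + C * real (Suc n) powr (- Re k))) \<longlonglongrightarrow> M * (e' + C * 0)"
      using k by (intro tendsto_intros LIMSEQ_Suc[where f="\<lambda>n. real n powr (- Re k)"] tendsto_neg_powr filterlim_real_sequentially) auto
    moreover have "M * (e' + C * 0) < e" using M e by (simp add: e'_def)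
    ultimately have "eventually (\<lambda>n. M * (e' + C * real (Suc n) powr (- Re k)) < e) sequentially"
      by (rule order_tendstoD)
    then show "\<forall>\<^sub>F n in sequentially. \<forall>y\<in>K. dist (of_nat (Suc n) powr (-(k + a)) * rl_integral a b (of_nat (Suc n) * y))
        (l * Beta (k + 1) a * pw (k + a) y) < e"
    proof eventually_elim
      case (elim n)
      show ?case
      proof
        fix y assume y: "y \<in> K"
        then show "dist (of_nat (Suc n) powr (-(k + a)) * rl_integral a b (of_nat (Suc n) * y))
          (l * Beta (k + 1) a * pw (k + a) y) < e"
          unfolding dist_norm using diff[of y n] bound[OF y, of n] elim K by (auto simp del: of_nat_Suc)
      qed
    qed
  qed
qed

text \<open>The eigenvalue of y^M D^M on y^r is the falling factorial r (r - 1) ... (r - M + 1),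
  here written as a Pochhammer symbol.\<close>

lemma euler_tower_pw:
  assumes y: "y \<in> Q"
  shows "y ^ M * (deriv ^^ M) (\<lambda>y. l * pw r y) y = l * pochhammer (r - of_nat M + 1) M * pw r y"
proof -
  define E where "E = rec_nat (\<lambda>y. l * pw r y) (\<lambda>i f y. y * deriv f y - of_nat i * f y)"
  have hol: "(\<lambda>y. l * pw r y) holomorphic_on Q" by (intro holomorphic_intros pw_holomorphic)
  have "E i y = l * (\<Prod>j<i. r - of_nat j) * pw r y" if "y \<in> Q" for i y
    using that
  proof (induction i arbitrary: y)
    case (Suc i)
    have "((\<lambda>y. l * (\<Prod>j<i. r - of_nat j) * pw r y) has_field_derivative
        l * (\<Prod>j<i. r - of_nat j) * (r * pw r y / y)) (at y)"
      by (intro DERIV_cmult pw_has_field_derivative Suc.prems)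
    then have "(E i has_field_derivative l * (\<Prod>j<i. r - of_nat j) * (r * pw r y / y)) (at y)"
      by (rule has_field_derivative_transform_within_open[OF _ open_Q Suc.prems]) (simp add: Suc.IH)
    moreover have "y \<noteq> 0" using Suc.prems zero_notin_Q by auto
    ultimately show ?case
      using Suc.IH[OF Suc.prems] by (simp add: E_def DERIV_imp_deriv algebra_simps)
  qed (simp add: E_def)
  moreover have "E M y = y ^ M * (deriv ^^ M) (\<lambda>y. l * pw r y) y"
    by (rule euler_tower_deriv[OF open_Q hol _ _ y]) (simp_all add: E_def)
  ultimately show ?thesis using y by (simp add: prod_falling_pochhammer)
qed

text \<open>Uniform limits of holomorphic functions may be differentiated. Differentiating z |-> f
  (N z) brings out the factor N^M, which accounts for the changed power in front.\<close>

lemma higher_deriv_rl_integral_limit: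
  assumes b: "vanishing b" and a: "Re a > 1" and k: "Re k > 0"
    and lim: "((\<lambda>y. b y * pw (-k) y) \<longlongrightarrow> l) (inf at_infinity (principal Q))"
    and y: "y \<in> Q"
  shows "(\<lambda>n. of_nat (Suc n) powr (- (k + a - of_nat M)) * (deriv ^^ M) (rl_integral a b) (of_nat (Suc n) * y))
    \<longlonglongrightarrow> l * Beta (k + 1) a * pochhammer (k + a - of_nat M + 1) M * pw (k + a - of_nat M) y"
proof -
  let ?f = "rl_integral a b"
  have y0: "y \<noteq> 0" using y zero_notin_Q by auto
  have hol: "?f holomorphic_on Q" by (rule rl_integral_holomorphic[OF b a])
  obtain r where r: "r > 0" "cball y r \<subseteq> Q" using open_Q y open_contains_cball by blast
  have scale: "of_nat (Suc n) * z \<in> Q" if "z \<in> Q" for n z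
    using cone[of "real (Suc n)" z] that by simp
  have scale_hol: "(\<lambda>z. ?f (of_nat (Suc n) * z)) holomorphic_on Q" for n
    using holomorphic_on_compose_gen[OF _ hol, of "\<lambda>z. of_nat (Suc n) * z" Q] scale
    by (auto simp: o_def simp del: of_nat_Suc intro!: holomorphic_intros)
  have "(\<lambda>n. (deriv ^^ M) (\<lambda>z. of_nat (Suc n) powr (-(k + a)) * ?f (of_nat (Suc n) * z)) y) \<longlonglongrightarrow>
      (deriv ^^ M) (\<lambda>y. l * Beta (k + 1) a * pw (k + a) y) y"
  proof (rule higher_deriv_complex_uniform_limit[where A="ball y r"])
    show "uniform_limit (ball y r) (\<lambda>n z. of_nat (Suc n) powr (-(k + a)) * ?f (of_nat (Suc n) * z))
        (\<lambda>y. l * Beta (k + 1) a * pw (k + a) y) sequentially"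
      using rl_integral_asymptotics[OF b a k lim compact_cball r(2)]
      by (rule uniform_limit_on_subset) auto
    show "\<forall>\<^sub>F n in sequentially. (\<lambda>z. of_nat (Suc n) powr (-(k + a)) * ?f (of_nat (Suc n) * z)) holomorphic_on ball y r"
      using r by (intro always_eventually allI holomorphic_on_mult holomorphic_on_const
          holomorphic_on_subset[OF scale_hol]) auto
  qed (use r in auto)
  also have "(\<lambda>n. (deriv ^^ M) (\<lambda>z. of_nat (Suc n) powr (-(k + a)) * ?f (of_nat (Suc n) * z)) y)
     = (\<lambda>n. of_nat (Suc n) powr (- (k + a - of_nat M)) * (deriv ^^ M) ?f (of_nat (Suc n) * y))"
  proof
    fix n
    have "(deriv ^^ M) (\<lambda>z. of_nat (Suc n) powr (-(k + a)) * ?f (of_nat (Suc n) * z)) y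
        = of_nat (Suc n) powr (-(k + a)) * (deriv ^^ M) (\<lambda>z. ?f (of_nat (Suc n) * z)) y"
      by (rule higher_deriv_cmult[OF scale_hol y open_Q])
    also have "(deriv ^^ M) (\<lambda>z. ?f (of_nat (Suc n) * z)) y = of_nat (Suc n) ^ M * (deriv ^^ M) ?f (of_nat (Suc n) * y)"
      by (rule higher_deriv_compose_linear[OF hol open_Q open_Q y scale])
    also have "of_nat (Suc n) powr (-(k + a)) * (of_nat (Suc n) ^ M * (deriv ^^ M) ?f (of_nat (Suc n) * y))
      = (of_nat (Suc n) powr (-(k + a)) * of_nat (Suc n) powr (of_nat M)) * (deriv ^^ M) ?f (of_nat (Suc n) * y)"
      by (subst powr_nat') (auto simp del: of_nat_Suc)
    also have "of_nat (Suc n) powr (-(k + a)) * of_nat (Suc n) powr (of_nat M)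
        = (of_nat (Suc n) powr (-(k + a - of_nat M)) :: complex)"
    proof -
      have e: "- (k + a - of_nat M) = - (k + a) + of_nat M" by simp
      show ?thesis by (simp only: e powr_add)
    qed
    finally show "(deriv ^^ M) (\<lambda>z. of_nat (Suc n) powr (-(k + a)) * ?f (of_nat (Suc n) * z)) y
      = of_nat (Suc n) powr (- (k + a - of_nat M)) * (deriv ^^ M) ?f (of_nat (Suc n) * y)" .
  qed
  also have "(deriv ^^ M) (\<lambda>y. l * Beta (k + 1) a * pw (k + a) y) y
      = l * Beta (k + 1) a * pochhammer (k + a - of_nat M + 1) M * pw (k + a - of_nat M) y"
  proof -
    have "pw (k + a) y = pw (k + a - of_nat M) y * y ^ M"
      using pw_add_nat[OF y, of "k + a - of_nat M" M] by simp
    then show ?thesis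
      using euler_tower_pw[OF y, of M "l * Beta (k + 1) a" "k + a"] y0 by (simp add: field_simps)
  qed
  finally show ?thesis .
qed

text \<open>The quotient of Pochhammer symbols is the effect of fractional integration of order
  \<alpha> on y^(\<beta> + m), normalised to 1 at m = 0. Formally \<open>u\<close> is thus a
  multiple of \<open>rl_integral \<alpha> B\<close>. To obtain a convergent integral, D^M is applied
  to the integral of order \<open>a\<close> of y^L B and compared with the product of the operators
  y d/dy - (\<alpha> - 1 - i), i < L, applied to \<open>u\<close>: on series both amount to
  integrating y^L B to the order \<alpha> - L.\<close>

theorem connection_coefficient:
  assumes u: "u holomorphic_on Q" and B: "B holomorphic_on Q"
    and fB: "frobenius \<beta> g B"
    and fu: "frobenius (\<beta> + \<alpha>) (\<lambda>m. pochhammer (\<beta> + 1) m / pochhammer (\<beta> + \<alpha> + 1) m * g m) u"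
    and lim: "((\<lambda>y. B y * pw (-\<kappa>) y) \<longlongrightarrow> b0) (inf at_infinity (principal Q))"
    and two: "two_exponents (\<kappa> + \<alpha>) (\<alpha> - 1) u c"
    and ni: "\<beta> + 1 \<notin> \<int>\<^sub>\<le>\<^sub>0" "\<beta> + \<alpha> + 1 \<notin> \<int>\<^sub>\<le>\<^sub>0" "\<kappa> + 1 \<notin> \<int>\<^sub>\<le>\<^sub>0" "\<kappa> + \<alpha> + 1 \<notin> \<int>\<^sub>\<le>\<^sub>0"
  shows "c = b0 * Gamma (\<kappa> + 1) * Gamma (\<beta> + \<alpha> + 1) / (Gamma (\<kappa> + \<alpha> + 1) * Gamma (\<beta> + 1))"
proof -
  \<comment> \<open>\<open>L\<close> makes the exponents of y^L B positive at the apex and at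
    infinity. The bound by - Re \<kappa> also guarantees that \<alpha> - 1 - L ends up below
    \<kappa> + \<alpha> in real part.\<close>
  obtain L :: nat where "real L > max (- Re \<beta>) (- Re \<kappa>)" using reals_Archimedean2 by blast
  then have L: "Re (\<beta> + of_nat L) > 0" "Re (\<kappa> + of_nat L) > 0" by auto
  \<comment> \<open>\<open>M\<close> makes the order of integration large enough for a continuous
    integrand at the upper end.\<close>
  obtain M :: nat where "real M > 1 - Re \<alpha> + L" using reals_Archimedean2 by blast
  define a where "a = \<alpha> - of_nat L + of_nat M"
  have a: "Re a > 1" using \<open>real M > 1 - Re \<alpha> + L\<close> by (simp add: a_def)
  define b where "b = (\<lambda>y. if y = 0 then 0 else y ^ L * B y)"
  have fLB: "frobenius (\<beta> + of_nat L) g (\<lambda>y. y ^ L * B y)" using fB by (rule frobenius_shift)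
  have fb: "frobenius (\<beta> + of_nat L) g b"
    by (rule frobenius_cong[OF _ fLB]) (use zero_notin_Q in \<open>auto simp: b_def\<close>)
  have b: "vanishing b"
    unfolding b_def by (rule vanishing_of_frobenius[OF fLB L(1)]) (intro holomorphic_intros B)
  have limb: "((\<lambda>y. b y * pw (- (\<kappa> + of_nat L)) y) \<longlongrightarrow> b0) (inf at_infinity (principal Q))"
  proof (rule Lim_transform_eventually[OF lim])
    have "B y * pw (-\<kappa>) y = b y * pw (- (\<kappa> + of_nat L)) y" if y: "y \<in> Q" for y
      using pw_add_nat[OF y, of "- (\<kappa> + of_nat L)" L] y zero_notin_Q by (auto simp: b_def)
    then show "\<forall>\<^sub>F y in inf at_infinity (principal Q). B y * pw (-\<kappa>) y = b y * pw (- (\<kappa> + of_nat L)) y"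
      by (simp add: eventually_inf_principal)
  qed

  \<comment> \<open>The subtracted numbers are successive exponents of the second family at
    infinity, each removed by \<open>two_exponents_step\<close>. At the apex the same factors build
    up a Pochhammer symbol of length \<open>L\<close>.\<close>
  define F where "F = rec_nat u (\<lambda>i f y. y * deriv f y - (\<alpha> - 1 - of_nat i) * f y)"
  have F0: "F 0 = u" and FS: "F (Suc i) = (\<lambda>y. y * deriv (F i) y - (\<alpha> - 1 - of_nat i) * F i y)" for i
    by (simp_all add: F_def)
  define cu where "cu = (\<lambda>m. pochhammer (\<beta> + 1) m / pochhammer (\<beta> + \<alpha> + 1) m * g m)"
  have F_hol: "F i holomorphic_on Q" for i
    by (induction i) (auto simp: F0 FS intro!: holomorphic_intros u open_Q)
  have F_frob: "frobenius (\<beta> + \<alpha>) (\<lambda>m. pochhammer (\<beta> + 1 + of_nat m) i * cu m) (F i)" for i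
  proof (induction i)
    case 0
    then show ?case using fu by (simp add: F0 cu_def)
  next
    case (Suc i)
    have "frobenius (\<beta> + \<alpha>)
      (\<lambda>m. (\<beta> + \<alpha> + of_nat m) * (pochhammer (\<beta> + 1 + of_nat m) i * cu m) +
        (- (\<alpha> - 1 - of_nat i)) * (pochhammer (\<beta> + 1 + of_nat m) i * cu m))
      (\<lambda>y. y * deriv (F i) y + (- (\<alpha> - 1 - of_nat i)) * F i y)"
      by (intro frobenius_add frobenius_euler frobenius_cmult Suc)
    then show ?case by (simp add: FS pochhammer_Suc algebra_simps)
  qed
  have F_two: "two_exponents (\<kappa> + \<alpha>) (\<alpha> - 1 - of_nat i) (F i) (pochhammer (\<kappa> + 1) i * c)" for i
  proof (induction i)
    case 0
    then show ?case using two by (simp add: F0)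
  next
    case (Suc i)
    show ?case using two_exponents_step[OF Suc] by (simp add: FS pochhammer_Suc algebra_simps)
  qed

  define W where "W = rl_integral a b"
  have W_hol: "W holomorphic_on Q" unfolding W_def by (rule rl_integral_holomorphic[OF b a])
  define cW where "cW = (\<lambda>m. Beta (\<beta> + of_nat L + of_nat m + 1) a * g m)"
  have eW: "\<beta> + of_nat L + a = \<beta> + \<alpha> + of_nat M" by (simp add: a_def)
  have W_frob: "frobenius (\<beta> + \<alpha> + of_nat M) cW W"
    unfolding W_def cW_def eW[symmetric] by (rule rl_integral_frobenius[OF b a L(1) fb])
  \<comment> \<open>By \<open>euler_tower_deriv\<close> this is y^i times the i-th derivative of
    \<open>W\<close>, in a form whose series is immediate.\<close>
  define E where "E = rec_nat W (\<lambda>i f y. y * deriv f y - of_nat i * f y)"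
  have E0: "E 0 = W" and ES: "E (Suc i) = (\<lambda>y. y * deriv (E i) y - of_nat i * E i y)" for i
    by (simp_all add: E_def)
  have E_hol: "E i holomorphic_on Q" for i
    by (induction i) (auto simp: E0 ES intro!: holomorphic_intros W_hol open_Q)
  have E_frob: "frobenius (\<beta> + \<alpha> + of_nat M)
      (\<lambda>m. (\<Prod>j<i. \<beta> + \<alpha> + of_nat M + of_nat m - of_nat j) * cW m) (E i)" for i
  proof (induction i)
    case 0
    then show ?case using W_frob by (simp add: E0)
  next
    case (Suc i)
    let ?p = "\<lambda>m. (\<Prod>j<i. \<beta> + \<alpha> + of_nat M + of_nat m - of_nat j) * cW m"
    have "frobenius (\<beta> + \<alpha> + of_nat M)
      (\<lambda>m. (\<beta> + \<alpha> + of_nat M + of_nat m) * ?p m + (- of_nat i) * ?p m)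
      (\<lambda>y. y * deriv (E i) y + (- of_nat i) * E i y)"
      by (intro frobenius_add frobenius_euler frobenius_cmult Suc)
    then show ?case by (simp add: ES algebra_simps)
  qed

  \<comment> \<open>The factor of proportionality that remains when all Gamma values are written as
    Gamma at m = 0 times a Pochhammer symbol.\<close>
  define K where "K = Gamma (\<beta> + 1) * Gamma a / Gamma (\<beta> + \<alpha> + 1)"
  have G: "Gamma (\<beta> + 1) \<noteq> 0" "Gamma (\<beta> + \<alpha> + 1) \<noteq> 0" "Gamma (\<kappa> + 1) \<noteq> 0" "Gamma (\<kappa> + \<alpha> + 1) \<noteq> 0"
    using ni by (auto simp: Gamma_eq_zero_iff)
  have a0: "Gamma a \<noteq> 0"
    using a by (auto simp: Gamma_eq_zero_iff elim!: nonpos_Ints_cases)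
  have pn: "pochhammer z m \<noteq> 0" if "z \<notin> \<int>\<^sub>\<le>\<^sub>0" for z :: complex and m
    using that by (auto simp: pochhammer_eq_0_iff)
  have coeff: "(\<Prod>j<M. \<beta> + \<alpha> + of_nat M + of_nat m - of_nat j) * cW m
      = K * (pochhammer (\<beta> + 1 + of_nat m) L * cu m)" for m
  proof -
    have 1: "(\<Prod>j<M. \<beta> + \<alpha> + of_nat M + of_nat m - of_nat j) = pochhammer (\<beta> + \<alpha> + 1 + of_nat m) M"
      unfolding prod_falling_pochhammer by (simp add: algebra_simps)
    have "Gamma (\<beta> + \<alpha> + 1 + of_nat (m + M)) = Gamma (\<beta> + \<alpha> + 1) * pochhammer (\<beta> + \<alpha> + 1) (m + M)"
      using pochhammer_Gamma[OF ni(2), of "m + M"] G by (simp add: field_simps)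
    also have "\<dots> = Gamma (\<beta> + \<alpha> + 1) * (pochhammer (\<beta> + \<alpha> + 1) m * pochhammer (\<beta> + \<alpha> + 1 + of_nat m) M)"
      by (simp add: pochhammer_product')
    finally have 2: "Gamma (\<beta> + \<alpha> + 1 + of_nat (m + M)) = \<dots>" .
    have "Gamma (\<beta> + 1 + of_nat (m + L)) = Gamma (\<beta> + 1) * pochhammer (\<beta> + 1) (m + L)"
      using pochhammer_Gamma[OF ni(1), of "m + L"] G by (simp add: field_simps)
    also have "\<dots> = Gamma (\<beta> + 1) * (pochhammer (\<beta> + 1) m * pochhammer (\<beta> + 1 + of_nat m) L)"
      by (simp add: pochhammer_product')
    finally have 3: "Gamma (\<beta> + 1 + of_nat (m + L)) = \<dots>" .
    have 4: "Beta (\<beta> + of_nat L + of_nat m + 1) a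
        = Gamma (\<beta> + 1 + of_nat (m + L)) * Gamma a / Gamma (\<beta> + \<alpha> + 1 + of_nat (m + M))"
      unfolding Beta_def by (simp add: a_def algebra_simps)
    have 5: "pochhammer (\<beta> + \<alpha> + 1 + of_nat m) M \<noteq> 0"
      using pn[OF ni(2), of "m + M"] by (simp add: pochhammer_product')
    show ?thesis
    proof -
      have ring: "P5 * ((G1 * (p1 * p2)) * Ga / (G2 * (p3 * P5)) * x) = G1 * Ga / G2 * (p2 * (p1 / p3 * x))"
        if "P5 \<noteq> 0" "G2 \<noteq> 0" "p3 \<noteq> 0" for P5 G1 p1 p2 Ga G2 p3 x :: complex
        using that by simp
      show ?thesis
        unfolding 1 cW_def cu_def K_def 4 2 3 by (rule ring[OF 5 G(2) pn[OF ni(2)]])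
    qed
  qed
  \<comment> \<open>The factor y^M brings the series of \<open>F L\<close> to the exponent of
    \<open>W\<close>, so that \<open>frobenius_identity\<close> applies.\<close>
  have EF: "E M y = K * (y ^ M * F L y)" if y: "y \<in> Q" for y
  proof (rule frobenius_identity[OF _ _ E_hol _ y])
    show "frobenius (\<beta> + \<alpha> + of_nat M) (\<lambda>m. (\<Prod>j<M. \<beta> + \<alpha> + of_nat M + of_nat m - of_nat j) * cW m) (E M)"
      by (rule E_frob)
    show "frobenius (\<beta> + \<alpha> + of_nat M) (\<lambda>m. (\<Prod>j<M. \<beta> + \<alpha> + of_nat M + of_nat m - of_nat j) * cW m)
        (\<lambda>y. K * (y ^ M * F L y))"
      unfolding coeff by (intro frobenius_cmult frobenius_shift F_frob)
    show "(\<lambda>y. K * (y ^ M * F L y)) holomorphic_on Q"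
      by (intro holomorphic_intros F_hol)
  qed
  have DF: "(deriv ^^ M) W y = K * F L y" if y: "y \<in> Q" for y
  proof -
    have "y ^ M * (deriv ^^ M) W y = y ^ M * (K * F L y)"
      using EF[OF y] euler_tower_deriv[OF open_Q W_hol E0 ES y, of M] by (simp add: mult_ac)
    moreover have "y \<noteq> 0" using y zero_notin_Q by auto
    ultimately show ?thesis by simp
  qed

  obtain y where y: "y \<in> Q" using Q_nonempty by auto
  have ek: "\<kappa> + of_nat L + a - of_nat M = \<kappa> + \<alpha>" by (simp add: a_def)
  have lim1: "(\<lambda>n. of_nat (Suc n) powr (- (\<kappa> + \<alpha>)) * (deriv ^^ M) W (of_nat (Suc n) * y))
    \<longlonglongrightarrow> b0 * Beta (\<kappa> + of_nat L + 1) a * pochhammer (\<kappa> + \<alpha> + 1) M * pw (\<kappa> + \<alpha>) y"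
    using higher_deriv_rl_integral_limit[OF b a L(2) limb y, of M] unfolding ek W_def .
  have eq: "(\<lambda>n. of_nat (Suc n) powr (- (\<kappa> + \<alpha>)) * (deriv ^^ M) W (of_nat (Suc n) * y))
    = (\<lambda>n. K * (of_nat (Suc n) powr (- (\<kappa> + \<alpha>)) * F L (of_nat (Suc n) * y)))"
  proof
    fix n
    have "of_nat (Suc n) * y \<in> Q" using cone[of "real (Suc n)" y] y by simp
    from DF[OF this] show "of_nat (Suc n) powr (- (\<kappa> + \<alpha>)) * (deriv ^^ M) W (of_nat (Suc n) * y)
      = K * (of_nat (Suc n) powr (- (\<kappa> + \<alpha>)) * F L (of_nat (Suc n) * y))" by simp
  qed
  have lim2: "(\<lambda>n. K * (of_nat (Suc n) powr (- (\<kappa> + \<alpha>)) * F L (of_nat (Suc n) * y)))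
    \<longlonglongrightarrow> K * (pochhammer (\<kappa> + 1) L * c * pw (\<kappa> + \<alpha>) y)"
    using L by (intro tendsto_mult tendsto_const two_exponents_limit[OF F_two _ y]) auto
  \<comment> \<open>One sequence, two limits: from the integral on the left, from the expansion at
    infinity on the right.\<close>
  have "b0 * Beta (\<kappa> + of_nat L + 1) a * pochhammer (\<kappa> + \<alpha> + 1) M * pw (\<kappa> + \<alpha>) y
      = K * (pochhammer (\<kappa> + 1) L * c * pw (\<kappa> + \<alpha>) y)"
    by (rule LIMSEQ_unique[OF lim1[unfolded eq] lim2])
  then have "(b0 * Beta (\<kappa> + of_nat L + 1) a * pochhammer (\<kappa> + \<alpha> + 1) M) * pw (\<kappa> + \<alpha>) y
      = (K * (pochhammer (\<kappa> + 1) L * c)) * pw (\<kappa> + \<alpha>) y"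
    by (simp only: mult.assoc)
  then have main: "b0 * Beta (\<kappa> + of_nat L + 1) a * pochhammer (\<kappa> + \<alpha> + 1) M = K * (pochhammer (\<kappa> + 1) L * c)"
    by (simp only: mult_right_cancel[OF pw_nonzero])
  have 1: "Gamma (\<kappa> + \<alpha> + 1 + of_nat M) = Gamma (\<kappa> + \<alpha> + 1) * pochhammer (\<kappa> + \<alpha> + 1) M"
    using pochhammer_Gamma[OF ni(4), of M] G by (simp add: field_simps)
  have 2: "Gamma (\<kappa> + 1 + of_nat L) = Gamma (\<kappa> + 1) * pochhammer (\<kappa> + 1) L"
    using pochhammer_Gamma[OF ni(3), of L] G by (simp add: field_simps)
  have 3: "Beta (\<kappa> + of_nat L + 1) a = Gamma (\<kappa> + 1 + of_nat L) * Gamma a / Gamma (\<kappa> + \<alpha> + 1 + of_nat M)"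
    unfolding Beta_def by (simp add: a_def algebra_simps)
  have "pochhammer (\<kappa> + 1) L * (b0 * Gamma (\<kappa> + 1) * Gamma a / Gamma (\<kappa> + \<alpha> + 1)) = pochhammer (\<kappa> + 1) L * (K * c)"
  proof -
    have ring: "p * (b * G1 * Ga / G2) = b * (G1 * p * Ga / (G2 * q)) * q" if "q \<noteq> 0"
      for p b G1 Ga G2 q :: complex
      using that by simp
    have "pochhammer (\<kappa> + 1) L * (b0 * Gamma (\<kappa> + 1) * Gamma a / Gamma (\<kappa> + \<alpha> + 1))
        = b0 * Beta (\<kappa> + of_nat L + 1) a * pochhammer (\<kappa> + \<alpha> + 1) M"
      unfolding 3 1 2 by (rule ring[OF pn[OF ni(4)]])
    also note main
    finally show ?thesis by (simp only: mult.left_commute)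
  qed
  then have "b0 * Gamma (\<kappa> + 1) * Gamma a / Gamma (\<kappa> + \<alpha> + 1) = K * c"
    by (simp only: mult_left_cancel[OF pn[OF ni(3)]])
  then show ?thesis using G a0 by (simp add: K_def field_simps)
qed

end

section \<open>Recursions for the coefficients\<close>

text \<open>Vectors are index functions here, so that function values and coefficients of series can
  be inserted alike.\<close>

definition mat_apply :: "nat \<Rightarrow> (nat \<Rightarrow> nat \<Rightarrow> complex) \<Rightarrow> (nat \<Rightarrow> complex) \<Rightarrow> nat \<Rightarrow> complex" where
  "mat_apply n a f \<nu> = (\<Sum>\<mu><n. a \<nu> \<mu> * f \<mu>)"

lemma mat_apply_cong: "(\<And>\<mu>. \<mu> < n \<Longrightarrow> f \<mu> = g \<mu>) \<Longrightarrow> mat_apply n a f \<nu> = mat_apply n a g \<nu>"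
  unfolding mat_apply_def by (intro sum.cong) auto

lemma mat_apply_diff: "mat_apply n a (\<lambda>\<mu>. f \<mu> - g \<mu>) \<nu> = mat_apply n a f \<nu> - mat_apply n a g \<nu>"
  unfolding mat_apply_def by (simp add: sum_subtractf right_diff_distrib)

lemma mat_apply_cmult: "mat_apply n a (\<lambda>\<mu>. k * f \<mu>) \<nu> = k * mat_apply n a f \<nu>"
  unfolding mat_apply_def by (simp add: sum_distrib_left mult_ac)

lemma mat_apply_zero: "mat_apply n a (\<lambda>\<mu>. 0) \<nu> = 0"
  unfolding mat_apply_def by simp

text \<open>Multiplication by y on coefficient sequences. The value 0 at index 0 lets one formula
  state a recursion for all m, including the first ones.\<close>

definition shift_coeff :: "(nat \<Rightarrow> complex) \<Rightarrow> nat \<Rightarrow> complex" where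
  "shift_coeff c m = (case m of 0 \<Rightarrow> 0 | Suc m \<Rightarrow> c m)"

lemma shift_coeff_simps [simp]: "shift_coeff c 0 = 0" "shift_coeff c (Suc m) = c m"
  by (simp_all add: shift_coeff_def)

text \<open>
  The recursion for the coefficients of a solution \<open>y ^ b * (\<Sum>m. g \<nu> m * y ^ m)\<close> of the
  first-order system satisfied by \<open>B\<close>, and the one for a solution
  \<open>y ^ l * (\<Sum>m. G \<nu> m * y ^ m)\<close> of the second-order equation satisfied by the upper half
  of a solution of the \<open>2n\<close>-dimensional system; \<open>y\<close> is the distance to the point \<open>e\<close>.
\<close>

definition first_order_rec where
  "first_order_rec n a \<tau> e \<kappa> r1 b g \<longleftrightarrow> (\<forall>m. \<forall>\<nu><n.
     e * (e - \<tau> \<nu>) * ((b + of_nat m) * g \<nu> m)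
     + (2 * e - \<tau> \<nu>) * shift_coeff (\<lambda>m. (b + of_nat m) * g \<nu> m) m
     + shift_coeff (shift_coeff (\<lambda>m. (b + of_nat m) * g \<nu> m)) m
     = \<kappa> * shift_coeff (shift_coeff (g \<nu>)) m + (\<kappa> * e - r1 * \<tau> \<nu>) * shift_coeff (g \<nu>) m
     + mat_apply n a (\<lambda>\<mu>. \<tau> \<mu> * shift_coeff (g \<mu>) m) \<nu>)"

definition second_order_rec where
  "second_order_rec n a \<tau> e r1 r2 l G \<longleftrightarrow> (\<forall>m. \<forall>\<nu><n.
     e * (e - \<tau> \<nu>) * ((l + of_nat m) * (l + of_nat m - 1) * G \<nu> m)
     + (2 * e - \<tau> \<nu>) * shift_coeff (\<lambda>m. (l + of_nat m) * (l + of_nat m - 1) * G \<nu> m) m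
     + shift_coeff (shift_coeff (\<lambda>m. (l + of_nat m) * (l + of_nat m - 1) * G \<nu> m)) m
     + (1 - r1 - r2) * (e * shift_coeff (\<lambda>m. (l + of_nat m) * G \<nu> m) m
         + shift_coeff (shift_coeff (\<lambda>m. (l + of_nat m) * G \<nu> m)) m)
     + (r1 + r2) * \<tau> \<nu> * shift_coeff (\<lambda>m. (l + of_nat m) * G \<nu> m) m
     - mat_apply n a (\<lambda>\<mu>. \<tau> \<mu> * shift_coeff (\<lambda>m. (l + of_nat m) * G \<mu> m) m) \<nu>
     + r1 * r2 * shift_coeff (shift_coeff (G \<nu>)) m = 0)"

text \<open>By linearity, uniqueness has to be shown only for vanishing leading
  coefficients.\<close>

lemma second_order_rec_diff:
  assumes "second_order_rec n a \<tau> e r1 r2 l F" "second_order_rec n a \<tau> e r1 r2 l G"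
  shows "second_order_rec n a \<tau> e r1 r2 l (\<lambda>\<nu> m. F \<nu> m - G \<nu> m)"
  unfolding second_order_rec_def
proof (intro allI impI)
  fix m \<nu> assume \<nu>: "\<nu> < n"
  have s: "shift_coeff (\<lambda>m. c m * (F \<mu> m - G \<mu> m)) m
      = shift_coeff (\<lambda>m. c m * F \<mu> m) m - shift_coeff (\<lambda>m. c m * G \<mu> m) m" for c \<mu> m
    by (cases m) (simp_all add: right_diff_distrib)
  have s2: "shift_coeff (shift_coeff (\<lambda>m. c m * (F \<mu> m - G \<mu> m))) m
      = shift_coeff (shift_coeff (\<lambda>m. c m * F \<mu> m)) m - shift_coeff (shift_coeff (\<lambda>m. c m * G \<mu> m)) m" for c \<mu> m
    by (cases m) (simp_all add: s)
  have s3: "shift_coeff (shift_coeff (\<lambda>m. F \<mu> m - G \<mu> m)) m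
      = shift_coeff (shift_coeff (F \<mu>)) m - shift_coeff (shift_coeff (G \<mu>)) m" for \<mu> m
    using s2[of "\<lambda>_. 1"] by simp
  show "e * (e - \<tau> \<nu>) * ((l + of_nat m) * (l + of_nat m - 1) * (F \<nu> m - G \<nu> m))
     + (2 * e - \<tau> \<nu>) * shift_coeff (\<lambda>m. (l + of_nat m) * (l + of_nat m - 1) * (F \<nu> m - G \<nu> m)) m
     + shift_coeff (shift_coeff (\<lambda>m. (l + of_nat m) * (l + of_nat m - 1) * (F \<nu> m - G \<nu> m))) m
     + (1 - r1 - r2) * (e * shift_coeff (\<lambda>m. (l + of_nat m) * (F \<nu> m - G \<nu> m)) m
         + shift_coeff (shift_coeff (\<lambda>m. (l + of_nat m) * (F \<nu> m - G \<nu> m))) m)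
     + (r1 + r2) * \<tau> \<nu> * shift_coeff (\<lambda>m. (l + of_nat m) * (F \<nu> m - G \<nu> m)) m
     - mat_apply n a (\<lambda>\<mu>. \<tau> \<mu> * shift_coeff (\<lambda>m. (l + of_nat m) * (F \<mu> m - G \<mu> m)) m) \<nu>
     + r1 * r2 * shift_coeff (shift_coeff (\<lambda>m. F \<nu> m - G \<nu> m)) m = 0"
  proof -
    note F = assms(1)[unfolded second_order_rec_def, rule_format, OF \<nu>, of m]
    note G = assms(2)[unfolded second_order_rec_def, rule_format, OF \<nu>, of m]
    show ?thesis
      unfolding s s2 s3 right_diff_distrib[of "\<tau> _"] mat_apply_diff
      using arg_cong2[OF F G, of "(-)"] by (simp add: algebra_simps)
  qed
qed

text \<open>The algebra behind the integral representation. The ratios c m of Pochhammer symbols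
  satisfy c (m + 1) (l + 1 + m) = c m (b + 1 + m). In the second-order recursion the lowest
  coefficient carries (s - r1) (s - r2) with s = l + j, and l - b = r2 + 1 makes s - r2 equal to b +
  1 + j. Thus this relation absorbs one factor, and what remains is a multiple of the first-order
  recursion.\<close>

lemma second_order_rec_of_first_order:
  assumes B: "first_order_rec n a \<tau> e \<kappa> r1 b g"
    and \<kappa>: "\<kappa> = r1 - r2 - 1" and l: "l = b + r2 + 1" and b: "b \<noteq> 0"
    and l0: "\<And>m. l + 1 + of_nat m \<noteq> 0"
  shows "second_order_rec n a \<tau> e r1 r2 l (\<lambda>\<nu> m. pochhammer (b + 1) m / pochhammer (l + 1) m * g \<nu> m)"
  unfolding second_order_rec_def
proof (intro allI impI)
  fix m \<nu> assume \<nu>: "\<nu> < n"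
  define c where "c = (\<lambda>m. pochhammer (b + 1) m / pochhammer (l + 1) m)"
  have c0: "c 0 = 1" by (simp add: c_def)
  have cS: "c (Suc m) * (l + 1 + of_nat m) = c m * (b + 1 + of_nat m)" for m
    using l0[of m] by (simp add: c_def pochhammer_Suc)
  note rec = B[unfolded first_order_rec_def, rule_format, OF \<nu>]
  have "e * (e - \<tau> \<nu>) * ((l + of_nat m) * (l + of_nat m - 1) * (c m * g \<nu> m))
     + (2 * e - \<tau> \<nu>) * shift_coeff (\<lambda>m. (l + of_nat m) * (l + of_nat m - 1) * (c m * g \<nu> m)) m
     + shift_coeff (shift_coeff (\<lambda>m. (l + of_nat m) * (l + of_nat m - 1) * (c m * g \<nu> m))) m
     + (1 - r1 - r2) * (e * shift_coeff (\<lambda>m. (l + of_nat m) * (c m * g \<nu> m)) m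
         + shift_coeff (shift_coeff (\<lambda>m. (l + of_nat m) * (c m * g \<nu> m))) m)
     + (r1 + r2) * \<tau> \<nu> * shift_coeff (\<lambda>m. (l + of_nat m) * (c m * g \<nu> m)) m
     - mat_apply n a (\<lambda>\<mu>. \<tau> \<mu> * shift_coeff (\<lambda>m. (l + of_nat m) * (c m * g \<mu> m)) m) \<nu>
     + r1 * r2 * shift_coeff (shift_coeff (\<lambda>m. c m * g \<nu> m)) m = 0"
  proof (cases m)
    case 0
    \<comment> \<open>The first-order recursion at index 0 contains the additional factor b, which
      is not 0.\<close>
    have "e * (e - \<tau> \<nu>) * g \<nu> 0 = 0"
      using rec[of 0] b by (simp add: mat_apply_zero)
    then show ?thesis by (auto simp: 0 mat_apply_zero)
  next
    case (Suc k)
    have ma: "mat_apply n a (\<lambda>\<mu>. \<tau> \<mu> * shift_coeff (\<lambda>m. (l + of_nat m) * (c m * g \<mu> m)) m) \<nu>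
        = (l + of_nat k) * c k * mat_apply n a (\<lambda>\<mu>. \<tau> \<mu> * g \<mu> k) \<nu>"
      unfolding mat_apply_cmult[symmetric] by (rule mat_apply_cong) (simp add: Suc mult_ac)
    show ?thesis
    proof (cases k)
      case 0
      have r: "mat_apply n a (\<lambda>\<mu>. \<tau> \<mu> * g \<mu> 0) \<nu>
          = e * (e - \<tau> \<nu>) * ((b + 1) * g \<nu> 1) + (2 * e - \<tau> \<nu>) * (b * g \<nu> 0) - (\<kappa> * e - r1 * \<tau> \<nu>) * g \<nu> 0"
        using rec[of 1] by (simp add: algebra_simps)
      have c1: "c 1 * (l + 1) = b + 1" using cS[of 0] by (simp add: c0)
      have "e * (e - \<tau> \<nu>) * ((l + 1) * l * (c 1 * g \<nu> 1)) = e * (e - \<tau> \<nu>) * l * g \<nu> 1 * (c 1 * (l + 1))"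
        by (simp only: mult_ac)
      then have e1: "e * (e - \<tau> \<nu>) * ((l + 1) * l * (c 1 * g \<nu> 1)) = e * (e - \<tau> \<nu>) * l * g \<nu> 1 * (b + 1)"
        by (simp only: c1)
      have fin: "e * (e - \<tau> \<nu>) * ((l + 1) * l * (c 1 * g \<nu> 1)) + (2 * e - \<tau> \<nu>) * (l * (l - 1) * g \<nu> 0)
          + (1 - r1 - r2) * (e * (l * g \<nu> 0)) + (r1 + r2) * \<tau> \<nu> * (l * g \<nu> 0)
          - l * mat_apply n a (\<lambda>\<mu>. \<tau> \<mu> * g \<mu> 0) \<nu> = 0"
        unfolding e1 r by (simp add: \<kappa> l algebra_simps)
      have s1: "l + of_nat (Suc 0) = l + 1" "l + 1 - 1 = l" "l + of_nat 0 = l" by simp_all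
      show ?thesis
        unfolding ma using fin unfolding 0 Suc shift_coeff_simps s1 c0 One_nat_def mult_1 mult_1_right
        by (simp only: add_0_right mult_zero_right)
    next
      case k: (Suc j)
      have r: "mat_apply n a (\<lambda>\<mu>. \<tau> \<mu> * g \<mu> (Suc j)) \<nu>
          = e * (e - \<tau> \<nu>) * ((b + of_nat (j + 2)) * g \<nu> (j + 2))
            + (2 * e - \<tau> \<nu>) * ((b + of_nat (Suc j)) * g \<nu> (Suc j)) + (b + of_nat j) * g \<nu> j
            - \<kappa> * g \<nu> j - (\<kappa> * e - r1 * \<tau> \<nu>) * g \<nu> (Suc j)"
        using rec[of "Suc (Suc j)"] by (simp add: algebra_simps)
      define s where "s = l + of_nat j"
      \<comment> \<open>With these two relations all three neighbouring terms become multiples of (s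
        + 1) * c (Suc j).\<close>
      have c1: "c j * (s - r2) = c (Suc j) * (s + 1)"
        using cS[of j] by (simp add: s_def l algebra_simps)
      have c2: "c (j + 2) * (s + 2) = c (Suc j) * (s - r2 + 1)"
        using cS[of "Suc j"] by (simp add: s_def l algebra_simps)
      have "e * (e - \<tau> \<nu>) * ((s + 2) * (s + 1) * (c (j + 2) * g \<nu> (j + 2)))
          + (2 * e - \<tau> \<nu>) * ((s + 1) * s * (c (Suc j) * g \<nu> (Suc j)))
          + s * (s - 1) * (c j * g \<nu> j)
          + (1 - r1 - r2) * (e * ((s + 1) * (c (Suc j) * g \<nu> (Suc j))) + s * (c j * g \<nu> j))
          + (r1 + r2) * \<tau> \<nu> * ((s + 1) * (c (Suc j) * g \<nu> (Suc j)))
          + r1 * r2 * (c j * g \<nu> j)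
        = e * (e - \<tau> \<nu>) * (s + 1) * g \<nu> (j + 2) * (c (j + 2) * (s + 2))
          + (s + 1) * c (Suc j) * g \<nu> (Suc j) * ((2 * e - \<tau> \<nu>) * s + (1 - r1 - r2) * e + (r1 + r2) * \<tau> \<nu>)
          + (c j * (s - r2)) * (s - r1) * g \<nu> j"
        by (simp add: algebra_simps)
      also have "\<dots> = (s + 1) * c (Suc j) * (e * (e - \<tau> \<nu>) * g \<nu> (j + 2) * (s - r2 + 1)
          + g \<nu> (Suc j) * ((2 * e - \<tau> \<nu>) * s + (1 - r1 - r2) * e + (r1 + r2) * \<tau> \<nu>)
          + (s - r1) * g \<nu> j)"
        unfolding c1 c2 by (simp add: algebra_simps)
      also have "\<dots> = (s + 1) * c (Suc j) * mat_apply n a (\<lambda>\<mu>. \<tau> \<mu> * g \<mu> (Suc j)) \<nu>"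
      proof -
        have "e * (e - \<tau> \<nu>) * g \<nu> (j + 2) * (s - r2 + 1)
          + g \<nu> (Suc j) * ((2 * e - \<tau> \<nu>) * s + (1 - r1 - r2) * e + (r1 + r2) * \<tau> \<nu>)
          + (s - r1) * g \<nu> j = mat_apply n a (\<lambda>\<mu>. \<tau> \<mu> * g \<mu> (Suc j)) \<nu>"
          unfolding r by (simp add: s_def l \<kappa> algebra_simps)
        then show ?thesis by simp
      qed
      finally have fin0: "e * (e - \<tau> \<nu>) * ((s + 2) * (s + 1) * (c (j + 2) * g \<nu> (j + 2)))
          + (2 * e - \<tau> \<nu>) * ((s + 1) * s * (c (Suc j) * g \<nu> (Suc j)))
          + s * (s - 1) * (c j * g \<nu> j)
          + (1 - r1 - r2) * (e * ((s + 1) * (c (Suc j) * g \<nu> (Suc j))) + s * (c j * g \<nu> j))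
          + (r1 + r2) * \<tau> \<nu> * ((s + 1) * (c (Suc j) * g \<nu> (Suc j)))
          + r1 * r2 * (c j * g \<nu> j)
        = (s + 1) * c (Suc j) * mat_apply n a (\<lambda>\<mu>. \<tau> \<mu> * g \<mu> (Suc j)) \<nu>" .
      have move: "x - y + z = 0" if "x + z = y" for x y z :: complex
        using that by (simp add: diff_add_eq)
      have fin: "e * (e - \<tau> \<nu>) * ((s + 2) * (s + 1) * (c (j + 2) * g \<nu> (j + 2)))
          + (2 * e - \<tau> \<nu>) * ((s + 1) * s * (c (Suc j) * g \<nu> (Suc j)))
          + s * (s - 1) * (c j * g \<nu> j)
          + (1 - r1 - r2) * (e * ((s + 1) * (c (Suc j) * g \<nu> (Suc j))) + s * (c j * g \<nu> j))
          + (r1 + r2) * \<tau> \<nu> * ((s + 1) * (c (Suc j) * g \<nu> (Suc j)))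
          - (s + 1) * c (Suc j) * mat_apply n a (\<lambda>\<mu>. \<tau> \<mu> * g \<mu> (Suc j)) \<nu>
          + r1 * r2 * (c j * g \<nu> j) = 0"
        by (rule move[OF fin0])
      have sj: "l + of_nat (Suc j) = s + 1" "l + of_nat (Suc (Suc j)) = s + 2" "l + of_nat j = s"
        by (simp_all add: s_def)
      have a1: "s + 1 - 1 = s" "s + 2 - 1 = s + 1" by simp_all
      show ?thesis
        unfolding ma unfolding Suc k shift_coeff_simps sj a1
        using fin by (simp only: add_2_eq_Suc')
    qed
  qed
  then show "e * (e - \<tau> \<nu>) * ((l + of_nat m) * (l + of_nat m - 1) * (pochhammer (b + 1) m / pochhammer (l + 1) m * g \<nu> m))
     + (2 * e - \<tau> \<nu>) * shift_coeff (\<lambda>m. (l + of_nat m) * (l + of_nat m - 1) * (pochhammer (b + 1) m / pochhammer (l + 1) m * g \<nu> m)) m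
     + shift_coeff (shift_coeff (\<lambda>m. (l + of_nat m) * (l + of_nat m - 1) * (pochhammer (b + 1) m / pochhammer (l + 1) m * g \<nu> m))) m
     + (1 - r1 - r2) * (e * shift_coeff (\<lambda>m. (l + of_nat m) * (pochhammer (b + 1) m / pochhammer (l + 1) m * g \<nu> m)) m
         + shift_coeff (shift_coeff (\<lambda>m. (l + of_nat m) * (pochhammer (b + 1) m / pochhammer (l + 1) m * g \<nu> m))) m)
     + (r1 + r2) * \<tau> \<nu> * shift_coeff (\<lambda>m. (l + of_nat m) * (pochhammer (b + 1) m / pochhammer (l + 1) m * g \<nu> m)) m
     - mat_apply n a (\<lambda>\<mu>. \<tau> \<mu> * shift_coeff (\<lambda>m. (l + of_nat m) * (pochhammer (b + 1) m / pochhammer (l + 1) m * g \<mu> m)) m) \<nu>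
     + r1 * r2 * shift_coeff (shift_coeff (\<lambda>m. pochhammer (b + 1) m / pochhammer (l + 1) m * g \<nu> m)) m = 0"
    unfolding c_def .
qed

text \<open>The case of a base point \<open>e\<close> that is one of the \<tau>. Rows with \<tau>
  different from \<open>e\<close> determine their coefficient through the top term. In the rows with
  \<tau> = \<open>e\<close> that term vanishes, and the coefficient is found one index later, where
  it carries the factor l + m - a \<nu> \<nu>; non-resonance makes this nonzero.\<close>

lemma second_order_rec_unique_nonzero:
  assumes rec: "second_order_rec n a \<tau> e r1 r2 l D" and e: "e \<noteq> 0"
    and D0: "\<And>\<nu>. \<nu> < n \<Longrightarrow> D \<nu> 0 = 0"
    and l: "\<And>m. l + of_nat m \<noteq> 0"
    and diag: "\<And>\<nu> \<mu>. \<nu> < n \<Longrightarrow> \<mu> < n \<Longrightarrow> \<tau> \<nu> = e \<Longrightarrow> \<tau> \<mu> = e \<Longrightarrow> \<nu> \<noteq> \<mu> \<Longrightarrow> a \<nu> \<mu> = 0"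
    and nores: "\<And>\<nu> m. \<nu> < n \<Longrightarrow> \<tau> \<nu> = e \<Longrightarrow> l + of_nat (Suc m) \<noteq> a \<nu> \<nu>"
    and \<nu>: "\<nu> < n"
  shows "D \<nu> m = 0"
proof -
  \<comment> \<open>The recursion reaches back two indices, so two consecutive coefficients are
    carried through the induction.\<close>
  have "\<forall>\<nu><n. shift_coeff (D \<nu>) m = 0 \<and> D \<nu> m = 0"
  proof (induction m)
    case 0
    then show ?case using D0 by simp
  next
    case (Suc m)
    note R = rec[unfolded second_order_rec_def, rule_format]
    have sh: "shift_coeff (\<lambda>m. c m * D \<nu> m) m = 0" if "\<nu> < n" for c \<nu>
      using Suc.IH that by (cases m) auto
    have off: "D \<nu> (Suc m) = 0" if \<nu>: "\<nu> < n" "\<tau> \<nu> \<noteq> e" for \<nu>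
    proof -
      have "mat_apply n a (\<lambda>\<mu>. \<tau> \<mu> * ((l + of_nat m) * D \<mu> m)) \<nu> = mat_apply n a (\<lambda>\<mu>. 0) \<nu>"
        using Suc.IH by (intro mat_apply_cong) simp
      then have "e * (e - \<tau> \<nu>) * ((l + of_nat (Suc m)) * (l + of_nat (Suc m) - 1) * D \<nu> (Suc m)) = 0"
        using R[of \<nu> "Suc m"] sh[OF \<nu>(1)] sh[OF \<nu>(1), of "\<lambda>_. 1"] Suc.IH \<nu> by (simp add: mat_apply_zero)
      moreover have "l + of_nat (Suc m) - 1 \<noteq> 0" using l[of m] by simp
      ultimately show ?thesis using e \<nu>(2) l[of "Suc m"] by simp
    qed
    \<comment> \<open>Of the matrix product only the diagonal term survives: the other entries
      inside the block are 0, and the components outside the block vanish by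
      \<open>off\<close>.\<close>
    have on: "D \<nu> (Suc m) = 0" if \<nu>: "\<nu> < n" "\<tau> \<nu> = e" for \<nu>
    proof -
      have "mat_apply n a (\<lambda>\<mu>. \<tau> \<mu> * ((l + of_nat (Suc m)) * D \<mu> (Suc m))) \<nu>
          = (\<Sum>\<mu>\<in>{\<nu>}. a \<nu> \<mu> * (\<tau> \<mu> * ((l + of_nat (Suc m)) * D \<mu> (Suc m))))"
        unfolding mat_apply_def
      proof (rule sum.mono_neutral_right)
        show "\<forall>\<mu>\<in>{..<n} - {\<nu>}. a \<nu> \<mu> * (\<tau> \<mu> * ((l + of_nat (Suc m)) * D \<mu> (Suc m))) = 0"
        proof
          fix \<mu> assume \<mu>: "\<mu> \<in> {..<n} - {\<nu>}"
          show "a \<nu> \<mu> * (\<tau> \<mu> * ((l + of_nat (Suc m)) * D \<mu> (Suc m))) = 0"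
            using off[of \<mu>] diag[OF \<nu>(1), of \<mu>] \<mu> \<nu> by (cases "\<tau> \<mu> = e") auto
        qed
      qed (use \<nu> in auto)
      then have ma: "mat_apply n a (\<lambda>\<mu>. \<tau> \<mu> * ((l + of_nat (Suc m)) * D \<mu> (Suc m))) \<nu>
          = a \<nu> \<nu> * (e * ((l + of_nat (Suc m)) * D \<nu> (Suc m)))" using \<nu> by simp
      have "e * ((l + of_nat (Suc m)) * (l + of_nat (Suc m) - 1) * D \<nu> (Suc m))
          + (1 - r1 - r2) * (e * ((l + of_nat (Suc m)) * D \<nu> (Suc m)))
          + (r1 + r2) * e * ((l + of_nat (Suc m)) * D \<nu> (Suc m))
          - a \<nu> \<nu> * (e * ((l + of_nat (Suc m)) * D \<nu> (Suc m))) = 0"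
        using R[OF \<nu>(1), of "Suc (Suc m)"] Suc.IH \<nu> unfolding shift_coeff_simps ma by simp
      then have "e * (l + of_nat (Suc m)) * ((l + of_nat (Suc m)) - a \<nu> \<nu>) * D \<nu> (Suc m) = 0"
        by (simp add: algebra_simps)
      then show ?thesis using e l[of "Suc m"] nores[OF \<nu>, of m] by (simp del: of_nat_Suc)
    qed
    show ?case using on off Suc.IH by (auto simp: shift_coeff_def)
  qed
  then show ?thesis using \<nu> by auto
qed

text \<open>At the base point 0 the top term is absent in all rows, and the next one yields an
  eigenvalue equation for the whole matrix, applied to the vector with entries \<tau> \<nu> * D
  \<nu>. The exponent is one more than that of the full solution, because its upper half starts one
  order later.\<close>

lemma second_order_rec_unique_zero:
  assumes rec: "second_order_rec n a \<tau> 0 r1 r2 (r1 + r2 - \<mu>0 + 1) D"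
    and D0: "\<And>\<nu>. \<nu> < n \<Longrightarrow> D \<nu> 0 = 0"
    and \<tau>: "\<And>\<nu>. \<nu> < n \<Longrightarrow> \<tau> \<nu> \<noteq> 0"
    and l: "\<And>m. r1 + r2 - \<mu>0 + 1 + of_nat m \<noteq> 0"
    and nores: "\<And>f m. (\<And>\<nu>. \<nu> < n \<Longrightarrow> mat_apply n a f \<nu> = (\<mu>0 - of_nat (Suc m)) * f \<nu>) \<Longrightarrow> (\<And>\<nu>. \<nu> < n \<Longrightarrow> f \<nu> = 0)"
    and \<nu>: "\<nu> < n"
  shows "D \<nu> m = 0"
proof -
  have "\<forall>\<nu><n. D \<nu> m = 0"
  proof (induction m)
    case 0
    then show ?case using D0 by simp
  next
    case (Suc m)
    let ?l = "r1 + r2 - \<mu>0 + 1 + of_nat (Suc m)"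
    have "\<tau> \<nu> * D \<nu> (Suc m) = 0" if "\<nu> < n" for \<nu>
    proof (rule nores[of "\<lambda>\<nu>. \<tau> \<nu> * D \<nu> (Suc m)" m, OF _ that])
      fix \<nu> assume \<nu>: "\<nu> < n"
      have "mat_apply n a (\<lambda>\<mu>. \<tau> \<mu> * (?l * D \<mu> (Suc m))) \<nu> = ?l * mat_apply n a (\<lambda>\<mu>. \<tau> \<mu> * D \<mu> (Suc m)) \<nu>"
        unfolding mat_apply_cmult[symmetric] by (intro mat_apply_cong) (simp add: mult_ac)
      then have "- \<tau> \<nu> * (?l * (?l - 1) * D \<nu> (Suc m)) + (r1 + r2) * \<tau> \<nu> * (?l * D \<nu> (Suc m))
          - ?l * mat_apply n a (\<lambda>\<mu>. \<tau> \<mu> * D \<mu> (Suc m)) \<nu> = 0"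
        using rec[unfolded second_order_rec_def, rule_format, OF \<nu>, of "Suc (Suc m)"] Suc \<nu>
        unfolding shift_coeff_simps by simp
      \<comment> \<open>Here (r1 + r2) - (?l - 1) collapses to \<mu>0 - (m + 1), which produces the
        shifted eigenvalue.\<close>
      then have "?l * (mat_apply n a (\<lambda>\<mu>. \<tau> \<mu> * D \<mu> (Suc m)) \<nu> - (\<mu>0 - of_nat (Suc m)) * (\<tau> \<nu> * D \<nu> (Suc m))) = 0"
        by (simp add: algebra_simps)
      then show "mat_apply n a (\<lambda>\<mu>. \<tau> \<mu> * D \<mu> (Suc m)) \<nu> = (\<mu>0 - of_nat (Suc m)) * (\<tau> \<nu> * D \<nu> (Suc m))"
        using l[of "Suc m"] by (simp del: of_nat_Suc)
    qed
    then show ?case using \<tau> by auto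
  qed
  then show ?thesis using \<nu> by auto
qed

section \<open>From the differential equations to the recursions, and the connection coefficient for
  vectors\<close>

context cone_branch
begin

lemma frobenius_mult_var':
  "frobenius a c f \<Longrightarrow> frobenius a (shift_coeff c) (\<lambda>y. y * f y)"
  using frobenius_mult_var[of a c f] by (simp add: shift_coeff_def[abs_def])

lemma frobenius_mat_apply:
  assumes "\<And>\<mu>. \<mu> < n \<Longrightarrow> frobenius b (c \<mu>) (f \<mu>)"
  shows "frobenius b (\<lambda>m. mat_apply n a (\<lambda>\<mu>. c \<mu> m) \<nu>) (\<lambda>y. mat_apply n a (\<lambda>\<mu>. f \<mu> y) \<nu>)"
  unfolding mat_apply_def using assms by (intro frobenius_sum frobenius_cmult) auto

lemma frobenius_first_order_rec:
  assumes frob: "\<And>\<nu>. \<nu> < n \<Longrightarrow> frobenius b (g \<nu>) (B \<nu>)"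
    and ode: "\<And>\<nu> y. \<nu> < n \<Longrightarrow> y \<in> Q \<Longrightarrow>
      (y + e) * (y + e - \<tau> \<nu>) * deriv (B \<nu>) y =
        \<kappa> * (y + e) * B \<nu> y - r1 * \<tau> \<nu> * B \<nu> y + mat_apply n a (\<lambda>\<mu>. \<tau> \<mu> * B \<mu> y) \<nu>"
  shows "first_order_rec n a \<tau> e \<kappa> r1 b g"
  unfolding first_order_rec_def
proof (intro allI impI)
  fix m \<nu> assume \<nu>: "\<nu> < n"
  let ?d = "\<lambda>m. (b + of_nat m) * g \<nu> m" and ?D = "\<lambda>y. y * deriv (B \<nu>) y"
  have D: "frobenius b ?d ?D" by (intro frobenius_euler frob \<nu>)
  have 1: "frobenius b (\<lambda>m. e * (e - \<tau> \<nu>) * ?d m + (2 * e - \<tau> \<nu>) * shift_coeff ?d m + shift_coeff (shift_coeff ?d) m)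
      (\<lambda>y. e * (e - \<tau> \<nu>) * ?D y + (2 * e - \<tau> \<nu>) * (y * ?D y) + y * (y * ?D y))"
    by (intro frobenius_add frobenius_cmult frobenius_mult_var' D)
  have 2: "frobenius b (\<lambda>m. \<kappa> * shift_coeff (shift_coeff (g \<nu>)) m + (\<kappa> * e - r1 * \<tau> \<nu>) * shift_coeff (g \<nu>) m
     + mat_apply n a (\<lambda>\<mu>. \<tau> \<mu> * shift_coeff (g \<mu>) m) \<nu>)
     (\<lambda>y. \<kappa> * (y * (y * B \<nu> y)) + (\<kappa> * e - r1 * \<tau> \<nu>) * (y * B \<nu> y) + mat_apply n a (\<lambda>\<mu>. \<tau> \<mu> * (y * B \<mu> y)) \<nu>)"
    by (intro frobenius_add frobenius_cmult frobenius_mult_var' frobenius_mat_apply frob \<nu>)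
  \<comment> \<open>The equation is multiplied by y, so that the derivative occurs only inside the
    Euler operator.\<close>
  have eq: "\<kappa> * (y * (y * B \<nu> y)) + (\<kappa> * e - r1 * \<tau> \<nu>) * (y * B \<nu> y) + mat_apply n a (\<lambda>\<mu>. \<tau> \<mu> * (y * B \<mu> y)) \<nu>
      = e * (e - \<tau> \<nu>) * ?D y + (2 * e - \<tau> \<nu>) * (y * ?D y) + y * (y * ?D y)" if y: "y \<in> Q" for y
  proof -
    have "mat_apply n a (\<lambda>\<mu>. \<tau> \<mu> * (y * B \<mu> y)) \<nu> = y * mat_apply n a (\<lambda>\<mu>. \<tau> \<mu> * B \<mu> y) \<nu>"
      unfolding mat_apply_cmult[symmetric] by (intro mat_apply_cong) (simp add: mult_ac)
    then have "\<kappa> * (y * (y * B \<nu> y)) + (\<kappa> * e - r1 * \<tau> \<nu>) * (y * B \<nu> y) + mat_apply n a (\<lambda>\<mu>. \<tau> \<mu> * (y * B \<mu> y)) \<nu>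
      = y * (\<kappa> * (y + e) * B \<nu> y - r1 * \<tau> \<nu> * B \<nu> y + mat_apply n a (\<lambda>\<mu>. \<tau> \<mu> * B \<mu> y) \<nu>)"
      by (simp add: algebra_simps)
    also have "\<dots> = y * ((y + e) * (y + e - \<tau> \<nu>) * deriv (B \<nu>) y)"
      by (simp only: ode[OF \<nu> y])
    finally show ?thesis by (simp add: algebra_simps)
  qed
  from frobenius_unique[OF 1 frobenius_cong[OF eq 2]]
  show "e * (e - \<tau> \<nu>) * ?d m + (2 * e - \<tau> \<nu>) * shift_coeff ?d m + shift_coeff (shift_coeff ?d) m
     = \<kappa> * shift_coeff (shift_coeff (g \<nu>)) m + (\<kappa> * e - r1 * \<tau> \<nu>) * shift_coeff (g \<nu>) m
     + mat_apply n a (\<lambda>\<mu>. \<tau> \<mu> * shift_coeff (g \<mu>) m) \<nu>" .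
qed

text \<open>y^2 D^2 = H (H - 1) for the Euler operator H = y d/dy.\<close>

lemma frobenius_second_deriv:
  assumes f: "frobenius l c f" and hol: "f holomorphic_on Q"
  shows "frobenius l (\<lambda>m. (l + of_nat m) * (l + of_nat m - 1) * c m) (\<lambda>y. y * (y * deriv (deriv f) y))"
proof -
  have 1: "frobenius l (\<lambda>m. (l + of_nat m) * ((l + of_nat m) * c m) + (- 1) * ((l + of_nat m) * c m))
      (\<lambda>y. y * deriv (\<lambda>y. y * deriv f y) y + (- 1) * (y * deriv f y))"
    by (intro frobenius_add frobenius_cmult frobenius_euler f)
  have eq: "y * deriv (\<lambda>y. y * deriv f y) y + (- 1) * (y * deriv f y) = y * (y * deriv (deriv f) y)" if y: "y \<in> Q" for y
  proof -
    have "deriv f holomorphic_on Q" using hol open_Q by (rule holomorphic_deriv)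
    then have D: "(deriv f has_field_derivative deriv (deriv f) y) (at y)"
      using open_Q y by (rule holomorphic_derivI)
    have "((\<lambda>y. y * deriv f y) has_field_derivative deriv f y + y * deriv (deriv f) y) (at y)"
      by (rule derivative_eq_intros D refl | simp)+
    then show ?thesis by (simp add: DERIV_imp_deriv algebra_simps)
  qed
  have "(\<lambda>m. (l + of_nat m) * ((l + of_nat m) * c m) + (- 1) * ((l + of_nat m) * c m))
      = (\<lambda>m. (l + of_nat m) * (l + of_nat m - 1) * c m)"
    by (simp add: algebra_simps)
  with frobenius_cong[OF eq 1] show ?thesis by simp
qed

text \<open>\<open>V\<close> is (y + e - \<tau>) u' - a u by the first equation. When this is
  inserted into the second one, the terms with the matrix applied twice cancel, as do all terms with
  the matrix applied to u itself and to (y + e) u'; only the matrix applied to \<tau> u'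
  survives.\<close>

lemma second_order_equation:
  assumes u: "\<And>\<nu>. \<nu> < n \<Longrightarrow> u \<nu> holomorphic_on Q"
    and eq1: "\<And>\<nu> y. \<nu> < n \<Longrightarrow> y \<in> Q \<Longrightarrow>
      (y + e - \<tau> \<nu>) * deriv (u \<nu>) y = mat_apply n a (\<lambda>\<mu>. u \<mu> y) \<nu> + V \<nu> y"
    and eq2: "\<And>\<nu> y. \<nu> < n \<Longrightarrow> y \<in> Q \<Longrightarrow>
      (y + e) * deriv (V \<nu>) y = - mat_apply n a (\<lambda>\<mu>. mat_apply n a (\<lambda>\<kappa>. u \<kappa> y) \<mu>) \<nu>
        + (r1 + r2) * mat_apply n a (\<lambda>\<mu>. u \<mu> y) \<nu> - r1 * r2 * u \<nu> y
        + (r1 + r2) * V \<nu> y - mat_apply n a (\<lambda>\<mu>. V \<mu> y) \<nu>"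
    and \<nu>: "\<nu> < n" and y: "y \<in> Q"
  shows "(y + e) * (y + e - \<tau> \<nu>) * deriv (deriv (u \<nu>)) y
      + ((1 - r1 - r2) * (y + e) + (r1 + r2) * \<tau> \<nu>) * deriv (u \<nu>) y
      - mat_apply n a (\<lambda>\<mu>. \<tau> \<mu> * deriv (u \<mu>) y) \<nu> + r1 * r2 * u \<nu> y = 0"
proof -
  have V: "V \<mu> z = (z + e - \<tau> \<mu>) * deriv (u \<mu>) z - mat_apply n a (\<lambda>\<kappa>. u \<kappa> z) \<mu>" if "\<mu> < n" "z \<in> Q" for \<mu> z
    using eq1[OF that] by simp
  have du: "(u \<mu> has_field_derivative deriv (u \<mu>) y) (at y)" if "\<mu> < n" for \<mu>
    using u[OF that] open_Q y by (rule holomorphic_derivI)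
  have ddu: "(deriv (u \<mu>) has_field_derivative deriv (deriv (u \<mu>)) y) (at y)" if "\<mu> < n" for \<mu>
    using holomorphic_deriv[OF u[OF that] open_Q] open_Q y by (rule holomorphic_derivI)
  have "((\<lambda>z. mat_apply n a (\<lambda>\<kappa>. u \<kappa> z) \<nu>) has_field_derivative mat_apply n a (\<lambda>\<kappa>. deriv (u \<kappa>) y) \<nu>) (at y)"
    unfolding mat_apply_def by (intro DERIV_sum DERIV_cmult du) auto
  moreover have "((\<lambda>z. (z + e - \<tau> \<nu>) * deriv (u \<nu>) z) has_field_derivative
      deriv (u \<nu>) y + (y + e - \<tau> \<nu>) * deriv (deriv (u \<nu>)) y) (at y)"
    by (rule derivative_eq_intros ddu[OF \<nu>] refl | simp)+
  ultimately have "((\<lambda>z. (z + e - \<tau> \<nu>) * deriv (u \<nu>) z - mat_apply n a (\<lambda>\<kappa>. u \<kappa> z) \<nu>) has_field_derivative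
      deriv (u \<nu>) y + (y + e - \<tau> \<nu>) * deriv (deriv (u \<nu>)) y - mat_apply n a (\<lambda>\<kappa>. deriv (u \<kappa>) y) \<nu>) (at y)"
    by (intro DERIV_diff)
  then have "(V \<nu> has_field_derivative
      deriv (u \<nu>) y + (y + e - \<tau> \<nu>) * deriv (deriv (u \<nu>)) y - mat_apply n a (\<lambda>\<kappa>. deriv (u \<kappa>) y) \<nu>) (at y)"
    by (rule has_field_derivative_transform_within_open[OF _ open_Q y]) (simp add: V \<nu>)
  then have dV: "deriv (V \<nu>) y
      = deriv (u \<nu>) y + (y + e - \<tau> \<nu>) * deriv (deriv (u \<nu>)) y - mat_apply n a (\<lambda>\<kappa>. deriv (u \<kappa>) y) \<nu>"
    by (rule DERIV_imp_deriv)
  have "mat_apply n a (\<lambda>\<mu>. V \<mu> y) \<nu>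
      = mat_apply n a (\<lambda>\<mu>. (y + e - \<tau> \<mu>) * deriv (u \<mu>) y - mat_apply n a (\<lambda>\<kappa>. u \<kappa> y) \<mu>) \<nu>"
    by (intro mat_apply_cong) (simp add: V y)
  also have "\<dots> = mat_apply n a (\<lambda>\<mu>. (y + e) * deriv (u \<mu>) y - \<tau> \<mu> * deriv (u \<mu>) y) \<nu>
      - mat_apply n a (\<lambda>\<mu>. mat_apply n a (\<lambda>\<kappa>. u \<kappa> y) \<mu>) \<nu>"
    unfolding mat_apply_diff[symmetric] by (intro mat_apply_cong) (simp add: algebra_simps)
  finally have mV: "mat_apply n a (\<lambda>\<mu>. V \<mu> y) \<nu> = (y + e) * mat_apply n a (\<lambda>\<mu>. deriv (u \<mu>) y) \<nu>
      - mat_apply n a (\<lambda>\<mu>. \<tau> \<mu> * deriv (u \<mu>) y) \<nu>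
      - mat_apply n a (\<lambda>\<mu>. mat_apply n a (\<lambda>\<kappa>. u \<kappa> y) \<mu>) \<nu>"
    unfolding mat_apply_diff mat_apply_cmult .
  show ?thesis
    using eq2[OF \<nu> y] unfolding dV mV V[OF \<nu> y] by (simp add: algebra_simps)
qed

lemma frobenius_second_order_rec:
  assumes u: "\<And>\<nu>. \<nu> < n \<Longrightarrow> u \<nu> holomorphic_on Q"
    and frob: "\<And>\<nu>. \<nu> < n \<Longrightarrow> frobenius l (G \<nu>) (u \<nu>)"
    and eq: "\<And>\<nu> y. \<nu> < n \<Longrightarrow> y \<in> Q \<Longrightarrow>
      (y + e) * (y + e - \<tau> \<nu>) * deriv (deriv (u \<nu>)) y
      + ((1 - r1 - r2) * (y + e) + (r1 + r2) * \<tau> \<nu>) * deriv (u \<nu>) y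
      - mat_apply n a (\<lambda>\<mu>. \<tau> \<mu> * deriv (u \<mu>) y) \<nu> + r1 * r2 * u \<nu> y = 0"
  shows "second_order_rec n a \<tau> e r1 r2 l G"
  unfolding second_order_rec_def
proof (intro allI impI)
  fix m \<nu> assume \<nu>: "\<nu> < n"
  let ?d2 = "\<lambda>m. (l + of_nat m) * (l + of_nat m - 1) * G \<nu> m" and ?D2 = "\<lambda>y. y * (y * deriv (deriv (u \<nu>)) y)"
  let ?d1 = "\<lambda>\<nu> m. (l + of_nat m) * G \<nu> m" and ?D1 = "\<lambda>\<nu> y. y * deriv (u \<nu>) y"
  have D1: "frobenius l (?d1 \<nu>) (?D1 \<nu>)" if "\<nu> < n" for \<nu> by (intro frobenius_euler frob that)
  have D2: "frobenius l ?d2 ?D2" by (intro frobenius_second_deriv frob u \<nu>)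
  have 1: "frobenius l (\<lambda>m. e * (e - \<tau> \<nu>) * ?d2 m + (2 * e - \<tau> \<nu>) * shift_coeff ?d2 m + shift_coeff (shift_coeff ?d2) m
     + (1 - r1 - r2) * (e * shift_coeff (?d1 \<nu>) m + shift_coeff (shift_coeff (?d1 \<nu>)) m)
     + (r1 + r2) * \<tau> \<nu> * shift_coeff (?d1 \<nu>) m
     + (-1) * mat_apply n a (\<lambda>\<mu>. \<tau> \<mu> * shift_coeff (?d1 \<mu>) m) \<nu>
     + r1 * r2 * shift_coeff (shift_coeff (G \<nu>)) m)
     (\<lambda>y. e * (e - \<tau> \<nu>) * ?D2 y + (2 * e - \<tau> \<nu>) * (y * ?D2 y) + y * (y * ?D2 y)
     + (1 - r1 - r2) * (e * (y * ?D1 \<nu> y) + y * (y * ?D1 \<nu> y))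
     + (r1 + r2) * \<tau> \<nu> * (y * ?D1 \<nu> y)
     + (-1) * mat_apply n a (\<lambda>\<mu>. \<tau> \<mu> * (y * ?D1 \<mu> y)) \<nu>
     + r1 * r2 * (y * (y * u \<nu> y)))"
    by (intro frobenius_add frobenius_cmult frobenius_mult_var' frobenius_mat_apply D1 D2 frob \<nu>)
  \<comment> \<open>The second-order equation multiplied by y^2.\<close>
  have eq0: "e * (e - \<tau> \<nu>) * ?D2 y + (2 * e - \<tau> \<nu>) * (y * ?D2 y) + y * (y * ?D2 y)
     + (1 - r1 - r2) * (e * (y * ?D1 \<nu> y) + y * (y * ?D1 \<nu> y))
     + (r1 + r2) * \<tau> \<nu> * (y * ?D1 \<nu> y)
     + (-1) * mat_apply n a (\<lambda>\<mu>. \<tau> \<mu> * (y * ?D1 \<mu> y)) \<nu>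
     + r1 * r2 * (y * (y * u \<nu> y)) = 0" if y: "y \<in> Q" for y
  proof -
    have ma: "mat_apply n a (\<lambda>\<mu>. \<tau> \<mu> * (y * ?D1 \<mu> y)) \<nu> = y * y * mat_apply n a (\<lambda>\<mu>. \<tau> \<mu> * deriv (u \<mu>) y) \<nu>"
      unfolding mat_apply_cmult[symmetric] by (intro mat_apply_cong) (simp add: mult_ac)
    have "e * (e - \<tau> \<nu>) * ?D2 y + (2 * e - \<tau> \<nu>) * (y * ?D2 y) + y * (y * ?D2 y)
     + (1 - r1 - r2) * (e * (y * ?D1 \<nu> y) + y * (y * ?D1 \<nu> y))
     + (r1 + r2) * \<tau> \<nu> * (y * ?D1 \<nu> y)
     + (-1) * mat_apply n a (\<lambda>\<mu>. \<tau> \<mu> * (y * ?D1 \<mu> y)) \<nu>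
     + r1 * r2 * (y * (y * u \<nu> y)) = y * y * ((y + e) * (y + e - \<tau> \<nu>) * deriv (deriv (u \<nu>)) y
      + ((1 - r1 - r2) * (y + e) + (r1 + r2) * \<tau> \<nu>) * deriv (u \<nu>) y
      - mat_apply n a (\<lambda>\<mu>. \<tau> \<mu> * deriv (u \<mu>) y) \<nu> + r1 * r2 * u \<nu> y)"
      unfolding ma by (simp add: algebra_simps)
    then show ?thesis unfolding eq[OF \<nu> y] by simp
  qed
  from frobenius_unique[OF frobenius_cong[OF eq0 1] frobenius_zero, of m]
  show "e * (e - \<tau> \<nu>) * ?d2 m + (2 * e - \<tau> \<nu>) * shift_coeff ?d2 m + shift_coeff (shift_coeff ?d2) m
     + (1 - r1 - r2) * (e * shift_coeff (?d1 \<nu>) m + shift_coeff (shift_coeff (?d1 \<nu>)) m)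
     + (r1 + r2) * \<tau> \<nu> * shift_coeff (?d1 \<nu>) m
     - mat_apply n a (\<lambda>\<mu>. \<tau> \<mu> * shift_coeff (?d1 \<mu>) m) \<nu>
     + r1 * r2 * shift_coeff (shift_coeff (G \<nu>)) m = 0"
    by simp
qed

text \<open>Vector form of \<open>connection_coefficient\<close>. The coefficients of
  \<open>u\<close> and those obtained from k \<open>B\<close> solve the same second-order recursion
  and start equally, so they agree by \<open>uniq\<close>, and the scalar theorem applies to each
  component. The number \<open>k\<close> reconciles the normalisations of \<open>u\<close> and
  \<open>B\<close> at the base point.\<close>

lemma okubo_connection:
  assumes u: "\<And>\<nu>. \<nu> < n \<Longrightarrow> u \<nu> holomorphic_on Q" and B: "\<And>\<nu>. \<nu> < n \<Longrightarrow> B \<nu> holomorphic_on Q"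
    and eq1: "\<And>\<nu> y. \<nu> < n \<Longrightarrow> y \<in> Q \<Longrightarrow>
      (y + e - \<tau> \<nu>) * deriv (u \<nu>) y = mat_apply n a (\<lambda>\<mu>. u \<mu> y) \<nu> + V \<nu> y"
    and eq2: "\<And>\<nu> y. \<nu> < n \<Longrightarrow> y \<in> Q \<Longrightarrow>
      (y + e) * deriv (V \<nu>) y = - mat_apply n a (\<lambda>\<mu>. mat_apply n a (\<lambda>\<kappa>. u \<kappa> y) \<mu>) \<nu>
        + (r1 + r2) * mat_apply n a (\<lambda>\<mu>. u \<mu> y) \<nu> - r1 * r2 * u \<nu> y
        + (r1 + r2) * V \<nu> y - mat_apply n a (\<lambda>\<mu>. V \<mu> y) \<nu>"
    and odeB: "\<And>\<nu> y. \<nu> < n \<Longrightarrow> y \<in> Q \<Longrightarrow>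
      (y + e) * (y + e - \<tau> \<nu>) * deriv (B \<nu>) y =
        (r1 - r2 - 1) * (y + e) * B \<nu> y - r1 * \<tau> \<nu> * B \<nu> y + mat_apply n a (\<lambda>\<mu>. \<tau> \<mu> * B \<mu> y) \<nu>"
    and fu: "\<And>\<nu>. \<nu> < n \<Longrightarrow> frobenius l (G \<nu>) (u \<nu>)"
    and fB: "\<And>\<nu>. \<nu> < n \<Longrightarrow> frobenius (l - r2 - 1) (g \<nu>) (B \<nu>)"
    and lead: "\<And>\<nu>. \<nu> < n \<Longrightarrow> G \<nu> 0 = k * g \<nu> 0"
    and uniq: "\<And>D \<nu> m. second_order_rec n a \<tau> e r1 r2 l D \<Longrightarrow> (\<And>\<nu>. \<nu> < n \<Longrightarrow> D \<nu> 0 = 0) \<Longrightarrow> \<nu> < n \<Longrightarrow> D \<nu> m = 0"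
    and ni: "l - r2 \<notin> \<int>\<^sub>\<le>\<^sub>0" "l - r2 \<noteq> 1" "l + 1 \<notin> \<int>\<^sub>\<le>\<^sub>0" "r1 - r2 \<notin> \<int>\<^sub>\<le>\<^sub>0" "r1 + 1 \<notin> \<int>\<^sub>\<le>\<^sub>0"
    and \<nu>: "\<nu> < n"
    and lim: "((\<lambda>y. B \<nu> y * pw (- (r1 - r2 - 1)) y) \<longlongrightarrow> b0) (inf at_infinity (principal Q))"
    and two: "two_exponents r1 r2 (u \<nu>) c"
  shows "c = k * b0 * Gamma (r1 - r2) * Gamma (l + 1) / (Gamma (r1 + 1) * Gamma (l - r2))"
proof -
  let ?b = "l - r2 - 1"
  have "first_order_rec n a \<tau> e (r1 - r2 - 1) r1 ?b (\<lambda>\<nu> m. k * g \<nu> m)"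
  proof (rule frobenius_first_order_rec[where B="\<lambda>\<nu> y. k * B \<nu> y"])
    fix \<nu> y assume h: "\<nu> < n" "y \<in> Q"
    have "deriv (\<lambda>y. k * B \<nu> y) y = k * deriv (B \<nu>) y"
      using holomorphic_on_imp_differentiable_at[OF B[OF h(1)] open_Q h(2)] by simp
    moreover have "mat_apply n a (\<lambda>\<mu>. \<tau> \<mu> * (k * B \<mu> y)) \<nu> = k * mat_apply n a (\<lambda>\<mu>. \<tau> \<mu> * B \<mu> y) \<nu>"
      unfolding mat_apply_cmult[symmetric] by (intro mat_apply_cong) (simp add: mult_ac)
    moreover have "k * ((y + e) * (y + e - \<tau> \<nu>) * deriv (B \<nu>) y) =
        k * ((r1 - r2 - 1) * (y + e) * B \<nu> y - r1 * \<tau> \<nu> * B \<nu> y + mat_apply n a (\<lambda>\<mu>. \<tau> \<mu> * B \<mu> y) \<nu>)"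
      by (simp only: odeB[OF h])
    ultimately show "(y + e) * (y + e - \<tau> \<nu>) * deriv (\<lambda>y. k * B \<nu> y) y =
        (r1 - r2 - 1) * (y + e) * (k * B \<nu> y) - r1 * \<tau> \<nu> * (k * B \<nu> y) + mat_apply n a (\<lambda>\<mu>. \<tau> \<mu> * (k * B \<mu> y)) \<nu>"
      by (simp add: algebra_simps)
  qed (intro frobenius_cmult fB)
  then have rB: "second_order_rec n a \<tau> e r1 r2 l (\<lambda>\<nu> m. pochhammer (?b + 1) m / pochhammer (l + 1) m * (k * g \<nu> m))"
  proof (rule second_order_rec_of_first_order)
    show "?b \<noteq> 0" using ni(2) by auto
    show "l + 1 + of_nat m \<noteq> 0" for m
    proof
      assume "l + 1 + of_nat m = 0"
      then have "l + 1 = - of_nat m" by (simp only: add_eq_0_iff2)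
      then have "l + 1 \<in> \<int>\<^sub>\<le>\<^sub>0" by (simp only: minus_of_nat_in_nonpos_Ints)
      then show False using ni(3) by simp
    qed
  qed auto
  have ru: "second_order_rec n a \<tau> e r1 r2 l G"
    by (rule frobenius_second_order_rec[OF u fu second_order_equation[OF u eq1 eq2]])
  have GB: "G \<nu> m = pochhammer (?b + 1) m / pochhammer (l + 1) m * (k * g \<nu> m)" for m
    using uniq[OF second_order_rec_diff[OF ru rB] _ \<nu>, of m] lead by simp
  \<comment> \<open>The scalar theorem with \<beta> = l - r2 - 1, \<alpha> = r2 + 1 and \<kappa> =
    r1 - r2 - 1.\<close>
  have "c = (k * b0) * Gamma (r1 - r2 - 1 + 1) * Gamma (?b + (r2 + 1) + 1) / (Gamma (r1 - r2 - 1 + (r2 + 1) + 1) * Gamma (?b + 1))"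
  proof (rule connection_coefficient[where u="u \<nu>" and B="\<lambda>y. k * B \<nu> y" and g="\<lambda>m. k * g \<nu> m"])
    show "(\<lambda>y. k * B \<nu> y) holomorphic_on Q" by (intro holomorphic_intros B \<nu>)
    show "frobenius ?b (\<lambda>m. k * g \<nu> m) (\<lambda>y. k * B \<nu> y)" by (intro frobenius_cmult fB \<nu>)
    have "G \<nu> = (\<lambda>m. pochhammer (?b + 1) m / pochhammer (?b + (r2 + 1) + 1) m * (k * g \<nu> m))"
      using GB by auto
    then show "frobenius (?b + (r2 + 1)) (\<lambda>m. pochhammer (?b + 1) m / pochhammer (?b + (r2 + 1) + 1) m * (k * g \<nu> m)) (u \<nu>)"
      using fu[OF \<nu>] by simp
    show "((\<lambda>y. k * B \<nu> y * pw (- (r1 - r2 - 1)) y) \<longlongrightarrow> k * b0) (inf at_infinity (principal Q))"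
      unfolding mult.assoc by (intro tendsto_mult tendsto_const lim)
    show "two_exponents (r1 - r2 - 1 + (r2 + 1)) (r2 + 1 - 1) (u \<nu>) c" using two by simp
  qed (use u \<nu> ni in auto)
  then show ?thesis by (simp add: mult.assoc)
qed

text \<open>\<open>connection_coefficient\<close> for u = B = 0. This makes leading coefficients at
  infinity well defined and is the source of linear independence in
  \<open>basis_expansion\<close>.\<close>

lemma two_exponents_zero:
  assumes "two_exponents a b (\<lambda>y. 0) c" "a - b \<notin> \<int>" "a \<notin> \<int>"
  shows "c = 0"
proof -
  have 1: "a - b \<notin> \<int>\<^sub>\<le>\<^sub>0" "a + 1 \<notin> \<int>\<^sub>\<le>\<^sub>0"
    using assms(2,3) nonpos_Ints_Int by (auto simp: algebra_simps dest!: nonpos_Ints_Int)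
  have "c = 0 * Gamma (a - b - 1 + 1) * Gamma (a - b - 1 + (b + 1) + 1) / (Gamma (a - b - 1 + (b + 1) + 1) * Gamma (a - b - 1 + 1))"
    by (rule connection_coefficient[where u="\<lambda>_. 0" and B="\<lambda>_. 0" and g="\<lambda>_. 0"])
      (use assms 1 in \<open>auto intro!: frobenius_zero\<close>)
  then show ?thesis by simp
qed

lemma two_exponents_sum:
  assumes "finite I" "\<And>i. i \<in> I \<Longrightarrow> two_exponents a b (f i) (c i)"
  shows "two_exponents a b (\<lambda>y. \<Sum>i\<in>I. k i * f i y) (\<Sum>i\<in>I. k i * c i)"
  using assms
proof (induction I)
  case empty
  then show ?case by (auto intro!: two_exponentsI[of 1 "\<lambda>_. 0" "\<lambda>_. 0"])
next
  case (insert i I)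
  obtain r \<phi> \<psi> where r: "r > 0" "\<phi> holomorphic_on ball 0 r" "\<psi> holomorphic_on ball 0 r" "\<phi> 0 = c i"
    "\<And>y. y \<in> Q \<Longrightarrow> norm y > 1 / r \<Longrightarrow> f i y = pw a y * \<phi> (1 / y) + pw b y * \<psi> (1 / y)"
    using insert.prems[of i] unfolding two_exponents_def by blast
  have "two_exponents a b (\<lambda>y. \<Sum>i\<in>I. k i * f i y) (\<Sum>i\<in>I. k i * c i)" using insert by auto
  then obtain r' \<phi>' \<psi>' where r': "r' > 0" "\<phi>' holomorphic_on ball 0 r'" "\<psi>' holomorphic_on ball 0 r'"
    "\<phi>' 0 = (\<Sum>i\<in>I. k i * c i)"
    "\<And>y. y \<in> Q \<Longrightarrow> norm y > 1 / r' \<Longrightarrow> (\<Sum>i\<in>I. k i * f i y) = pw a y * \<phi>' (1 / y) + pw b y * \<psi>' (1 / y)"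
    unfolding two_exponents_def by blast
  show ?case
  proof (rule two_exponentsI[of "min r r'" "\<lambda>z. k i * \<phi> z + \<phi>' z" "\<lambda>z. k i * \<psi> z + \<psi>' z"])
    fix y assume y: "y \<in> Q" "norm y > 1 / min r r'"
    then have "norm y > 1 / r" "norm y > 1 / r'"
    proof -
      have "1 / r \<le> 1 / min r r'" "1 / r' \<le> 1 / min r r'" using r(1) r'(1) by (simp_all add: frac_le)
      then show "norm y > 1 / r" "norm y > 1 / r'" using y(2) by linarith+
    qed
    then show "(\<Sum>i\<in>insert i I. k i * f i y) = pw a y * (k i * \<phi> (1 / y) + \<phi>' (1 / y)) + pw b y * (k i * \<psi> (1 / y) + \<psi>' (1 / y))"
      using r(5)[OF y(1)] r'(5)[OF y(1)] insert.hyps by (simp add: algebra_simps)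
  qed (use r r' insert.hyps in \<open>auto intro!: holomorphic_intros intro: holomorphic_on_subset\<close>)
qed

text \<open>Needed for the solution at the apex c itself, whose leading vector lies in the lower
  half.\<close>

lemma frobenius_drop:
  assumes f: "frobenius a c f" and c0: "c 0 = 0"
  shows "frobenius (a + 1) (\<lambda>m. c (Suc m)) f"
proof -
  obtain R where R: "R > 0" "\<And>y. y \<in> Q \<Longrightarrow> norm y < R \<Longrightarrow> (\<lambda>m. pw a y * (c m * y ^ m)) sums f y"
    using f unfolding frobenius_def by auto
  show ?thesis unfolding frobenius_def
  proof (intro exI[of _ R] conjI ballI impI)
    fix y assume y: "y \<in> Q" "norm y < R"
    have "(\<lambda>m. pw a y * (c (Suc m) * y ^ Suc m)) sums f y"
      using R(2)[OF y] sums_Suc_iff[of "\<lambda>m. pw a y * (c m * y ^ m)"] c0 by simp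
    then show "(\<lambda>m. pw (a + 1) y * (c (Suc m) * y ^ m)) sums f y"
      using pw_add_nat[OF y(1), of a 1] by (simp add: mult_ac)
  qed (use R in auto)
qed

end

section \<open>Sectors and branches of the logarithm\<close>

definition lg :: "real set \<Rightarrow> complex \<Rightarrow> complex" where
  "lg J z = of_real (ln (norm z)) + \<i> * of_real (arg_in J z)"

lemma powr_arg_lg: "powr_arg (arg_in J z) z a = exp (a * lg J z)"
  by (simp add: powr_arg_def lg_def)

text \<open>Sectors are images of horizontal strips under exp; all later statements about arguments
  are checked in the strip.\<close>

lemma sector_exp: "sector c J = (\<lambda>w. c + exp w) ` {w. Im w \<in> J}"
proof safe
  fix z assume "z \<in> sector c J"
  then obtain \<phi> where z: "z \<noteq> c" "\<phi> \<in> J" "is_Arg (z - c) \<phi>" by (auto simp: sector_def)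
  have "exp (of_real (ln (norm (z - c))) + \<i> * of_real \<phi>) = of_real (norm (z - c)) * exp (\<i> * of_real \<phi>)"
    using z(1) by (simp add: exp_add exp_of_real)
  also have "\<dots> = z - c" using z(3) by (simp add: is_Arg_def)
  finally show "z \<in> (\<lambda>w. c + exp w) ` {w. Im w \<in> J}"
    using z(2) by (intro image_eqI[of _ _ "of_real (ln (norm (z - c))) + \<i> * of_real \<phi>"]) auto
next
  fix w assume "Im w \<in> J"
  moreover have "is_Arg (exp w) (Im w)"
    unfolding is_Arg_def by (metis exp_eq_polar cis_conv_exp norm_exp_eq_Re)
  ultimately show "c + exp w \<in> sector c J" by (auto simp: sector_def)
qed

text \<open>Two arguments in an open interval of length at most 2 pi differ by less than 2 pi and
  hence coincide.\<close>

lemma lg_exp: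
  assumes J: "J = {a<..<b}" "b - a \<le> 2 * pi" and w: "Im w \<in> J"
  shows "lg J (exp w) = w"
proof -
  have A: "is_Arg (exp w) (Im w)"
    unfolding is_Arg_def by (metis exp_eq_polar cis_conv_exp norm_exp_eq_Re)
  have "arg_in J (exp w) = Im w"
    unfolding arg_in_def
  proof (rule the_equality)
    show "Im w \<in> J \<and> is_Arg (exp w) (Im w)" using w A by simp
    fix \<phi> assume \<phi>: "\<phi> \<in> J \<and> is_Arg (exp w) \<phi>"
    have "\<bar>\<phi> - Im w\<bar> < 2 * pi" using \<phi> w J(2) unfolding J(1) greaterThanLessThan_iff by linarith
    then show "\<phi> = Im w" using is_Arg_eqI[of "exp w" \<phi> "Im w"] \<phi> A by simp
  qed
  then show ?thesis by (simp add: lg_def complex_eq_iff)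
qed

lemma open_sector: assumes "open J" shows "open (sector c J)"
proof -
  have "open (exp ` {w::complex. Im w \<in> J})"
  proof (rule open_mapping_thm[of exp UNIV])
    show "open {w. Im w \<in> J}" using assms open_vimage[of J Im] by (simp add: vimage_def continuous_intros)
    show "\<not> (exp :: complex \<Rightarrow> complex) constant_on UNIV"
    proof
      assume "(exp :: complex \<Rightarrow> complex) constant_on UNIV"
      then have "exp (0::complex) = exp (\<i> * of_real pi)" unfolding constant_on_def by (metis UNIV_I)
      then show False by (simp add: exp_pi_i)
    qed
  qed (auto intro: holomorphic_intros)
  then have "open ((\<lambda>z. c + z) ` (exp ` {w. Im w \<in> J}))" by (rule open_translation)
  then show ?thesis by (simp add: sector_exp image_image)
qed

lemma connected_sector: "connected (sector c {a<..<b})"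
  unfolding sector_exp
proof (intro connected_continuous_image continuous_intros)
  have "{w. Im w \<in> {a<..<b}} = {w. a < Im w} \<inter> {w. Im w < b}" by auto
  then show "connected {w. Im w \<in> {a<..<b}}"
    by (metis convex_Int convex_connected convex_halfspace_Im_gt convex_halfspace_Im_lt)
qed

lemma exp_notin_nonpos_Reals:
  assumes "\<bar>Im v\<bar> < pi" shows "exp v \<notin> \<real>\<^sub>\<le>\<^sub>0" "Ln (exp v) = v"
proof -
  show 1: "Ln (exp v) = v" using assms by (intro Ln_exp) auto
  show "exp v \<notin> \<real>\<^sub>\<le>\<^sub>0"
  proof
    assume "exp v \<in> \<real>\<^sub>\<le>\<^sub>0"
    then have "Re (exp v) < 0" "Im (exp v) = 0" by (auto simp: complex_nonpos_Reals_iff less_le dest: arg_cong[of _ _ "\<lambda>z. z"]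
          intro!: notI) (metis complex_eqI exp_not_eq_zero zero_complex.sel)
    then have "Im (Ln (exp v)) = pi" by (simp add: Im_Ln_eq_pi)
    then show False using 1 assms by auto
  qed
qed

lemma cone_branch_sector:
  assumes J: "J = {a<..<b}" "a < b" "b - a \<le> 2 * pi"
  shows "cone_branch (sector 0 J) (lg J)"
proof
  have S: "sector 0 J = exp ` {w. Im w \<in> J}" by (simp add: sector_exp)
  show "open (sector 0 J)" using J by (intro open_sector) auto
  show "connected (sector 0 J)" unfolding J(1) by (rule connected_sector)
  have "exp (\<i> * of_real ((a + b) / 2)) \<in> sector 0 J"
    unfolding S using J by (intro imageI) (simp add: field_simps)
  then show "sector 0 J \<noteq> {}" by blast
  \<comment> \<open>Rotating by the midpoint moves the strip into |Im| < pi, where the principal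
    logarithm is holomorphic.\<close>
  define m where "m = (a + b) / 2"
  have m: "\<bar>x - m\<bar> < pi" if "x \<in> J" for x
    using that J by (auto simp: m_def abs_less_iff field_simps)
  have ex: "exp w * exp (- \<i> * of_real m) = exp (w - \<i> * of_real m)" for w
    by (simp add: exp_diff exp_minus field_simps)
  show "lg J holomorphic_on sector 0 J"
  proof (rule holomorphic_transform)
    show "(\<lambda>z. Ln (z * exp (- \<i> * of_real m)) + \<i> * of_real m) holomorphic_on sector 0 J"
    proof (intro holomorphic_intros)
      fix z assume "z \<in> sector 0 J"
      then obtain w where w: "z = exp w" "Im w \<in> J" unfolding S by auto
      show "z * exp (- \<i> * of_real m) \<notin> \<real>\<^sub>\<le>\<^sub>0"
        unfolding w(1) ex using m[OF w(2)] by (intro exp_notin_nonpos_Reals) simp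
    qed
    fix z assume "z \<in> sector 0 J"
    then obtain w where w: "z = exp w" "Im w \<in> J" unfolding S by auto
    show "Ln (z * exp (- \<i> * of_real m)) + \<i> * of_real m = lg J z"
      unfolding w(1) ex lg_exp[OF J(1,3) w(2)] using m[OF w(2)] by (subst exp_notin_nonpos_Reals(2)) simp_all
  qed
  show "exp (lg J y) = y" if "y \<in> sector 0 J" for y
    using that lg_exp[OF J(1,3)] unfolding S by auto
  show "of_real s * y \<in> sector 0 J" "lg J (of_real s * y) = of_real (ln s) + lg J y"
    if s: "0 < s" and y: "y \<in> sector 0 J" for s y
  proof -
    obtain w where w: "y = exp w" "Im w \<in> J" using y unfolding S by auto
    have e: "of_real s * y = exp (of_real (ln s) + w)"
      using s by (simp add: w exp_add exp_of_real)
    show "of_real s * y \<in> sector 0 J" unfolding e S using w by (intro imageI) simp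
    show "lg J (of_real s * y) = of_real (ln s) + lg J y"
    proof -
      have "Im (of_real (ln s) + w) \<in> J" using w by simp
      from lg_exp[OF J(1,3) this] show ?thesis unfolding e by (simp only: w(1) lg_exp[OF J(1,3) w(2)])
    qed
  qed
  show "\<exists>C. \<forall>y\<in>sector 0 J. \<bar>Im (lg J y)\<bar> \<le> C"
  proof (intro exI[of _ "max \<bar>a\<bar> \<bar>b\<bar>"] ballI)
    fix y assume "y \<in> sector 0 J"
    then obtain w where w: "y = exp w" "Im w \<in> J" unfolding S by auto
    show "\<bar>Im (lg J y)\<bar> \<le> max \<bar>a\<bar> \<bar>b\<bar>" unfolding w(1) lg_exp[OF J(1,3) w(2)] using w(2) J by auto
  qed
qed

text \<open>Geometrically, adding 1 turns a point of the upper half-plane towards the positive axis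
  without crossing it.\<close>

lemma Im_Ln_one_plus_exp_pos:
  assumes "0 < Im v" "Im v < pi"
  shows "1 + exp v \<noteq> 0" "0 < Im (Ln (1 + exp v))" "Im (Ln (1 + exp v)) < Im v"
proof -
  have im: "0 < Im (1 + exp v)" using assms by (simp add: Im_exp sin_gt_zero)
  then show nz: "1 + exp v \<noteq> 0" by (metis less_irrefl zero_complex.sel(2))
  have 1: "0 < Im (Ln (1 + exp v)) \<and> Im (Ln (1 + exp v)) < pi"
    using im by (rule Im_Ln_pos_lt_imp)
  then show "0 < Im (Ln (1 + exp v))" by simp
  define x where "x = Ln (1 + exp v)"
  \<comment> \<open>After rotation by - Im v the summand exp v is real, so the sign of the imaginary
    part is that of the rotated 1.\<close>
  have "exp (x - \<i> * of_real (Im v)) = exp (- \<i> * of_real (Im v)) + exp v * exp (- \<i> * of_real (Im v))"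
    using nz by (simp add: x_def exp_diff exp_minus field_simps)
  also have "exp v * exp (- \<i> * of_real (Im v)) = exp (of_real (Re v))"
  proof -
    have "exp v * exp (- \<i> * of_real (Im v)) = exp (v - \<i> * of_real (Im v))"
      by (simp add: exp_diff exp_minus field_simps)
    also have "v - \<i> * of_real (Im v) = of_real (Re v)" by (simp add: complex_eq_iff)
    finally show ?thesis .
  qed
  finally have "Im (exp (x - \<i> * of_real (Im v))) = - sin (Im v)"
    by (simp add: Im_exp)
  then have "exp (Re x) * sin (Im x - Im v) = - sin (Im v)" by (simp add: Im_exp)
  moreover have "sin (Im v) > 0" using assms by (simp add: sin_gt_zero)
  ultimately have "exp (Re x) * sin (Im x - Im v) < 0" by simp
  then have neg: "sin (Im x - Im v) < 0" by (simp add: mult_less_0_iff)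
  show "Im (Ln (1 + exp v)) < Im v"
  proof (rule ccontr)
    assume "\<not> ?thesis"
    then have "0 \<le> Im x - Im v" "Im x - Im v < pi" using 1 assms by (auto simp: x_def)
    then have "0 \<le> sin (Im x - Im v)" by (intro sin_ge_zero) auto
    then show False using neg by simp
  qed
qed

lemma Im_Ln_one_plus_exp_neg:
  assumes "- pi < Im v" "Im v < 0"
  shows "1 + exp v \<noteq> 0" "Im v < Im (Ln (1 + exp v))" "Im (Ln (1 + exp v)) < 0"
proof -
  have c: "0 < Im (cnj v)" "Im (cnj v) < pi" using assms by auto
  note * = Im_Ln_one_plus_exp_pos[OF c]
  have e: "1 + exp (cnj v) = cnj (1 + exp v)" by (simp add: exp_cnj)
  show "1 + exp v \<noteq> 0" using *(1) unfolding e complex_cnj_zero_iff .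
  have "0 < sin (- Im v)" using assms by (intro sin_gt_zero) auto
  then have "Im (1 + exp v) < 0" by (simp add: Im_exp mult_less_0_iff)
  then have "1 + exp v \<notin> \<real>\<^sub>\<le>\<^sub>0" by (auto simp: complex_nonpos_Reals_iff)
  then have "Ln (1 + exp (cnj v)) = cnj (Ln (1 + exp v))" unfolding e by (simp add: cnj_Ln)
  then show "Im v < Im (Ln (1 + exp v))" "Im (Ln (1 + exp v)) < 0" using *(2,3) by auto
qed

text \<open>
  A sector with apex 0 that has the ray through \<open>exp \<omega>\<close> on its boundary and an opening of at
  most \<open>pi\<close>: it is mapped into itself by the translation by \<open>exp \<omega>\<close>.
\<close>

locale half_sector =
  fixes J :: "real set" and a b :: real and \<omega> :: complex
  assumes J: "J = {a<..<b}" and ab: "a < b" "b - a \<le> pi" and edge: "a = Im \<omega> \<or> b = Im \<omega>"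
begin

lemma len: "b - a \<le> 2 * pi"
  using ab by simp

lemma sector_eq: "sector 0 J = exp ` {w. Im w \<in> J}"
  by (simp add: sector_exp)

text \<open>The logarithm of a translated point in two forms: relative to w, suited to large exp w,
  and relative to \<omega>, suited to small exp w. The last claim says that the argument of zeta -
  t' after inversion stays in the interval prescribed for the underlying solutions.\<close>

lemma translate:
  assumes w: "Im w \<in> J"
  shows "1 + exp (w - \<omega>) \<noteq> 0" "1 + exp (\<omega> - w) \<noteq> 0"
    and "exp w + exp \<omega> = exp (w + Ln (1 + exp (\<omega> - w)))" "Im (w + Ln (1 + exp (\<omega> - w))) \<in> J"
    and "exp w + exp \<omega> = exp (\<omega> + Ln (1 + exp (w - \<omega>)))" "Im (\<omega> + Ln (1 + exp (w - \<omega>))) \<in> J"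
    and "Im w - pi - 2 * Im \<omega> - Im (Ln (1 + exp (w - \<omega>))) \<in> {- Im \<omega> - 2 * pi <..< - Im \<omega>}"
proof -
  have *: "1 + exp (w - \<omega>) \<noteq> 0 \<and> 1 + exp (\<omega> - w) \<noteq> 0 \<and> Im (w + Ln (1 + exp (\<omega> - w))) \<in> J
    \<and> Im (\<omega> + Ln (1 + exp (w - \<omega>))) \<in> J
    \<and> Im w - pi - 2 * Im \<omega> - Im (Ln (1 + exp (w - \<omega>))) \<in> {- Im \<omega> - 2 * pi <..< - Im \<omega>}"
    using edge
  proof
    assume e: "a = Im \<omega>"
    have 1: "0 < Im (w - \<omega>)" "Im (w - \<omega>) < pi" and 2: "- pi < Im (\<omega> - w)" "Im (\<omega> - w) < 0"
      using w e ab J by auto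
    note Im_Ln_one_plus_exp_pos[OF 1] Im_Ln_one_plus_exp_neg[OF 2]
    with 1 2 w e ab show ?thesis by (auto simp: J)
  next
    assume e: "b = Im \<omega>"
    have 1: "0 < Im (\<omega> - w)" "Im (\<omega> - w) < pi" and 2: "- pi < Im (w - \<omega>)" "Im (w - \<omega>) < 0"
      using w e ab J by auto
    note Im_Ln_one_plus_exp_pos[OF 1] Im_Ln_one_plus_exp_neg[OF 2]
    with 1 2 w e ab show ?thesis by (auto simp: J)
  qed
  then show "1 + exp (w - \<omega>) \<noteq> 0" "1 + exp (\<omega> - w) \<noteq> 0" "Im (w + Ln (1 + exp (\<omega> - w))) \<in> J"
    "Im (\<omega> + Ln (1 + exp (w - \<omega>))) \<in> J"
    "Im w - pi - 2 * Im \<omega> - Im (Ln (1 + exp (w - \<omega>))) \<in> {- Im \<omega> - 2 * pi <..< - Im \<omega>}" by auto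
  show "exp w + exp \<omega> = exp (w + Ln (1 + exp (\<omega> - w)))"
    using * by (simp add: exp_add exp_diff field_simps)
  show "exp w + exp \<omega> = exp (\<omega> + Ln (1 + exp (w - \<omega>)))"
    using * by (simp add: exp_add exp_diff field_simps)
qed

lemma translate_sector:
  assumes y: "y \<in> sector 0 J"
  shows "y + exp \<omega> \<in> sector 0 J"
    and "lg J (y + exp \<omega>) = lg J y + Ln (1 + exp \<omega> / y)"
    and "lg J (y + exp \<omega>) = \<omega> + Ln (1 + y / exp \<omega>)"
    and "lg {- Im \<omega> - 2 * pi <..< - Im \<omega>} (1 / (y + exp \<omega>) - 1 / exp \<omega>)
      = lg J y - \<i> * pi - 2 * \<omega> - Ln (1 + y / exp \<omega>)"
proof -
  obtain w where w: "y = exp w" "Im w \<in> J" using y unfolding sector_eq by auto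
  note t = translate[OF w(2)]
  have d: "exp \<omega> / y = exp (\<omega> - w)" "y / exp \<omega> = exp (w - \<omega>)" by (simp_all add: w exp_diff)
  show "y + exp \<omega> \<in> sector 0 J" unfolding w(1) t(3) sector_eq using t(4) by blast
  show "lg J (y + exp \<omega>) = lg J y + Ln (1 + exp \<omega> / y)"
    unfolding d unfolding w(1) t(3) lg_exp[OF J len t(4)] lg_exp[OF J len w(2)] ..
  show "lg J (y + exp \<omega>) = \<omega> + Ln (1 + y / exp \<omega>)"
    unfolding d unfolding w(1) t(5) lg_exp[OF J len t(6)] ..
  \<comment> \<open>The difference of the inverses is - y / (e (y + e)) with e = exp \<omega>. Its
    logarithm has the sign counted as - i pi, which is forced by the interval on the left, and
    \<omega> twice; the constants of the connection formula originate here.\<close>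
  define v where "v = w - \<i> * pi - 2 * \<omega> - Ln (1 + exp (w - \<omega>))"
  have v: "Im v \<in> {- Im \<omega> - 2 * pi <..< - Im \<omega>}" using t(7) by (simp add: v_def)
  have "exp v = - (exp w / (exp \<omega> * exp \<omega> * (1 + exp (w - \<omega>))))"
  proof -
    have 1: "exp (2 * \<omega>) = exp \<omega> * exp \<omega>" using exp_add[of \<omega> \<omega>] by (simp only: mult_2)
    have 2: "exp (\<i> * of_real pi) = -1" by (simp add: exp_pi_i')
    have "exp v = exp w / exp (\<i> * of_real pi) / exp (2 * \<omega>) / exp (Ln (1 + exp (w - \<omega>)))"
      unfolding v_def exp_diff[of "w - \<i> * of_real pi - 2 * \<omega>"] exp_diff[of "w - \<i> * of_real pi" "2 * \<omega>"]
        exp_diff[of w "\<i> * of_real pi"] ..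
    then show ?thesis unfolding 1 2 exp_Ln[OF t(1)] by simp
  qed
  also have "exp \<omega> * exp \<omega> * (1 + exp (w - \<omega>)) = exp \<omega> * (exp w + exp \<omega>)"
    by (simp add: exp_diff field_simps)
  also have "- (exp w / (exp \<omega> * (exp w + exp \<omega>))) = 1 / (exp w + exp \<omega>) - 1 / exp \<omega>"
  proof -
    have "exp w + exp \<omega> \<noteq> 0" unfolding t(3) by simp
    then show ?thesis by (simp add: field_simps)
  qed
  finally have "exp v = 1 / (y + exp \<omega>) - 1 / exp \<omega>" by (simp add: w)
  then have "lg {- Im \<omega> - 2 * pi <..< - Im \<omega>} (1 / (y + exp \<omega>) - 1 / exp \<omega>) = v"
    using lg_exp[OF refl _ v] by simp
  then show "lg {- Im \<omega> - 2 * pi <..< - Im \<omega>} (1 / (y + exp \<omega>) - 1 / exp \<omega>)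
      = lg J y - \<i> * pi - 2 * \<omega> - Ln (1 + y / exp \<omega>)"
    unfolding v_def w(1) lg_exp[OF J len w(2)] by (simp add: exp_diff)
qed

end

section \<open>Solutions of the underlying system after inversion\<close>

text \<open>By the Leibniz rule the equation expresses each derivative at x0 through lower ones, so
  all of them vanish there; the identity theorem on the connected set does the rest.\<close>

lemma linear_ode_zero:
  fixes U :: "nat \<Rightarrow> complex \<Rightarrow> complex" and R :: "nat \<Rightarrow> nat \<Rightarrow> complex \<Rightarrow> complex"
  assumes S: "open S" "connected S"
    and U: "\<And>i. i < N \<Longrightarrow> U i holomorphic_on S"
    and R: "\<And>i j. i < N \<Longrightarrow> j < N \<Longrightarrow> R i j holomorphic_on S"
    and ode: "\<And>i x. i < N \<Longrightarrow> x \<in> S \<Longrightarrow> deriv (U i) x = (\<Sum>j<N. R i j x * U j x)"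
    and x0: "x0 \<in> S" "\<And>i. i < N \<Longrightarrow> U i x0 = 0"
    and i: "i < N" and x: "x \<in> S"
  shows "U i x = 0"
proof -
  have "\<forall>i<N. (deriv ^^ k) (U i) x0 = 0" for k
  proof (induction k rule: less_induct)
    case (less k)
    show ?case
    proof (cases k)
      case 0
      then show ?thesis using x0 by simp
    next
      case (Suc k')
      show ?thesis
      proof (intro allI impI)
        fix i assume i: "i < N"
        have dist: "(deriv ^^ k') (\<lambda>x. \<Sum>j\<in>I. R i j x * U j x) x0 = (\<Sum>j\<in>I. (deriv ^^ k') (\<lambda>x. R i j x * U j x) x0)"
          if "finite I" "I \<subseteq> {..<N}" for I
          using that
        proof (induction I)
          case (insert j I)
          have "(deriv ^^ k') (\<lambda>x. R i j x * U j x + (\<Sum>j\<in>I. R i j x * U j x)) x0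
              = (deriv ^^ k') (\<lambda>x. R i j x * U j x) x0 + (deriv ^^ k') (\<lambda>x. \<Sum>j\<in>I. R i j x * U j x) x0"
          proof (rule higher_deriv_add[OF _ _ S(1) x0(1)])
            show "(\<lambda>x. R i j x * U j x) holomorphic_on S"
              using insert.prems i by (intro holomorphic_on_mult R U) auto
            show "(\<lambda>x. \<Sum>j\<in>I. R i j x * U j x) holomorphic_on S"
            proof (intro holomorphic_on_sum holomorphic_on_mult R U i)
            qed (use insert.prems in auto)
          qed
          then show ?case using insert by simp
        qed simp
        have "(deriv ^^ k) (U i) x0 = (deriv ^^ k') (deriv (U i)) x0" by (simp add: Suc funpow_swap1)
        also have "\<dots> = (deriv ^^ k') (\<lambda>x. \<Sum>j<N. R i j x * U j x) x0"
        proof (rule higher_deriv_transform_within_open[OF _ _ S(1) x0(1) ode[OF i]])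
          show "deriv (U i) holomorphic_on S" using U[OF i] S(1) by (rule holomorphic_deriv)
          show "(\<lambda>x. \<Sum>j<N. R i j x * U j x) holomorphic_on S"
            using i by (intro holomorphic_on_sum holomorphic_on_mult R U) auto
        qed
        also have "\<dots> = (\<Sum>j<N. (deriv ^^ k') (\<lambda>x. R i j x * U j x) x0)" by (rule dist) auto
        also have "\<dots> = 0"
        proof (rule sum.neutral, rule ballI)
          fix j assume j: "j \<in> {..<N}"
          have "(deriv ^^ k') (\<lambda>x. R i j x * U j x) x0 =
              (\<Sum>l = 0..k'. of_nat (k' choose l) * (deriv ^^ l) (R i j) x0 * (deriv ^^ (k' - l)) (U j) x0)"
            using j i by (intro higher_deriv_mult[OF R U S(1) x0(1)]) auto
          also have "\<dots> = 0"
            using j less.IH Suc by (intro sum.neutral) auto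
          finally show "(deriv ^^ k') (\<lambda>x. R i j x * U j x) x0 = 0" .
        qed
        finally show "(deriv ^^ k) (U i) x0 = 0" .
      qed
    qed
  qed
  then show ?thesis
    using holomorphic_fun_eq_0_on_connected[OF U[OF i] S _ x0(1) x] i by blast
qed

lemma powser_holomorphic_extension:
  fixes G :: "nat \<Rightarrow> complex"
  assumes "summable (\<lambda>m. G m * z0 ^ m)" "z0 \<noteq> 0"
  obtains H where "H holomorphic_on ball 0 (norm z0)" "H 0 = G 0"
    "\<And>z. norm z < norm z0 \<Longrightarrow> (\<lambda>m. G m * z ^ m) sums H z"
proof -
  have s: "(\<lambda>m. G m * z ^ m) sums (\<Sum>m. G m * z ^ m)" if "norm z < norm z0" for z
    using powser_inside[OF assms(1) that] by (rule summable_sums)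
  show ?thesis
  proof (rule that[of "\<lambda>z. \<Sum>m. G m * z ^ m"])
    show "(\<lambda>z. \<Sum>m. G m * z ^ m) holomorphic_on ball 0 (norm z0)"
      by (rule power_series_holomorphic[where a=G]) (use s in auto)
    show "(\<Sum>m. G m * 0 ^ m) = G 0" by (rule powser_zero)
  qed (use s in auto)
qed

section \<open>Expansions at infinity under translation, and from given series\<close>

context cone_branch
begin

text \<open>With z = 1 / y one has (y + e)^a = y^a exp (a Ln (1 + e z)) and 1 / (y + e) = z / (1 + e
  z). Both corrections are holomorphic near z = 0 and trivial there, so the leading coefficient does
  not change.\<close>

lemma two_exponents_translate:
  assumes f: "two_exponents a b f c"
    and TR: "\<And>y. y \<in> Q \<Longrightarrow> y + e \<in> Q" "\<And>y. y \<in> Q \<Longrightarrow> Lg (y + e) = Lg y + Ln (1 + e / y)"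
  shows "two_exponents a b (\<lambda>y. f (y + e)) c"
proof -
  obtain r \<phi> \<psi> where r: "r > 0" "\<phi> holomorphic_on ball 0 r" "\<psi> holomorphic_on ball 0 r" "\<phi> 0 = c"
    "\<And>y. y \<in> Q \<Longrightarrow> norm y > 1 / r \<Longrightarrow> f y = pw a y * \<phi> (1 / y) + pw b y * \<psi> (1 / y)"
    using f unfolding two_exponents_def by blast
  \<comment> \<open>The first bound keeps |e z| below 1/2 and so 1 + e z off the cut of
    \<open>Ln\<close>; with the second, z / (1 + e z) stays inside the original disc.\<close>
  define r' where "r' = min (1 / (2 * norm e + 1)) (r / 2)"
  have r': "r' > 0" using r(1) by (simp add: r'_def add_nonneg_pos)
  have small: "norm (e * z) < 1 / 2" if "norm z < r'" for z
  proof -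
    have "norm z < 1 / (2 * norm e + 1)" using that by (simp add: r'_def)
    moreover have "0 < 2 * norm e + 1" by (simp add: add_nonneg_pos)
    ultimately have "norm z * (2 * norm e + 1) < 1" by (simp only: pos_less_divide_eq)
    then have "2 * (norm e * norm z) + norm z < 1" by (simp add: algebra_simps)
    then have "2 * (norm e * norm z) < 1" using norm_ge_zero[of z] by linarith
    then show ?thesis by (simp add: norm_mult)
  qed
  have nn: "1 + e * z \<notin> \<real>\<^sub>\<le>\<^sub>0" if "norm z < r'" for z
  proof
    assume h: "1 + e * z \<in> \<real>\<^sub>\<le>\<^sub>0"
    have "- Re (e * z) \<le> norm (e * z)" using abs_Re_le_cmod[of "e * z"] by linarith
    then have "2 * - Re (e * z) < 1" using small[OF that] by simp
    moreover have "1 + Re (e * z) \<le> 0" using h by (simp add: complex_nonpos_Reals_iff)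
    ultimately show False by linarith
  qed
  have nz: "1 + e * z \<noteq> 0" if "norm z < r'" for z
    using nn[OF that] by auto
  have half: "norm (1 + e * z) \<ge> 1 / 2" if "norm z < r'" for z
  proof -
    have "1 \<le> norm (1 + e * z) + norm (e * z)" using norm_triangle_ineq4[of "1 + e * z" "e * z"] by simp
    then show ?thesis using small[OF that] by simp
  qed
  have inner: "norm (z / (1 + e * z)) < r" if z: "norm z < r'" for z
  proof -
    have "norm z < r / 2" using z by (simp add: r'_def)
    then have "norm z < r * (1 / 2)" by simp
    also have "\<dots> \<le> r * norm (1 + e * z)" using half[OF z] r(1) by (intro mult_left_mono) auto
    finally show ?thesis using nz[OF z] by (simp add: norm_divide divide_less_eq)
  qed
  have hol: "(\<lambda>z. exp (k * Ln (1 + e * z)) * g (z / (1 + e * z))) holomorphic_on ball 0 r'"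
    if g: "g holomorphic_on ball 0 r" for k g
  proof -
    have "(g \<circ> (\<lambda>z. z / (1 + e * z))) holomorphic_on ball 0 r'"
      using inner nz by (intro holomorphic_on_compose_gen[OF _ g] holomorphic_intros) auto
    then show ?thesis
      using nn by (intro holomorphic_intros) (auto simp: o_def)
  qed
  show ?thesis
  proof (rule two_exponentsI[OF r' hol[OF r(2)] hol[OF r(3)]])
    show "exp (a * Ln (1 + e * 0)) * \<phi> (0 / (1 + e * 0)) = c" using r(4) by simp
    fix y assume y: "y \<in> Q" "norm y > 1 / r'"
 have y0: "y \<noteq> 0" "y + e \<noteq> 0" using y(1) TR(1)[OF y(1)] zero_notin_Q by metis+
    have z: "norm (1 / y) < r'" using y(2) r' y0 by (simp add: norm_divide field_simps)
    have i: "1 / (y + e) = (1 / y) / (1 + e * (1 / y))" using y0 by (simp add: field_simps)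
    have "norm (1 / (y + e)) < r" unfolding i by (rule inner[OF z])
    then have "norm (y + e) > 1 / r" using r(1) y0 by (simp add: norm_divide field_simps)
    from r(5)[OF TR(1)[OF y(1)] this]
    have "f (y + e) = pw a (y + e) * \<phi> ((1 / y) / (1 + e * (1 / y))) + pw b (y + e) * \<psi> ((1 / y) / (1 + e * (1 / y)))"
      unfolding i .
    moreover have "pw k (y + e) = pw k y * exp (k * Ln (1 + e * (1 / y)))" for k
      unfolding pw_def TR(2)[OF y(1)] by (simp add: exp_add distrib_left)
    ultimately show "f (y + e) = pw a y * (exp (a * Ln (1 + e * (1 / y))) * \<phi> ((1 / y) / (1 + e * (1 / y))))
        + pw b y * (exp (b * Ln (1 + e * (1 / y))) * \<psi> ((1 / y) / (1 + e * (1 / y))))"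
      by (simp add: mult.assoc)
  qed
qed

text \<open>A series with a single exponent is read as a two-exponent expansion in either order, the
  other part being 0. This lets both families at infinity enter the same comparison of
  coefficients.\<close>

lemma two_exponents_of_sums:
  assumes s: "\<And>x. x \<in> Q \<Longrightarrow> norm x > R \<Longrightarrow> (\<lambda>m. pw a x * (G m * inverse x ^ m)) sums f x"
  shows "two_exponents a b f (G 0)" "two_exponents b a f 0"
proof -
  \<comment> \<open>The given bound \<open>R\<close> may be negative.\<close>
  define R' where "R' = max R 0 + 1"
  have "R' > 0" unfolding R'_def by (simp add: add_nonneg_pos)
  then obtain x0 where x0: "x0 \<in> Q" "norm x0 = R'" by (rule small_point)
  have x00: "x0 \<noteq> 0" using x0 zero_notin_Q by auto
  have "R < norm x0" using x0 by (simp add: R'_def)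
  then have "summable (\<lambda>m. pw a x0 * (G m * inverse x0 ^ m))" using s[OF x0(1)] by (simp add: sums_iff)
  then have "summable (\<lambda>m. G m * inverse x0 ^ m)" by (simp add: summable_mult_D)
  then obtain H where H: "H holomorphic_on ball 0 (norm (inverse x0))" "H 0 = G 0"
    "\<And>z. norm z < norm (inverse x0) \<Longrightarrow> (\<lambda>m. G m * z ^ m) sums H z"
    using powser_holomorphic_extension[of G "inverse x0"] x00 by auto
  have e: "f x = pw a x * H (1 / x)" if x: "x \<in> Q" "norm x > 1 / norm (inverse x0)" for x
  proof -
    have n: "norm x > norm x0" using x(2) x00 by (simp add: norm_divide inverse_eq_divide)
    then have "norm x > R" using x0(2) by (simp add: R'_def)
    moreover have "norm (inverse x) < norm (inverse x0)"
      using n x00 by (simp add: norm_inverse less_imp_inverse_less)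
    ultimately have "f x = pw a x * H (inverse x)"
      using sums_unique2[OF s[OF x(1)] sums_mult[OF H(3)]] by blast
    then show ?thesis by (simp add: inverse_eq_divide)
  qed
  have p: "norm (inverse x0) > 0" using x00 by simp
  show "two_exponents a b f (G 0)"
    by (rule two_exponentsI[OF p H(1) holomorphic_on_const[of 0]]) (use H(2) e in auto)
  show "two_exponents b a f 0"
    by (rule two_exponentsI[OF p holomorphic_on_const[of 0] H(1)]) (use e in auto)
qed

end

text \<open>Under zeta = \<eta> + 1 / x the factor zeta - t' becomes - (x - \<tau>) / (x \<tau>).
  The power x^(r1 - r2 - 1) changes the constant - (r2 + 1) of the transformed equation into - r1,
  and dividing by \<tau> makes the matrix act on \<tau> B, as \<open>first_order_rec\<close>
  requires.\<close>

lemma euler_kernel_ode: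
  fixes Lg :: "complex \<Rightarrow> complex" and w :: "nat \<Rightarrow> complex \<Rightarrow> complex" and \<tau> :: "nat \<Rightarrow> complex"
    and r1 r2 \<eta> :: complex
  assumes Lg: "Lg holomorphic_on X" "\<And>x. x \<in> X \<Longrightarrow> exp (Lg x) = x" and X: "open X"
    and D: "open D" "\<And>x. x \<in> X \<Longrightarrow> \<eta> + 1 / x \<in> D"
    and w: "\<And>\<nu>. \<nu> < n \<Longrightarrow> w \<nu> holomorphic_on D"
    and ode: "\<And>\<nu> \<zeta>. \<nu> < n \<Longrightarrow> \<zeta> \<in> D \<Longrightarrow>
      (\<zeta> - (\<eta> + 1 / \<tau> \<nu>)) * deriv (w \<nu>) \<zeta> = (- r2 - 1) * w \<nu> \<zeta> + mat_apply n a (\<lambda>\<mu>. w \<mu> \<zeta>) \<nu>"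
    and \<tau>: "\<And>\<nu>. \<nu> < n \<Longrightarrow> \<tau> \<nu> \<noteq> 0"
    and \<nu>: "\<nu> < n"
  defines "B \<equiv> \<lambda>\<nu> x. exp ((r1 - r2 - 1) * Lg x) * w \<nu> (\<eta> + 1 / x) / \<tau> \<nu>"
  shows "B \<nu> holomorphic_on X"
    and "\<And>x. x \<in> X \<Longrightarrow> x * (x - \<tau> \<nu>) * deriv (B \<nu>) x =
        (r1 - r2 - 1) * x * B \<nu> x - r1 * \<tau> \<nu> * B \<nu> x + mat_apply n a (\<lambda>\<mu>. \<tau> \<mu> * B \<mu> x) \<nu>"
proof -
  have x0: "x \<noteq> 0" if "x \<in> X" for x using Lg(2)[OF that] by auto
  have "(w \<nu> \<circ> (\<lambda>x. \<eta> + 1 / x)) holomorphic_on X"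
    using x0 D(2) by (intro holomorphic_on_compose_gen[OF _ w[OF \<nu>]] holomorphic_intros) auto
  then show "B \<nu> holomorphic_on X"
    unfolding B_def using \<tau>[OF \<nu>] Lg(1) by (intro holomorphic_intros) (auto simp: o_def)
  fix x assume x: "x \<in> X"
  define \<kappa> where "\<kappa> = r1 - r2 - 1"
  have dL: "(Lg has_field_derivative 1 / x) (at x)"
  proof -
    have L: "(Lg has_field_derivative deriv Lg x) (at x)"
      using Lg(1) X x by (rule holomorphic_derivI)
    have "((\<lambda>y. exp (Lg y)) has_field_derivative exp (Lg x) * deriv Lg x) (at x)"
      by (rule derivative_eq_intros L refl | simp)+
    moreover have "((\<lambda>y. exp (Lg y)) has_field_derivative 1) (at x)"
      by (rule has_field_derivative_transform_within_open[OF _ X x, of "\<lambda>y. y"]) (auto simp: Lg(2))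
    ultimately have "exp (Lg x) * deriv Lg x = 1" by (rule DERIV_unique)
    then have "deriv Lg x = 1 / x" using Lg(2)[OF x] x0[OF x] by (metis nonzero_mult_div_cancel_left)
    with L show ?thesis by simp
  qed
  have dw: "(w \<nu> has_field_derivative deriv (w \<nu>) (\<eta> + 1 / x)) (at (\<eta> + 1 / x))"
    using w[OF \<nu>] D(1) D(2)[OF x] by (rule holomorphic_derivI)
  have di: "((\<lambda>x. \<eta> + 1 / x) has_field_derivative - (1 / (x * x))) (at x)"
    by (rule derivative_eq_intros refl x0[OF x] | simp add: x0[OF x])+
  have dc: "((\<lambda>x. w \<nu> (\<eta> + 1 / x)) has_field_derivative deriv (w \<nu>) (\<eta> + 1 / x) * - (1 / (x * x))) (at x)"
    by (rule DERIV_chain2[OF dw di])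
  have de: "((\<lambda>x. exp (\<kappa> * Lg x)) has_field_derivative exp (\<kappa> * Lg x) * (\<kappa> / x)) (at x)"
    by (rule derivative_eq_intros dL refl | simp)+
  define E where "E = exp (\<kappa> * Lg x)"
  define W where "W = w \<nu> (\<eta> + 1 / x)"
  define W' where "W' = deriv (w \<nu>) (\<eta> + 1 / x)"
  have dd: "deriv (B \<nu>) x = (E * (\<kappa> / x) * W + W' * - (1 / (x * x)) * E) / \<tau> \<nu>"
    unfolding B_def \<kappa>_def[symmetric] E_def W_def W'_def
    using DERIV_cdivide[OF DERIV_mult[OF de dc], of "\<tau> \<nu>"] by (intro DERIV_imp_deriv)
  have d: "x * (x - \<tau> \<nu>) * deriv (B \<nu>) x = E * \<kappa> * (x - \<tau> \<nu>) / \<tau> \<nu> * W - E * ((x - \<tau> \<nu>) / (x * \<tau> \<nu>) * W')"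
    unfolding dd using x0[OF x] \<tau>[OF \<nu>] by (simp add: field_simps)
  have k: "(\<eta> + 1 / x - (\<eta> + 1 / \<tau> \<nu>)) = - ((x - \<tau> \<nu>) / (x * \<tau> \<nu>))"
    using x0[OF x] \<tau>[OF \<nu>] by (simp add: field_simps)
  have neg: "a * b = - c" if "- a * b = c" for a b c :: complex using that by auto
  have "(x - \<tau> \<nu>) / (x * \<tau> \<nu>) * W' = - ((- r2 - 1) * W + mat_apply n a (\<lambda>\<mu>. w \<mu> (\<eta> + 1 / x)) \<nu>)"
    using ode[OF \<nu> D(2)[OF x]] unfolding k W_def[symmetric] W'_def[symmetric] by (rule neg)
  then have o: "(x - \<tau> \<nu>) / (x * \<tau> \<nu>) * W' = (r2 + 1) * W - mat_apply n a (\<lambda>\<mu>. w \<mu> (\<eta> + 1 / x)) \<nu>"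
    by (simp add: algebra_simps)
  have m: "mat_apply n a (\<lambda>\<mu>. \<tau> \<mu> * B \<mu> x) \<nu> = E * mat_apply n a (\<lambda>\<mu>. w \<mu> (\<eta> + 1 / x)) \<nu>"
    unfolding mat_apply_cmult[symmetric] by (intro mat_apply_cong) (simp add: B_def E_def \<kappa>_def \<tau>)
  have b: "B \<nu> x = E * W / \<tau> \<nu>" by (simp add: B_def E_def \<kappa>_def W_def)
  show "x * (x - \<tau> \<nu>) * deriv (B \<nu>) x =
        (r1 - r2 - 1) * x * B \<nu> x - r1 * \<tau> \<nu> * B \<nu> x + mat_apply n a (\<lambda>\<mu>. \<tau> \<mu> * B \<mu> x) \<nu>"
    unfolding d o m b using \<tau>[OF \<nu>] by (simp add: \<kappa>_def field_simps)
qed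

context cone_branch
begin

text \<open>At infinity zeta tends to \<eta>, so the leading coefficient of the kernel is the value
  of w there; the translation by \<open>e\<close> contributes the factor exp (\<kappa> Ln (1 + e /
  y)), which tends to 1.\<close>

lemma kernel_limit:
  assumes TR: "\<And>y. y \<in> Q \<Longrightarrow> y + e \<in> Q" "\<And>y. y \<in> Q \<Longrightarrow> Lg (y + e) = Lg y + Ln (1 + e / y)"
    and w: "((\<lambda>x. w (\<eta> + 1 / x)) \<longlongrightarrow> w0) (inf at_infinity (principal Q))"
  shows "((\<lambda>y. exp (\<kappa> * Lg (y + e)) * w (\<eta> + 1 / (y + e)) / \<tau> * pw (- \<kappa>) y) \<longlongrightarrow> w0 / \<tau>)
    (inf at_infinity (principal Q))"
proof -
  let ?F = "inf at_infinity (principal Q)"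
  have "filterlim (\<lambda>y. y + e) at_infinity at_infinity"
    using tendsto_add_filterlim_at_infinity'[OF filterlim_ident tendsto_const] .
  then have "filterlim (\<lambda>y. y + e) at_infinity ?F"
    by (rule filterlim_mono) auto
  moreover have "filterlim (\<lambda>y. y + e) (principal Q) ?F"
    using TR(1) by (simp add: filterlim_principal eventually_inf_principal)
  ultimately have "filterlim (\<lambda>y. y + e) ?F ?F" by (simp add: filterlim_inf)
  then have 1: "((\<lambda>y. w (\<eta> + 1 / (y + e))) \<longlongrightarrow> w0) ?F"
    by (rule filterlim_compose[OF w])
  have "((\<lambda>y::complex. inverse y) \<longlongrightarrow> 0) ?F"
    by (rule tendsto_mono[OF inf_le1 tendsto_inverse_0])
  then have L: "((\<lambda>y. 1 + e * inverse y) \<longlongrightarrow> 1 + e * 0) ?F"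
    by (intro tendsto_add tendsto_mult tendsto_const)
  have "((\<lambda>y. exp (\<kappa> * Ln (1 + e * inverse y))) \<longlongrightarrow> exp (\<kappa> * Ln (1 + e * 0))) ?F"
    by (rule tendsto_exp[OF tendsto_mult[OF tendsto_const tendsto_Ln[OF L]]]) simp
  then have 2: "((\<lambda>y. exp (\<kappa> * Ln (1 + e / y))) \<longlongrightarrow> 1) ?F" by (simp add: divide_inverse)
  have "((\<lambda>y. exp (\<kappa> * Ln (1 + e / y)) * (w (\<eta> + 1 / (y + e)) / \<tau>)) \<longlongrightarrow> 1 * (w0 / \<tau>)) ?F"
    unfolding divide_inverse[of _ \<tau>] by (intro tendsto_mult 1 2 tendsto_const)
  from this[unfolded mult_1] show ?thesis
  proof (rule Lim_transform_eventually)
    show "\<forall>\<^sub>F y in ?F. exp (\<kappa> * Ln (1 + e / y)) * (w (\<eta> + 1 / (y + e)) / \<tau>) =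
      exp (\<kappa> * Lg (y + e)) * w (\<eta> + 1 / (y + e)) / \<tau> * pw (- \<kappa>) y"
      unfolding eventually_inf_principal
    proof (intro always_eventually allI impI)
      fix y assume y: "y \<in> Q"
      have "exp (\<kappa> * Lg (y + e)) * pw (- \<kappa>) y = exp (\<kappa> * Ln (1 + e / y))"
        unfolding TR(2)[OF y] pw_def by (simp add: distrib_left flip: exp_add)
      then show "exp (\<kappa> * Ln (1 + e / y)) * (w (\<eta> + 1 / (y + e)) / \<tau>) =
        exp (\<kappa> * Lg (y + e)) * w (\<eta> + 1 / (y + e)) / \<tau> * pw (- \<kappa>) y"
        by (metis (no_types, lifting) mult.assoc mult.commute times_divide_eq_right)
    qed
  qed
qed

end

text \<open>The inversion is a local coordinate change at the singular point, so the expansion of w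
  in zeta becomes one in y with the same exponent s. The constant in front is evaluated from the
  logarithms of \<open>translate_sector\<close> at y = 0.\<close>

lemma (in half_sector) kernel_frobenius_point:
  assumes w: "\<And>y. y \<in> sector 0 J \<Longrightarrow> norm (1 / (y + exp \<omega>) - 1 / exp \<omega>) < R \<Longrightarrow>
      (\<lambda>m. exp (s * lg {- Im \<omega> - 2 * pi <..< - Im \<omega>} (1 / (y + exp \<omega>) - 1 / exp \<omega>))
        * (h m * (1 / (y + exp \<omega>) - 1 / exp \<omega>) ^ m)) sums w (\<eta> + 1 / (y + exp \<omega>))"
    and R: "R > 0"
  shows "\<exists>g. cone_branch.frobenius (sector 0 J) (lg J) s g
      (\<lambda>y. exp (\<kappa> * lg J (y + exp \<omega>)) * w (\<eta> + 1 / (y + exp \<omega>)) / \<tau>)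
    \<and> g 0 = exp (\<kappa> * \<omega> - s * (\<i> * pi + 2 * \<omega>)) * h 0 / \<tau>"
proof -
  interpret cone_branch "sector 0 J" "lg J"
    using cone_branch_sector[OF J ab(1) len] .
  define e where "e = exp \<omega>"
  have e0: "e \<noteq> 0" by (simp add: e_def)
  \<comment> \<open>The coordinate zeta - t' as a function of y = x - t.\<close>
  define Z where "Z = (\<lambda>y. - y / (e * (y + e)))"
  have nn: "1 + y / e \<notin> \<real>\<^sub>\<le>\<^sub>0" "y + e \<noteq> 0" if "norm y < norm e" for y
  proof -
    have "norm (y / e) < 1" using that e0 by (simp add: norm_divide)
    then have "Re (1 + y / e) > 0" using abs_Re_le_cmod[of "y / e"] by auto
    then show "1 + y / e \<notin> \<real>\<^sub>\<le>\<^sub>0" by (auto simp: complex_nonpos_Reals_iff)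
    show "y + e \<noteq> 0"
    proof
      assume "y + e = 0"
      then have "y = - e" by (simp add: eq_neg_iff_add_eq_0)
      then show False using that by simp
    qed
  qed
  have Zeq: "1 / (y + e) - 1 / e = Z y" if "y + e \<noteq> 0" for y
    using that e0 by (simp add: Z_def field_simps)
  have Zcont: "isCont Z 0" unfolding Z_def using e0 by (intro continuous_intros) auto
  have Z0: "Z 0 = 0" by (simp add: Z_def)
  have small: "\<exists>d>0. \<forall>y. norm y < d \<longrightarrow> norm (Z y) < r" if "r > 0" for r
    using Zcont that unfolding continuous_at_eps_delta by (force simp: dist_norm Z0)
  obtain d where d: "d > 0" "\<And>y. norm y < d \<Longrightarrow> norm (Z y) < R" using small[OF R] by auto
  \<comment> \<open>Convergence is given only at images of sector points; one such point provides a
    full disc of convergence in the variable \<open>Z\<close>.\<close>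
  obtain y0 where y0: "y0 \<in> sector 0 J" "norm y0 = min d (norm e) / 2"
    using small_point[of "min d (norm e) / 2"] d e0 by auto
  have "0 < min d (norm e)" using d(1) e0 by simp
  moreover have "x / 2 < x" if "x > 0" for x :: real using that by simp
  ultimately have "norm y0 < min d (norm e)" unfolding y0(2) by blast
  then have y0': "norm y0 < d" "norm y0 < norm e" "y0 \<noteq> 0" using y0(1) zero_notin_Q by auto
  have "summable (\<lambda>m. exp (s * lg {- Im \<omega> - 2 * pi <..< - Im \<omega>} (Z y0)) * (h m * Z y0 ^ m))"
    using w[OF y0(1)] d(2)[OF y0'(1)] unfolding e_def[symmetric] Zeq[OF nn(2)[OF y0'(2)]] by (simp add: sums_iff)
  then have "summable (\<lambda>m. h m * Z y0 ^ m)" by (simp add: summable_mult_D)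
  moreover have Zy0: "Z y0 \<noteq> 0" using y0'(3) e0 nn(2)[OF y0'(2)] by (simp add: Z_def)
  ultimately obtain H where H: "H holomorphic_on ball 0 (norm (Z y0))" "H 0 = h 0"
    "\<And>z. norm z < norm (Z y0) \<Longrightarrow> (\<lambda>m. h m * z ^ m) sums H z"
    using powser_holomorphic_extension by blast
  obtain d' where d': "d' > 0" "\<And>y. norm y < d' \<Longrightarrow> norm (Z y) < norm (Z y0)"
    using small[of "norm (Z y0)"] Zy0 by auto
  define r where "r = min (min d d') (norm e)"
  have r: "r > 0" using d d' e0 by (simp add: r_def)
  define C where "C = exp (\<kappa> * \<omega> - s * (\<i> * pi + 2 * \<omega>))"
  \<comment> \<open>What is left after splitting off y^s: both logarithms have been expressed
    through \<open>lg J y\<close> and Ln (1 + y / e), and the latter is holomorphic at 0.\<close>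
  define \<phi> where "\<phi> = (\<lambda>y. C * exp ((\<kappa> - s) * Ln (1 + y / e)) * H (Z y) / \<tau>)"
  have "\<phi> holomorphic_on ball 0 r"
  proof -
    have "(H \<circ> Z) holomorphic_on ball 0 r"
      using d' nn(2) e0 unfolding Z_def
      by (intro holomorphic_on_compose_gen[OF _ H(1)] holomorphic_intros) (auto simp: r_def Z_def)
    then show ?thesis
      unfolding \<phi>_def divide_inverse[of _ \<tau>] using nn(1) e0 by (intro holomorphic_intros) (auto simp: r_def o_def)
  qed
  moreover have "exp (\<kappa> * lg J (y + e)) * w (\<eta> + 1 / (y + e)) / \<tau> = pw s y * \<phi> y"
    if y: "y \<in> sector 0 J" "norm y < r" for y
  proof -
    have n: "norm y < d" "norm y < d'" "norm y < norm e" using y by (auto simp: r_def)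
    note Zy = Zeq[OF nn(2)[OF n(3)]]
    note t = translate_sector[OF y(1), folded e_def]
    have "(\<lambda>m. exp (s * lg {- Im \<omega> - 2 * pi <..< - Im \<omega>} (Z y)) * (h m * Z y ^ m)) sums w (\<eta> + 1 / (y + e))"
      using w[OF y(1)] d(2)[OF n(1)] unfolding e_def[symmetric] Zy by simp
    from sums_unique2[OF this sums_mult[OF H(3)[OF d'(2)[OF n(2)]]]]
    have w': "w (\<eta> + 1 / (y + e)) = exp (s * (lg J y - \<i> * pi - 2 * \<omega> - Ln (1 + y / e))) * H (Z y)"
      using t(4) unfolding Zy by simp
    have "exp (\<kappa> * lg J (y + e)) * exp (s * (lg J y - \<i> * pi - 2 * \<omega> - Ln (1 + y / e)))
        = pw s y * (C * exp ((\<kappa> - s) * Ln (1 + y / e)))"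
      unfolding t(3) pw_def C_def exp_add[symmetric] by (rule arg_cong[where f=exp]) (simp add: algebra_simps)
    then show ?thesis unfolding w' \<phi>_def by (metis (no_types, lifting) mult.assoc times_divide_eq_right)
  qed
  ultimately have "frobenius s (\<lambda>m. (deriv ^^ m) \<phi> 0 / fact m)
      (\<lambda>y. exp (\<kappa> * lg J (y + e)) * w (\<eta> + 1 / (y + e)) / \<tau>)"
    by (rule frobenius_of_holomorphic[OF r])
  moreover have "\<phi> 0 = C * h 0 / \<tau>" by (simp add: \<phi>_def Z0 H(2))
  ultimately show ?thesis
    unfolding e_def[symmetric] C_def[symmetric]
    by (intro exI[of _ "\<lambda>m. (deriv ^^ m) \<phi> 0 / fact m"]) simp
qed

lemma lg_inverse:
  assumes J: "J = {a<..<b}" "b - a \<le> 2 * pi" and x: "x \<in> sector 0 J"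
  shows "1 / x \<in> sector 0 {- b <..< - a}" "lg {- b <..< - a} (1 / x) = - lg J x"
proof -
  obtain v where v: "x = exp v" "Im v \<in> J" using x unfolding sector_exp by auto
  have i: "1 / x = exp (- v)" by (simp add: v exp_minus inverse_eq_divide)
  have m: "Im (- v) \<in> {- b <..< - a}" using v J by auto
  show "1 / x \<in> sector 0 {- b <..< - a}" unfolding i sector_exp using m by auto
  show "lg {- b <..< - a} (1 / x) = - lg J x"
    unfolding i using lg_exp[OF refl _ m] lg_exp[OF J v(2)] J(2) by (simp add: v(1))
qed

text \<open>Inversion sends zeta = infinity to x = 0 and changes the sign of the logarithm, hence
  the exponent \<kappa> - s.\<close>

lemma (in cone_branch) kernel_frobenius_infinity:
  assumes w: "\<And>x. x \<in> Q \<Longrightarrow> norm (1 / x) > R \<Longrightarrow>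
      (\<lambda>m. exp (s * - Lg x) * (h m * inverse (1 / x) ^ m)) sums w (\<eta> + 1 / x)"
  shows "frobenius (\<kappa> - s) (\<lambda>m. h m / \<tau>) (\<lambda>x. exp (\<kappa> * Lg x) * w (\<eta> + 1 / x) / \<tau>)"
  unfolding frobenius_def
proof (intro exI[of _ "1 / (max R 0 + 1)"] conjI ballI impI)
  have p: "max R 0 + 1 > 0" by (simp add: add_nonneg_pos)
  then show "1 / (max R 0 + 1) > 0" by simp
  fix x assume x: "x \<in> Q" "norm x < 1 / (max R 0 + 1)"
  have x0: "norm x > 0" using x(1) zero_notin_Q by auto
  have "norm x * (max R 0 + 1) < 1" using x(2) p by (simp only: pos_less_divide_eq)
  then have "max R 0 + 1 < 1 / norm x" using x0 by (simp only: pos_less_divide_eq mult.commute)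
  then have "R < norm (1 / x)" by (simp add: norm_divide)
  from sums_divide[OF sums_mult[OF w[OF x(1) this], of "exp (\<kappa> * Lg x)"], of \<tau>]
  have S: "(\<lambda>m. exp (\<kappa> * Lg x) * (exp (s * - Lg x) * (h m * x ^ m)) / \<tau>) sums
      (exp (\<kappa> * Lg x) * w (\<eta> + 1 / x) / \<tau>)" by simp
  have E: "exp (\<kappa> * Lg x) * (exp (s * - Lg x) * (h m * x ^ m)) / \<tau> = pw (\<kappa> - s) x * (h m / \<tau> * x ^ m)" for m
  proof -
    have "exp (\<kappa> * Lg x) * exp (s * - Lg x) = pw (\<kappa> - s) x"
      unfolding pw_def by (simp add: left_diff_distrib flip: exp_add)
    then show ?thesis by (metis (no_types, lifting) mult.assoc times_divide_eq_left times_divide_eq_right)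
  qed
  show "(\<lambda>m. pw (\<kappa> - s) x * (h m / \<tau> * x ^ m)) sums (exp (\<kappa> * Lg x) * w (\<eta> + 1 / x) / \<tau>)"
    using S unfolding E .
qed

section \<open>Block matrices and bases of solutions\<close>

lemma sum_lessThan_add: "(\<Sum>i<m + n. f i) = (\<Sum>i<m. f i) + (\<Sum>i<n. f (m + i :: nat) :: complex)"
  by (induction n) (simp_all add: add.assoc)

abbreviation entry_apply :: "complex mat \<Rightarrow> (nat \<Rightarrow> complex) \<Rightarrow> nat \<Rightarrow> complex" where
  "entry_apply M \<equiv> mat_apply (dim_row M) (\<lambda>\<nu> \<mu>. M $$ (\<nu>, \<mu>))"

lemma mult_mat_vec_entry:
  assumes "M \<in> carrier_mat n k" "v \<in> carrier_vec k" "\<nu> < n"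
  shows "(M *\<^sub>v v) $ \<nu> = (\<Sum>\<mu><k. M $$ (\<nu>, \<mu>) * v $ \<mu>)"
  using assms by (auto simp: scalar_prod_def lessThan_atLeast0 intro!: sum.cong)

lemma entry_apply_mult:
  assumes M: "M \<in> carrier_mat n n" and N: "N \<in> carrier_mat n n" and \<nu>: "\<nu> < n"
  shows "entry_apply (M * N) f \<nu> = entry_apply M (entry_apply N f) \<nu>"
proof -
  have v: "vec n f \<in> carrier_vec n" by simp
  have e: "entry_apply X f \<mu> = (X *\<^sub>v vec n f) $ \<mu>" if "X \<in> carrier_mat n n" "\<mu> < n" for X \<mu>
    using that by (simp add: mult_mat_vec_entry[OF that(1) v that(2)] mat_apply_def)
  have "entry_apply (M * N) f \<nu> = ((M * N) *\<^sub>v vec n f) $ \<nu>"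
    using M N \<nu> by (intro e) auto
  also have "(M * N) *\<^sub>v vec n f = M *\<^sub>v (N *\<^sub>v vec n f)"
    by (rule assoc_mult_mat_vec[OF M N v])
  also have "(M *\<^sub>v (N *\<^sub>v vec n f)) $ \<nu> = (\<Sum>\<mu><n. M $$ (\<nu>, \<mu>) * (N *\<^sub>v vec n f) $ \<mu>)"
    using M N \<nu> by (intro mult_mat_vec_entry) auto
  also have "\<dots> = (\<Sum>\<mu><n. M $$ (\<nu>, \<mu>) * entry_apply N f \<mu>)"
    by (intro sum.cong refl arg_cong2[where f="(*)"]) (simp add: e[OF N])
  finally show ?thesis using M by (simp add: mat_apply_def)
qed

lemma entry_apply_one: "\<nu> < n \<Longrightarrow> entry_apply (1\<^sub>m n) f \<nu> = f \<nu>"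
proof -
  assume \<nu>: "\<nu> < n"
  have "(\<Sum>\<mu><n. 1\<^sub>m n $$ (\<nu>, \<mu>) * f \<mu>) = (\<Sum>\<mu>\<in>{\<nu>}. 1\<^sub>m n $$ (\<nu>, \<mu>) * f \<mu>)"
    using \<nu> by (intro sum.mono_neutral_right) auto
  then show ?thesis using \<nu> by (simp add: mat_apply_def)
qed

lemma offset_Suc: "i \<ge> 1 \<Longrightarrow> offset d (Suc i) = offset d i + d i"
  by (simp add: offset_def)

lemma offset_Suc_eq_sum: "offset d (Suc N) = (\<Sum>a = 1..N. d a)"
  by (simp add: offset_def atLeastLessThanSuc_atLeastAtMost)

lemma offset_mono: "i \<le> j \<Longrightarrow> offset d i \<le> offset d j"
  unfolding offset_def by (intro sum_mono2) auto

lemma offset_bound: "i \<in> {1..N} \<Longrightarrow> b < d i \<Longrightarrow> offset d i + b < (\<Sum>a = 1..N. d a)"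
  using offset_mono[of "Suc i" "Suc N" d] offset_Suc[of i d] by (simp add: offset_Suc_eq_sum)

lemma offset_decompose:
  assumes "\<nu> < (\<Sum>a = 1..N. d a)"
  obtains i b where "i \<in> {1..N}" "b < d i" "\<nu> = offset d i + b"
proof -
  have "\<exists>i\<in>{1..N}. \<exists>b<d i. \<nu> = offset d i + b" using assms
  proof (induction N)
    case (Suc N)
    show ?case
    proof (cases "\<nu> < (\<Sum>a = 1..N. d a)")
      case True
      then show ?thesis using Suc.IH by force
    next
      case False
      then have "\<nu> = offset d (Suc N) + (\<nu> - offset d (Suc N))" "\<nu> - offset d (Suc N) < d (Suc N)"
        using Suc.prems by (auto simp: offset_Suc_eq_sum)
      then show ?thesis by (intro bexI[of _ "Suc N"]) auto
    qed
  qed simp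
  then show ?thesis using that by blast
qed

lemma scalar_blocks_Suc:
  "scalar_blocks (Suc N) c d = (let A = scalar_blocks N c d; B = c (Suc N) \<cdot>\<^sub>m 1\<^sub>m (d (Suc N)) in
     four_block_mat A (0\<^sub>m (dim_row A) (dim_col B)) (0\<^sub>m (dim_row B) (dim_col A)) B)"
proof -
  have "[1..<Suc (Suc N)] = [1..<Suc N] @ [Suc N]" by simp
  then show ?thesis unfolding scalar_blocks_def by (simp only: map_append list.map diag_block_mat_last Let_def)
qed

lemma scalar_blocks_carrier:
  "scalar_blocks N c d \<in> carrier_mat (\<Sum>a = 1..N. d a) (\<Sum>a = 1..N. d a)"
proof (induction N)
  case 0
  then show ?case by (simp add: scalar_blocks_def)
next
  case (Suc N)
  then show ?case unfolding scalar_blocks_Suc Let_def by (intro carrier_matI) auto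
qed

lemma scalar_blocks_offdiag:
  "\<nu> < (\<Sum>a = 1..N. d a) \<Longrightarrow> \<mu> < (\<Sum>a = 1..N. d a) \<Longrightarrow> \<nu> \<noteq> \<mu> \<Longrightarrow> scalar_blocks N c d $$ (\<nu>, \<mu>) = 0"
proof (induction N)
  case (Suc N)
  then show ?case using scalar_blocks_carrier[of N c d] unfolding scalar_blocks_Suc Let_def by auto
qed simp

lemma scalar_blocks_diag:
  "i \<in> {1..N} \<Longrightarrow> b < d i \<Longrightarrow> scalar_blocks N c d $$ (offset d i + b, offset d i + b) = c i"
proof (induction N)
  case (Suc N)
  have S: "scalar_blocks N c d \<in> carrier_mat (\<Sum>a = 1..N. d a) (\<Sum>a = 1..N. d a)" by (rule scalar_blocks_carrier)
  show ?case
  proof (cases "i = Suc N")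
    case True
    then show ?thesis using Suc.prems S unfolding scalar_blocks_Suc Let_def by (auto simp: offset_Suc_eq_sum)
  next
    case False
    then have i: "i \<in> {1..N}" using Suc.prems by auto
    have "offset d i + b < (\<Sum>a = 1..N. d a)" by (rule offset_bound[where d=d, OF i Suc.prems(2)])
    then show ?thesis using Suc.IH[OF i Suc.prems(2)] S unfolding scalar_blocks_Suc Let_def by auto
  qed
qed simp

text \<open>The values of the \<open>F k\<close> at one point form an invertible matrix: a kernel
  vector would give a combination that vanishes at that point, hence identically by
  \<open>linear_ode_zero\<close>, against independence. Matching initial values then represents
  \<open>U\<close>.\<close>

lemma fundamental_combination:
  fixes F :: "nat \<Rightarrow> nat \<Rightarrow> complex \<Rightarrow> complex" and R :: "nat \<Rightarrow> nat \<Rightarrow> complex \<Rightarrow> complex"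
  assumes S: "open S" "connected S" "S \<noteq> {}"
    and R: "\<And>i j. i < N \<Longrightarrow> j < N \<Longrightarrow> R i j holomorphic_on S"
    and F: "\<And>k i. k < N \<Longrightarrow> i < N \<Longrightarrow> F k i holomorphic_on S"
    and odeF: "\<And>k i x. k < N \<Longrightarrow> i < N \<Longrightarrow> x \<in> S \<Longrightarrow> deriv (F k i) x = (\<Sum>j<N. R i j x * F k j x)"
    and U: "\<And>i. i < N \<Longrightarrow> U i holomorphic_on S"
    and odeU: "\<And>i x. i < N \<Longrightarrow> x \<in> S \<Longrightarrow> deriv (U i) x = (\<Sum>j<N. R i j x * U j x)"
    and indep: "\<And>v k. (\<And>i x. i < N \<Longrightarrow> x \<in> S \<Longrightarrow> (\<Sum>k<N. v k * F k i x) = 0) \<Longrightarrow> k < N \<Longrightarrow> v k = 0"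
  obtains C where "\<And>i x. i < N \<Longrightarrow> x \<in> S \<Longrightarrow> U i x = (\<Sum>k<N. C k * F k i x)"
proof -
  obtain x0 where x0: "x0 \<in> S" using S(3) by auto
  \<comment> \<open>The factor \<open>b\<close> is 0 for combinations of the \<open>F k\<close>
    alone and 1 for their comparison with \<open>U\<close>.\<close>
  have comb_hol: "(\<lambda>x. b * U i x - (\<Sum>k<N. v k * F k i x)) holomorphic_on S" if "i < N" for b v i
    using that by (intro holomorphic_intros U F) auto
  have comb_ode: "deriv (\<lambda>x. b * U i x - (\<Sum>k<N. v k * F k i x)) x
      = (\<Sum>j<N. R i j x * (b * U j x - (\<Sum>k<N. v k * F k j x)))" if i: "i < N" and x: "x \<in> S" for b v i x
  proof -
    have dU: "(U i has_field_derivative (\<Sum>j<N. R i j x * U j x)) (at x)"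
      using holomorphic_derivI[OF U[OF i] S(1) x] odeU[OF i x] by simp
    have dF: "(F k i has_field_derivative (\<Sum>j<N. R i j x * F k j x)) (at x)" if "k < N" for k
      using holomorphic_derivI[OF F[OF that i] S(1) x] odeF[OF that i x] by simp
    have "((\<lambda>x. b * U i x - (\<Sum>k<N. v k * F k i x)) has_field_derivative
        b * (\<Sum>j<N. R i j x * U j x) - (\<Sum>k<N. v k * (\<Sum>j<N. R i j x * F k j x))) (at x)"
      by (intro DERIV_diff DERIV_cmult DERIV_sum dU dF) auto
    moreover have "(\<Sum>k<N. v k * (\<Sum>j<N. R i j x * F k j x)) = (\<Sum>j<N. R i j x * (\<Sum>k<N. v k * F k j x))"
      unfolding sum_distrib_left by (subst sum.swap) (intro sum.cong refl, simp add: mult_ac)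
    ultimately show ?thesis
      by (simp add: DERIV_imp_deriv sum_distrib_left right_diff_distrib sum_subtractf mult_ac)
  qed
  have zero: "b * U i x - (\<Sum>k<N. v k * F k i x) = 0"
    if z: "\<And>i. i < N \<Longrightarrow> b * U i x0 - (\<Sum>k<N. v k * F k i x0) = 0" and i: "i < N" "x \<in> S" for b v i x
    using linear_ode_zero[where U="\<lambda>i x. b * U i x - (\<Sum>k<N. v k * F k i x)", OF S(1,2) comb_hol R comb_ode x0 z i]
    by simp
  define M where "M = mat N N (\<lambda>(i, k). F k i x0)"
  have M: "M \<in> carrier_mat N N" by (simp add: M_def)
  have Mv: "(M *\<^sub>v v) $ i = (\<Sum>k<N. v $ k * F k i x0)" if "v \<in> carrier_vec N" "i < N" for v i
    unfolding mult_mat_vec_entry[OF M that] using that(2) by (intro sum.cong) (auto simp: M_def)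
  have "det M \<noteq> 0"
  proof
    assume "det M = 0"
    then obtain v where v: "v \<in> carrier_vec N" "v \<noteq> 0\<^sub>v N" "M *\<^sub>v v = 0\<^sub>v N"
      using det_0_iff_vec_prod_zero[OF M] by auto
    have "(\<Sum>k<N. v $ k * F k i x) = 0" if "i < N" "x \<in> S" for i x
    proof -
      have "0 * U i x - (\<Sum>k<N. v $ k * F k i x) = 0"
        by (rule zero[OF _ that]) (use Mv[OF v(1)] v(3) in auto)
      then show ?thesis by simp
    qed
    then have "v $ k = 0" if "k < N" for k using indep[of "\<lambda>k. v $ k" k] that by auto
    then have "v = 0\<^sub>v N" using v(1) by (intro eq_vecI) auto
    then show False using v(2) by simp
  qed
  then obtain B where B: "B \<in> carrier_mat N N" "M * B = 1\<^sub>m N"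
    using det_non_zero_imp_unit[OF M, of "()"] unfolding Units_def ring_mat_def by auto
  define v where "v = B *\<^sub>v vec N (\<lambda>i. U i x0)"
  have v: "v \<in> carrier_vec N" using B by (simp add: v_def)
  have "M *\<^sub>v v = vec N (\<lambda>i. U i x0)"
    unfolding v_def using assoc_mult_mat_vec[OF M B(1), of "vec N (\<lambda>i. U i x0)"] B(2) by simp
  then have at: "U i x0 = (\<Sum>k<N. v $ k * F k i x0)" if "i < N" for i
    using Mv[OF v that] that by simp
  have "U i x = (\<Sum>k<N. v $ k * F k i x)" if "i < N" "x \<in> S" for i x
  proof -
    have "1 * U i x - (\<Sum>k<N. v $ k * F k i x) = 0"
      by (rule zero[OF _ that]) (simp add: at)
    then show ?thesis by simp
  qed
  then show ?thesis using that by blast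
qed

lemma okubo_solution_diagonal:
  assumes sol: "okubo_solution T A S U" and T: "T \<in> carrier_mat N N" and A: "A \<in> carrier_mat N N"
    and diag: "\<And>\<nu> \<mu>. \<nu> < N \<Longrightarrow> \<mu> < N \<Longrightarrow> \<nu> \<noteq> \<mu> \<Longrightarrow> T $$ (\<nu>, \<mu>) = 0"
  shows "\<And>x. x \<in> S \<Longrightarrow> U x \<in> carrier_vec N"
    and "\<And>\<nu>. \<nu> < N \<Longrightarrow> (\<lambda>x. U x $ \<nu>) holomorphic_on S"
    and "\<And>\<nu> x. \<nu> < N \<Longrightarrow> x \<in> S \<Longrightarrow>
      (x - T $$ (\<nu>, \<nu>)) * deriv (\<lambda>y. U y $ \<nu>) x = (\<Sum>\<mu><N. A $$ (\<nu>, \<mu>) * U x $ \<mu>)"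
proof -
  have dim: "dim_row A = N" using A by simp
  show c: "U x \<in> carrier_vec N" if "x \<in> S" for x
    using sol that by (simp add: okubo_solution_def Let_def dim)
  show "(\<lambda>x. U x $ \<nu>) holomorphic_on S" if "\<nu> < N" for \<nu>
    using sol that by (simp add: okubo_solution_def Let_def dim)
  fix \<nu> x assume \<nu>: "\<nu> < N" and x: "x \<in> S"
  have X: "x \<cdot>\<^sub>m 1\<^sub>m N - T \<in> carrier_mat N N" using T by auto
  let ?D = "vec N (\<lambda>\<nu>. deriv (\<lambda>y. U y $ \<nu>) x)"
  have "(x \<cdot>\<^sub>m 1\<^sub>m N - T) *\<^sub>v ?D = A *\<^sub>v U x"
    using sol x by (simp add: okubo_solution_def Let_def dim)
  then have "(\<Sum>\<mu><N. (x \<cdot>\<^sub>m 1\<^sub>m N - T) $$ (\<nu>, \<mu>) * ?D $ \<mu>) = (\<Sum>\<mu><N. A $$ (\<nu>, \<mu>) * U x $ \<mu>)"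
    using mult_mat_vec_entry[OF X, of ?D \<nu>] mult_mat_vec_entry[OF A c[OF x] \<nu>] \<nu> by simp
  moreover have "(\<Sum>\<mu><N. (x \<cdot>\<^sub>m 1\<^sub>m N - T) $$ (\<nu>, \<mu>) * ?D $ \<mu>) = (\<Sum>\<mu>\<in>{\<nu>}. (x \<cdot>\<^sub>m 1\<^sub>m N - T) $$ (\<nu>, \<mu>) * ?D $ \<mu>)"
    using \<nu> T diag by (intro sum.mono_neutral_right) auto
  ultimately show "(x - T $$ (\<nu>, \<nu>)) * deriv (\<lambda>y. U y $ \<nu>) x = (\<Sum>\<mu><N. A $$ (\<nu>, \<mu>) * U x $ \<mu>)"
    using \<nu> T by simp
qed

section \<open>The system of rank 2n\<close>

lemma (in cone_branch) two_exponents_cong: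
  assumes "\<And>y. y \<in> Q \<Longrightarrow> f y = g y" "two_exponents a b f c"
  shows "two_exponents a b g c"
  using assms unfolding two_exponents_def by metis

text \<open>
  The \<open>2n\<close>-dimensional system on a sector with apex \<open>c = t (p + 1)\<close>. The lower half \<open>u\<^sub>2\<close> of a
  solution enters only through \<open>V = P u\<^sub>2\<close>, which turns \<open>A'\<close> into \<open>A\<close>.
\<close>

locale okubo_sector =
  fixes n :: nat and A P Pinv A' T :: "complex mat" and \<rho> :: "nat \<Rightarrow> complex" and c :: complex
    and J :: "real set" and a b :: real
  assumes carriers: "A \<in> carrier_mat n n" "P \<in> carrier_mat n n" "Pinv \<in> carrier_mat n n"
      "A' \<in> carrier_mat n n" "T \<in> carrier_mat n n"
    and inverse_P: "P * Pinv = 1\<^sub>m n" "Pinv * P = 1\<^sub>m n" and diag_A: "Pinv * A * P = A'"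
    and diag_T: "\<And>\<nu> \<mu>. \<nu> < n \<Longrightarrow> \<mu> < n \<Longrightarrow> \<nu> \<noteq> \<mu> \<Longrightarrow> T $$ (\<nu>, \<mu>) = 0"
    and J: "J = {a<..<b}" "a < b" "b - a \<le> 2 * pi"
    and T_notin: "\<And>\<nu>. \<nu> < n \<Longrightarrow> T $$ (\<nu>, \<nu>) \<notin> sector c J"
    and rho_nonint: "\<And>j. j \<in> {1, 2} \<Longrightarrow> \<rho> j \<notin> \<int>" "\<rho> 1 - \<rho> 2 \<notin> \<int>"
begin

abbreviation S :: "complex set" where "S \<equiv> sector c J"

definition TT :: "complex mat" where
  "TT = four_block_mat T (0\<^sub>m n n) (0\<^sub>m n n) (c \<cdot>\<^sub>m 1\<^sub>m n)"

definition AA :: "complex mat" where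
  "AA = four_block_mat A P
     (- ((A' - \<rho> 1 \<cdot>\<^sub>m 1\<^sub>m n) * (A' - \<rho> 2 \<cdot>\<^sub>m 1\<^sub>m n) * Pinv))
     ((\<rho> 1 + \<rho> 2) \<cdot>\<^sub>m 1\<^sub>m n - A')"

sublocale cone_branch "sector 0 J" "lg J"
  by (rule cone_branch_sector[OF J])

lemma sector_shift: "x \<in> sector 0 J \<longleftrightarrow> c + x \<in> S"
  by (auto simp: sector_exp)

lemma open_S: "open S" and connected_S: "connected S" and S_nonempty: "S \<noteq> {}"
proof -
  show "open S" using J by (intro open_sector) auto
  show "connected S" unfolding J(1) by (rule connected_sector)
  show "S \<noteq> {}" using Q_nonempty sector_shift by blast
qed

lemma c_notin: "c \<notin> S"
  by (simp add: sector_def)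

lemma TT_carrier: "TT \<in> carrier_mat (2 * n) (2 * n)"
  unfolding TT_def using carriers by (intro carrier_matI) auto

lemma AA_carrier: "AA \<in> carrier_mat (2 * n) (2 * n)"
  unfolding AA_def using carriers by (intro carrier_matI) auto

lemma TT_offdiag: "\<nu> < 2 * n \<Longrightarrow> \<mu> < 2 * n \<Longrightarrow> \<nu> \<noteq> \<mu> \<Longrightarrow> TT $$ (\<nu>, \<mu>) = 0"
  unfolding TT_def using carriers diag_T by auto

lemma TT_diag: "\<nu> < n \<Longrightarrow> TT $$ (\<nu>, \<nu>) = T $$ (\<nu>, \<nu>)" "\<nu> < n \<Longrightarrow> TT $$ (n + \<nu>, n + \<nu>) = c"
  unfolding TT_def using carriers by auto

lemma TT_notin: "\<nu> < 2 * n \<Longrightarrow> TT $$ (\<nu>, \<nu>) \<notin> S"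
  using T_notin c_notin TT_diag(1)[of \<nu>] TT_diag(2)[of "\<nu> - n"] by (cases "\<nu> < n") auto

lemma solution_facts:
  assumes "okubo_solution TT AA S U"
  shows "\<And>\<nu>. \<nu> < 2 * n \<Longrightarrow> (\<lambda>x. U x $ \<nu>) holomorphic_on S"
    and "\<And>\<nu> x. \<nu> < 2 * n \<Longrightarrow> x \<in> S \<Longrightarrow>
      (x - TT $$ (\<nu>, \<nu>)) * deriv (\<lambda>y. U y $ \<nu>) x = (\<Sum>\<mu><2 * n. AA $$ (\<nu>, \<mu>) * U x $ \<mu>)"
  using okubo_solution_diagonal(2,3)[OF assms TT_carrier AA_carrier TT_offdiag] by auto

definition lower :: "(complex \<Rightarrow> complex vec) \<Rightarrow> nat \<Rightarrow> complex \<Rightarrow> complex" where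
  "lower U \<nu> x = (\<Sum>\<mu><n. P $$ (\<nu>, \<mu>) * U x $ (n + \<mu>))"

abbreviation apply_A :: "(nat \<Rightarrow> complex) \<Rightarrow> nat \<Rightarrow> complex" where
  "apply_A \<equiv> mat_apply n (\<lambda>\<nu> \<mu>. A $$ (\<nu>, \<mu>))"

lemma entry_apply_A: "entry_apply A = apply_A"
  using carriers(1) by auto

lemma P_A': "P * A' = A * P"
proof -
  have "P * A' = P * (Pinv * (A * P))" using diag_A carriers by (simp add: assoc_mult_mat[of _ n n _ n _ n])
  also have "\<dots> = (P * Pinv) * (A * P)" using carriers by (simp add: assoc_mult_mat[of _ n n _ n _ n])
  finally show ?thesis using carriers inverse_P by simp
qed

lemma entry_apply_minus_scalar:
  assumes "M \<in> carrier_mat n n" "\<nu> < n"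
  shows "entry_apply (M - r \<cdot>\<^sub>m 1\<^sub>m n) f \<nu> = entry_apply M f \<nu> - r * f \<nu>"
proof -
  have "entry_apply (M - r \<cdot>\<^sub>m 1\<^sub>m n) f \<nu> = (\<Sum>\<mu><n. M $$ (\<nu>, \<mu>) * f \<mu> - r * (1\<^sub>m n $$ (\<nu>, \<mu>) * f \<mu>))"
    unfolding mat_apply_def using assms by (intro sum.cong) (auto simp: left_diff_distrib)
  also have "\<dots> = entry_apply M f \<nu> - r * entry_apply (1\<^sub>m n) f \<nu>"
    using assms by (simp add: mat_apply_def sum_subtractf sum_distrib_left)
  finally show ?thesis by (simp only: entry_apply_one[OF assms(2)])
qed

lemma conjugated_factor:
  assumes "\<nu> < n"
  shows "entry_apply P (entry_apply (A' - r \<cdot>\<^sub>m 1\<^sub>m n) f) \<nu>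
    = apply_A (entry_apply P f) \<nu> - r * entry_apply P f \<nu>"
proof -
  have d: "dim_row P = n" using carriers by simp
  have "entry_apply P (entry_apply (A' - r \<cdot>\<^sub>m 1\<^sub>m n) f) \<nu> = entry_apply P (\<lambda>\<mu>. entry_apply A' f \<mu> - r * f \<mu>) \<nu>"
    using carriers(4) by (intro mat_apply_cong entry_apply_minus_scalar) (auto simp: d)
  also have "\<dots> = entry_apply P (entry_apply A' f) \<nu> - r * entry_apply P f \<nu>"
    by (simp add: mat_apply_diff mat_apply_cmult)
  also have "entry_apply P (entry_apply A' f) \<nu> = entry_apply A (entry_apply P f) \<nu>"
    unfolding entry_apply_mult[OF carriers(2,4) assms, symmetric] P_A'
    by (rule entry_apply_mult[OF carriers(1,2) assms])
  finally show ?thesis unfolding entry_apply_A .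
qed

text \<open>Since P A' = A P, conjugation by P turns the product in the lower left block into (A -
  r) (A - s).\<close>

lemma conjugated_product:
  assumes \<nu>: "\<nu> < n"
  shows "entry_apply P (entry_apply ((A' - r \<cdot>\<^sub>m 1\<^sub>m n) * (A' - s \<cdot>\<^sub>m 1\<^sub>m n) * Pinv) f) \<nu>
    = apply_A (apply_A f) \<nu> - (r + s) * apply_A f \<nu> + r * s * f \<nu>"
proof -
  have d: "dim_row P = n" using carriers by simp
  have M: "A' - x \<cdot>\<^sub>m 1\<^sub>m n \<in> carrier_mat n n" for x using carriers by auto
  have g: "entry_apply P (entry_apply Pinv f) \<mu> = f \<mu>" if "\<mu> < n" for \<mu>
    using entry_apply_mult[OF carriers(2,3) that, of f] inverse_P(1) entry_apply_one[OF that, of f] by simp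
  have i: "entry_apply P (entry_apply (A' - s \<cdot>\<^sub>m 1\<^sub>m n) (entry_apply Pinv f)) \<mu> = apply_A f \<mu> - s * f \<mu>" if "\<mu> < n" for \<mu>
    unfolding conjugated_factor[OF that] g[OF that] by (intro arg_cong2[where f="(-)"] mat_apply_cong g refl)
  have "entry_apply P (entry_apply ((A' - r \<cdot>\<^sub>m 1\<^sub>m n) * (A' - s \<cdot>\<^sub>m 1\<^sub>m n) * Pinv) f) \<nu>
    = entry_apply P (entry_apply (A' - r \<cdot>\<^sub>m 1\<^sub>m n) (entry_apply (A' - s \<cdot>\<^sub>m 1\<^sub>m n) (entry_apply Pinv f))) \<nu>"
  proof (rule mat_apply_cong)
    fix \<mu> assume "\<mu> < dim_row P"
    then have \<mu>: "\<mu> < n" by (simp add: d)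
    have "entry_apply ((A' - r \<cdot>\<^sub>m 1\<^sub>m n) * (A' - s \<cdot>\<^sub>m 1\<^sub>m n) * Pinv) f \<mu>
        = entry_apply ((A' - r \<cdot>\<^sub>m 1\<^sub>m n) * (A' - s \<cdot>\<^sub>m 1\<^sub>m n)) (entry_apply Pinv f) \<mu>"
      by (rule entry_apply_mult[OF mult_carrier_mat[OF M M] carriers(3) \<mu>])
    also have "\<dots> = entry_apply (A' - r \<cdot>\<^sub>m 1\<^sub>m n) (entry_apply (A' - s \<cdot>\<^sub>m 1\<^sub>m n) (entry_apply Pinv f)) \<mu>"
      by (rule entry_apply_mult[OF M M \<mu>])
    finally show "entry_apply ((A' - r \<cdot>\<^sub>m 1\<^sub>m n) * (A' - s \<cdot>\<^sub>m 1\<^sub>m n) * Pinv) f \<mu> = \<dots>" .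
  qed
  also have "\<dots> = apply_A (\<lambda>\<mu>. apply_A f \<mu> - s * f \<mu>) \<nu> - r * (apply_A f \<nu> - s * f \<nu>)"
  proof -
    have "apply_A (entry_apply P (entry_apply (A' - s \<cdot>\<^sub>m 1\<^sub>m n) (entry_apply Pinv f))) \<nu>
        = apply_A (\<lambda>\<mu>. apply_A f \<mu> - s * f \<mu>) \<nu>"
      by (intro mat_apply_cong i)
    then show ?thesis
      using conjugated_factor[OF \<nu>, of r "entry_apply (A' - s \<cdot>\<^sub>m 1\<^sub>m n) (entry_apply Pinv f)"] i[OF \<nu>] by simp
  qed
  also have "\<dots> = apply_A (apply_A f) \<nu> - (r + s) * apply_A f \<nu> + r * s * f \<nu>"
    by (simp add: mat_apply_diff mat_apply_cmult algebra_simps)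
  finally show ?thesis .
qed

lemma reduced_system:
  assumes sol: "okubo_solution TT AA S U" and \<nu>: "\<nu> < n" and x: "x \<in> S"
  shows "(x - T $$ (\<nu>, \<nu>)) * deriv (\<lambda>y. U y $ \<nu>) x = apply_A (\<lambda>\<mu>. U x $ \<mu>) \<nu> + lower U \<nu> x"
    and "(x - c) * deriv (lower U \<nu>) x = - apply_A (apply_A (\<lambda>\<mu>. U x $ \<mu>)) \<nu>
        + (\<rho> 1 + \<rho> 2) * apply_A (\<lambda>\<mu>. U x $ \<mu>) \<nu> - \<rho> 1 * \<rho> 2 * U x $ \<nu>
        + (\<rho> 1 + \<rho> 2) * lower U \<nu> x - apply_A (\<lambda>\<mu>. lower U \<mu> x) \<nu>"
proof -
  note f = solution_facts[OF sol]
  have two: "2 * n = n + n" by simp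
  have "(x - T $$ (\<nu>, \<nu>)) * deriv (\<lambda>y. U y $ \<nu>) x = (\<Sum>\<mu><2 * n. AA $$ (\<nu>, \<mu>) * U x $ \<mu>)"
    using f(2)[of \<nu> x] \<nu> x TT_diag(1)[OF \<nu>] by simp
  also have "\<dots> = (\<Sum>\<mu><n. AA $$ (\<nu>, \<mu>) * U x $ \<mu>) + (\<Sum>\<mu><n. AA $$ (\<nu>, n + \<mu>) * U x $ (n + \<mu>))"
    unfolding two sum_lessThan_add ..
  also have "(\<Sum>\<mu><n. AA $$ (\<nu>, \<mu>) * U x $ \<mu>) = apply_A (\<lambda>\<mu>. U x $ \<mu>) \<nu>"
    unfolding mat_apply_def using carriers \<nu> by (intro sum.cong refl) (auto simp: AA_def)
  also have "(\<Sum>\<mu><n. AA $$ (\<nu>, n + \<mu>) * U x $ (n + \<mu>)) = lower U \<nu> x"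
    unfolding lower_def using carriers \<nu> by (intro sum.cong refl) (auto simp: AA_def)
  finally show "(x - T $$ (\<nu>, \<nu>)) * deriv (\<lambda>y. U y $ \<nu>) x = apply_A (\<lambda>\<mu>. U x $ \<mu>) \<nu> + lower U \<nu> x" .

  define K where "K = (A' - \<rho> 1 \<cdot>\<^sub>m 1\<^sub>m n) * (A' - \<rho> 2 \<cdot>\<^sub>m 1\<^sub>m n) * Pinv"
  have K: "K \<in> carrier_mat n n" unfolding K_def using carriers by (intro mult_carrier_mat) auto
  let ?u = "\<lambda>\<mu>. U x $ \<mu>" and ?v = "\<lambda>\<mu>. U x $ (n + \<mu>)"
  have low: "(x - c) * deriv (\<lambda>y. U y $ (n + \<mu>)) x = - entry_apply K ?u \<mu> + (\<rho> 1 + \<rho> 2) * ?v \<mu> - entry_apply A' ?v \<mu>"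
    if \<mu>: "\<mu> < n" for \<mu>
  proof -
    have "(x - c) * deriv (\<lambda>y. U y $ (n + \<mu>)) x = (\<Sum>k<2 * n. AA $$ (n + \<mu>, k) * U x $ k)"
      using f(2)[of "n + \<mu>" x] \<mu> x TT_diag(2)[OF \<mu>] by simp
    also have "\<dots> = (\<Sum>k<n. AA $$ (n + \<mu>, k) * ?u k) + (\<Sum>k<n. AA $$ (n + \<mu>, n + k) * ?v k)"
      unfolding two sum_lessThan_add ..
    also have "(\<Sum>k<n. AA $$ (n + \<mu>, k) * ?u k) = (\<Sum>k<n. - (K $$ (\<mu>, k) * ?u k))"
      unfolding AA_def K_def[symmetric] using carriers K \<mu> by (intro sum.cong refl) auto
    also have "\<dots> = - entry_apply K ?u \<mu>"
      using K by (simp add: mat_apply_def sum_negf)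
    also have "(\<Sum>k<n. AA $$ (n + \<mu>, n + k) * ?v k)
        = (\<Sum>k<n. (\<rho> 1 + \<rho> 2) * (1\<^sub>m n $$ (\<mu>, k) * ?v k) - A' $$ (\<mu>, k) * ?v k)"
      unfolding AA_def using carriers \<mu> by (intro sum.cong refl) (auto simp: left_diff_distrib)
    also have "\<dots> = (\<rho> 1 + \<rho> 2) * entry_apply (1\<^sub>m n) ?v \<mu> - entry_apply A' ?v \<mu>"
      using carriers by (simp add: mat_apply_def sum_subtractf sum_distrib_left)
    also have "entry_apply (1\<^sub>m n) ?v \<mu> = ?v \<mu>" by (rule entry_apply_one[OF \<mu>])
    finally show ?thesis by (simp add: algebra_simps)
  qed
  have dU: "((\<lambda>y. U y $ k) has_field_derivative deriv (\<lambda>y. U y $ k) x) (at x)" if "k < 2 * n" for k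
    using f(1)[OF that] open_S x by (rule holomorphic_derivI)
  have "(lower U \<nu> has_field_derivative (\<Sum>\<mu><n. P $$ (\<nu>, \<mu>) * deriv (\<lambda>y. U y $ (n + \<mu>)) x)) (at x)"
    unfolding lower_def[abs_def] by (intro DERIV_sum DERIV_cmult dU) auto
  then have "(x - c) * deriv (lower U \<nu>) x = (\<Sum>\<mu><n. P $$ (\<nu>, \<mu>) * ((x - c) * deriv (\<lambda>y. U y $ (n + \<mu>)) x))"
    by (simp add: DERIV_imp_deriv sum_distrib_left mult_ac)
  also have "\<dots> = (\<Sum>\<mu><n. P $$ (\<nu>, \<mu>) * (- entry_apply K ?u \<mu> + (\<rho> 1 + \<rho> 2) * ?v \<mu> - entry_apply A' ?v \<mu>))"
    by (intro sum.cong refl arg_cong2[where f="(*)"] low) auto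
  also have "\<dots> = - entry_apply P (entry_apply K ?u) \<nu> + (\<rho> 1 + \<rho> 2) * entry_apply P ?v \<nu> - entry_apply P (entry_apply A' ?v) \<nu>"
    using carriers by (simp add: mat_apply_def sum_subtractf sum.distrib sum_distrib_left sum_negf algebra_simps)
  also have "entry_apply P (entry_apply A' ?v) \<nu> = apply_A (\<lambda>\<mu>. lower U \<mu> x) \<nu>"
  proof -
    have "entry_apply P (entry_apply A' ?v) \<nu> = entry_apply A (entry_apply P ?v) \<nu>"
      unfolding entry_apply_mult[OF carriers(2,4) \<nu>, symmetric] P_A'
      by (rule entry_apply_mult[OF carriers(1,2) \<nu>])
    also have "\<dots> = apply_A (\<lambda>\<mu>. lower U \<mu> x) \<nu>"
      unfolding entry_apply_A using carriers by (intro mat_apply_cong) (simp add: lower_def mat_apply_def)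
    finally show ?thesis .
  qed
  also have "entry_apply P (entry_apply K ?u) \<nu> = apply_A (apply_A ?u) \<nu> - (\<rho> 1 + \<rho> 2) * apply_A ?u \<nu> + \<rho> 1 * \<rho> 2 * ?u \<nu>"
    unfolding K_def by (rule conjugated_product[OF \<nu>])
  also have "entry_apply P ?v \<nu> = lower U \<nu> x"
    using carriers by (simp add: lower_def mat_apply_def)
  finally show "(x - c) * deriv (lower U \<nu>) x = - apply_A (apply_A ?u) \<nu>
        + (\<rho> 1 + \<rho> 2) * apply_A ?u \<nu> - \<rho> 1 * \<rho> 2 * U x $ \<nu>
        + (\<rho> 1 + \<rho> 2) * lower U \<nu> x - apply_A (\<lambda>\<mu>. lower U \<mu> x) \<nu>"
    by simp
qed

text \<open>Only the upper half of the leading vector enters, that is, a column of P.\<close>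

lemma infinity_two_exponents:
  assumes ex: "expands_at_infinity c J r ((P *\<^sub>v unit_vec n h) @\<^sub>v v') S U" and v': "v' \<in> carrier_vec n"
    and h: "h < n" and \<nu>: "\<nu> < n"
  shows "two_exponents r s (\<lambda>x. U (c + x) $ \<nu>) (P $$ (\<nu>, h))"
    and "two_exponents s r (\<lambda>x. U (c + x) $ \<nu>) 0"
proof -
  let ?v = "(P *\<^sub>v unit_vec n h) @\<^sub>v v'"
  have dim: "dim_vec ?v = 2 * n" using carriers v' by simp
  have "?v $ \<nu> = (P *\<^sub>v unit_vec n h) $ \<nu>" using carriers \<nu> by simp
  also have "\<dots> = (\<Sum>\<mu><n. P $$ (\<nu>, \<mu>) * unit_vec n h $ \<mu>)"
    by (rule mult_mat_vec_entry[OF carriers(2) _ \<nu>]) simp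
  also have "\<dots> = (\<Sum>\<mu>\<in>{h}. P $$ (\<nu>, \<mu>) * unit_vec n h $ \<mu>)"
    using h by (intro sum.mono_neutral_right) auto
  finally have v\<nu>: "?v $ \<nu> = P $$ (\<nu>, h)" using h by simp
  obtain G R where G: "G 0 = ?v" "\<And>x k. x \<in> S \<Longrightarrow> norm (x - c) > R \<Longrightarrow> k < 2 * n \<Longrightarrow>
      (\<lambda>m. powr_arg (arg_in J (x - c)) (x - c) r * (G m $ k * inverse (x - c) ^ m)) sums (U x $ k)"
    using ex unfolding expands_at_infinity_def dim by blast
  have "(\<lambda>m. pw r x * (G m $ \<nu> * inverse x ^ m)) sums (U (c + x) $ \<nu>)" if "x \<in> sector 0 J" "norm x > R" for x
    using G(2)[of "c + x" \<nu>] that \<nu> sector_shift by (simp add: powr_arg_lg pw_def)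
  from two_exponents_of_sums[where a=r and b=s, OF this] v\<nu> G(1)
  show "two_exponents r s (\<lambda>x. U (c + x) $ \<nu>) (P $$ (\<nu>, h))" "two_exponents s r (\<lambda>x. U (c + x) $ \<nu>) 0"
    by (simp_all del: index_append_vec)
qed

text \<open>Leading vectors at infinity are columns of P, so inverting P solves for the
  coefficients: with g = 0 this gives independence, in general it brings in the rows of
  \<open>Pinv\<close>.\<close>

lemma P_kernel:
  assumes "\<And>\<nu>. \<nu> < n \<Longrightarrow> (\<Sum>k<n. f k * P $$ (\<nu>, k)) = g \<nu>" "k < n"
  shows "f k = (\<Sum>\<nu><n. Pinv $$ (k, \<nu>) * g \<nu>)"
proof -
  have "f k = entry_apply (Pinv * P) f k" using entry_apply_one[OF assms(2), of f] inverse_P(2) by simp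
  also have "\<dots> = entry_apply Pinv (entry_apply P f) k" by (rule entry_apply_mult[OF carriers(3,2) assms(2)])
  also have "\<dots> = entry_apply Pinv g k"
    using carriers assms(1) by (intro mat_apply_cong) (simp add: mat_apply_def mult.commute)
  finally show ?thesis using carriers by (simp add: mat_apply_def)
qed

definition solutions_at_infinity :: "(nat \<Rightarrow> nat \<Rightarrow> complex \<Rightarrow> complex vec) \<Rightarrow> bool" where
  "solutions_at_infinity U_inf \<longleftrightarrow> (\<forall>j\<in>{1, 2}. \<forall>h\<in>{1..n}. okubo_solution TT AA S (U_inf j h) \<and>
     expands_at_infinity c J (\<rho> j)
       ((P *\<^sub>v unit_vec n (h - 1)) @\<^sub>v ((\<rho> j \<cdot>\<^sub>m 1\<^sub>m n - A') *\<^sub>v unit_vec n (h - 1))) S (U_inf j h))"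

text \<open>The 2n solutions at infinity are independent already in their upper halves: the
  exponents separate the two families, since \<rho> 1 - \<rho> 2 is no integer, and invertibility of
  P separates the members of one family.\<close>

lemma basis_expansion:
  assumes inf: "solutions_at_infinity U_inf" and sol: "okubo_solution TT AA S U"
  obtains C :: "nat \<Rightarrow> nat \<Rightarrow> complex" where "\<And>x \<nu>. x \<in> S \<Longrightarrow> \<nu> < 2 * n \<Longrightarrow>
    U x $ \<nu> = (\<Sum>h<n. C 1 h * U_inf 1 (Suc h) x $ \<nu>) + (\<Sum>h<n. C 2 h * U_inf 2 (Suc h) x $ \<nu>)"
proof -
  define F where "F = (\<lambda>k. if k < n then U_inf 1 (Suc k) else U_inf 2 (Suc (k - n)))"
  define R where "R = (\<lambda>i j x. AA $$ (i, j) / (x - TT $$ (i, i)))"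
  have F_sol: "okubo_solution TT AA S (F k)" if "k < 2 * n" for k
    using inf that by (auto simp: F_def solutions_at_infinity_def)
  have ode: "deriv (\<lambda>x. W x $ i) x = (\<Sum>j<2 * n. R i j x * W x $ j)"
    if "okubo_solution TT AA S W" "i < 2 * n" "x \<in> S" for W i x
  proof -
    have nz: "x - TT $$ (i, i) \<noteq> 0" using TT_notin[OF that(2)] that(3) by auto
    have "deriv (\<lambda>x. W x $ i) x = (\<Sum>\<mu><2 * n. AA $$ (i, \<mu>) * W x $ \<mu>) / (x - TT $$ (i, i))"
      using solution_facts(2)[OF that] nz by (simp only: eq_divide_eq mult.commute) simp
    then show ?thesis by (simp add: R_def sum_divide_distrib)
  qed
  have two: "2 * n = n + n" by simp
  have te: "two_exponents r s (\<lambda>x. \<Sum>k<2 * n. v k * F k (c + x) $ \<nu>) (\<Sum>k<2 * n. v k * e k)"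
    if "\<And>k. k < 2 * n \<Longrightarrow> two_exponents r s (\<lambda>x. F k (c + x) $ \<nu>) (e k)" for r s v e \<nu>
    by (rule two_exponents_sum) (use that in auto)
  have i1: "two_exponents (\<rho> 1) (\<rho> 2) (\<lambda>x. F k (c + x) $ \<nu>) (if k < n then P $$ (\<nu>, k) else 0)"
    and i2: "two_exponents (\<rho> 2) (\<rho> 1) (\<lambda>x. F k (c + x) $ \<nu>) (if k < n then 0 else P $$ (\<nu>, k - n))"
    if k: "k < 2 * n" and \<nu>: "\<nu> < n" for k \<nu>
  proof -
    define j h where "j = (if k < n then 1 else 2 :: nat)" and "h = (if k < n then k else k - n)"
    have jh: "j \<in> {1, 2}" "h < n" "Suc h \<in> {1..n}" "F k = U_inf j (Suc h)" using k by (auto simp: j_def h_def F_def)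
    have "expands_at_infinity c J (\<rho> j) ((P *\<^sub>v unit_vec n h) @\<^sub>v ((\<rho> j \<cdot>\<^sub>m 1\<^sub>m n - A') *\<^sub>v unit_vec n h)) S (F k)"
      using inf jh unfolding solutions_at_infinity_def by (metis diff_Suc_1)
    note E = infinity_two_exponents[OF this _ jh(2) \<nu>]
    have v': "(\<rho> j \<cdot>\<^sub>m 1\<^sub>m n - A') *\<^sub>v unit_vec n h \<in> carrier_vec n"
      using carriers by (intro mult_mat_vec_carrier[of _ n n]) auto
    show "two_exponents (\<rho> 1) (\<rho> 2) (\<lambda>x. F k (c + x) $ \<nu>) (if k < n then P $$ (\<nu>, k) else 0)"
      using E(1)[OF v', of "\<rho> 2"] E(2)[OF v', of "\<rho> 1"] by (cases "k < n") (auto simp: j_def h_def)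
    show "two_exponents (\<rho> 2) (\<rho> 1) (\<lambda>x. F k (c + x) $ \<nu>) (if k < n then 0 else P $$ (\<nu>, k - n))"
      using E(1)[OF v', of "\<rho> 1"] E(2)[OF v', of "\<rho> 2"] by (cases "k < n") (auto simp: j_def h_def)
  qed
  obtain C where C: "\<And>i x. i < 2 * n \<Longrightarrow> x \<in> S \<Longrightarrow> U x $ i = (\<Sum>k<2 * n. C k * F k x $ i)"
  proof (rule fundamental_combination[where F="\<lambda>k i x. F k x $ i" and U="\<lambda>i x. U x $ i" and R=R and N="2 * n",
        OF open_S connected_S S_nonempty])
    show "R i j holomorphic_on S" if "i < 2 * n" "j < 2 * n" for i j
      unfolding R_def using TT_notin[OF that(1)] by (intro holomorphic_intros) auto
    show "v k = 0" if z: "\<And>i x. i < 2 * n \<Longrightarrow> x \<in> S \<Longrightarrow> (\<Sum>k<2 * n. v k * F k x $ i) = 0" and k: "k < 2 * n" for v k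
    proof -
      have zero: "two_exponents r s (\<lambda>x. 0) e" if "\<nu> < n" "two_exponents r s (\<lambda>x. \<Sum>k<2 * n. v k * F k (c + x) $ \<nu>) e" for r s e \<nu>
      proof (rule two_exponents_cong[OF _ that(2)])
        show "(\<Sum>k<2 * n. v k * F k (c + x) $ \<nu>) = 0" if "x \<in> sector 0 J" for x
          using z[of \<nu> "c + x"] that sector_shift \<open>\<nu> < n\<close> by simp
      qed
      \<comment> \<open>The coefficient of y^(\<rho> 1) in a combination that vanishes; the second
        family contributes 0 to it. Further below the families exchange roles.\<close>
      have "(\<Sum>k<n. v k * P $$ (\<nu>, k)) = 0" if \<nu>: "\<nu> < n" for \<nu>
      proof -
        have "(\<Sum>k<2 * n. v k * (if k < n then P $$ (\<nu>, k) else 0)) = 0"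
          by (rule two_exponents_zero[OF zero[OF \<nu> te[OF i1[OF _ \<nu>]]]]) (use rho_nonint in auto)
        then show ?thesis unfolding two sum_lessThan_add by simp
      qed
      from P_kernel[of v "\<lambda>_. 0", OF this] have v1: "v k = 0" if "k < n" for k using that by simp
      have "(\<Sum>k<n. v (n + k) * P $$ (\<nu>, k)) = 0" if \<nu>: "\<nu> < n" for \<nu>
      proof -
        have ni: "\<rho> 2 - \<rho> 1 \<notin> \<int>" using rho_nonint(2) Ints_minus[of "\<rho> 2 - \<rho> 1"] by auto
        have "(\<Sum>k<2 * n. v k * (if k < n then 0 else P $$ (\<nu>, k - n))) = 0"
          by (rule two_exponents_zero[OF zero[OF \<nu> te[OF i2[OF _ \<nu>]]]]) (use rho_nonint ni in auto)
        then show ?thesis unfolding two sum_lessThan_add by simp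
      qed
      from P_kernel[of "\<lambda>k. v (n + k)" "\<lambda>_. 0", OF this] have v2: "v (n + k) = 0" if "k < n" for k using that by simp
      show ?thesis using v1[of k] v2[of "k - n"] k by (cases "k < n") auto
    qed
  qed (use solution_facts(1)[OF F_sol] solution_facts(1)[OF sol] ode[OF F_sol] ode[OF sol] in auto)
  show ?thesis
  proof (rule that[of "\<lambda>j h. if j = 1 then C h else C (n + h)"])
    fix x \<nu> assume h: "x \<in> S" "\<nu> < 2 * n"
    show "U x $ \<nu> = (\<Sum>h<n. (if 1 = (1::nat) then C h else C (n + h)) * U_inf 1 (Suc h) x $ \<nu>)
        + (\<Sum>h<n. (if 2 = (1::nat) then C h else C (n + h)) * U_inf 2 (Suc h) x $ \<nu>)"
      unfolding C[OF h(2,1)] unfolding two sum_lessThan_add by (simp add: F_def)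
  qed
qed

text \<open>The leading coefficient of y^(\<rho> j) in each component of U is computed twice: from
  the expansion in the basis it is a combination of columns of P, and
  \<open>okubo_connection\<close> gives it through w at \<eta>. The base point c + e covers the
  finite singular points with e nonzero as well as c itself with e = 0.\<close>

lemma connection_coefficients:
  assumes inf: "solutions_at_infinity U_inf" and sol: "okubo_solution TT AA S U"
    and C: "\<And>x \<nu>. x \<in> S \<Longrightarrow> \<nu> < 2 * n \<Longrightarrow>
      U x $ \<nu> = (\<Sum>h<n. C 1 h * U_inf 1 (Suc h) x $ \<nu>) + (\<Sum>h<n. C 2 h * U_inf 2 (Suc h) x $ \<nu>)"
    and j: "j \<in> {1, 2}" and r: "r1 = \<rho> j" "r2 = \<rho> (3 - j)"
    and TR: "\<And>y. y \<in> sector 0 J \<Longrightarrow> y + e \<in> sector 0 J"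
      "\<And>y. y \<in> sector 0 J \<Longrightarrow> lg J (y + e) = lg J y + Ln (1 + e / y)"
    and \<tau>0: "\<And>\<nu>. \<nu> < n \<Longrightarrow> T $$ (\<nu>, \<nu>) \<noteq> c"
    and T': "T' \<in> carrier_mat n n" "\<And>\<nu> \<mu>. \<nu> < n \<Longrightarrow> \<mu> < n \<Longrightarrow> \<nu> \<noteq> \<mu> \<Longrightarrow> T' $$ (\<nu>, \<mu>) = 0"
      "\<And>\<nu>. \<nu> < n \<Longrightarrow> T' $$ (\<nu>, \<nu>) = \<eta> + 1 / (T $$ (\<nu>, \<nu>) - c)"
    and D: "open D" "\<And>x. x \<in> sector 0 J \<Longrightarrow> \<eta> + 1 / x \<in> D"
    and w: "okubo_solution T' ((- r2 - 1) \<cdot>\<^sub>m 1\<^sub>m n + A) D w" "w \<eta> \<in> carrier_vec n"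
    and w_lim: "\<And>\<nu>. \<nu> < n \<Longrightarrow>
      ((\<lambda>x. w (\<eta> + 1 / x) $ \<nu>) \<longlongrightarrow> w \<eta> $ \<nu>) (inf at_infinity (principal (sector 0 J)))"
    and fU: "\<And>\<nu>. \<nu> < n \<Longrightarrow> frobenius l (G \<nu>) (\<lambda>y. U (c + (y + e)) $ \<nu>)"
    and fB: "\<And>\<nu>. \<nu> < n \<Longrightarrow> frobenius (l - r2 - 1) (g \<nu>)
      (\<lambda>y. exp ((r1 - r2 - 1) * lg J (y + e)) * w (\<eta> + 1 / (y + e)) $ \<nu> / (T $$ (\<nu>, \<nu>) - c))"
    and lead: "\<And>\<nu>. \<nu> < n \<Longrightarrow> G \<nu> 0 = k * g \<nu> 0"
    and uniq: "\<And>D \<nu> m. second_order_rec n (\<lambda>\<nu> \<mu>. A $$ (\<nu>, \<mu>)) (\<lambda>\<nu>. T $$ (\<nu>, \<nu>) - c) e r1 r2 l D \<Longrightarrow>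
      (\<And>\<nu>. \<nu> < n \<Longrightarrow> D \<nu> 0 = 0) \<Longrightarrow> \<nu> < n \<Longrightarrow> D \<nu> m = 0"
    and ni: "l - r2 \<notin> \<int>" "l + 1 \<notin> \<int>\<^sub>\<le>\<^sub>0"
    and h: "h < n"
  shows "C j h = - (k * Gamma (r1 - r2) * Gamma (l + 1) / (Gamma (r1 + 1) * Gamma (l - r2)))
    * gamma_coeff Pinv T' \<eta> (Suc h) w"
proof -
  define \<tau> where "\<tau> = (\<lambda>\<nu>. T $$ (\<nu>, \<nu>) - c)"
  have \<tau>: "\<tau> \<nu> \<noteq> 0" if "\<nu> < n" for \<nu> using \<tau>0[OF that] by (simp add: \<tau>_def)
  define B where "B = (\<lambda>\<nu> x. exp ((r1 - r2 - 1) * lg J x) * w (\<eta> + 1 / x) $ \<nu> / \<tau> \<nu>)"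
  have rr: "\<rho> 1 + \<rho> 2 = r1 + r2" "\<rho> 1 * \<rho> 2 = r1 * r2" using j r by auto
  have rni: "r1 - r2 \<notin> \<int>" "r1 \<notin> \<int>"
  proof -
    have "\<rho> 2 - \<rho> 1 \<notin> \<int>" using rho_nonint(2) Ints_minus[of "\<rho> 2 - \<rho> 1"] by auto
    then show "r1 - r2 \<notin> \<int>" using j r rho_nonint(2) by auto
    show "r1 \<notin> \<int>" using j r rho_nonint(1) by auto
  qed
  have mem: "c + (y + e) \<in> S" if "y \<in> sector 0 J" for y
    using TR(1)[OF that] sector_shift by blast
  have shift_deriv: "deriv (\<lambda>y. f (c + (y + e))) y = deriv f (c + (y + e))"
    if "f holomorphic_on S" "y \<in> sector 0 J" for f y
    using deriv_translate[OF that(1) open_S, of y "c + e"] mem[OF that(2)] by (simp add: ac_simps)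
  have shift_hol: "(\<lambda>y. f (c + (y + e))) holomorphic_on sector 0 J" if "f holomorphic_on S" for f
  proof -
    have "(f \<circ> (\<lambda>y. c + (y + e))) holomorphic_on sector 0 J"
      by (rule holomorphic_on_compose_gen[OF _ that]) (use mem in \<open>auto intro!: holomorphic_intros\<close>)
    then show ?thesis by (simp add: o_def)
  qed
  have U_hol: "(\<lambda>x. U x $ \<nu>) holomorphic_on S" if "\<nu> < 2 * n" for \<nu>
    using solution_facts(1)[OF sol that] .
  have lower_hol: "lower U \<nu> holomorphic_on S" for \<nu>
    unfolding lower_def[abs_def] by (intro holomorphic_intros U_hol) auto
  have A_car: "(- r2 - 1) \<cdot>\<^sub>m 1\<^sub>m n + A \<in> carrier_mat n n" using carriers by auto
  have w_hol: "(\<lambda>\<zeta>. w \<zeta> $ \<nu>) holomorphic_on D" if "\<nu> < n" for \<nu>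
    using okubo_solution_diagonal(2)[OF w(1) T'(1) A_car T'(2)] that by blast
  have w_eq: "(\<zeta> - T' $$ (\<nu>, \<nu>)) * deriv (\<lambda>\<zeta>. w \<zeta> $ \<nu>) \<zeta>
      = (\<Sum>\<mu><n. ((- r2 - 1) \<cdot>\<^sub>m 1\<^sub>m n + A) $$ (\<nu>, \<mu>) * w \<zeta> $ \<mu>)" if "\<nu> < n" "\<zeta> \<in> D" for \<nu> \<zeta>
    using okubo_solution_diagonal(3)[OF w(1) T'(1) A_car T'(2)] that by blast
  have w_ode: "(\<zeta> - (\<eta> + 1 / \<tau> \<nu>)) * deriv (\<lambda>\<zeta>. w \<zeta> $ \<nu>) \<zeta> = (- r2 - 1) * w \<zeta> $ \<nu> + apply_A (\<lambda>\<mu>. w \<zeta> $ \<mu>) \<nu>"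
    if \<nu>: "\<nu> < n" and \<zeta>: "\<zeta> \<in> D" for \<nu> \<zeta>
  proof -
    have "(\<zeta> - (\<eta> + 1 / \<tau> \<nu>)) * deriv (\<lambda>\<zeta>. w \<zeta> $ \<nu>) \<zeta> = (\<Sum>\<mu><n. ((- r2 - 1) \<cdot>\<^sub>m 1\<^sub>m n + A) $$ (\<nu>, \<mu>) * w \<zeta> $ \<mu>)"
      using w_eq[OF \<nu> \<zeta>] T'(3)[OF \<nu>] by (simp add: \<tau>_def)
    also have "\<dots> = (\<Sum>\<mu><n. (- r2 - 1) * (1\<^sub>m n $$ (\<nu>, \<mu>) * w \<zeta> $ \<mu>) + A $$ (\<nu>, \<mu>) * w \<zeta> $ \<mu>)"
      using carriers \<nu> by (intro sum.cong refl) (auto simp: distrib_right)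
    also have "\<dots> = (- r2 - 1) * entry_apply (1\<^sub>m n) (\<lambda>\<mu>. w \<zeta> $ \<mu>) \<nu> + apply_A (\<lambda>\<mu>. w \<zeta> $ \<mu>) \<nu>"
      by (simp add: mat_apply_def sum.distrib sum_distrib_left)
    finally show ?thesis by (simp only: entry_apply_one[OF \<nu>])
  qed
  have B_facts: "B \<nu> holomorphic_on sector 0 J"
    "\<And>x. x \<in> sector 0 J \<Longrightarrow> x * (x - \<tau> \<nu>) * deriv (B \<nu>) x =
        (r1 - r2 - 1) * x * B \<nu> x - r1 * \<tau> \<nu> * B \<nu> x + apply_A (\<lambda>\<mu>. \<tau> \<mu> * B \<mu> x) \<nu>" if \<nu>: "\<nu> < n" for \<nu>
  proof -
    show "B \<nu> holomorphic_on sector 0 J"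
      unfolding B_def
      by (rule euler_kernel_ode(1)[where w="\<lambda>\<nu> \<zeta>. w \<zeta> $ \<nu>" and \<tau>=\<tau> and n=n and a="\<lambda>\<nu> \<mu>. A $$ (\<nu>, \<mu>)" and ?r2.0=r2 and D=D])
        (use Lg_holomorphic exp_Lg open_Q D w_hol w_ode \<tau> \<nu> in blast)+
    show "x * (x - \<tau> \<nu>) * deriv (B \<nu>) x =
        (r1 - r2 - 1) * x * B \<nu> x - r1 * \<tau> \<nu> * B \<nu> x + apply_A (\<lambda>\<mu>. \<tau> \<mu> * B \<mu> x) \<nu>" if "x \<in> sector 0 J" for x
      unfolding B_def
      by (rule euler_kernel_ode(2)[where w="\<lambda>\<nu> \<zeta>. w \<zeta> $ \<nu>" and \<tau>=\<tau> and n=n and a="\<lambda>\<nu> \<mu>. A $$ (\<nu>, \<mu>)" and ?r2.0=r2 and D=D and X="sector 0 J"])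
        (use Lg_holomorphic exp_Lg open_Q D w_hol w_ode \<tau> \<nu> that in blast)+
  qed
  have B_shift: "deriv (\<lambda>y. B \<nu> (y + e)) y = deriv (B \<nu>) (y + e)" if "\<nu> < n" "y \<in> sector 0 J" for \<nu> y
    using deriv_translate[OF B_facts(1)[OF that(1)] open_Q TR(1)[OF that(2)]] .
  have B_shift_hol: "(\<lambda>y. B \<nu> (y + e)) holomorphic_on sector 0 J" if "\<nu> < n" for \<nu>
  proof -
    have "(B \<nu> \<circ> (\<lambda>y. y + e)) holomorphic_on sector 0 J"
      by (rule holomorphic_on_compose_gen[OF _ B_facts(1)[OF that]]) (use TR(1) in \<open>auto intro!: holomorphic_intros\<close>)
    then show ?thesis by (simp add: o_def)
  qed
  have eq: "(\<Sum>h<n. C j h * P $$ (\<nu>, h)) = k * (w \<eta> $ \<nu> / \<tau> \<nu>) * Gamma (r1 - r2) * Gamma (l + 1) / (Gamma (r1 + 1) * Gamma (l - r2))"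
    if \<nu>: "\<nu> < n" for \<nu>
  proof (rule okubo_connection[where u="\<lambda>\<nu> y. U (c + (y + e)) $ \<nu>" and B="\<lambda>\<nu> y. B \<nu> (y + e)" and G=G and g=g
        and \<tau>=\<tau> and a="\<lambda>\<nu> \<mu>. A $$ (\<nu>, \<mu>)" and V="\<lambda>\<nu> y. lower U \<nu> (c + (y + e))" and \<nu>=\<nu> and n=n and e=e])
    show "(\<lambda>y. U (c + (y + e)) $ \<nu>) holomorphic_on sector 0 J" if "\<nu> < n" for \<nu>
      using that by (intro shift_hol U_hol) auto
    show "(\<lambda>y. B \<nu> (y + e)) holomorphic_on sector 0 J" if "\<nu> < n" for \<nu>
      by (rule B_shift_hol[OF that])
    fix \<nu> y assume \<nu>: "\<nu> < n" and y: "y \<in> sector 0 J"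
    show "(y + e - \<tau> \<nu>) * deriv (\<lambda>y. U (c + (y + e)) $ \<nu>) y = apply_A (\<lambda>\<mu>. U (c + (y + e)) $ \<mu>) \<nu> + lower U \<nu> (c + (y + e))"
      using reduced_system(1)[OF sol \<nu> mem[OF y]] shift_deriv[OF U_hol[of \<nu>] y] \<nu> by (simp add: \<tau>_def algebra_simps)
    show "(y + e) * deriv (\<lambda>y. lower U \<nu> (c + (y + e))) y =
        - apply_A (\<lambda>\<mu>. apply_A (\<lambda>\<kappa>. U (c + (y + e)) $ \<kappa>) \<mu>) \<nu> + (r1 + r2) * apply_A (\<lambda>\<mu>. U (c + (y + e)) $ \<mu>) \<nu>
        - r1 * r2 * U (c + (y + e)) $ \<nu> + (r1 + r2) * lower U \<nu> (c + (y + e)) - apply_A (\<lambda>\<mu>. lower U \<mu> (c + (y + e))) \<nu>"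
      using reduced_system(2)[OF sol \<nu> mem[OF y]] shift_deriv[OF lower_hol y] unfolding rr by simp
    show "(y + e) * (y + e - \<tau> \<nu>) * deriv (\<lambda>y. B \<nu> (y + e)) y =
        (r1 - r2 - 1) * (y + e) * B \<nu> (y + e) - r1 * \<tau> \<nu> * B \<nu> (y + e) + apply_A (\<lambda>\<mu>. \<tau> \<mu> * B \<mu> (y + e)) \<nu>"
      unfolding B_shift[OF \<nu> y] by (rule B_facts(2)[OF \<nu> TR(1)[OF y]])
  next
    show "frobenius l (G \<nu>) (\<lambda>y. U (c + (y + e)) $ \<nu>)" if "\<nu> < n" for \<nu> by (rule fU[OF that])
    show "frobenius (l - r2 - 1) (g \<nu>) (\<lambda>y. B \<nu> (y + e))" if "\<nu> < n" for \<nu>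
      unfolding B_def \<tau>_def by (rule fB[OF that])
    show "G \<nu> 0 = k * g \<nu> 0" if "\<nu> < n" for \<nu> by (rule lead[OF that])
    show "D \<nu> m = 0" if "second_order_rec n (\<lambda>\<nu> \<mu>. A $$ (\<nu>, \<mu>)) \<tau> e r1 r2 l D" "\<And>\<nu>. \<nu> < n \<Longrightarrow> D \<nu> 0 = 0" "\<nu> < n" for D \<nu> m
      using uniq[OF that(1)[unfolded \<tau>_def] that(2,3)] .
    show "l - r2 \<notin> \<int>\<^sub>\<le>\<^sub>0" "l - r2 \<noteq> 1" "r1 - r2 \<notin> \<int>\<^sub>\<le>\<^sub>0" using ni rni by auto
    show "r1 + 1 \<notin> \<int>\<^sub>\<le>\<^sub>0"
    proof
      assume "r1 + 1 \<in> \<int>\<^sub>\<le>\<^sub>0"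
      then have "r1 + 1 - 1 \<in> \<int>" by (intro Ints_diff nonpos_Ints_Int Ints_1)
      then show False using rni by simp
    qed
    show "l + 1 \<notin> \<int>\<^sub>\<le>\<^sub>0" by (rule ni)
    show "\<nu> < n" by (rule \<nu>)
    show "((\<lambda>y. B \<nu> (y + e) * pw (- (r1 - r2 - 1)) y) \<longlongrightarrow> w \<eta> $ \<nu> / \<tau> \<nu>) (inf at_infinity (principal (sector 0 J)))"
      unfolding B_def using kernel_limit[OF TR w_lim[OF \<nu>]] .
    \<comment> \<open>In the expansion of U, the family whose exponent is not r1 has leading
      coefficient 0 at y^r1.\<close>
    have part: "two_exponents r1 r2 (\<lambda>x. \<Sum>h<n. C i h * U_inf i (Suc h) (c + x) $ \<nu>)
        (\<Sum>h<n. C i h * (if i = j then P $$ (\<nu>, h) else 0))" if i: "i \<in> {1, 2}" for i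
    proof (rule two_exponents_sum)
      fix h assume "h \<in> {..<n}"
      then have h: "h < n" "Suc h \<in> {1..n}" by auto
      have v': "(\<rho> i \<cdot>\<^sub>m 1\<^sub>m n - A') *\<^sub>v unit_vec n h \<in> carrier_vec n"
        using carriers by (intro mult_mat_vec_carrier[of _ n n]) auto
      have ex: "expands_at_infinity c J (\<rho> i) ((P *\<^sub>v unit_vec n h) @\<^sub>v ((\<rho> i \<cdot>\<^sub>m 1\<^sub>m n - A') *\<^sub>v unit_vec n h)) S (U_inf i (Suc h))"
        using inf i h unfolding solutions_at_infinity_def by (metis diff_Suc_1)
      show "two_exponents r1 r2 (\<lambda>x. U_inf i (Suc h) (c + x) $ \<nu>) (if i = j then P $$ (\<nu>, h) else 0)"
        using infinity_two_exponents[OF ex v' h(1) \<nu>] i j r by (cases "i = j") auto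
    qed simp
    have "two_exponents r1 r2 (\<lambda>x. \<Sum>i\<in>{1,2}. 1 * (\<Sum>h<n. C i h * U_inf i (Suc h) (c + x) $ \<nu>))
        (\<Sum>i\<in>{1,2}. 1 * (\<Sum>h<n. C i h * (if i = j then P $$ (\<nu>, h) else 0)))"
      by (rule two_exponents_sum[OF _ part]) auto
    moreover have "(\<Sum>i\<in>{1,2}. 1 * (\<Sum>h<n. C i h * (if i = j then P $$ (\<nu>, h) else 0))) = (\<Sum>h<n. C j h * P $$ (\<nu>, h))"
      using j by auto
    moreover have "(\<Sum>i\<in>{1,2}. 1 * (\<Sum>h<n. C i h * U_inf i (Suc h) (c + x) $ \<nu>)) = U (c + x) $ \<nu>" if "x \<in> sector 0 J" for x
      using C[of "c + x" \<nu>] that sector_shift \<nu> by simp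
    ultimately have "two_exponents r1 r2 (\<lambda>x. U (c + x) $ \<nu>) (\<Sum>h<n. C j h * P $$ (\<nu>, h))"
      using two_exponents_cong[of "\<lambda>x. \<Sum>i\<in>{1,2}. 1 * (\<Sum>h<n. C i h * U_inf i (Suc h) (c + x) $ \<nu>)" "\<lambda>x. U (c + x) $ \<nu>"] by auto
    then show "two_exponents r1 r2 (\<lambda>y. U (c + (y + e)) $ \<nu>) (\<Sum>h<n. C j h * P $$ (\<nu>, h))"
      by (rule two_exponents_translate[OF _ TR])
  qed
  define K where "K = k * Gamma (r1 - r2) * Gamma (l + 1) / (Gamma (r1 + 1) * Gamma (l - r2))"
  have X: "\<eta> \<cdot>\<^sub>m 1\<^sub>m (dim_row T') - T' \<in> carrier_mat n n" using T'(1) by auto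
  \<comment> \<open>\<eta> - t' is - 1 / \<tau>, so the quotient w / \<tau> delivered by the kernel
    is, up to sign, the vector inside \<open>gamma_coeff\<close>.\<close>
  have entry: "((\<eta> \<cdot>\<^sub>m 1\<^sub>m (dim_row T') - T') *\<^sub>v w \<eta>) $ \<nu> = - (w \<eta> $ \<nu> / \<tau> \<nu>)" if \<nu>: "\<nu> < n" for \<nu>
  proof -
    have "((\<eta> \<cdot>\<^sub>m 1\<^sub>m (dim_row T') - T') *\<^sub>v w \<eta>) $ \<nu> = (\<Sum>\<mu><n. (\<eta> \<cdot>\<^sub>m 1\<^sub>m (dim_row T') - T') $$ (\<nu>, \<mu>) * w \<eta> $ \<mu>)"
      by (rule mult_mat_vec_entry[OF X w(2) \<nu>])
    also have "\<dots> = (\<Sum>\<mu>\<in>{\<nu>}. (\<eta> \<cdot>\<^sub>m 1\<^sub>m (dim_row T') - T') $$ (\<nu>, \<mu>) * w \<eta> $ \<mu>)"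
      using \<nu> T'(1,2) by (intro sum.mono_neutral_right) auto
    also have "\<dots> = - (w \<eta> $ \<nu> / \<tau> \<nu>)" using \<nu> T'(1) T'(3)[OF \<nu>] by (simp add: \<tau>_def)
    finally show ?thesis .
  qed
  have "C j h = (\<Sum>\<nu><n. Pinv $$ (h, \<nu>) * (k * (w \<eta> $ \<nu> / \<tau> \<nu>) * Gamma (r1 - r2) * Gamma (l + 1) / (Gamma (r1 + 1) * Gamma (l - r2))))"
    by (rule P_kernel[OF eq h])
  also have "\<dots> = (\<Sum>\<nu><n. - K * (Pinv $$ (h, \<nu>) * ((\<eta> \<cdot>\<^sub>m 1\<^sub>m (dim_row T') - T') *\<^sub>v w \<eta>) $ \<nu>))"
  proof (intro sum.cong refl)
    fix \<nu> assume "\<nu> \<in> {..<n}"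
    then have \<nu>: "\<nu> < n" by simp
    show "Pinv $$ (h, \<nu>) * (k * (w \<eta> $ \<nu> / \<tau> \<nu>) * Gamma (r1 - r2) * Gamma (l + 1) / (Gamma (r1 + 1) * Gamma (l - r2)))
        = - K * (Pinv $$ (h, \<nu>) * ((\<eta> \<cdot>\<^sub>m 1\<^sub>m (dim_row T') - T') *\<^sub>v w \<eta>) $ \<nu>)"
      unfolding entry[OF \<nu>] K_def by (simp add: mult_ac)
  qed
  also have "\<dots> = - K * gamma_coeff Pinv T' \<eta> (Suc h) w"
    unfolding gamma_coeff_def using carriers(3) X h
    by (auto simp: scalar_prod_def sum_distrib_left lessThan_atLeast0 simp del: index_mult_mat_vec intro!: sum.cong)
  finally show ?thesis by (simp add: K_def)
qed

end

lemma okubo_solution_subset: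
  "okubo_solution T A X U \<Longrightarrow> Y \<subseteq> X \<Longrightarrow> okubo_solution T A Y U"
  unfolding okubo_solution_def Let_def by (meson holomorphic_on_subset subsetD)

lemma lg_subset:
  assumes J: "J = {a<..<b}" "b - a \<le> 2 * pi" and I: "I = {a'<..<b'}" "b' - a' \<le> 2 * pi"
    and sub: "J \<subseteq> I" and y: "y \<in> sector 0 J"
  shows "lg I y = lg J y"
proof -
  obtain v where v: "y = exp v" "Im v \<in> J" using y unfolding sector_exp by auto
  show ?thesis unfolding v(1) lg_exp[OF J v(2)] using lg_exp[OF I] v(2) sub by blast
qed

section \<open>The two kinds of base points: the eigenvalues of T, and the apex c\<close>

context okubo_sector
begin

lemma value_at_infinity:
  assumes sol: "okubo_solution T' M X w" and dim: "dim_row M = n" and \<nu>: "\<nu> < n"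
    and X: "\<eta> \<in> X" "\<And>x. x \<in> sector 0 J \<Longrightarrow> \<eta> + 1 / x \<in> X"
  shows "((\<lambda>x. w (\<eta> + 1 / x) $ \<nu>) \<longlongrightarrow> w \<eta> $ \<nu>) (inf at_infinity (principal (sector 0 J)))"
proof (rule continuous_on_tendsto_compose[where s=X and f="\<lambda>\<zeta>. w \<zeta> $ \<nu>"])
  show "continuous_on X (\<lambda>\<zeta>. w \<zeta> $ \<nu>)"
    using sol \<nu> dim unfolding okubo_solution_def Let_def by (auto intro: holomorphic_on_imp_continuous_on)
  have "((\<lambda>x::complex. \<eta> + inverse x) \<longlongrightarrow> \<eta> + 0) (inf at_infinity (principal (sector 0 J)))"
    by (intro tendsto_add tendsto_const tendsto_mono[OF inf_le1 tendsto_inverse_0])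
  then show "((\<lambda>x. \<eta> + 1 / x) \<longlongrightarrow> \<eta>) (inf at_infinity (principal (sector 0 J)))"
    by (simp add: inverse_eq_divide)
  show "\<forall>\<^sub>F x in inf at_infinity (principal (sector 0 J)). \<eta> + 1 / x \<in> X"
    using X(2) by (simp add: eventually_inf_principal)
qed (rule X(1))

lemma inverse_sector: "x \<in> sector 0 J \<Longrightarrow> \<eta> + 1 / x \<in> sector \<eta> {- b <..< - a}"
proof -
  assume "x \<in> sector 0 J"
  then have "1 / x \<in> sector 0 {- b <..< - a}" by (rule lg_inverse(1)[OF J(1,3)])
  then obtain v where "1 / x = exp v" "Im v \<in> {- b <..< - a}" unfolding sector_exp by auto
  then show "\<eta> + 1 / x \<in> sector \<eta> {- b <..< - a}"
    unfolding sector_exp by (intro image_eqI[where x=v]) simp_all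
qed

lemma sum_two_families:
  "(\<Sum>j\<in>{1, 2}. \<Sum>h = 1..n. K j * \<gamma> j h * f j h) =
    (\<Sum>h<n. K 1 * \<gamma> 1 (Suc h) * f 1 (Suc h)) + (\<Sum>h<n. K 2 * \<gamma> 2 (Suc h) * f (2::nat) (Suc h) :: complex)"
  by (simp add: sum.atLeast1_atMost_eq)

text \<open>The case e = exp \<omega>. The opening of the sector is at most pi and the singular
  point lies on its boundary ray, so translation by e preserves the sector, and U and the kernel can
  be compared in the coordinate y = x - c - e.\<close>

lemma connection_at_point:
  assumes half: "half_sector J a b \<omega>" and inf: "solutions_at_infinity U_inf" and sol: "okubo_solution TT AA S U"
    and I: "J \<subseteq> I" "I = {a'<..<b'}" "b' - a' \<le> 2 * pi"
    and exU: "expands_at (c + exp \<omega>) I lam (unit_vec (2 * n) \<nu>0) S U"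
    and \<nu>0: "\<nu>0 < n" "T $$ (\<nu>0, \<nu>0) = c + exp \<omega>"
    and \<tau>0: "\<And>\<nu>. \<nu> < n \<Longrightarrow> T $$ (\<nu>, \<nu>) \<noteq> c"
    and T': "T' \<in> carrier_mat n n" "\<And>\<nu> \<mu>. \<nu> < n \<Longrightarrow> \<mu> < n \<Longrightarrow> \<nu> \<noteq> \<mu> \<Longrightarrow> T' $$ (\<nu>, \<mu>) = 0"
      "\<And>\<nu>. \<nu> < n \<Longrightarrow> T' $$ (\<nu>, \<nu>) = \<eta> + 1 / (T $$ (\<nu>, \<nu>) - c)"
    and X: "sector \<eta> {- b <..< - a} \<subseteq> X" "\<eta> \<in> X"
    and w: "\<And>j. j \<in> {1, 2} \<Longrightarrow> okubo_solution T' ((- \<rho> (3 - j) - 1) \<cdot>\<^sub>m 1\<^sub>m n + A) X (w j)"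
      "\<And>j. j \<in> {1, 2} \<Longrightarrow> expands_at (\<eta> + 1 / exp \<omega>) {- Im \<omega> - 2 * pi <..< - Im \<omega>}
        (- \<rho> (3 - j) - 1 + lam) (unit_vec n \<nu>0) X (w j)"
    and block: "\<And>\<nu> \<mu>. \<nu> < n \<Longrightarrow> \<mu> < n \<Longrightarrow> T $$ (\<nu>, \<nu>) = c + exp \<omega> \<Longrightarrow> T $$ (\<mu>, \<mu>) = c + exp \<omega> \<Longrightarrow>
      \<nu> \<noteq> \<mu> \<Longrightarrow> A $$ (\<nu>, \<mu>) = 0"
    and nores: "\<And>\<nu> m. \<nu> < n \<Longrightarrow> T $$ (\<nu>, \<nu>) = c + exp \<omega> \<Longrightarrow> lam + of_nat (Suc m) \<noteq> A $$ (\<nu>, \<nu>)"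
    and ni: "lam \<notin> \<int>" "\<And>j. j \<in> {1, 2} \<Longrightarrow> lam - \<rho> j \<notin> \<int>"
    and x: "x \<in> S" and \<nu>: "\<nu> < 2 * n"
  shows "U x $ \<nu> = (\<Sum>j\<in>{1, 2}. \<Sum>h = 1..n. (exp (pi * \<i> * (lam - \<rho> (3 - j))) * exp ((2 * lam - \<rho> 1 - \<rho> 2) * \<omega>)
      * (Gamma (\<rho> j - \<rho> (3 - j)) * Gamma (lam + 1) / (Gamma (\<rho> j + 1) * Gamma (lam - \<rho> (3 - j)))))
      * gamma_coeff Pinv T' \<eta> h (w j) * U_inf j h x $ \<nu>)"
proof -
  note J_interval = J
  interpret half_sector J a b \<omega> by (rule half)
  define e where "e = exp \<omega>"
  note tr = translate_sector[folded e_def]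
  obtain G R where G: "R > 0" "G 0 = unit_vec (2 * n) \<nu>0"
    "\<And>x k. x \<in> S \<Longrightarrow> norm (x - (c + e)) < R \<Longrightarrow> k < 2 * n \<Longrightarrow>
      (\<lambda>m. powr_arg (arg_in I (x - (c + e))) (x - (c + e)) lam * (G m $ k * (x - (c + e)) ^ m)) sums (U x $ k)"
    using exU unfolding expands_at_def e_def by auto
  have fU: "frobenius lam (\<lambda>m. G m $ k) (\<lambda>y. U (c + (y + e)) $ k)" if k: "k < n" for k
    unfolding frobenius_def
  proof (intro exI[of _ R] conjI ballI impI G(1))
    fix y assume y: "y \<in> sector 0 J" "norm y < R"
    have m: "c + (y + e) \<in> S" using tr(1)[OF y(1)] sector_shift by blast
    have "exp (lam * lg I y) = pw lam y" unfolding pw_def lg_subset[OF J_interval(1,3) I(2,3,1) y(1)] ..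
    then show "(\<lambda>m. pw lam y * (G m $ k * y ^ m)) sums (U (c + (y + e)) $ k)"
      using G(3)[OF m, of k] y(2) k by (simp add: powr_arg_lg)
  qed
  obtain C :: "nat \<Rightarrow> nat \<Rightarrow> complex" where C: "\<And>x \<nu>. x \<in> S \<Longrightarrow> \<nu> < 2 * n \<Longrightarrow>
    U x $ \<nu> = (\<Sum>h<n. C 1 h * U_inf 1 (Suc h) x $ \<nu>) + (\<Sum>h<n. C 2 h * U_inf 2 (Suc h) x $ \<nu>)"
  proof (rule basis_expansion[OF inf sol])
    fix C :: "nat \<Rightarrow> nat \<Rightarrow> complex"
    assume "\<And>x \<nu>. x \<in> S \<Longrightarrow> \<nu> < 2 * n \<Longrightarrow>
      U x $ \<nu> = (\<Sum>h<n. C 1 h * U_inf 1 (Suc h) x $ \<nu>) + (\<Sum>h<n. C 2 h * U_inf 2 (Suc h) x $ \<nu>)"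
    then show ?thesis by (rule that[of C])
  qed
  have Cj: "C j h = (exp (pi * \<i> * (lam - \<rho> (3 - j))) * exp ((2 * lam - \<rho> 1 - \<rho> 2) * \<omega>)
      * (Gamma (\<rho> j - \<rho> (3 - j)) * Gamma (lam + 1) / (Gamma (\<rho> j + 1) * Gamma (lam - \<rho> (3 - j)))))
      * gamma_coeff Pinv T' \<eta> (Suc h) (w j)" if j: "j \<in> {1, 2}" and h: "h < n" for j h
  proof -
    define r1 r2 where "r1 = \<rho> j" and "r2 = \<rho> (3 - j)"
    have rsum: "\<rho> 1 + \<rho> 2 = r1 + r2" using j by (auto simp: r1_def r2_def)
    have r2_ni: "lam - r2 \<notin> \<int>" using ni(2)[of "3 - j"] j by (auto simp: r2_def)
    define s where "s = - r2 - 1 + lam"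
    define \<kappa> where "\<kappa> = r1 - r2 - 1"
    obtain H R' where H: "R' > 0" "H 0 = unit_vec n \<nu>0"
      "\<And>\<zeta> k. \<zeta> \<in> X \<Longrightarrow> norm (\<zeta> - (\<eta> + 1 / e)) < R' \<Longrightarrow> k < n \<Longrightarrow>
        (\<lambda>m. powr_arg (arg_in {- Im \<omega> - 2 * pi <..< - Im \<omega>} (\<zeta> - (\<eta> + 1 / e))) (\<zeta> - (\<eta> + 1 / e)) s
          * (H m $ k * (\<zeta> - (\<eta> + 1 / e)) ^ m)) sums (w j \<zeta> $ k)"
      using w(2)[OF j] unfolding expands_at_def e_def s_def r2_def by auto
    have inX: "\<eta> + 1 / x \<in> X" if "x \<in> sector 0 J" for x using inverse_sector[OF that] X(1) by blast
    have ex: "\<exists>g. frobenius s g (\<lambda>y. exp (\<kappa> * lg J (y + e)) * w j (\<eta> + 1 / (y + e)) $ k / (T $$ (k, k) - c))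
        \<and> g 0 = exp (\<kappa> * \<omega> - s * (\<i> * pi + 2 * \<omega>)) * H 0 $ k / (T $$ (k, k) - c)" if k: "k < n" for k
    proof (rule kernel_frobenius_point[where w="\<lambda>\<zeta>. w j \<zeta> $ k" and h="\<lambda>m. H m $ k", OF _ H(1), folded e_def])
      fix y assume y: "y \<in> sector 0 J" "norm (1 / (y + e) - 1 / e) < R'"
      show "(\<lambda>m. exp (s * lg {- Im \<omega> - 2 * pi <..< - Im \<omega>} (1 / (y + e) - 1 / e)) * (H m $ k * (1 / (y + e) - 1 / e) ^ m))
          sums w j (\<eta> + 1 / (y + e)) $ k"
        using H(3)[OF inX[OF tr(1)[OF y(1)]] _ k] y(2) by (simp add: powr_arg_lg)
    qed
    have "\<forall>k. \<exists>g. k < n \<longrightarrow> frobenius s g (\<lambda>y. exp (\<kappa> * lg J (y + e)) * w j (\<eta> + 1 / (y + e)) $ k / (T $$ (k, k) - c))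
        \<and> g 0 = exp (\<kappa> * \<omega> - s * (\<i> * pi + 2 * \<omega>)) * H 0 $ k / (T $$ (k, k) - c)"
      using ex by blast
    from choice[OF this] obtain g where g: "\<And>k. k < n \<Longrightarrow> frobenius s (g k)
        (\<lambda>y. exp (\<kappa> * lg J (y + e)) * w j (\<eta> + 1 / (y + e)) $ k / (T $$ (k, k) - c))"
      "\<And>k. k < n \<Longrightarrow> g k 0 = exp (\<kappa> * \<omega> - s * (\<i> * pi + 2 * \<omega>)) * H 0 $ k / (T $$ (k, k) - c)"
      by blast
    \<comment> \<open>Inverse of the constant in front of the kernel series; the factor e undoes the
      division by T - c in row \<nu>0.\<close>
    define k where "k = exp (- (\<kappa> * \<omega> - s * (\<i> * pi + 2 * \<omega>))) * e"
    have s': "lam - r2 - 1 = s" by (simp add: s_def)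
    have main: "C j h = - (k * Gamma (r1 - r2) * Gamma (lam + 1) / (Gamma (r1 + 1) * Gamma (lam - r2)))
        * gamma_coeff Pinv T' \<eta> (Suc h) (w j)"
    proof (rule connection_coefficients[OF inf sol C j r1_def r2_def tr(1,2) \<tau>0 T' _ _ _ _ _ fU _ _ _ r2_ni _ h,
          where D="sector \<eta> {- b <..< - a}" and g=g])
      show "open (sector \<eta> {- b <..< - a})" by (intro open_sector) auto
      show "\<eta> + 1 / x \<in> sector \<eta> {- b <..< - a}" if "x \<in> sector 0 J" for x using inverse_sector[OF that] .
      show "okubo_solution T' ((- r2 - 1) \<cdot>\<^sub>m 1\<^sub>m n + A) (sector \<eta> {- b <..< - a}) (w j)"
        using okubo_solution_subset[OF w(1)[OF j] X(1)] by (simp add: r2_def)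
      show "w j \<eta> \<in> carrier_vec n"
        using w(1)[OF j] X(2) carriers unfolding okubo_solution_def Let_def by auto
      show "((\<lambda>x. w j (\<eta> + 1 / x) $ \<nu>) \<longlongrightarrow> w j \<eta> $ \<nu>) (inf at_infinity (principal (sector 0 J)))" if "\<nu> < n" for \<nu>
        using value_at_infinity[OF w(1)[OF j] _ that X(2) inX] carriers by simp
      show "frobenius (lam - r2 - 1) (g \<nu>) (\<lambda>y. exp ((r1 - r2 - 1) * lg J (y + e)) * w j (\<eta> + 1 / (y + e)) $ \<nu> / (T $$ (\<nu>, \<nu>) - c))"
        if "\<nu> < n" for \<nu>
        using g(1)[OF that] unfolding s' \<kappa>_def .
      show "G 0 $ \<nu> = k * g \<nu> 0" if \<nu>: "\<nu> < n" for \<nu>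
      proof (cases "\<nu> = \<nu>0")
        case True
        have "exp (- (\<kappa> * \<omega> - s * (\<i> * pi + 2 * \<omega>))) * exp (\<kappa> * \<omega> - s * (\<i> * pi + 2 * \<omega>)) = 1"
          by (simp flip: exp_add)
        moreover have "e \<noteq> 0" by (simp add: e_def)
        ultimately show ?thesis
          using True \<nu>0 g(2)[OF \<nu>0(1)] by (simp add: G(2) H(2) k_def e_def[symmetric])
      next
        case False
        then show ?thesis using \<nu> \<nu>0 g(2)[OF \<nu>] by (simp add: G(2) H(2))
      qed
      show "D \<nu> m = 0" if "second_order_rec n (\<lambda>\<nu> \<mu>. A $$ (\<nu>, \<mu>)) (\<lambda>\<nu>. T $$ (\<nu>, \<nu>) - c) e r1 r2 lam D"
        "\<And>\<nu>. \<nu> < n \<Longrightarrow> D \<nu> 0 = 0" "\<nu> < n" for D \<nu> m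
      proof (rule second_order_rec_unique_nonzero[OF that(1) _ that(2) _ _ _ that(3)])
        show "e \<noteq> 0" by (simp add: e_def)
        show "lam + of_nat m \<noteq> 0" for m
        proof
          assume "lam + of_nat m = 0"
          then have "lam = - of_nat m" by (simp only: add_eq_0_iff2)
          then show False using ni(1) by simp
        qed
        show "A $$ (\<nu>, \<mu>) = 0" if "\<nu> < n" "\<mu> < n" "T $$ (\<nu>, \<nu>) - c = e" "T $$ (\<mu>, \<mu>) - c = e" "\<nu> \<noteq> \<mu>" for \<nu> \<mu>
          using block[OF that(1,2) _ _ that(5)] that(3,4) by (simp add: e_def algebra_simps)
        show "lam + of_nat (Suc m) \<noteq> A $$ (\<nu>, \<nu>)" if "\<nu> < n" "T $$ (\<nu>, \<nu>) - c = e" for \<nu> m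
          using nores[OF that(1)] that(2) by (simp add: e_def algebra_simps)
      qed
      show "lam + 1 \<notin> \<int>\<^sub>\<le>\<^sub>0"
      proof
        assume "lam + 1 \<in> \<int>\<^sub>\<le>\<^sub>0"
        then have "lam + 1 - 1 \<in> \<int>" by (intro Ints_diff nonpos_Ints_Int Ints_1)
        then show False using ni(1) by simp
      qed
    qed
    \<comment> \<open>s is lam - r2 with 1 subtracted; this leaves a factor exp (- i pi), which
      cancels the minus sign of \<open>connection_coefficients\<close>.\<close>
    have "- k = exp (pi * \<i> * (lam - r2)) * exp ((2 * lam - \<rho> 1 - \<rho> 2) * \<omega>)"
    proof -
      have "k = exp (- (\<kappa> * \<omega> - s * (\<i> * pi + 2 * \<omega>)) + \<omega>)" unfolding k_def e_def by (simp only: exp_add)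
      also have "- (\<kappa> * \<omega> - s * (\<i> * pi + 2 * \<omega>)) + \<omega>
          = pi * \<i> * (lam - r2) + (2 * lam - (\<rho> 1 + \<rho> 2)) * \<omega> + (- (\<i> * pi))"
        unfolding rsum by (simp add: \<kappa>_def s_def algebra_simps)
      also have "exp \<dots> = exp (pi * \<i> * (lam - r2)) * exp ((2 * lam - (\<rho> 1 + \<rho> 2)) * \<omega>) * exp (- (\<i> * pi))"
        by (simp only: exp_add)
      also have "exp (- (\<i> * complex_of_real pi)) = - 1" by (simp add: exp_minus)
      finally show ?thesis by (simp add: diff_diff_eq)
    qed
    then show ?thesis unfolding main r1_def[symmetric] r2_def[symmetric]
      by (metis (no_types, lifting) minus_mult_left mult.assoc times_divide_eq_right)
  qed
  show ?thesis
    unfolding C[OF x \<nu>] sum_two_families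
    by (intro arg_cong2[where f="(+)"] sum.cong refl arg_cong2[where f="(*)"] Cj) auto
qed

text \<open>The case e = 0. The leading vector lies in the lower half, so the upper half starts one
  order later, with exponent e0 + 1, and its first coefficient \<open>G 1\<close> has to be computed
  from the system. No translation occurs, and the kernel is expanded from infinity in zeta.\<close>

lemma connection_at_center:
  assumes inf: "solutions_at_infinity U_inf" and sol: "okubo_solution TT AA S U"
    and exU: "expands_at c J (\<rho> 1 + \<rho> 2 - \<mu>0) (unit_vec (2 * n) (n + \<nu>0)) S U"
    and \<nu>0: "\<nu>0 < n"
    and \<tau>0: "\<And>\<nu>. \<nu> < n \<Longrightarrow> T $$ (\<nu>, \<nu>) \<noteq> c"
    and T': "T' \<in> carrier_mat n n" "\<And>\<nu> \<mu>. \<nu> < n \<Longrightarrow> \<mu> < n \<Longrightarrow> \<nu> \<noteq> \<mu> \<Longrightarrow> T' $$ (\<nu>, \<mu>) = 0"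
      "\<And>\<nu>. \<nu> < n \<Longrightarrow> T' $$ (\<nu>, \<nu>) = \<eta> + 1 / (T $$ (\<nu>, \<nu>) - c)"
    and w: "\<And>j. j \<in> {1, 2} \<Longrightarrow> \<epsilon> j > 0 \<and>
        okubo_solution T' ((- \<rho> (3 - j) - 1) \<cdot>\<^sub>m 1\<^sub>m n + A) (sector \<eta> {- b <..< - a} \<union> ball \<eta> (\<epsilon> j)) (w j)"
      "\<And>j. j \<in> {1, 2} \<Longrightarrow> expands_at_infinity \<eta> {- b <..< - a} (- \<rho> (3 - j) - 1 + \<mu>0)
        (P *\<^sub>v unit_vec n \<nu>0) (sector \<eta> {- b <..< - a}) (w j)"
    and diag_A': "\<And>\<nu> \<mu>. \<nu> < n \<Longrightarrow> \<mu> < n \<Longrightarrow> \<nu> \<noteq> \<mu> \<Longrightarrow> A' $$ (\<nu>, \<mu>) = 0"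
    and nores: "\<And>\<nu> m. \<nu> < n \<Longrightarrow> \<mu>0 - of_nat (Suc m) \<noteq> A' $$ (\<nu>, \<nu>)"
    and ni: "\<rho> 1 + \<rho> 2 - \<mu>0 + 1 \<notin> \<int>\<^sub>\<le>\<^sub>0" "\<And>j. j \<in> {1, 2} \<Longrightarrow> \<rho> j - \<mu>0 \<notin> \<int>"
    and x: "x \<in> S" and \<nu>: "\<nu> < 2 * n"
  shows "U x $ \<nu> = (\<Sum>j\<in>{1, 2}. \<Sum>h = 1..n.
      (Gamma (\<rho> j - \<rho> (3 - j)) * Gamma (\<rho> 1 + \<rho> 2 - \<mu>0 + 1) / (Gamma (\<rho> j + 1) * Gamma (\<rho> j - \<mu>0 + 1)))
      * gamma_coeff Pinv T' \<eta> h (w j) * U_inf j h x $ \<nu>)"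
proof -
  define e0 where "e0 = \<rho> 1 + \<rho> 2 - \<mu>0"
  obtain G R where G: "R > 0" "G 0 = unit_vec (2 * n) (n + \<nu>0)"
    "\<And>x k. x \<in> S \<Longrightarrow> norm (x - c) < R \<Longrightarrow> k < 2 * n \<Longrightarrow>
      (\<lambda>m. powr_arg (arg_in J (x - c)) (x - c) e0 * (G m $ k * (x - c) ^ m)) sums (U x $ k)"
    using exU unfolding expands_at_def e0_def by auto
  have fU: "frobenius e0 (\<lambda>m. G m $ k) (\<lambda>y. U (c + y) $ k)" if k: "k < 2 * n" for k
    unfolding frobenius_def
  proof (intro exI[of _ R] conjI ballI impI G(1))
    fix y assume y: "y \<in> sector 0 J" "norm y < R"
    show "(\<lambda>m. pw e0 y * (G m $ k * y ^ m)) sums (U (c + y) $ k)"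
      using G(3)[of "c + y" k] y k sector_shift by (simp add: powr_arg_lg pw_def)
  qed
  have G0: "G 0 $ k = 0" if "k < n" for k using that \<nu>0 by (simp add: G(2))
  have e01: "e0 + 1 \<noteq> 0" using ni(1) by (auto simp: e0_def)
  \<comment> \<open>Index 1 of the upper equations multiplied by y. The term with A drops out since
    the upper part of G 0 is 0, and the lower part of G 0 selects the column \<nu>0 of P.\<close>
  have G1: "G 1 $ k = - 1 / (e0 + 1) * (P $$ (k, \<nu>0) / (T $$ (k, k) - c))" if k: "k < n" for k
  proof -
    let ?D = "\<lambda>y. y * deriv (\<lambda>y. U (c + y) $ k) y" and ?d = "\<lambda>m. (e0 + of_nat m) * G m $ k"
    have D: "frobenius e0 ?d ?D" using k by (intro frobenius_euler fU) auto
    have 1: "frobenius e0 (\<lambda>m. shift_coeff ?d m + (- (T $$ (k, k) - c)) * ?d m) (\<lambda>y. y * ?D y + (- (T $$ (k, k) - c)) * ?D y)"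
      by (intro frobenius_add frobenius_cmult frobenius_mult_var' D)
    have 2: "frobenius e0 (shift_coeff (\<lambda>m. apply_A (\<lambda>\<mu>. G m $ \<mu>) k + (\<Sum>\<mu><n. P $$ (k, \<mu>) * G m $ (n + \<mu>))))
        (\<lambda>y. y * (apply_A (\<lambda>\<mu>. U (c + y) $ \<mu>) k + lower U k (c + y)))"
      unfolding lower_def
      by (intro frobenius_mult_var' frobenius_add frobenius_mat_apply frobenius_sum frobenius_cmult fU) auto
    have eq: "y * (apply_A (\<lambda>\<mu>. U (c + y) $ \<mu>) k + lower U k (c + y)) = y * ?D y + (- (T $$ (k, k) - c)) * ?D y"
      if y: "y \<in> sector 0 J" for y
    proof -
      have m: "c + y \<in> S" using y sector_shift by blast
      have d: "deriv (\<lambda>y. U (c + y) $ k) y = deriv (\<lambda>x. U x $ k) (c + y)"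
        using deriv_translate[OF solution_facts(1)[OF sol, of k] open_S, of y c] m k by (simp add: add.commute)
      show ?thesis unfolding reduced_system(1)[OF sol k m, symmetric] d by (simp add: algebra_simps)
    qed
    from frobenius_unique[OF 1 frobenius_cong[OF eq 2], of 1]
    have "shift_coeff ?d 1 + (- (T $$ (k, k) - c)) * ?d 1 = apply_A (\<lambda>\<mu>. G 0 $ \<mu>) k + (\<Sum>\<mu><n. P $$ (k, \<mu>) * G 0 $ (n + \<mu>))"
      by simp
    moreover have "apply_A (\<lambda>\<mu>. G 0 $ \<mu>) k = 0"
      using mat_apply_cong[of n "\<lambda>\<mu>. G 0 $ \<mu>" "\<lambda>_. 0"] G0 by (simp add: mat_apply_zero)
    moreover have "(\<Sum>\<mu><n. P $$ (k, \<mu>) * G 0 $ (n + \<mu>)) = P $$ (k, \<nu>0)"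
    proof -
      have "(\<Sum>\<mu><n. P $$ (k, \<mu>) * G 0 $ (n + \<mu>)) = (\<Sum>\<mu>\<in>{\<nu>0}. P $$ (k, \<mu>) * G 0 $ (n + \<mu>))"
        using \<nu>0 by (intro sum.mono_neutral_right) (auto simp: G(2))
      then show ?thesis using \<nu>0 by (simp add: G(2))
    qed
    ultimately have "- (T $$ (k, k) - c) * ((e0 + 1) * G 1 $ k) = P $$ (k, \<nu>0)" using G0[OF k] by simp
    then have P0: "P $$ (k, \<nu>0) = - (T $$ (k, k) - c) * ((e0 + 1) * G 1 $ k)" by simp
    have field: "v = - 1 / z * (- q * (z * v) / q)" if "z \<noteq> 0" "q \<noteq> 0" for q v z :: complex
      using that by simp
    show ?thesis unfolding P0 by (rule field[OF e01]) (use \<tau>0[OF k] in simp)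
  qed
  have fU1: "frobenius (e0 + 1) (\<lambda>m. G (Suc m) $ k) (\<lambda>y. U (c + (y + 0)) $ k)" if k: "k < n" for k
    using frobenius_drop[OF fU G0[OF k]] k by simp
  obtain C :: "nat \<Rightarrow> nat \<Rightarrow> complex" where C: "\<And>x \<nu>. x \<in> S \<Longrightarrow> \<nu> < 2 * n \<Longrightarrow>
    U x $ \<nu> = (\<Sum>h<n. C 1 h * U_inf 1 (Suc h) x $ \<nu>) + (\<Sum>h<n. C 2 h * U_inf 2 (Suc h) x $ \<nu>)"
  proof (rule basis_expansion[OF inf sol])
    fix C :: "nat \<Rightarrow> nat \<Rightarrow> complex"
    assume "\<And>x \<nu>. x \<in> S \<Longrightarrow> \<nu> < 2 * n \<Longrightarrow>
      U x $ \<nu> = (\<Sum>h<n. C 1 h * U_inf 1 (Suc h) x $ \<nu>) + (\<Sum>h<n. C 2 h * U_inf 2 (Suc h) x $ \<nu>)"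
    then show ?thesis by (rule that[of C])
  qed
  have Cj: "C j h = (Gamma (\<rho> j - \<rho> (3 - j)) * Gamma (\<rho> 1 + \<rho> 2 - \<mu>0 + 1) / (Gamma (\<rho> j + 1) * Gamma (\<rho> j - \<mu>0 + 1)))
      * gamma_coeff Pinv T' \<eta> (Suc h) (w j)" if j: "j \<in> {1, 2}" and h: "h < n" for j h
  proof -
    define r1 r2 where "r1 = \<rho> j" and "r2 = \<rho> (3 - j)"
    have rsum: "\<rho> 1 + \<rho> 2 = r1 + r2" using j by (auto simp: r1_def r2_def)
    have e0r: "e0 = r1 + r2 - \<mu>0" unfolding e0_def rsum ..
    define X where "X = sector \<eta> {- b <..< - a} \<union> ball \<eta> (\<epsilon> j)"
    define s where "s = - r2 - 1 + \<mu>0"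
    define \<kappa> where "\<kappa> = r1 - r2 - 1"
    have \<eta>X: "\<eta> \<in> X" and wX: "okubo_solution T' ((- r2 - 1) \<cdot>\<^sub>m 1\<^sub>m n + A) X (w j)"
      using w(1)[OF j] by (auto simp: X_def r2_def)
    have inX: "\<eta> + 1 / x \<in> X" if "x \<in> sector 0 J" for x using inverse_sector[OF that] by (auto simp: X_def)
    have dimP: "dim_vec (P *\<^sub>v unit_vec n \<nu>0) = n" using carriers by simp
    obtain H R' where H: "H 0 = P *\<^sub>v unit_vec n \<nu>0"
      "\<And>\<zeta> k. \<zeta> \<in> sector \<eta> {- b <..< - a} \<Longrightarrow> norm (\<zeta> - \<eta>) > R' \<Longrightarrow> k < n \<Longrightarrow>
        (\<lambda>m. powr_arg (arg_in {- b <..< - a} (\<zeta> - \<eta>)) (\<zeta> - \<eta>) s * (H m $ k * inverse (\<zeta> - \<eta>) ^ m)) sums (w j \<zeta> $ k)"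
      using w(2)[OF j] unfolding expands_at_infinity_def s_def r2_def dimP by blast
    have H0: "H 0 $ k = P $$ (k, \<nu>0)" if k: "k < n" for k
    proof -
      have "H 0 $ k = (\<Sum>\<mu><n. P $$ (k, \<mu>) * unit_vec n \<nu>0 $ \<mu>)"
        unfolding H(1) by (rule mult_mat_vec_entry[OF carriers(2) _ k]) simp
      also have "\<dots> = (\<Sum>\<mu>\<in>{\<nu>0}. P $$ (k, \<mu>) * unit_vec n \<nu>0 $ \<mu>)"
        using \<nu>0 by (intro sum.mono_neutral_right) auto
      finally show ?thesis using \<nu>0 by simp
    qed
    have fB: "frobenius (\<kappa> - s) (\<lambda>m. H m $ k / (T $$ (k, k) - c))
        (\<lambda>x. exp (\<kappa> * lg J x) * w j (\<eta> + 1 / x) $ k / (T $$ (k, k) - c))" if k: "k < n" for k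
    proof (rule kernel_frobenius_infinity[where w="\<lambda>\<zeta>. w j \<zeta> $ k"])
      fix x assume x: "x \<in> sector 0 J" "norm (1 / x) > R'"
      show "(\<lambda>m. exp (s * - lg J x) * (H m $ k * inverse (1 / x) ^ m)) sums w j (\<eta> + 1 / x) $ k"
        using H(2)[OF inverse_sector[OF x(1)] _ k] x lg_inverse(2)[OF J(1,3) x(1)] by (simp add: powr_arg_lg)
    qed
    have l_ni: "e0 + 1 - r2 \<notin> \<int>"
    proof
      assume "e0 + 1 - r2 \<in> \<int>"
      then have "e0 + 1 - r2 - 1 \<in> \<int>" by (rule Ints_diff[OF _ Ints_1])
      moreover have "e0 + 1 - r2 - 1 = \<rho> j - \<mu>0" by (simp add: e0r r1_def)
      ultimately show False using ni(2)[OF j] by simp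
    qed
    have m0: "e0 + 1 + of_nat m \<noteq> 0" for m
    proof
      assume "e0 + 1 + of_nat m = 0"
      then have "e0 + 1 = - of_nat m" by (simp only: add_eq_0_iff2)
      then have "e0 + 1 \<in> \<int>\<^sub>\<le>\<^sub>0" by (simp only: minus_of_nat_in_nonpos_Ints)
      then show False using ni(1) by (simp add: e0_def)
    qed
    have main: "C j h = - ((- 1 / (e0 + 1)) * Gamma (r1 - r2) * Gamma (e0 + 1 + 1) / (Gamma (r1 + 1) * Gamma (e0 + 1 - r2)))
        * gamma_coeff Pinv T' \<eta> (Suc h) (w j)"
    proof (rule connection_coefficients[OF inf sol C j r1_def r2_def _ _ \<tau>0 T' _ _ _ _ _ fU1 _ _ _ l_ni _ h,
          where D="sector \<eta> {- b <..< - a}" and g="\<lambda>k m. H m $ k / (T $$ (k, k) - c)"])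
      show "y + 0 \<in> sector 0 J" "lg J (y + 0) = lg J y + Ln (1 + 0 / y)" if "y \<in> sector 0 J" for y using that by simp_all
      show "open (sector \<eta> {- b <..< - a})" by (intro open_sector) auto
      show "\<eta> + 1 / x \<in> sector \<eta> {- b <..< - a}" if "x \<in> sector 0 J" for x using inverse_sector[OF that] .
      show "okubo_solution T' ((- r2 - 1) \<cdot>\<^sub>m 1\<^sub>m n + A) (sector \<eta> {- b <..< - a}) (w j)"
        using okubo_solution_subset[OF wX] by (simp add: X_def)
      show "w j \<eta> \<in> carrier_vec n"
        using wX \<eta>X carriers unfolding okubo_solution_def Let_def by auto
      show "((\<lambda>x. w j (\<eta> + 1 / x) $ \<nu>) \<longlongrightarrow> w j \<eta> $ \<nu>) (inf at_infinity (principal (sector 0 J)))" if "\<nu> < n" for \<nu>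
        using value_at_infinity[OF wX _ that \<eta>X inX] carriers by simp
      have eqe: "e0 + 1 - r2 - 1 = \<kappa> - s" by (simp add: \<kappa>_def s_def e0r)
      show "frobenius (e0 + 1 - r2 - 1) (\<lambda>m. H m $ \<nu> / (T $$ (\<nu>, \<nu>) - c))
          (\<lambda>y. exp ((r1 - r2 - 1) * lg J (y + 0)) * w j (\<eta> + 1 / (y + 0)) $ \<nu> / (T $$ (\<nu>, \<nu>) - c))"
        if "\<nu> < n" for \<nu>
        unfolding eqe using fB[OF that] by (simp add: \<kappa>_def)
      show "G (Suc 0) $ \<nu> = - 1 / (e0 + 1) * (H 0 $ \<nu> / (T $$ (\<nu>, \<nu>) - c))" if \<nu>: "\<nu> < n" for \<nu>
        using G1[OF \<nu>] H0[OF \<nu>] by simp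
      show "D \<nu> m = 0" if rec: "second_order_rec n (\<lambda>\<nu> \<mu>. A $$ (\<nu>, \<mu>)) (\<lambda>\<nu>. T $$ (\<nu>, \<nu>) - c) 0 r1 r2 (e0 + 1) D"
        and D0: "\<And>\<nu>. \<nu> < n \<Longrightarrow> D \<nu> 0 = 0" and \<nu>: "\<nu> < n" for D \<nu> m
      proof (rule second_order_rec_unique_zero[where ?\<mu>0.0=\<mu>0 and D=D, OF _ D0 _ _ _ \<nu>])
        show "second_order_rec n (\<lambda>\<nu> \<mu>. A $$ (\<nu>, \<mu>)) (\<lambda>\<nu>. T $$ (\<nu>, \<nu>) - c) 0 r1 r2 (r1 + r2 - \<mu>0 + 1) D"
          using rec by (simp add: e0r)
        show "T $$ (\<nu>, \<nu>) - c \<noteq> 0" if "\<nu> < n" for \<nu> using \<tau>0[OF that] by simp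
        show "r1 + r2 - \<mu>0 + 1 + of_nat m \<noteq> 0" for m using m0[of m] by (simp add: e0r)
        \<comment> \<open>A is similar to the diagonal matrix A', none of whose entries equals
          \<mu>0 - (m + 1); so this number is no eigenvalue of A.\<close>
        show "f \<nu> = 0" if f: "\<And>\<nu>. \<nu> < n \<Longrightarrow> apply_A f \<nu> = (\<mu>0 - of_nat (Suc m)) * f \<nu>" and \<nu>: "\<nu> < n" for f m \<nu>
        proof -
          let ?f = "entry_apply Pinv f"
          have dims: "dim_row Pinv = n" "dim_row P = n" "dim_row A' = n" using carriers by auto
          have z: "?f k = 0" if k: "k < n" for k
          proof -
            have AP: "A * P \<in> carrier_mat n n" using carriers by auto
            have PAP: "Pinv * (A * P) = A'" using diag_A carriers by (simp add: assoc_mult_mat[of _ n n _ n _ n])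
            have PPf: "entry_apply P ?f \<mu> = f \<mu>" if "\<mu> < n" for \<mu>
              using entry_apply_mult[OF carriers(2,3) that, of f] inverse_P(1) entry_apply_one[OF that, of f] by simp
            have "entry_apply A' ?f k = entry_apply Pinv (entry_apply (A * P) ?f) k"
              unfolding PAP[symmetric] by (rule entry_apply_mult[OF carriers(3) AP k])
            also have "\<dots> = entry_apply Pinv (\<lambda>\<mu>. (\<mu>0 - of_nat (Suc m)) * f \<mu>) k"
            proof (rule mat_apply_cong)
              fix \<mu> assume "\<mu> < dim_row Pinv"
              then have \<mu>: "\<mu> < n" by (simp add: dims)
              have "entry_apply (A * P) ?f \<mu> = apply_A (entry_apply P ?f) \<mu>"
                using entry_apply_mult[OF carriers(1,2) \<mu>] entry_apply_A by simp
              also have "\<dots> = apply_A f \<mu>" by (intro mat_apply_cong PPf)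
              finally show "entry_apply (A * P) ?f \<mu> = (\<mu>0 - of_nat (Suc m)) * f \<mu>" using f[OF \<mu>] by simp
            qed
            also have "\<dots> = (\<mu>0 - of_nat (Suc m)) * ?f k" by (rule mat_apply_cmult)
            finally have 1: "entry_apply A' ?f k = (\<mu>0 - of_nat (Suc m)) * ?f k" .
            have "entry_apply A' ?f k = (\<Sum>\<mu>\<in>{k}. A' $$ (k, \<mu>) * ?f \<mu>)"
              unfolding mat_apply_def dims using k diag_A' by (intro sum.mono_neutral_right) auto
            then have 2: "entry_apply A' ?f k = A' $$ (k, k) * ?f k" by simp
            show ?thesis using 1[unfolded 2] nores[OF k, of m] by (metis mult_right_cancel)
          qed
          have "f \<nu> = entry_apply P ?f \<nu>"
            using entry_apply_mult[OF carriers(2,3) \<nu>, of f] inverse_P(1) entry_apply_one[OF \<nu>, of f] by simp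
          also have "\<dots> = entry_apply P (\<lambda>_. 0) \<nu>" by (intro mat_apply_cong z) (simp add: dims)
          finally show ?thesis by (simp add: mat_apply_zero)
        qed
      qed
      show "e0 + 1 + 1 \<notin> \<int>\<^sub>\<le>\<^sub>0"
      proof
        assume "e0 + 1 + 1 \<in> \<int>\<^sub>\<le>\<^sub>0"
        then have "e0 + 1 \<in> \<int>\<^sub>\<le>\<^sub>0" by (rule plus_one_in_nonpos_Ints_imp)
        then show False using ni(1) by (simp add: e0_def)
      qed
    qed
    \<comment> \<open>The factor e0 + 1 cancels against the constant in \<open>G 1\<close>, which
      lowers the argument of Gamma by one.\<close>
    have g: "Gamma (e0 + 1 + 1) = (e0 + 1) * Gamma (e0 + 1)" by (rule Gamma_plus1[OF ni(1)[folded e0_def]])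
    have l: "e0 + 1 - r2 = r1 - \<mu>0 + 1" by (simp add: e0r)
    have field: "- (- 1 / z * X * (z * Y) / W) = X * Y / W" if "z \<noteq> 0" for z X Y W :: complex
      using that by simp
    show ?thesis
      unfolding main g l field[OF e01] unfolding r1_def r2_def e0_def ..
  qed
  show ?thesis
    unfolding C[OF x \<nu>] sum_two_families
    by (intro arg_cong2[where f="(+)"] sum.cong refl arg_cong2[where f="(*)"] Cj) auto
qed

end

section \<open>Position of the singular points\<close>

text \<open>Inversion changes the sign of arguments, so min and max are exchanged and each sector
  corresponds to the one with the opposite sign. The last claim records that no \<theta> of a
  neighbouring ray is reached.\<close>

lemma sector_args_interval:
  fixes \<theta> :: "nat \<Rightarrow> real"
  assumes i: "i \<in> {1..p}" and \<delta>: "\<delta> > 0" "\<And>i. i \<in> {0..p} \<Longrightarrow> \<delta> < \<theta> (i + 1) - \<theta> i"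
  obtains a b where "sector_args \<theta> \<delta> s i = {a<..<b}" "a < b" "b - a \<le> pi" "a = \<theta> i \<or> b = \<theta> i"
    "sector_args' (\<lambda>i. - \<theta> i) \<delta> (opposite s) i = {- b <..< - a}"
    "sector_args \<theta> \<delta> s i \<subseteq> side_args \<theta> s i"
    "\<forall>\<phi>\<in>{a<..<b}. \<theta> i < \<phi> \<and> \<phi> < \<theta> (i + 1) \<or> \<theta> (i - 1) < \<phi> \<and> \<phi> < \<theta> i"
proof (cases s)
  case Plus
  show ?thesis
  proof (rule that[of "\<theta> i" "min (\<theta> (i + 1) - \<delta>) (\<theta> i + pi)"])
    have "\<delta> < \<theta> (i + 1) - \<theta> i" using \<delta>(2)[of i] i by auto
    then show "\<theta> i < min (\<theta> (i + 1) - \<delta>) (\<theta> i + pi)" by (simp add: min_def)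
    show "sector_args' (\<lambda>i. - \<theta> i) \<delta> (opposite s) i = {- min (\<theta> (i + 1) - \<delta>) (\<theta> i + pi) <..< - \<theta> i}"
    proof -
      have e: "- (\<theta> i + pi) = - \<theta> i - pi" "- (\<theta> (i + 1) - \<delta>) = - \<theta> (i + 1) + \<delta>" by simp_all
      show ?thesis by (simp only: Plus opposite.simps sector_args'.simps minus_min_eq_max e)
    qed
  qed (use Plus \<delta>(1) in \<open>auto simp: min_def split: if_splits\<close>)
next
  case Minus
  show ?thesis
  proof (rule that[of "max (\<theta> (i - 1) + \<delta>) (\<theta> i - pi)" "\<theta> i"])
    have "\<delta> < \<theta> (i - 1 + 1) - \<theta> (i - 1)" using \<delta>(2)[of "i - 1"] i by auto
    then show "max (\<theta> (i - 1) + \<delta>) (\<theta> i - pi) < \<theta> i" using i by (simp add: max_def)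
    show "sector_args' (\<lambda>i. - \<theta> i) \<delta> (opposite s) i = {- \<theta> i <..< - max (\<theta> (i - 1) + \<delta>) (\<theta> i - pi)}"
    proof -
      have e: "- (\<theta> (i - 1) + \<delta>) = - \<theta> (i - 1) - \<delta>" "- (\<theta> i - pi) = - \<theta> i + pi" by simp_all
      show ?thesis by (simp only: Minus opposite.simps sector_args'.simps minus_max_eq_min e)
    qed
  qed (use Minus \<delta>(1) in \<open>auto simp: max_def split: if_splits\<close>)
qed

text \<open>An argument in J and \<theta> k differ by less than 2 pi, so they would have to be
  equal; but J lies strictly between two neighbouring values of \<theta>.\<close>

lemma ray_notin_sector:
  fixes \<theta> :: "nat \<Rightarrow> real"
  assumes \<theta>: "\<And>i. i \<in> {1..p} \<Longrightarrow> is_Arg (t i - c) (\<theta> i)"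
    and mono: "strict_mono_on {1..p + 1} \<theta>" and bound: "\<theta> (p + 1) < \<theta> 1 + 2 * pi" and \<theta>0: "\<theta> 0 = \<theta> (p + 1) - 2 * pi"
    and i: "i \<in> {1..p}" and k: "k \<in> {1..p}"
    and J: "\<And>\<phi>. \<phi> \<in> J \<Longrightarrow> \<theta> i < \<phi> \<and> \<phi> < \<theta> (i + 1) \<or> \<theta> (i - 1) < \<phi> \<and> \<phi> < \<theta> i"
  shows "t k \<notin> sector c J"
proof
  assume "t k \<in> sector c J"
  then obtain \<phi> where \<phi>: "t k \<noteq> c" "\<phi> \<in> J" "is_Arg (t k - c) \<phi>" by (auto simp: sector_def)
  have le: "\<theta> x \<le> \<theta> y" if "x \<in> {1..p+1}" "y \<in> {1..p+1}" "x \<le> y" for x y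
    using mono that by (metis strict_mono_on_leD)
  have kr: "\<theta> 1 \<le> \<theta> k" "\<theta> k < \<theta> (p + 1)"
    using le[of 1 k] k mono by (auto simp: strict_mono_on_def)
  consider "\<theta> i < \<phi>" "\<phi> < \<theta> (i + 1)" | "\<theta> (i - 1) < \<phi>" "\<phi> < \<theta> i" using J[OF \<phi>(2)] by blast
  then show False
  proof cases
    case 1
    have ir: "\<theta> 1 \<le> \<theta> i" "\<theta> (i + 1) \<le> \<theta> (p + 1)" using le[of 1 i] le[of "i + 1" "p + 1"] i by auto
    have "\<bar>\<phi> - \<theta> k\<bar> < 2 * pi" using 1 ir kr bound by linarith
    then have "\<phi> = \<theta> k" using is_Arg_eqI[OF \<phi>(3) \<theta>[OF k]] \<phi>(1) by simp
    then show False using 1 le[of k i] le[of "i + 1" k] i k by (cases "k \<le> i") auto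
  next
    case 2
    show False
    \<comment> \<open>The index 0 is outside the range of monotonicity; there \<theta> 0 = \<theta>
      (p + 1) - 2 pi gives the bound.\<close>
    proof (cases "i = 1")
      case True
      have "\<bar>\<phi> - \<theta> k\<bar> < 2 * pi" using 2 kr bound \<theta>0 True by (simp add: abs_less_iff)
      then have "\<phi> = \<theta> k" using is_Arg_eqI[OF \<phi>(3) \<theta>[OF k]] \<phi>(1) by simp
      then show False using 2 kr True by simp
    next
      case False
      then have i1: "i - 1 \<in> {1..p+1}" "i \<in> {1..p+1}" using i by auto
      have ir: "\<theta> 1 \<le> \<theta> (i - 1)" "\<theta> i \<le> \<theta> (p + 1)" using le[of 1 "i - 1"] le[of i "p + 1"] i1 by auto
      have "\<bar>\<phi> - \<theta> k\<bar> < 2 * pi" using 2 ir kr bound by linarith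
      then have "\<phi> = \<theta> k" using is_Arg_eqI[OF \<phi>(3) \<theta>[OF k]] \<phi>(1) by simp
      moreover have "k \<le> i - 1 \<or> i \<le> k" by linarith
      ultimately show False using 2 le[of k "i - 1"] le[of i k] i1 k by auto
    qed
  qed
qed


text \<open>A slit point corresponds under inversion to a point of the segment from c to t k. It has
  the same direction from c as t k, so the sector would contain t k as well.\<close>

lemma sector_subset_slit_plane:
  assumes "\<And>k. k \<in> {1..p} \<Longrightarrow> t k \<noteq> c" "\<And>k. k \<in> {1..p} \<Longrightarrow> t k \<notin> sector c {a<..<b}"
  shows "sector \<eta> {- b <..< - a} \<subseteq> slit_plane p (\<lambda>k. \<eta> + 1 / (t k - c)) \<eta>"
    and "\<eta> \<in> slit_plane p (\<lambda>k. \<eta> + 1 / (t k - c)) \<eta>"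
proof -
  show "sector \<eta> {- b <..< - a} \<subseteq> slit_plane p (\<lambda>k. \<eta> + 1 / (t k - c)) \<eta>"
  proof
    fix z assume "z \<in> sector \<eta> {- b <..< - a}"
    then obtain v where v: "z = \<eta> + exp v" "Im v \<in> {- b <..< - a}" by (auto simp: sector_exp)
    show "z \<in> slit_plane p (\<lambda>k. \<eta> + 1 / (t k - c)) \<eta>"
    proof (rule ccontr)
      assume "z \<notin> slit_plane p (\<lambda>k. \<eta> + 1 / (t k - c)) \<eta>"
      then obtain k s where k: "k \<in> {1..p}" "s \<ge> 1" "z = \<eta> + 1 / (t k - c) * complex_of_real s"
        unfolding slit_plane_def by auto
      have e: "exp v = of_real s / (t k - c)" using v(1) k(3) by simp
      have "t k - c = of_real s * exp (- v)"
        using assms(1)[OF k(1)] unfolding exp_minus e using k(2) by (simp add: field_simps)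
      also have "\<dots> = exp (of_real (ln s) - v)"
        using k(2) by (simp add: exp_diff exp_minus exp_of_real divide_inverse)
      finally have "t k = c + exp (of_real (ln s) - v)" by (simp add: algebra_simps)
      moreover have "Im (of_real (ln s) - v) \<in> {a<..<b}" using v(2) by auto
      ultimately show False using assms(2)[OF k(1)] unfolding sector_exp by blast
    qed
  qed
  show "\<eta> \<in> slit_plane p (\<lambda>k. \<eta> + 1 / (t k - c)) \<eta>"
    using assms(1) by (auto simp: slit_plane_def)
qed

text \<open>Each sector satisfies \<open>okubo_sector\<close>, and the block numbering is translated
  into positions of unit vectors. In the second half the condition on \<rho> 1 + \<rho> 2 - mu k + 1
  keeps Gamma off its poles and the exponents of the upper half away from 0.\<close>

theorem theorem7p4:
  fixes p q n :: nat
    and t t' :: "nat \<Rightarrow> complex"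
    and d r m :: "nat \<Rightarrow> nat"
    and l :: "nat \<Rightarrow> nat \<Rightarrow> nat"
    and lam :: "nat \<Rightarrow> nat \<Rightarrow> complex"
    and mu \<rho> :: "nat \<Rightarrow> complex"
    and \<eta>\<^sub>0 :: complex
    and \<theta> \<theta>' :: "nat \<Rightarrow> real"
    and \<delta> :: real
    and A P Pinv A' T T' TT AA :: "complex mat"
    and U_t U_last :: "side \<Rightarrow> nat \<Rightarrow> nat \<Rightarrow> nat \<Rightarrow> complex \<Rightarrow> complex vec"
    and U_inf :: "side \<Rightarrow> nat \<Rightarrow> nat \<Rightarrow> nat \<Rightarrow> complex \<Rightarrow> complex vec"
    and w_t :: "nat \<Rightarrow> nat \<Rightarrow> nat \<Rightarrow> complex \<Rightarrow> complex \<Rightarrow> complex vec"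
    and w_inf :: "side \<Rightarrow> nat \<Rightarrow> nat \<Rightarrow> nat \<Rightarrow> complex \<Rightarrow> complex \<Rightarrow> complex vec"
  defines "n \<equiv> (\<Sum>i = 1..p. d i)"
    and "T \<equiv> scalar_blocks p t d"
    and "A' \<equiv> scalar_blocks q mu m"
    and "TT \<equiv> four_block_mat T (0\<^sub>m n n) (0\<^sub>m n n) (t (p + 1) \<cdot>\<^sub>m 1\<^sub>m n)"
    and "AA \<equiv> four_block_mat A P
           (- ((A' - \<rho> 1 \<cdot>\<^sub>m 1\<^sub>m n) * (A' - \<rho> 2 \<cdot>\<^sub>m 1\<^sub>m n) * Pinv))
           ((\<rho> 1 + \<rho> 2) \<cdot>\<^sub>m 1\<^sub>m n - A')"
    and "t' \<equiv> \<lambda>i. \<eta>\<^sub>0 + 1 / (t i - t (p + 1))"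
    and "T' \<equiv> scalar_blocks p t' d"
    and "\<theta>' \<equiv> \<lambda>i. - \<theta> i"
  assumes p: "p \<ge> 1"
    and t_distinct: "inj_on t {1..p + 1}"
    and t_general: "\<And>a b c. \<lbrakk>a \<in> {1..p + 1}; b \<in> {1..p + 1}; c \<in> {1..p + 1};
          a \<noteq> b; b \<noteq> c; a \<noteq> c\<rbrakk> \<Longrightarrow> \<not> collinear {t a, t b, t c}"
    and d_pos: "\<And>i. i \<in> {1..p} \<Longrightarrow> d i \<ge> 1"
    and l_pos: "\<And>i k. \<lbrakk>i \<in> {1..p}; k \<in> {1..r i}\<rbrakk> \<Longrightarrow> l i k \<ge> 1"
    and l_sum: "\<And>i. i \<in> {1..p} \<Longrightarrow> (\<Sum>k = 1..r i. l i k) = d i"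
    and m_pos: "\<And>k. k \<in> {1..q} \<Longrightarrow> m k \<ge> 1"
    and m_sum: "(\<Sum>k = 1..q. m k) = n"
    and lam_distinct: "\<And>i. i \<in> {1..p} \<Longrightarrow> inj_on (lam i) {1..r i}"
    and mu_distinct: "inj_on mu {1..q}"
    and A: "A \<in> carrier_mat n n"
    and A_blocks: "\<And>i. i \<in> {1..p} \<Longrightarrow> diagonal_block d i A = scalar_blocks (r i) (lam i) (l i)"
    and P: "P \<in> carrier_mat n n" "Pinv \<in> carrier_mat n n" "P * Pinv = 1\<^sub>m n" "Pinv * P = 1\<^sub>m n"
    and A_diag: "Pinv * A * P = A'"
    and lam_nonint: "\<And>i k. \<lbrakk>i \<in> {1..p}; k \<in> {1..r i}\<rbrakk> \<Longrightarrow> lam i k \<notin> \<int>"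
    and lam_lam_nonint: "\<And>i k h. \<lbrakk>i \<in> {1..p}; k \<in> {1..r i}; h \<in> {1..r i}; k \<noteq> h\<rbrakk>
          \<Longrightarrow> lam i k - lam i h \<notin> \<int>"
    and mu_nonint: "\<And>k. k \<in> {1..q} \<Longrightarrow> mu k \<notin> \<int>"
    and mu_mu_nonint: "\<And>k h. \<lbrakk>k \<in> {1..q}; h \<in> {1..q}; k \<noteq> h\<rbrakk> \<Longrightarrow> mu k - mu h \<notin> \<int>"
    and lam_mu_nonint: "\<And>i k h. \<lbrakk>i \<in> {1..p}; k \<in> {1..r i}; h \<in> {1..q}\<rbrakk> \<Longrightarrow> lam i k - mu h \<notin> \<int>"
    and rho_nonint: "\<And>j. j \<in> {1, 2} \<Longrightarrow> \<rho> j \<notin> \<int>"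
    and rho_rho_nonint: "\<rho> 1 - \<rho> 2 \<notin> \<int>"
    and rho_lam_nonint: "\<And>j i k. \<lbrakk>j \<in> {1, 2}; i \<in> {1..p}; k \<in> {1..r i}\<rbrakk> \<Longrightarrow> \<rho> j - lam i k \<notin> \<int>"
    and rho_mu_nonint: "\<And>j k. \<lbrakk>j \<in> {1, 2}; k \<in> {1..q}\<rbrakk> \<Longrightarrow> \<rho> j - mu k \<notin> \<int>"
    and theta_arg: "\<And>i. i \<in> {1..p} \<Longrightarrow> is_Arg (t i - t (p + 1)) (\<theta> i)"
    and theta_mono: "strict_mono_on {1..p + 1} \<theta>"
    and theta_bound: "\<theta> (p + 1) < \<theta> 1 + 2 * pi"
    and theta_0: "\<theta> 0 = \<theta> (p + 1) - 2 * pi"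
    and delta: "\<delta> > 0" "\<And>i. i \<in> {0..p} \<Longrightarrow> \<delta> < \<theta> (i + 1) - \<theta> i"
    and U_t: "\<And>s i k h. \<lbrakk>i \<in> {1..p}; k \<in> {1..r i}; h \<in> {1..l i k}\<rbrakk> \<Longrightarrow>
          okubo_solution TT AA (sector (t (p + 1)) (sector_args \<theta> \<delta> s i)) (U_t s i k h) \<and>
          expands_at (t i) (side_args \<theta> s i) (lam i k)
            (unit_vec (2 * n) (offset d i + offset (l i) k + (h - 1)))
            (sector (t (p + 1)) (sector_args \<theta> \<delta> s i)) (U_t s i k h)"
    and U_inf: "\<And>s i j h. \<lbrakk>i \<in> {1..p}; j \<in> {1, 2}; h \<in> {1..n}\<rbrakk> \<Longrightarrow>
          okubo_solution TT AA (sector (t (p + 1)) (sector_args \<theta> \<delta> s i)) (U_inf s i j h) \<and>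
          expands_at_infinity (t (p + 1)) (sector_args \<theta> \<delta> s i) (\<rho> j)
            ((P *\<^sub>v unit_vec n (h - 1)) @\<^sub>v ((\<rho> j \<cdot>\<^sub>m 1\<^sub>m n - A') *\<^sub>v unit_vec n (h - 1)))
            (sector (t (p + 1)) (sector_args \<theta> \<delta> s i)) (U_inf s i j h)"
    and U_last: "\<And>s i k h. \<lbrakk>i \<in> {1..p}; k \<in> {1..q}; h \<in> {1..m k};
            \<rho> 1 + \<rho> 2 - mu k + 1 \<notin> \<int>\<^sub>\<le>\<^sub>0\<rbrakk> \<Longrightarrow>
          okubo_solution TT AA (sector (t (p + 1)) (sector_args \<theta> \<delta> s i)) (U_last s i k h) \<and>
          expands_at (t (p + 1)) (sector_args \<theta> \<delta> s i) (\<rho> 1 + \<rho> 2 - mu k)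
            (unit_vec (2 * n) (n + offset m k + (h - 1)))
            (sector (t (p + 1)) (sector_args \<theta> \<delta> s i)) (U_last s i k h)"
    and w_t: "\<And>i k h \<sigma>. \<lbrakk>i \<in> {1..p}; k \<in> {1..r i}; h \<in> {1..l i k};
            \<forall>i\<in>{1..p}. \<forall>k\<in>{1..r i}. \<sigma> + lam i k \<notin> \<int>\<rbrakk> \<Longrightarrow>
          okubo_solution T' (\<sigma> \<cdot>\<^sub>m 1\<^sub>m n + A) (slit_plane p t' \<eta>\<^sub>0) (w_t i k h \<sigma>) \<and>
          expands_at (t' i) {\<theta>' i - 2 * pi <..< \<theta>' i} (\<sigma> + lam i k)
            (unit_vec n (offset d i + offset (l i) k + (h - 1)))
            (slit_plane p t' \<eta>\<^sub>0) (w_t i k h \<sigma>)"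
    and w_inf: "\<And>s i k h \<sigma>. \<lbrakk>i \<in> {1..p}; k \<in> {1..q}; h \<in> {1..m k};
            \<forall>i\<in>{1..p}. \<forall>k\<in>{1..r i}. \<sigma> + lam i k \<notin> \<int>\<rbrakk> \<Longrightarrow>
          (\<exists>\<epsilon>>0. okubo_solution T' (\<sigma> \<cdot>\<^sub>m 1\<^sub>m n + A)
             (sector \<eta>\<^sub>0 (sector_args' \<theta>' \<delta> s i) \<union> ball \<eta>\<^sub>0 \<epsilon>) (w_inf s i k h \<sigma>)) \<and>
          expands_at_infinity \<eta>\<^sub>0 (sector_args' \<theta>' \<delta> s i) (\<sigma> + mu k)
            (P *\<^sub>v unit_vec n (offset m k + (h - 1)))
            (sector \<eta>\<^sub>0 (sector_args' \<theta>' \<delta> s i)) (w_inf s i k h \<sigma>)"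
  shows "(\<forall>i\<in>{1..p}. \<forall>k\<in>{1..r i}. \<forall>h\<in>{1..l i k}.
            let C = (\<lambda>j h'. let j' = 3 - j in
              exp (pi * \<i> * (lam i k - \<rho> j'))
              * powr_arg (\<theta> i) (t i - t (p + 1)) (2 * lam i k - \<rho> 1 - \<rho> 2)
              * (Gamma (\<rho> j - \<rho> j') * Gamma (lam i k + 1)
                 / (Gamma (\<rho> j + 1) * Gamma (lam i k - \<rho> j')))
              * gamma_coeff Pinv T' \<eta>\<^sub>0 h' (w_t i k h (- \<rho> j' - 1)))
            in \<forall>s. \<forall>x\<in>sector (t (p + 1)) (sector_args \<theta> \<delta> s i). \<forall>\<nu><2 * n.
                 U_t s i k h x $ \<nu> = (\<Sum>j\<in>{1, 2}. \<Sum>h' = 1..n. C j h' * U_inf s i j h' x $ \<nu>))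
       \<and> (\<forall>i\<in>{1..p}. \<forall>k\<in>{1..q}. \<forall>h\<in>{1..m k}. \<rho> 1 + \<rho> 2 - mu k + 1 \<notin> \<int>\<^sub>\<le>\<^sub>0 \<longrightarrow>
            (\<forall>s. let C = (\<lambda>j h'. let j' = 3 - j in
              Gamma (\<rho> j - \<rho> j') * Gamma (\<rho> 1 + \<rho> 2 - mu k + 1)
                 / (Gamma (\<rho> j + 1) * Gamma (\<rho> j - mu k + 1))
              * gamma_coeff Pinv T' \<eta>\<^sub>0 h' (w_inf (opposite s) i k h (- \<rho> j' - 1)))
            in \<forall>x\<in>sector (t (p + 1)) (sector_args \<theta> \<delta> s i). \<forall>\<nu><2 * n.
                 U_last s i k h x $ \<nu> = (\<Sum>j\<in>{1, 2}. \<Sum>h' = 1..n. C j h' * U_inf s i j h' x $ \<nu>)))"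
proof -
  define c where "c = t (p + 1)"
  have cT: "T \<in> carrier_mat n n" and cT': "T' \<in> carrier_mat n n"
    unfolding T_def T'_def n_def by (rule scalar_blocks_carrier)+
  have cA': "A' \<in> carrier_mat n n"
    unfolding A'_def m_sum[symmetric] by (rule scalar_blocks_carrier)
  have offT: "T $$ (\<nu>, \<mu>) = 0" and offT': "T' $$ (\<nu>, \<mu>) = 0" if "\<nu> < n" "\<mu> < n" "\<nu> \<noteq> \<mu>" for \<nu> \<mu>
    unfolding T_def T'_def using that unfolding n_def by (simp_all add: scalar_blocks_offdiag)
  have offA': "A' $$ (\<nu>, \<mu>) = 0" if "\<nu> < n" "\<mu> < n" "\<nu> \<noteq> \<mu>" for \<nu> \<mu>
    unfolding A'_def using that unfolding m_sum[symmetric] by (simp add: scalar_blocks_offdiag)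
  have diagT: "T $$ (offset d i + x, offset d i + x) = t i" "T' $$ (offset d i + x, offset d i + x) = t' i"
    if "i \<in> {1..p}" "x < d i" for i x
    unfolding T_def T'_def by (rule scalar_blocks_diag[where d=d, OF that])+
  have tc: "t i \<noteq> c" if "i \<in> {1..p}" for i
    using inj_onD[OF t_distinct, of i "p + 1"] that by (auto simp: c_def)
  have block: "\<exists>i\<in>{1..p}. \<exists>x<d i. \<nu> = offset d i + x \<and> T $$ (\<nu>, \<nu>) = t i \<and> T' $$ (\<nu>, \<nu>) = t' i" if \<nu>: "\<nu> < n" for \<nu>
  proof -
    obtain i x where "i \<in> {1..p}" "x < d i" "\<nu> = offset d i + x"
      using offset_decompose[of \<nu> d p] \<nu> unfolding n_def by blast
    then show ?thesis using diagT by blast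
  qed
  have Tc: "T $$ (\<nu>, \<nu>) \<noteq> c" if "\<nu> < n" for \<nu> using block[OF that] tc by metis
  have T'T: "T' $$ (\<nu>, \<nu>) = \<eta>\<^sub>0 + 1 / (T $$ (\<nu>, \<nu>) - c)" if "\<nu> < n" for \<nu>
    using block[OF that] unfolding t'_def c_def by metis
  have A_entry: "A $$ (offset d i + x, offset d i + y) = scalar_blocks (r i) (lam i) (l i) $$ (x, y)"
    if "i \<in> {1..p}" "x < d i" "y < d i" for i x y
    unfolding A_blocks[OF that(1), symmetric] diagonal_block_def using that by simp
  have in_block: "\<exists>x<d i. \<nu> = offset d i + x" if h: "\<nu> < n" "T $$ (\<nu>, \<nu>) = t i" "i \<in> {1..p}" for \<nu> i
  proof -
    obtain i' x where x: "i' \<in> {1..p}" "x < d i'" "\<nu> = offset d i' + x" "T $$ (\<nu>, \<nu>) = t i'" using block[OF h(1)] by blast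
    have "i' = i" using inj_onD[OF t_distinct, of i' i] x h by auto
    then show ?thesis using x by blast
  qed
  \<comment> \<open>The parameter - \<rho> j' - 1 is admissible for the underlying system.\<close>
  have \<sigma>: "\<forall>i\<in>{1..p}. \<forall>k\<in>{1..r i}. (- \<rho> (3 - j) - 1) + lam i k \<notin> \<int>" if j: "j \<in> {1, 2}" for j :: nat
  proof (intro ballI notI)
    fix i k assume ik: "i \<in> {1..p}" "k \<in> {1..r i}" and h: "(- \<rho> (3 - j) - 1) + lam i k \<in> \<int>"
    have "- ((- \<rho> (3 - j) - 1) + lam i k + 1) \<in> \<int>" by (intro Ints_minus Ints_add[OF h Ints_1])
    then have "\<rho> (3 - j) - lam i k \<in> \<int>" by (simp add: algebra_simps)
    moreover have "3 - j \<in> {1, 2}" using j by auto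
    ultimately show False using rho_lam_nonint[OF _ ik] by blast
  qed

  have main: "(\<forall>k\<in>{1..r i}. \<forall>h\<in>{1..l i k}. \<forall>x\<in>sector c (sector_args \<theta> \<delta> s i). \<forall>\<nu><2 * n.
      U_t s i k h x $ \<nu> = (\<Sum>j\<in>{1, 2}. \<Sum>h' = 1..n.
        (exp (pi * \<i> * (lam i k - \<rho> (3 - j))) * powr_arg (\<theta> i) (t i - c) (2 * lam i k - \<rho> 1 - \<rho> 2)
          * (Gamma (\<rho> j - \<rho> (3 - j)) * Gamma (lam i k + 1) / (Gamma (\<rho> j + 1) * Gamma (lam i k - \<rho> (3 - j)))))
        * gamma_coeff Pinv T' \<eta>\<^sub>0 h' (w_t i k h (- \<rho> (3 - j) - 1)) * U_inf s i j h' x $ \<nu>))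
    \<and> (\<forall>k\<in>{1..q}. \<forall>h\<in>{1..m k}. \<rho> 1 + \<rho> 2 - mu k + 1 \<notin> \<int>\<^sub>\<le>\<^sub>0 \<longrightarrow>
      (\<forall>x\<in>sector c (sector_args \<theta> \<delta> s i). \<forall>\<nu><2 * n.
      U_last s i k h x $ \<nu> = (\<Sum>j\<in>{1, 2}. \<Sum>h' = 1..n.
        (Gamma (\<rho> j - \<rho> (3 - j)) * Gamma (\<rho> 1 + \<rho> 2 - mu k + 1) / (Gamma (\<rho> j + 1) * Gamma (\<rho> j - mu k + 1)))
        * gamma_coeff Pinv T' \<eta>\<^sub>0 h' (w_inf (opposite s) i k h (- \<rho> (3 - j) - 1)) * U_inf s i j h' x $ \<nu>)))"
    if i: "i \<in> {1..p}" for i s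
  proof -
    obtain a b where ab: "sector_args \<theta> \<delta> s i = {a<..<b}" "a < b" "b - a \<le> pi" "a = \<theta> i \<or> b = \<theta> i"
      "sector_args' \<theta>' \<delta> (opposite s) i = {- b <..< - a}"
      "sector_args \<theta> \<delta> s i \<subseteq> side_args \<theta> s i"
      "\<forall>\<phi>\<in>{a<..<b}. \<theta> i < \<phi> \<and> \<phi> < \<theta> (i + 1) \<or> \<theta> (i - 1) < \<phi> \<and> \<phi> < \<theta> i"
      unfolding \<theta>'_def
    proof (rule sector_args_interval[where \<theta>=\<theta> and s=s, OF i delta(1)])
      show "\<delta> < \<theta> (j + 1) - \<theta> j" if "j \<in> {0..p}" for j by (rule delta(2)[OF that])
    next
      fix a b assume h: "sector_args \<theta> \<delta> s i = {a<..<b}" "a < b" "b - a \<le> pi" "a = \<theta> i \<or> b = \<theta> i"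
        "sector_args' (\<lambda>i. - \<theta> i) \<delta> (opposite s) i = {- b <..< - a}"
        "sector_args \<theta> \<delta> s i \<subseteq> side_args \<theta> s i"
        "\<forall>\<phi>\<in>{a<..<b}. \<theta> i < \<phi> \<and> \<phi> < \<theta> (i + 1) \<or> \<theta> (i - 1) < \<phi> \<and> \<phi> < \<theta> i"
      show thesis by (rule that[unfolded \<theta>'_def, OF h])
    qed
    define J where "J = {a<..<b}"
    have Jeq: "sector_args \<theta> \<delta> s i = J" by (simp add: J_def ab(1))
    have len: "b - a \<le> 2 * pi" using ab(3) pi_gt_zero by linarith
    \<comment> \<open>Used twice: the rank 2n system is regular in the sector, and the inverted
      sector avoids the slits.\<close>
    have ray: "t k \<notin> sector c J" if "k \<in> {1..p}" for k
    proof (rule ray_notin_sector[OF _ theta_mono theta_bound theta_0 i that])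
      show "is_Arg (t i - c) (\<theta> i)" if "i \<in> {1..p}" for i using theta_arg[OF that] by (simp add: c_def)
    qed (use ab(7) in \<open>auto simp: J_def\<close>)
    interpret O: okubo_sector n A P Pinv A' T \<rho> c J a b
    proof
      show "T $$ (\<nu>, \<nu>) \<notin> sector c J" if "\<nu> < n" for \<nu> using block[OF that] ray by metis
    qed (use A P cA' cT A_diag offT J_def ab(2) len rho_nonint rho_rho_nonint in auto)
    have TT: "O.TT = TT" unfolding O.TT_def unfolding TT_def c_def ..
    have AA: "O.AA = AA" unfolding O.AA_def unfolding AA_def ..
    have inf: "O.solutions_at_infinity (U_inf s i)"
      unfolding O.solutions_at_infinity_def TT AA
    proof (intro ballI)
      fix j h :: nat assume jh: "j \<in> {1, 2}" "h \<in> {1..n}"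
      show "okubo_solution TT AA O.S (U_inf s i j h) \<and> expands_at_infinity c J (\<rho> j)
          ((P *\<^sub>v unit_vec n (h - 1)) @\<^sub>v ((\<rho> j \<cdot>\<^sub>m 1\<^sub>m n - A') *\<^sub>v unit_vec n (h - 1))) O.S (U_inf s i j h)"
        by (rule U_inf[OF i jh, of s, unfolded Jeq, folded c_def])
    qed
    \<comment> \<open>The logarithm of t i - c with the prescribed argument, so that
      \<open>powr_arg (\<theta> i) (t i - c)\<close> is an exponential of a multiple of it.\<close>
    define \<omega> where "\<omega> = complex_of_real (ln (norm (t i - c))) + \<i> * complex_of_real (\<theta> i)"
    have e: "exp \<omega> = t i - c"
    proof -
      have "exp \<omega> = of_real (norm (t i - c)) * exp (\<i> * of_real (\<theta> i))"
        unfolding \<omega>_def using tc[OF i] by (simp add: exp_add exp_of_real)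
      then show ?thesis using theta_arg[OF i] by (simp add: is_Arg_def c_def)
    qed
    have Im\<omega>: "Im \<omega> = \<theta> i" by (simp add: \<omega>_def)
    have ce: "c + exp \<omega> = t i" by (simp add: e)
    have half: "half_sector J a b \<omega>"
      by unfold_locales (use ab(2,3,4) J_def Im\<omega> in auto)
    have slit: "sector \<eta>\<^sub>0 {- b <..< - a} \<subseteq> slit_plane p t' \<eta>\<^sub>0" "\<eta>\<^sub>0 \<in> slit_plane p t' \<eta>\<^sub>0"
      unfolding t'_def c_def[symmetric]
      by (intro sector_subset_slit_plane[where t=t and c=c and a=a and b=b] tc ray[unfolded J_def]; assumption)+
    have t'e: "\<eta>\<^sub>0 + 1 / exp \<omega> = t' i" by (simp add: t'_def e c_def)
    have \<theta>'e: "{- Im \<omega> - 2 * pi <..< - Im \<omega>} = {\<theta>' i - 2 * pi <..< \<theta>' i}" by (simp add: \<theta>'_def Im\<omega>)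
    obtain a' b' where I: "side_args \<theta> s i = {a'<..<b'}" "b' - a' \<le> 2 * pi"
      by (cases s) auto
    show ?thesis
    proof (intro conjI ballI allI impI)
      fix k h x \<nu> assume k: "k \<in> {1..r i}" and h: "h \<in> {1..l i k}"
        and x: "x \<in> sector c (sector_args \<theta> \<delta> s i)" and \<nu>: "\<nu> < 2 * n"
      define z where "z = offset (l i) k + (h - 1)"
      have z: "z < d i"
        unfolding z_def l_sum[OF i, symmetric] using offset_bound[where d="l i", OF k, of "h - 1"] h by auto
      have n0: "offset d i + z < n" unfolding n_def by (rule offset_bound[where d=d, OF i z])
      have idx: "offset d i + offset (l i) k + (h - 1) = offset d i + z" by (simp add: z_def add.assoc)
      note ut = U_t[OF i k h, of s, unfolded idx, folded c_def, unfolded Jeq]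
      have wt: "okubo_solution T' ((- \<rho> (3 - j) - 1) \<cdot>\<^sub>m 1\<^sub>m n + A) (slit_plane p t' \<eta>\<^sub>0) (w_t i k h (- \<rho> (3 - j) - 1))"
        "expands_at (t' i) {\<theta>' i - 2 * pi <..< \<theta>' i} (- \<rho> (3 - j) - 1 + lam i k) (unit_vec n (offset d i + z))
          (slit_plane p t' \<eta>\<^sub>0) (w_t i k h (- \<rho> (3 - j) - 1))" if "j \<in> {1, 2}" for j :: nat
        using w_t[OF i k h \<sigma>[OF that]] unfolding idx by auto
      show "U_t s i k h x $ \<nu> = (\<Sum>j\<in>{1, 2}. \<Sum>h' = 1..n.
        (exp (pi * \<i> * (lam i k - \<rho> (3 - j))) * powr_arg (\<theta> i) (t i - c) (2 * lam i k - \<rho> 1 - \<rho> 2)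
          * (Gamma (\<rho> j - \<rho> (3 - j)) * Gamma (lam i k + 1) / (Gamma (\<rho> j + 1) * Gamma (lam i k - \<rho> (3 - j)))))
        * gamma_coeff Pinv T' \<eta>\<^sub>0 h' (w_t i k h (- \<rho> (3 - j) - 1)) * U_inf s i j h' x $ \<nu>)"
        unfolding powr_arg_def \<omega>_def[symmetric]
      proof (rule O.connection_at_point[OF half inf _ _ I _ n0 _ Tc cT' offT' T'T slit,
            where w="\<lambda>j. w_t i k h (- \<rho> (3 - j) - 1)"])
        show "okubo_solution O.TT O.AA O.S (U_t s i k h)" unfolding TT AA using ut by simp
        show "J \<subseteq> side_args \<theta> s i" using ab(6) unfolding Jeq .
        show "expands_at (c + exp \<omega>) (side_args \<theta> s i) (lam i k) (unit_vec (2 * n) (offset d i + z)) O.S (U_t s i k h)"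
          unfolding ce using ut by simp
        show "T $$ (offset d i + z, offset d i + z) = c + exp \<omega>" unfolding ce by (rule diagT(1)[OF i z])
        show "okubo_solution T' ((- \<rho> (3 - j) - 1) \<cdot>\<^sub>m 1\<^sub>m n + A) (slit_plane p t' \<eta>\<^sub>0) (w_t i k h (- \<rho> (3 - j) - 1))"
          if "j \<in> {1, 2}" for j by (rule wt(1)[OF that])
        show "expands_at (\<eta>\<^sub>0 + 1 / exp \<omega>) {- Im \<omega> - 2 * pi <..< - Im \<omega>} (- \<rho> (3 - j) - 1 + lam i k)
          (unit_vec n (offset d i + z)) (slit_plane p t' \<eta>\<^sub>0) (w_t i k h (- \<rho> (3 - j) - 1))"
          if "j \<in> {1, 2}" for j unfolding t'e \<theta>'e by (rule wt(2)[OF that])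
        show "A $$ (\<nu>, \<mu>) = 0" if h: "\<nu> < n" "\<mu> < n" "T $$ (\<nu>, \<nu>) = c + exp \<omega>" "T $$ (\<mu>, \<mu>) = c + exp \<omega>" "\<nu> \<noteq> \<mu>" for \<nu> \<mu>
        proof -
          obtain x y where xy: "x < d i" "\<nu> = offset d i + x" "y < d i" "\<mu> = offset d i + y"
            using in_block[OF h(1) _ i] in_block[OF h(2) _ i] h(3,4) unfolding ce by blast
          then have "x \<noteq> y" using h(5) by auto
          then show ?thesis unfolding xy(2,4) A_entry[OF i xy(1,3)]
            using xy(1,3) by (intro scalar_blocks_offdiag) (simp_all only: l_sum[OF i] not_False_eq_True)
        qed
        \<comment> \<open>Equality would make lam i k' - lam i k a positive integer, which is absurd
          for k' = k and excluded by assumption otherwise.\<close>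
        show "lam i k + of_nat (Suc m) \<noteq> A $$ (\<nu>, \<nu>)" if h: "\<nu> < n" "T $$ (\<nu>, \<nu>) = c + exp \<omega>" for \<nu> m
        proof -
          obtain x where x: "x < d i" "\<nu> = offset d i + x" using in_block[OF h(1) _ i] h(2) unfolding ce by blast
          obtain k' y where k': "k' \<in> {1..r i}" "y < l i k'" "x = offset (l i) k' + y"
            using offset_decompose[of x "l i" "r i"] x(1) unfolding l_sum[OF i] by blast
          have Ae: "A $$ (\<nu>, \<nu>) = lam i k'"
            using A_entry[OF i x(1) x(1)] scalar_blocks_diag[where d="l i", OF k'(1,2)] unfolding x(2) k'(3) by (rule trans)
          show ?thesis
          proof
            assume "lam i k + of_nat (Suc m) = A $$ (\<nu>, \<nu>)"
            then have eq: "lam i k' - lam i k = of_nat (Suc m)" unfolding Ae by (simp add: algebra_simps)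
            show False
            proof (cases "k' = k")
              case True
              then show False using eq by (simp del: of_nat_Suc)
            next
              case False
              then show False using lam_lam_nonint[OF i k'(1) k] eq Ints_of_nat by metis
            qed
          qed
        qed
        show "lam i k \<notin> \<int>" by (rule lam_nonint[OF i k])
        show "lam i k - \<rho> j \<notin> \<int>" if "j \<in> {1, 2}" for j
          using rho_lam_nonint[OF that i k] Ints_minus[of "lam i k - \<rho> j"] by auto
        show "x \<in> O.S" using x unfolding Jeq .
      qed (assumption | rule \<nu>)+
    next
      fix k h x \<nu> assume k: "k \<in> {1..q}" and h: "h \<in> {1..m k}" and ni: "\<rho> 1 + \<rho> 2 - mu k + 1 \<notin> \<int>\<^sub>\<le>\<^sub>0"
        and x: "x \<in> sector c (sector_args \<theta> \<delta> s i)" and \<nu>: "\<nu> < 2 * n"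
      define z where "z = offset m k + (h - 1)"
      have z: "z < n"
        unfolding z_def m_sum[symmetric] using offset_bound[where d=m, OF k, of "h - 1"] h by auto
      have idx: "n + offset m k + (h - 1) = n + z" by (simp add: z_def add.assoc)
      note ul = U_last[OF i k h ni, of s, unfolded idx, folded c_def, unfolded Jeq]
      note wi = w_inf[OF i k h \<sigma>, of _ "opposite s", unfolded ab(5), folded z_def]
      \<comment> \<open>The disc around \<eta> may depend on the parameter, hence on j.\<close>
      have "\<forall>j. \<exists>\<epsilon>. j \<in> {1, 2::nat} \<longrightarrow> \<epsilon> > 0 \<and> okubo_solution T' ((- \<rho> (3 - j) - 1) \<cdot>\<^sub>m 1\<^sub>m n + A)
          (sector \<eta>\<^sub>0 {- b <..< - a} \<union> ball \<eta>\<^sub>0 \<epsilon>) (w_inf (opposite s) i k h (- \<rho> (3 - j) - 1))"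
        using wi by blast
      from choice[OF this] obtain \<epsilon> where \<epsilon>: "\<And>j. j \<in> {1, 2::nat} \<Longrightarrow> \<epsilon> j > 0 \<and> okubo_solution T' ((- \<rho> (3 - j) - 1) \<cdot>\<^sub>m 1\<^sub>m n + A)
          (sector \<eta>\<^sub>0 {- b <..< - a} \<union> ball \<eta>\<^sub>0 (\<epsilon> j)) (w_inf (opposite s) i k h (- \<rho> (3 - j) - 1))"
        by blast
      show "U_last s i k h x $ \<nu> = (\<Sum>j\<in>{1, 2}. \<Sum>h' = 1..n.
        (Gamma (\<rho> j - \<rho> (3 - j)) * Gamma (\<rho> 1 + \<rho> 2 - mu k + 1) / (Gamma (\<rho> j + 1) * Gamma (\<rho> j - mu k + 1)))
        * gamma_coeff Pinv T' \<eta>\<^sub>0 h' (w_inf (opposite s) i k h (- \<rho> (3 - j) - 1)) * U_inf s i j h' x $ \<nu>)"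
      proof (rule O.connection_at_center[OF inf _ _ z Tc cT' offT' T'T,
            where w="\<lambda>j. w_inf (opposite s) i k h (- \<rho> (3 - j) - 1)" and \<epsilon>=\<epsilon>])
        show "\<epsilon> j > 0 \<and> okubo_solution T' ((- \<rho> (3 - j) - 1) \<cdot>\<^sub>m 1\<^sub>m n + A)
          (sector \<eta>\<^sub>0 {- b <..< - a} \<union> ball \<eta>\<^sub>0 (\<epsilon> j)) (w_inf (opposite s) i k h (- \<rho> (3 - j) - 1))"
          if "j \<in> {1, 2}" for j by (rule \<epsilon>[OF that])
        show "okubo_solution O.TT O.AA O.S (U_last s i k h)" unfolding TT AA using ul by simp
        show "expands_at c J (\<rho> 1 + \<rho> 2 - mu k) (unit_vec (2 * n) (n + z)) O.S (U_last s i k h)" using ul by simp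
        show "expands_at_infinity \<eta>\<^sub>0 {- b <..< - a} (- \<rho> (3 - j) - 1 + mu k) (P *\<^sub>v unit_vec n z)
            (sector \<eta>\<^sub>0 {- b <..< - a}) (w_inf (opposite s) i k h (- \<rho> (3 - j) - 1))" if "j \<in> {1, 2}" for j
          using wi[OF that] by blast
        show "A' $$ (\<nu>, \<mu>) = 0" if "\<nu> < n" "\<mu> < n" "\<nu> \<noteq> \<mu>" for \<nu> \<mu> by (rule offA'[OF that])
        show "mu k - of_nat (Suc m') \<noteq> A' $$ (\<nu>, \<nu>)" if "\<nu> < n" for \<nu> m'
        proof
          assume eq: "mu k - of_nat (Suc m') = A' $$ (\<nu>, \<nu>)"
          obtain k' y where k': "k' \<in> {1..q}" "y < m k'" "\<nu> = offset m k' + y"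
            using offset_decompose[of \<nu> m q] \<open>\<nu> < n\<close> unfolding m_sum by blast
          have "A' $$ (\<nu>, \<nu>) = mu k'"
            unfolding A'_def k'(3) by (rule scalar_blocks_diag[where d=m, OF k'(1,2)])
          then have eq': "mu k - mu k' = of_nat (Suc m')" using eq by (simp add: algebra_simps)
          show False
          proof (cases "k' = k")
            case True
            then show False using eq' by (simp del: of_nat_Suc)
          next
            case False
            then show False using mu_mu_nonint[OF k k'(1)] eq' Ints_of_nat by metis
          qed
        qed
        show "\<rho> j - mu k \<notin> \<int>" if "j \<in> {1, 2}" for j by (rule rho_mu_nonint[OF that k])
        show "x \<in> O.S" using x unfolding Jeq .
      qed (assumption | rule \<nu> ni)+
    qed
  qed
  show ?thesis
    unfolding Let_def c_def[symmetric] using main by blast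
qed

end
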